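(* Let $\Omega,\Omega'$ be minimal aperiodic tiling spaces in $\mathbb{R}^d$, with $\Omega$ uniquely ergodic with invariant probability measure $\mu$, and let $h:\Omega\to\Omega'$ be a surjective continuous orbit-preserving map such that $C_\mu[h]$ is non-singular. Then $h$ is homotopic to the composition $\phi\circ h_0$ of a shape deformation $h_0$ and a factor map $\phi$. In the case of finite local complexity (FLC), the same statement holds with $\phi$ a local derivation.
   Context: **Tiling spaces.** A tile is a convex polytope in $\mathbb{R}^d$ with non-empty interior, possibly carrying a label in a compact metric space; the set of prototiles (tiles up to translation) is compact. A tiling is a collection of tiles covering $\mathbb{R}^d$, any two of which meet only along their boundaries. A Delone set is a uniformly discrete and relatively dense subset of $\mathbb{R}^d$, possibly labelled. Tilings and labelled Delone sets are used interchangeably. $\mathbb{R}^d$ acts by translation, $T\mapsto T-x$. The patch $T\cap B(x,R)$ is the set of labelled tiles meeting $B(x,R)$ (for Delone sets: labelled points in $B(x,R)$). Two tilings (Delone sets) are $\varepsilon$-close if on a ball of radius about $1/\varepsilon$ around the origin there is a one-to-one correspondence between their tiles (points), corresponding tiles being $\varepsilon$-close in Hausdorff distance (points being $\varepsilon$-close) with $\varepsilon$-close labels. A tiling space is a compact translation-invariant set of tilings (or labelled Delone sets). It is minimal if every $\mathbb{R}^d$-orbit is dense, aperiodic if $T-x=T$ implies $x=0$ for each of its elements, uniquely ergodic if it carries exactly one translation-invariant Borel probability measure, FLC if for each $R$ there are finitely many patches of radius $R$ up to translation. **Maps.** A map is orbit-preserving if it sends $\mathbb{R}^d$-orbits into $\mathbb{R}^d$-orbits.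 A factor map is a continuous onto map $\phi$ with $\phi(T-x)=\phi(T)-x$. A local derivation between FLC tiling spaces is a factor map such that for all $r>0$ there is $R>0$ with: $T\cap B(0,R)=T'\cap B(0,R)$ implies $\phi(T)\cap B(0,r)=\phi(T')\cap B(0,r)$. **Class of a map and Ruelle–Sullivan map.** A weak 1-cocycle is a continuous $\alpha:\Omega\times\mathbb{R}^d\to\mathbb{R}^d$ with $\alpha(T,x)+\alpha(T-x,y)=\alpha(T,x+y)$, taken modulo coboundaries $\alpha(T,v)=s(T-v)-s(T)$ with $s:\Omega\to\mathbb{R}^d$ continuous; the quotient is $H^1_w(\Omega;\mathbb{R}^d)$. For a continuous orbit-preserving $h$, $h(T-v)=h(T)-h_T(v)$ defines a cocycle $(T,v)\mapsto h_T(v)$ with class $[h]\in H^1_w(\Omega;\mathbb{R}^d)$. $C_\mu([\alpha])$ is the linear map $v\mapsto\int_\Omega\alpha(T,v)\,d\mu(T)=\lim_{r\to\infty}r^{-d}\int_{C_r}\alpha(T-s,v)\,ds$, $C_r=[-r/2,r/2]^d$. (In the FLC case there is also a strong class of $h$ in $\check H^1(\Omega;\mathbb{R}^d)$, which maps to this weak class and has the same image under $C_\mu$.) **Shape deformation.** Let $T\in\Omega$ be a tiling with a vertex at $0$, with vertex set (or associated Delone set) $\Lambda$. A function $f$ on $\mathbb{R}^d$ is strongly pattern-equivariant (PE) with radius $R$ (FLC case) if $f(x)=f(y)$ whenever $(T-x)\cap B(0,R)=(T-y)\cap B(0,R)$; it is weakly PE if there is a continuous $F$ on $\Omega$ with $f(x)=F(T-x)$.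 A smooth $\mathbb{R}^d$-valued 1-form is strongly PE if its coefficients are strongly PE (with a common radius), and weakly PE if its coefficients and all their partial derivatives are weakly PE. Let $\omega$ be a closed strongly PE (FLC case) or weakly PE (general case) $\mathbb{R}^d$-valued 1-form, $A(x)=\int_0^x\omega$, and suppose $A:\mathbb{R}^d\to\mathbb{R}^d$ is a homeomorphism. In the FLC case with PE radius $R$, label each $p\in\Lambda$ by the patch of $T$ of radius $R_0$ around $p$, where $R_0$ exceeds $R$ plus the greatest distance between neighbouring points of $\Lambda$; in the general case label $p$ by $T-p$. Let $\Lambda'$ be obtained by moving each $p$ to $A(p)$, keeping its label; view $\Lambda'$ as (the vertex set of) a new tiling $T'$ with orbit closure $\Omega_1$. The map $h_\omega(T-x)=T'-A(x)$ extends to a homeomorphism $h_\omega:\Omega\to\Omega_1$, called a shape deformation. *)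

theory Defs
  imports "HOL-Probability.Probability"
begin

section \<open>The Hausdorff metric\<close>

definition hausdorff_dist :: "'a::heine_borel set \<Rightarrow> 'a set \<Rightarrow> real" where
  "hausdorff_dist A B =
     (if compact A \<and> A \<noteq> {} \<and> compact B \<and> B \<noteq> {}
      then max (SUP a\<in>A. infdist a B) (SUP b\<in>B. infdist b A) else 0)"

definition hausdorff_metric :: "'a::heine_borel set metric" where
  "hausdorff_metric = metric ({K. compact K \<and> K \<noteq> {}}, hausdorff_dist)"

lemma infdist_le_hausdorff_dist:
  assumes "compact A" "A \<noteq> {}" "compact B" "B \<noteq> {}" "a \<in> A"
  shows "infdist a B \<le> hausdorff_dist A B"
proof -
  have "bdd_above ((\<lambda>a. infdist a B) ` A)"
    using assms
    by (intro bounded_imp_bdd_above compact_imp_bounded compact_continuous_image)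
       (intro continuous_intros)
  then have "infdist a B \<le> (SUP a\<in>A. infdist a B)"
    using assms by (intro cSUP_upper)
  then show ?thesis
    using assms unfolding hausdorff_dist_def by simp
qed

lemma hausdorff_dist_le:
  assumes "compact A" "A \<noteq> {}" "compact B" "B \<noteq> {}"
    and "\<And>a. a \<in> A \<Longrightarrow> infdist a B \<le> c" "\<And>b. b \<in> B \<Longrightarrow> infdist b A \<le> c"
  shows "hausdorff_dist A B \<le> c"
  unfolding hausdorff_dist_def using assms by (auto intro!: cSUP_least)

lemma hausdorff_dist_commute: "hausdorff_dist A B = hausdorff_dist B A"
  unfolding hausdorff_dist_def by (simp add: max.commute)

lemma hausdorff_dist_nonneg: "0 \<le> hausdorff_dist A B"
proof (cases "compact A \<and> A \<noteq> {} \<and> compact B \<and> B \<noteq> {}")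
  case True
  then obtain a where "a \<in> A" by blast
  then show ?thesis
    using True infdist_le_hausdorff_dist[of A B a] infdist_nonneg[of a B] by linarith
qed (auto simp: hausdorff_dist_def)

lemma infdist_le_infdist_hausdorff_dist:
  assumes "compact B" "B \<noteq> {}" "compact C" "C \<noteq> {}"
  shows "infdist a C \<le> infdist a B + hausdorff_dist B C"
proof -
  obtain b where b: "b \<in> B" "infdist a B = dist a b"
    using infdist_attains_inf[of B a] assms compact_imp_closed by blast
  have "infdist a C \<le> infdist b C + dist a b"
    by (rule infdist_triangle)
  also have "infdist b C \<le> hausdorff_dist B C"
    using assms b by (intro infdist_le_hausdorff_dist)
  finally show ?thesis using b by simp
qed

lemma hausdorff_dist_zero_imp_subset:
  assumes "compact A" "A \<noteq> {}" "compact B" "B \<noteq> {}" "hausdorff_dist A B = 0"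
  shows "A \<subseteq> B"
proof
  fix a assume "a \<in> A"
  then have "infdist a B = 0"
    using infdist_le_hausdorff_dist[of A B a] infdist_nonneg[of a B] assms by auto
  then show "a \<in> B"
    using in_closed_iff_infdist_zero[of B a] assms compact_imp_closed by blast
qed

lemma Metric_space_hausdorff:
  "Metric_space {K::'a::heine_borel set. compact K \<and> K \<noteq> {}} hausdorff_dist"
proof
  fix A B C :: "'a set"
  show "0 \<le> hausdorff_dist A B"
    by (rule hausdorff_dist_nonneg)
  show "hausdorff_dist A B = hausdorff_dist B A"
    by (rule hausdorff_dist_commute)
  assume A: "A \<in> {K. compact K \<and> K \<noteq> {}}" and B: "B \<in> {K. compact K \<and> K \<noteq> {}}"
  show "hausdorff_dist A B = 0 \<longleftrightarrow> A = B"
  proof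
    assume "hausdorff_dist A B = 0"
    then show "A = B"
      using A B hausdorff_dist_zero_imp_subset[of A B] hausdorff_dist_zero_imp_subset[of B A]
        hausdorff_dist_commute[of A B] by auto
  next
    assume "A = B"
    then show "hausdorff_dist A B = 0"
      using A unfolding hausdorff_dist_def by simp
  qed
  assume C: "C \<in> {K. compact K \<and> K \<noteq> {}}"
  show "hausdorff_dist A C \<le> hausdorff_dist A B + hausdorff_dist B C"
  proof (rule hausdorff_dist_le)
    fix a assume "a \<in> A"
    then show "infdist a C \<le> hausdorff_dist A B + hausdorff_dist B C"
      using infdist_le_infdist_hausdorff_dist[of B C a] infdist_le_hausdorff_dist[of A B a] A B C
      by simp
  next
    fix c assume "c \<in> C"
    then show "infdist c A \<le> hausdorff_dist A B + hausdorff_dist B C"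
      using infdist_le_infdist_hausdorff_dist[of B A c] infdist_le_hausdorff_dist[of C B c] A B C
        hausdorff_dist_commute[of A B] hausdorff_dist_commute[of B C] by simp
  qed (use A C in auto)
qed

lemma mspace_hausdorff_metric [simp]:
    "mspace hausdorff_metric = {K :: 'a::heine_borel set. compact K \<and> K \<noteq> {}}"
  and mdist_hausdorff_metric [simp]:
    "mdist (hausdorff_metric :: 'a set metric) = hausdorff_dist"
  unfolding hausdorff_metric_def
  by (simp_all add: Metric_space.mspace_metric Metric_space.mdist_metric Metric_space_hausdorff)


section \<open>Tilings and labelled Delone sets\<close>

text \<open>
  Tilings and labelled Delone sets are both patterns: sets of labelled compact subsets of
  Euclidean space.  In a Delone set the point \<open>p\<close> with label \<open>l\<close> is the element \<open>({p}, l)\<close>; the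
  Hausdorff distance of singletons is the distance of the points, and \<open>{p}\<close> meets a ball iff \<open>p\<close>
  lies in it, so patches, closeness and translations are given by the same formulas in both cases.
  The label space is a metric \<open>m\<close>; unlabelled patterns are those where it is a single point.
\<close>

type_synonym ('n, 'l) tile = "(real ^ 'n) set \<times> 'l"
type_synonym ('n, 'l) pattern = "('n, 'l) tile set"

definition shift_tile :: "real ^ 'n \<Rightarrow> ('n, 'l) tile \<Rightarrow> ('n, 'l) tile" where
  "shift_tile x t = ((\<lambda>y. y - x) ` fst t, snd t)"

text \<open>\<open>shift x T\<close> is \<open>T - x\<close>.\<close>

definition shift :: "real ^ 'n \<Rightarrow> ('n, 'l) pattern \<Rightarrow> ('n, 'l) pattern" where
  "shift x T = shift_tile x ` T"

definition orbit :: "('n::finite, 'l) pattern \<Rightarrow> ('n, 'l) pattern set" where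
  "orbit T = range (\<lambda>x. shift x T)"

definition patch :: "('n::finite, 'l) pattern \<Rightarrow> real ^ 'n \<Rightarrow> real \<Rightarrow> ('n, 'l) pattern" where
  "patch T x R = {t \<in> T. fst t \<inter> ball x R \<noteq> {}}"

definition convex_tile :: "'l metric \<Rightarrow> ('n::finite, 'l) tile \<Rightarrow> bool" where
  "convex_tile m t \<longleftrightarrow> polytope (fst t) \<and> interior (fst t) \<noteq> {} \<and> snd t \<in> mspace m"

definition tiling :: "'l metric \<Rightarrow> ('n::finite, 'l) pattern \<Rightarrow> bool" where
  "tiling m T \<longleftrightarrow>
     (\<forall>t\<in>T. convex_tile m t) \<and> \<Union>(fst ` T) = UNIV \<and>
     (\<forall>s\<in>T. \<forall>t\<in>T. s \<noteq> t \<longrightarrow> fst s \<inter> fst t \<subseteq> frontier (fst s) \<inter> frontier (fst t))"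

definition delone :: "(real ^ 'n) set \<Rightarrow> bool" where
  "delone \<Lambda> \<longleftrightarrow>
     (\<exists>r>0. \<forall>p\<in>\<Lambda>. \<forall>q\<in>\<Lambda>. p \<noteq> q \<longrightarrow> r \<le> dist p q) \<and>
     (\<exists>R. \<forall>x. \<exists>p\<in>\<Lambda>. dist x p \<le> R)"

definition delone_pattern :: "'l metric \<Rightarrow> ('n::finite, 'l) pattern \<Rightarrow> bool" where
  "delone_pattern m T \<longleftrightarrow>
     (\<exists>\<Lambda> lab. delone \<Lambda> \<and> lab ` \<Lambda> \<subseteq> mspace m \<and> T = (\<lambda>p. ({p}, lab p)) ` \<Lambda>)"


section \<open>Tiling spaces\<close>

definition close :: "'l metric \<Rightarrow> real \<Rightarrow> ('n::finite, 'l) pattern \<Rightarrow> ('n, 'l) pattern \<Rightarrow> bool" where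
  "close m \<epsilon> S T \<longleftrightarrow>
     (\<exists>S0 T0 f. patch S 0 (1 / \<epsilon>) \<subseteq> S0 \<and> S0 \<subseteq> S \<and> patch T 0 (1 / \<epsilon>) \<subseteq> T0 \<and> T0 \<subseteq> T \<and>
        bij_betw f S0 T0 \<and>
        (\<forall>t\<in>S0. mdist hausdorff_metric (fst t) (fst (f t)) < \<epsilon> \<and> mdist m (snd t) (snd (f t)) < \<epsilon>))"

definition tiling_topology ::
    "'l metric \<Rightarrow> ('n::finite, 'l) pattern set \<Rightarrow> ('n, 'l) pattern topology" where
  "tiling_topology m \<Omega> =
     topology (\<lambda>U. U \<subseteq> \<Omega> \<and> (\<forall>S\<in>U. \<exists>\<epsilon>>0. \<forall>T\<in>\<Omega>. close m \<epsilon> S T \<longrightarrow> T \<in> U))"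

lemma close_mono:
  fixes S T :: "('n::finite, 'l) pattern"
  assumes "close m \<epsilon> S T" "0 < \<epsilon>" "\<epsilon> \<le> \<delta>"
  shows "close m \<delta> S T"
proof -
  have "1 / \<delta> \<le> 1 / \<epsilon>" using assms by (simp add: frac_le)
  then have "patch P 0 (1 / \<delta>) \<subseteq> patch P 0 (1 / \<epsilon>)" for P :: "('n, 'l) pattern"
    unfolding patch_def using subset_ball[of "1 / \<delta>" "1 / \<epsilon>" 0] by blast
  then show ?thesis
    using assms unfolding close_def by (meson order_trans order_less_le_trans)
qed

lemma openin_tiling_topology:
  "openin (tiling_topology m \<Omega>) U \<longleftrightarrow>
     U \<subseteq> \<Omega> \<and> (\<forall>S\<in>U. \<exists>\<epsilon>>0. \<forall>T\<in>\<Omega>. close m \<epsilon> S T \<longrightarrow> T \<in> U)"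
proof -
  let ?P = "\<lambda>U. U \<subseteq> \<Omega> \<and> (\<forall>S\<in>U. \<exists>\<epsilon>>0. \<forall>T\<in>\<Omega>. close m \<epsilon> S T \<longrightarrow> T \<in> U)"
  have "istopology ?P"
    unfolding istopology_def
  proof (intro conjI allI impI)
    fix U V assume U: "?P U" and V: "?P V"
    then show "U \<inter> V \<subseteq> \<Omega>" by blast
    show "\<forall>S\<in>U \<inter> V. \<exists>\<epsilon>>0. \<forall>T\<in>\<Omega>. close m \<epsilon> S T \<longrightarrow> T \<in> U \<inter> V"
    proof
      fix S assume "S \<in> U \<inter> V"
      then obtain a b where "a > 0" "b > 0"
        and "\<forall>T\<in>\<Omega>. close m a S T \<longrightarrow> T \<in> U" "\<forall>T\<in>\<Omega>. close m b S T \<longrightarrow> T \<in> V"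
        using U V by blast
      then show "\<exists>\<epsilon>>0. \<forall>T\<in>\<Omega>. close m \<epsilon> S T \<longrightarrow> T \<in> U \<inter> V"
        by (intro exI[of _ "min a b"]) (auto dest: close_mono[where \<epsilon> = "min a b" and \<delta> = a]
            close_mono[where \<epsilon> = "min a b" and \<delta> = b])
    qed
  next
    fix K assume K: "\<forall>U\<in>K. ?P U"
    then show "\<Union>K \<subseteq> \<Omega>" by blast
    show "\<forall>S\<in>\<Union>K. \<exists>\<epsilon>>0. \<forall>T\<in>\<Omega>. close m \<epsilon> S T \<longrightarrow> T \<in> \<Union>K"
      using K by (meson UnionE UnionI)
  qed
  then show ?thesis
    unfolding tiling_topology_def by (simp add: topology_inverse')
qed

lemma topspace_tiling_topology [simp]: "topspace (tiling_topology m \<Omega>) = \<Omega>"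
  unfolding topspace_def openin_tiling_topology
  by (auto intro!: exI[of _ \<Omega>] exI[of _ "1::real"])

text \<open>
  The prototile condition asks for a compact set of tiles (in the product of the Hausdorff metric
  and the label metric) containing a translate of every tile that occurs.
\<close>

definition compact_prototiles :: "'l metric \<Rightarrow> ('n::finite, 'l) pattern set \<Rightarrow> bool" where
  "compact_prototiles m \<Omega> \<longleftrightarrow>
     (\<exists>P. compactin (mtopology_of (prod_metric hausdorff_metric m)) P \<and>
        (\<forall>t\<in>P. convex_tile m t) \<and> (\<forall>T\<in>\<Omega>. \<forall>t\<in>T. \<exists>x. shift_tile x t \<in> P))"

definition tiling_space :: "'l metric \<Rightarrow> ('n::finite, 'l) pattern set \<Rightarrow> bool" where
  "tiling_space m \<Omega> \<longleftrightarrow>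
     compact_space (mtopology_of m) \<and>
     ((\<forall>T\<in>\<Omega>. tiling m T) \<and> compact_prototiles m \<Omega> \<or> (\<forall>T\<in>\<Omega>. delone_pattern m T)) \<and>
     (\<forall>T\<in>\<Omega>. \<forall>x. shift x T \<in> \<Omega>) \<and>
     compact_space (tiling_topology m \<Omega>)"

definition minimal :: "'l metric \<Rightarrow> ('n::finite, 'l) pattern set \<Rightarrow> bool" where
  "minimal m \<Omega> \<longleftrightarrow> (\<forall>T\<in>\<Omega>. tiling_topology m \<Omega> closure_of orbit T = \<Omega>)"

definition aperiodic :: "('n::finite, 'l) pattern set \<Rightarrow> bool" where
  "aperiodic \<Omega> \<longleftrightarrow> (\<forall>T\<in>\<Omega>. \<forall>x. shift x T = T \<longrightarrow> x = 0)"

definition FLC :: "('n::finite, 'l) pattern set \<Rightarrow> bool" where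
  "FLC \<Omega> \<longleftrightarrow>
     (\<forall>R. \<exists>F. finite F \<and> (\<forall>T\<in>\<Omega>. \<forall>x. \<exists>P\<in>F. \<exists>y. patch T x R = shift y P))"

definition invariant_prob ::
    "'l metric \<Rightarrow> ('n::finite, 'l) pattern set \<Rightarrow> ('n, 'l) pattern measure \<Rightarrow> bool" where
  "invariant_prob m \<Omega> \<mu> \<longleftrightarrow>
     prob_space \<mu> \<and> space \<mu> = \<Omega> \<and>
     sets \<mu> = sigma_sets \<Omega> {U. openin (tiling_topology m \<Omega>) U} \<and>
     (\<forall>x. \<forall>E\<in>sets \<mu>. emeasure \<mu> (shift x ` E) = emeasure \<mu> E)"

definition uniquely_ergodic ::
    "'l metric \<Rightarrow> ('n::finite, 'l) pattern set \<Rightarrow> ('n, 'l) pattern measure \<Rightarrow> bool" where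
  "uniquely_ergodic m \<Omega> \<mu> \<longleftrightarrow>
     invariant_prob m \<Omega> \<mu> \<and> (\<forall>\<nu>. invariant_prob m \<Omega> \<nu> \<longrightarrow> \<nu> = \<mu>)"


section \<open>Maps between tiling spaces\<close>

definition tiling_map ::
    "'l metric \<Rightarrow> ('n::finite, 'l) pattern set \<Rightarrow> 'k metric \<Rightarrow> ('n, 'k) pattern set \<Rightarrow>
     (('n, 'l) pattern \<Rightarrow> ('n, 'k) pattern) \<Rightarrow> bool" where
  "tiling_map m \<Omega> m' \<Omega>' h \<longleftrightarrow>
     continuous_map (tiling_topology m \<Omega>) (tiling_topology m' \<Omega>') h"

definition orbit_preserving ::
    "('n::finite, 'l) pattern set \<Rightarrow> (('n, 'l) pattern \<Rightarrow> ('n, 'k) pattern) \<Rightarrow> bool" where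
  "orbit_preserving \<Omega> h \<longleftrightarrow> (\<forall>T\<in>\<Omega>. h ` orbit T \<subseteq> orbit (h T))"

definition factor_map ::
    "'l metric \<Rightarrow> ('n::finite, 'l) pattern set \<Rightarrow> 'k metric \<Rightarrow> ('n, 'k) pattern set \<Rightarrow>
     (('n, 'l) pattern \<Rightarrow> ('n, 'k) pattern) \<Rightarrow> bool" where
  "factor_map m \<Omega> m' \<Omega>' \<phi> \<longleftrightarrow>
     tiling_space m \<Omega> \<and> tiling_space m' \<Omega>' \<and>
     tiling_map m \<Omega> m' \<Omega>' \<phi> \<and> \<phi> ` \<Omega> = \<Omega>' \<and>
     (\<forall>T\<in>\<Omega>. \<forall>x. \<phi> (shift x T) = shift x (\<phi> T))"

definition local_derivation ::
    "'l metric \<Rightarrow> ('n::finite, 'l) pattern set \<Rightarrow> 'k metric \<Rightarrow> ('n, 'k) pattern set \<Rightarrow>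
     (('n, 'l) pattern \<Rightarrow> ('n, 'k) pattern) \<Rightarrow> bool" where
  "local_derivation m \<Omega> m' \<Omega>' \<phi> \<longleftrightarrow>
     FLC \<Omega> \<and> FLC \<Omega>' \<and> factor_map m \<Omega> m' \<Omega>' \<phi> \<and>
     (\<forall>r>0. \<exists>R>0. \<forall>T\<in>\<Omega>. \<forall>T'\<in>\<Omega>.
        patch T 0 R = patch T' 0 R \<longrightarrow> patch (\<phi> T) 0 r = patch (\<phi> T') 0 r)"

definition homotopic_maps ::
    "'l metric \<Rightarrow> ('n::finite, 'l) pattern set \<Rightarrow> 'k metric \<Rightarrow> ('n, 'k) pattern set \<Rightarrow>
     (('n, 'l) pattern \<Rightarrow> ('n, 'k) pattern) \<Rightarrow> (('n, 'l) pattern \<Rightarrow> ('n, 'k) pattern) \<Rightarrow> bool" where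
  "homotopic_maps m \<Omega> m' \<Omega>' f g \<longleftrightarrow>
     homotopic_with (\<lambda>_. True) (tiling_topology m \<Omega>) (tiling_topology m' \<Omega>') f g"

text \<open>
  The cocycle \<open>h\<^sub>T(v)\<close> representing the class \<open>[h]\<close>.  The vector is unique when the target space
  is aperiodic.
\<close>

definition orbit_cocycle ::
    "(('n::finite, 'l) pattern \<Rightarrow> ('n, 'k) pattern) \<Rightarrow> ('n, 'l) pattern \<Rightarrow> real ^ 'n \<Rightarrow> real ^ 'n" where
  "orbit_cocycle h T v = (THE w. h (shift v T) = shift w (h T))"

text \<open>
  The Ruelle--Sullivan map on a representing cocycle.  Coboundaries have integral \<open>0\<close> by
  invariance of \<open>\<mu>\<close>, so the value depends only on the class.
\<close>

definition ruelle_sullivan ::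
    "('n::finite, 'l) pattern measure \<Rightarrow> (('n, 'l) pattern \<Rightarrow> real ^ 'n \<Rightarrow> real ^ 'n) \<Rightarrow>
     real ^ 'n \<Rightarrow> real ^ 'n" where
  "ruelle_sullivan \<mu> \<alpha> = (\<lambda>v. LINT T|\<mu>. \<alpha> T v)"


section \<open>Pattern-equivariant forms\<close>

definition strongly_PE_fun :: "('n::finite, 'l) pattern \<Rightarrow> real \<Rightarrow> (real ^ 'n \<Rightarrow> 'b) \<Rightarrow> bool" where
  "strongly_PE_fun T R f \<longleftrightarrow>
     (\<forall>x y. patch (shift x T) 0 R = patch (shift y T) 0 R \<longrightarrow> f x = f y)"

definition weakly_PE_fun ::
    "'l metric \<Rightarrow> ('n::finite, 'l) pattern set \<Rightarrow> ('n, 'l) pattern \<Rightarrow> (real ^ 'n \<Rightarrow> real) \<Rightarrow> bool" where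
  "weakly_PE_fun m \<Omega> T f \<longleftrightarrow>
     (\<exists>F. continuous_map (tiling_topology m \<Omega>) euclideanreal F \<and> (\<forall>x. f x = F (shift x T)))"

definition partial_deriv :: "'n \<Rightarrow> (real ^ 'n \<Rightarrow> real) \<Rightarrow> real ^ 'n \<Rightarrow> real" where
  "partial_deriv j f x = frechet_derivative f (at x) (axis j 1)"

definition partial_derivs :: "'n list \<Rightarrow> (real ^ 'n \<Rightarrow> real) \<Rightarrow> real ^ 'n \<Rightarrow> real" where
  "partial_derivs js f = foldr partial_deriv js f"

definition smooth_fun :: "(real ^ 'n \<Rightarrow> real) \<Rightarrow> bool" where
  "smooth_fun f \<longleftrightarrow> (\<forall>js x. partial_derivs js f differentiable at x)"

text \<open>
  A vector-valued 1-form is given by its coefficient matrix: \<open>\<omega> x $ i $ j\<close> is the coefficient of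
  \<open>dx\<^sub>j\<close> in the \<open>i\<close>-th component, so that \<open>\<omega> x *v v\<close> is the value of the form at \<open>x\<close> on \<open>v\<close>.
\<close>

type_synonym 'n form = "real ^ 'n \<Rightarrow> real ^ 'n ^ 'n"

definition smooth_form :: "'n::finite form \<Rightarrow> bool" where
  "smooth_form \<omega> \<longleftrightarrow> (\<forall>i j. smooth_fun (\<lambda>x. \<omega> x $ i $ j))"

definition closed_form :: "'n::finite form \<Rightarrow> bool" where
  "closed_form \<omega> \<longleftrightarrow>
     (\<forall>i j k x. partial_deriv k (\<lambda>x. \<omega> x $ i $ j) x = partial_deriv j (\<lambda>x. \<omega> x $ i $ k) x)"

definition strongly_PE_form :: "('n::finite, 'l) pattern \<Rightarrow> real \<Rightarrow> 'n form \<Rightarrow> bool" where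
  "strongly_PE_form T R \<omega> \<longleftrightarrow>
     smooth_form \<omega> \<and> (\<forall>i j. strongly_PE_fun T R (\<lambda>x. \<omega> x $ i $ j))"

definition weakly_PE_form ::
    "'l metric \<Rightarrow> ('n::finite, 'l) pattern set \<Rightarrow> ('n, 'l) pattern \<Rightarrow> 'n form \<Rightarrow> bool" where
  "weakly_PE_form m \<Omega> T \<omega> \<longleftrightarrow>
     smooth_form \<omega> \<and> (\<forall>i j js. weakly_PE_fun m \<Omega> T (partial_derivs js (\<lambda>x. \<omega> x $ i $ j)))"

text \<open>\<open>A(x)\<close>, the integral of \<open>\<omega>\<close> from \<open>0\<close> to \<open>x\<close>, taken along the segment.\<close>

definition form_primitive :: "'n::finite form \<Rightarrow> real ^ 'n \<Rightarrow> real ^ 'n" where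
  "form_primitive \<omega> x = integral {0..1} (\<lambda>t. \<omega> (t *\<^sub>R x) *v x)"


section \<open>Shape deformations\<close>

text \<open>For a Delone pattern the vertex set is the set of its points.\<close>

definition vertex_set :: "('n::finite, 'l) pattern \<Rightarrow> (real ^ 'n) set" where
  "vertex_set T = {v. \<exists>t\<in>T. v extreme_point_of fst t}"

text \<open>
  A rule placing a control point inside every tile, equivariantly and continuously.  Relative
  interiors are used because the elements of a Delone pattern are singletons.
\<close>

definition control_points ::
    "'l metric \<Rightarrow> ('n::finite, 'l) pattern set \<Rightarrow> (('n, 'l) tile \<Rightarrow> real ^ 'n) \<Rightarrow> bool" where
  "control_points m \<Omega> c \<longleftrightarrow>
     continuous_map (subtopology (mtopology_of (prod_metric hausdorff_metric m)) (\<Union>\<Omega>)) euclidean c \<and>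
     (\<forall>t\<in>\<Union>\<Omega>. c t \<in> rel_interior (fst t) \<and> (\<forall>x. c (shift_tile x t) = c t - x))"

text \<open>
  The alternative to the vertex set is needed without finite local complexity, where the vertex
  set of a tiling need not be uniformly discrete.
\<close>

definition associated_delone ::
    "'l metric \<Rightarrow> ('n::finite, 'l) pattern set \<Rightarrow> ('n, 'l) pattern \<Rightarrow> (real ^ 'n) set \<Rightarrow> bool" where
  "associated_delone m \<Omega> T \<Lambda> \<longleftrightarrow>
     delone \<Lambda> \<and> (\<Lambda> = vertex_set T \<or> (\<exists>c. control_points m \<Omega> c \<and> \<Lambda> = c ` T))"

text \<open>Points are neighbours if their closed Voronoi cells meet.\<close>

definition neighbours :: "(real ^ 'n) set \<Rightarrow> real ^ 'n \<Rightarrow> real ^ 'n \<Rightarrow> bool" where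
  "neighbours \<Lambda> p q \<longleftrightarrow>
     p \<in> \<Lambda> \<and> q \<in> \<Lambda> \<and> p \<noteq> q \<and> (\<exists>x. dist x p = infdist x \<Lambda> \<and> dist x q = infdist x \<Lambda>)"

definition deformed_pattern ::
    "(real ^ 'n \<Rightarrow> real ^ 'n) \<Rightarrow> (real ^ 'n \<Rightarrow> 'k) \<Rightarrow> (real ^ 'n) set \<Rightarrow> ('n::finite, 'k) pattern" where
  "deformed_pattern A lab \<Lambda> = (\<lambda>p. ({A p}, lab p)) ` \<Lambda>"

definition orbit_closure :: "'l metric \<Rightarrow> ('n::finite, 'l) pattern \<Rightarrow> ('n, 'l) pattern set" where
  "orbit_closure m T = tiling_topology m {S. delone_pattern m S} closure_of orbit T"

definition extends_deformation ::
    "'l metric \<Rightarrow> ('n::finite, 'l) pattern set \<Rightarrow> 'k metric \<Rightarrow> ('n, 'k) pattern set \<Rightarrow>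
     ('n, 'l) pattern \<Rightarrow> ('n, 'k) pattern \<Rightarrow> (real ^ 'n \<Rightarrow> real ^ 'n) \<Rightarrow>
     (('n, 'l) pattern \<Rightarrow> ('n, 'k) pattern) \<Rightarrow> bool" where
  "extends_deformation m \<Omega> m1 \<Omega>1 T T' A h \<longleftrightarrow>
     homeomorphic_map (tiling_topology m \<Omega>) (tiling_topology m1 \<Omega>1) h \<and>
     (\<forall>x. h (shift x T) = shift (A x) T')"

text \<open>
  General case: the point \<open>p\<close> carries the label \<open>T - p\<close>, and the label space is \<open>\<Omega>\<close> with some
  metric \<open>m1\<close> inducing its topology; by compactness the topology on the deformed space does not
  depend on this metric.
\<close>

definition weak_shape_deformation ::
    "'l metric \<Rightarrow> ('n::finite, 'l) pattern set \<Rightarrow>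
     ('n, 'l) pattern metric \<Rightarrow> ('n, ('n, 'l) pattern) pattern set \<Rightarrow>
     (('n, 'l) pattern \<Rightarrow> ('n, ('n, 'l) pattern) pattern) \<Rightarrow> bool" where
  "weak_shape_deformation m \<Omega> m1 \<Omega>1 h \<longleftrightarrow>
     mspace m1 = \<Omega> \<and> mtopology_of m1 = tiling_topology m \<Omega> \<and>
     (\<exists>T \<Lambda> \<omega> A T'.
        T \<in> \<Omega> \<and> associated_delone m \<Omega> T \<Lambda> \<and> 0 \<in> \<Lambda> \<and>
        weakly_PE_form m \<Omega> T \<omega> \<and> closed_form \<omega> \<and>
        A = form_primitive \<omega> \<and> homeomorphic_map euclidean euclidean A \<and>
        T' = deformed_pattern A (\<lambda>p. shift p T) \<Lambda> \<and>
        \<Omega>1 = orbit_closure m1 T' \<and>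
        extends_deformation m \<Omega> m1 \<Omega>1 T T' A h)"

text \<open>
  FLC case: the point \<open>p\<close> carries as label the patch of radius \<open>R0\<close> around \<open>p\<close>, translated to the
  origin; only finitely many labels occur, and they carry the discrete metric.
\<close>

definition strong_shape_deformation ::
    "'l metric \<Rightarrow> ('n::finite, 'l) pattern set \<Rightarrow>
     ('n, 'l) pattern metric \<Rightarrow> ('n, ('n, 'l) pattern) pattern set \<Rightarrow>
     (('n, 'l) pattern \<Rightarrow> ('n, ('n, 'l) pattern) pattern) \<Rightarrow> bool" where
  "strong_shape_deformation m \<Omega> m1 \<Omega>1 h \<longleftrightarrow>
     FLC \<Omega> \<and>
     (\<exists>T \<Lambda> \<omega> A T' R R0 lab.
        T \<in> \<Omega> \<and> associated_delone m \<Omega> T \<Lambda> \<and> 0 \<in> \<Lambda> \<and>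
        0 < R \<and> strongly_PE_form T R \<omega> \<and> closed_form \<omega> \<and>
        A = form_primitive \<omega> \<and> homeomorphic_map euclidean euclidean A \<and>
        (\<forall>p q. neighbours \<Lambda> p q \<longrightarrow> R + dist p q < R0) \<and>
        lab = (\<lambda>p. patch (shift p T) 0 R0) \<and>
        m1 = metric (lab ` \<Lambda>, discrete_metric.dd) \<and>
        T' = deformed_pattern A lab \<Lambda> \<and>
        \<Omega>1 = orbit_closure m1 T' \<and>
        extends_deformation m \<Omega> m1 \<Omega>1 T T' A h)"

end

theory Submission
  imports Defs
begin

text \<open>
  Along an orbit, \<open>h\<close> translates by the cocycle \<open>\<alpha> X v\<close> with \<open>h (X - v) = h X - \<alpha> X v\<close>.  If \<open>f\<close> is a
  continuous function on \<open>\<Omega>\<close>, then \<open>follow f X = h X - f X\<close> defines a map homotopic to \<open>h\<close>, by way of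
  \<open>h X - t f X\<close>, and its cocycle is \<open>\<beta> = \<alpha>\<close> plus the coboundary of \<open>f\<close>.  The proof looks for \<open>f\<close> such that every
  \<open>\<beta> X\<close> is a homeomorphism of Euclidean space and the primitive of a smooth pattern-equivariant form.
  Moving the points of \<open>X\<close> by \<open>\<beta> X\<close> is then a shape deformation \<open>h0\<close>; a translation by \<open>v\<close> in \<open>\<Omega>\<close> becomes a
  translation by \<open>\<beta> X v\<close> both after \<open>h0\<close> and after \<open>follow f\<close>, so that \<open>follow f\<close> composed with the inverse of
  \<open>h0\<close> commutes with translations.  This is the factor map (\<open>factor_through_deform\<close>).

  Continuity of \<open>\<alpha>\<close> has to be proved first.  For small \<open>v\<close> the displacement \<open>\<alpha> X v\<close> is nearly a period of
  \<open>h X\<close>, and since the tiles of a pattern are uniformly separated, near periods are either tiny or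
  bounded below.  By Sierpinski's theorem the displacements along a short segment cannot jump between
  the separated clusters that this leaves (\<open>\<alpha>_small\<close>), and aperiodicity of \<open>\<Omega>'\<close> turns boundedness into
  continuity (\<open>\<alpha>_limit_if_bounded\<close>).

  The function \<open>f\<close> comes from two averaging processes, both of which change a cocycle by a coboundary
  (\<open>deformation_exists\<close>).  Convolution with a smooth bump along orbits makes the cocycle differentiable; its
  derivative is given by a continuous matrix-valued function on \<open>\<Omega>\<close> with the same mean \<open>C\<^sub>\<mu>[h]\<close>.  Finite
  averages over translates then bring the derivative uniformly close to this mean, because \<open>\<mu>\<close> is the
  only invariant measure: otherwise a cluster point of averages would be an invariant positive
  functional with another value, and the measure representing it would be a second one
  (\<open>invariant_state_exists\<close>, \<open>riesz_integral_ge\<close>).  Since \<open>C\<^sub>\<mu>[h]\<close> is invertible, a map whose derivative is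
  uniformly close to it is a bi-Lipschitz homeomorphism.

  Under finite local complexity, \<open>f\<close> must also make \<open>follow f\<close> and the form depend only on a bounded patch.
  Patterns that agree on a large ball have images that agree up to a small translation.  Measuring
  this translation against a fixed representative of each patch, and averaging over the tiles near the
  origin, gives a correction that makes \<open>h\<close> local (\<open>correction_local\<close>).  The cocycle of a local map is local
  (\<open>corrected_cocycle_local\<close>), and the two averaging processes preserve this.  Finally, labels that are large
  patches allow a pattern to be recovered from the deformed one by walking from point to point, with
  control over the radius (\<open>walk\<close>, \<open>deform_inverse_local\<close>); this makes the factor map a local derivation.

  Tilings and Delone patterns are treated together by means of control points with uniform constants
  (\<open>pattern_space_exists\<close>), and the topology is handled through a metric, which exists because closeness
  satisfies a triangle inequality (\<open>close_trans\<close>).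
\<close>

section \<open>The metric on patterns\<close>

text \<open>What tilings and Delone patterns have in common as far as the metric is concerned.\<close>

definition locally_finite_pattern :: "'l metric \<Rightarrow> ('n::finite, 'l) pattern \<Rightarrow> bool" where
  "locally_finite_pattern m S \<longleftrightarrow>
     (\<forall>t\<in>S. compact (fst t) \<and> fst t \<noteq> {} \<and> snd t \<in> mspace m) \<and> (\<forall>R. finite (patch S 0 R))"

definition tile_close :: "'l metric \<Rightarrow> real \<Rightarrow> ('n::finite, 'l) tile \<Rightarrow> ('n, 'l) tile \<Rightarrow> bool" where
  "tile_close m e s t \<longleftrightarrow> hausdorff_dist (fst s) (fst t) < e \<and> mdist m (snd s) (snd t) < e"

lemma close_iff:
  "close m \<epsilon> S T \<longleftrightarrow>
     (\<exists>S0 T0 f. patch S 0 (1 / \<epsilon>) \<subseteq> S0 \<and> S0 \<subseteq> S \<and> patch T 0 (1 / \<epsilon>) \<subseteq> T0 \<and> T0 \<subseteq> T \<and>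
        bij_betw f S0 T0 \<and> (\<forall>t\<in>S0. tile_close m \<epsilon> t (f t)))"
  unfolding close_def tile_close_def by simp

lemma patch_mono: "r \<le> R \<Longrightarrow> patch S x r \<subseteq> patch S x R"
  unfolding patch_def using subset_ball[of r R x] by blast

lemma patch_subset: "patch S x r \<subseteq> S"
  unfolding patch_def by blast

lemma hausdorff_dist_triangle:
  assumes "compact A" "A \<noteq> {}" "compact B" "B \<noteq> {}" "compact C" "C \<noteq> {}"
  shows "hausdorff_dist A C \<le> hausdorff_dist A B + hausdorff_dist B C"
  using Metric_space.triangle[OF Metric_space_hausdorff, of A B C] assms by simp

lemma hausdorff_dist_near_point:
  assumes "compact A" "A \<noteq> {}" "compact B" "B \<noteq> {}" "a \<in> A"
  obtains b where "b \<in> B" "dist a b \<le> hausdorff_dist A B"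
proof -
  obtain b where "b \<in> B" "infdist a B = dist a b"
    using infdist_attains_inf[of B a] assms compact_imp_closed by blast
  then show thesis
    using that infdist_le_hausdorff_dist[of A B a] assms by auto
qed

lemma meets_ball_of_hausdorff_near:
  fixes A B :: "(real ^ 'n) set"
  assumes "compact A" "A \<noteq> {}" "compact B" "B \<noteq> {}" "hausdorff_dist A B < e"
    and "A \<inter> ball x r \<noteq> {}" "r + e \<le> R"
  shows "B \<inter> ball x R \<noteq> {}"
proof -
  obtain a where a: "a \<in> A" "dist x a < r" using assms by auto
  obtain b where "b \<in> B" "dist a b \<le> hausdorff_dist A B"
    using hausdorff_dist_near_point assms a by metis
  then have "dist x b < R"
    using a assms dist_triangle[of x b a] by linarith
  then show ?thesis using \<open>b \<in> B\<close> by auto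
qed

lemma tile_close_commute: "tile_close m e s t \<longleftrightarrow> tile_close m e t s"
  unfolding tile_close_def by (simp add: hausdorff_dist_commute mdist_commute)

lemma tile_close_trans:
  assumes "tile_close m a s t" "tile_close m b t u"
    and "\<And>v. v \<in> {s,t,u} \<Longrightarrow> compact (fst v) \<and> fst v \<noteq> {} \<and> snd v \<in> mspace m"
  shows "tile_close m (a + b) s u"
  using assms hausdorff_dist_triangle[of "fst s" "fst t" "fst u"]
    mdist_triangle[of "snd s" m "snd t" "snd u"]
  unfolding tile_close_def by auto

lemma close_sym:
  assumes "close m e S T" shows "close m e T S"
proof -
  obtain S0 T0 f where *: "patch S 0 (1/e) \<subseteq> S0" "S0 \<subseteq> S" "patch T 0 (1/e) \<subseteq> T0" "T0 \<subseteq> T"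
      "bij_betw f S0 T0" "\<forall>t\<in>S0. tile_close m e t (f t)"
    using assms unfolding close_iff by blast
  have "bij_betw (inv_into S0 f) T0 S0" by (rule bij_betw_inv_into[OF *(5)])
  moreover have "tile_close m e t (inv_into S0 f t)" if "t \<in> T0" for t
    using * that tile_close_commute bij_betw_inv_into_right[OF *(5) that]
      bij_betwE[OF bij_betw_inv_into[OF *(5)]] by metis
  ultimately show ?thesis unfolding close_iff using * by blast
qed

lemma mdist_self: "x \<in> mspace m \<Longrightarrow> mdist m x x = 0"
  by (rule Metric_space.mdist_zero[OF Metric_space_mspace_mdist])

lemma close_refl:
  assumes "locally_finite_pattern m S" "e > 0" shows "close m e S S"
proof -
  have "tile_close m e t t" if "t \<in> S" for t
    using that assms Metric_space.mdist_zero[OF Metric_space_hausdorff, of "fst t"]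
    unfolding locally_finite_pattern_def tile_close_def by (auto simp: mdist_self)
  then show ?thesis unfolding close_iff
    by (intro exI[of _ S] exI[of _ id]) (auto simp: patch_subset)
qed

text \<open>
  Composing a matching on the ball of radius \<open>1/a\<close> with one on the ball of radius \<open>1/b\<close> loses the
  tiles that leave the second ball under a displacement of size \<open>a\<close>; the radius \<open>1/(a+b)\<close> is small
  enough to avoid this precisely because \<open>a + b \<le> 1\<close>.  This makes closeness an honest metric.
\<close>

lemma close_trans:
  assumes nice: "locally_finite_pattern m S" "locally_finite_pattern m T" "locally_finite_pattern m V"
    and "close m a S T" "close m b T V" and ab: "a > 0" "b > 0" "a + b \<le> 1"
  shows "close m (a + b) S V"
proof -
  obtain S0 T0 f where *: "patch S 0 (1/a) \<subseteq> S0" "S0 \<subseteq> S" "patch T 0 (1/a) \<subseteq> T0" "T0 \<subseteq> T"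
      "bij_betw f S0 T0" "\<forall>t\<in>S0. tile_close m a t (f t)"
    using assms unfolding close_iff by blast
  obtain T1 V1 g where **: "patch T 0 (1/b) \<subseteq> T1" "T1 \<subseteq> T" "patch V 0 (1/b) \<subseteq> V1" "V1 \<subseteq> V"
      "bij_betw g T1 V1" "\<forall>t\<in>T1. tile_close m b t (g t)"
    using assms unfolding close_iff by blast
  have radius: "1/(u+v) + u \<le> 1/v" if "u > 0" "v > 0" "u + v \<le> 1" for u v :: real
  proof -
    have "v * (u + v) \<le> 1" using that mult_mono[of v 1 "u+v" 1] by auto
    then have "u * (v * (u + v)) \<le> u" using that mult_left_mono[of "v * (u + v)" 1 u] by simp
    then show ?thesis using that by (simp add: field_simps)
  qed
  have r1: "1/(a+b) + a \<le> 1/b" and r2: "1/(a+b) + b \<le> 1/a"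
    using radius[of a b] radius[of b a] ab by (auto simp: add.commute)
  have le1: "1/(a+b) \<le> 1/a" "1/(a+b) \<le> 1/b" using ab by (auto simp: field_simps)
  have c: "compact (fst t) \<and> fst t \<noteq> {} \<and> snd t \<in> mspace m" if "t \<in> S \<union> T \<union> V" for t
    using nice that unfolding locally_finite_pattern_def by auto
  define S2 where "S2 = {s \<in> S0. f s \<in> T1}"
  define V2 where "V2 = g ` (T0 \<inter> T1)"
  have fS0: "f s \<in> T0" if "s \<in> S0" for s using bij_betwE[OF *(5)] that by blast
  have gT1: "g t \<in> V1" if "t \<in> T1" for t using bij_betwE[OF **(5)] that by blast
  have fS2: "f ` S2 = T0 \<inter> T1"
    using *(5) unfolding S2_def bij_betw_def by auto
  have "bij_betw f S2 (T0 \<inter> T1)"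
    using *(5) fS2 unfolding bij_betw_def S2_def by (auto intro: inj_on_subset)
  moreover have "bij_betw g (T0 \<inter> T1) V2"
    using **(5) unfolding bij_betw_def V2_def by (auto intro: inj_on_subset)
  ultimately have bij: "bij_betw (g \<circ> f) S2 V2" by (rule bij_betw_trans)
  have "patch S 0 (1/(a+b)) \<subseteq> S2"
  proof
    fix s assume s: "s \<in> patch S 0 (1/(a+b))"
    then have s0: "s \<in> S0" using *(1) patch_mono[OF le1(1)] by blast
    have "compact (fst s) \<and> fst s \<noteq> {}" "compact (fst (f s)) \<and> fst (f s) \<noteq> {}"
      using c[of s] c[of "f s"] s0 *(2,4) fS0[OF s0] by blast+
    then have "fst (f s) \<inter> ball 0 (1/b) \<noteq> {}"
      using s s0 *(6) r1 unfolding tile_close_def patch_def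
      by (intro meets_ball_of_hausdorff_near[of "fst s" "fst (f s)" a _ "1/(a+b)"]) auto
    then show "s \<in> S2"
      using s0 fS0[OF s0] *(4) **(1) unfolding S2_def patch_def by auto
  qed
  moreover have "patch V 0 (1/(a+b)) \<subseteq> V2"
  proof
    fix v assume v: "v \<in> patch V 0 (1/(a+b))"
    then have "v \<in> V1" using **(3) patch_mono[OF le1(2)] by blast
    then obtain t where t: "t \<in> T1" "g t = v" using **(5) unfolding bij_betw_def by auto
    have "compact (fst v) \<and> fst v \<noteq> {}" "compact (fst t) \<and> fst t \<noteq> {}"
      using c[of v] c[of t] t **(2,4) \<open>v \<in> V1\<close> by blast+
    then have "fst t \<inter> ball 0 (1/a) \<noteq> {}"
      using v t **(6) r2 unfolding tile_close_def patch_def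
      by (intro meets_ball_of_hausdorff_near[of "fst v" "fst t" b _ "1/(a+b)"])
         (auto simp: hausdorff_dist_commute)
    then show "v \<in> V2"
      using t **(2) *(3) unfolding V2_def patch_def by auto
  qed
  moreover have "tile_close m (a+b) s ((g \<circ> f) s)" if "s \<in> S2" for s
  proof -
    have "s \<in> S0" "f s \<in> T1" using that unfolding S2_def by auto
    moreover from this have "s \<in> S" "f s \<in> T" "g (f s) \<in> V"
      using *(2) **(2,4) gT1[of "f s"] by blast+
    ultimately have "tile_close m (a+b) s (g (f s))"
      using *(6) **(6) c by (intro tile_close_trans[of m a s "f s" b]) blast+
    then show ?thesis by simp
  qed
  ultimately show ?thesis
    unfolding close_iff using bij *(2) **(4) gT1
    by (intro exI[of _ S2] exI[of _ V2] exI[of _ "g \<circ> f"]) (auto simp: S2_def V2_def)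
qed

text \<open>
  A tile of \<open>S\<close> that is missing from \<open>T\<close> would have positive distance from each of the finitely many
  tiles of \<open>T\<close> nearby, whereas closeness at a smaller scale pairs it with one of them.
\<close>

lemma close_all_imp_subset:
  assumes "locally_finite_pattern m S" "locally_finite_pattern m T"
    and cl: "\<And>e. 0 < e \<Longrightarrow> e \<le> 1/2 \<Longrightarrow> close m e S T"
  shows "S \<subseteq> T"
proof
  fix t assume t: "t \<in> S"
  then have "fst t \<noteq> {}" using assms unfolding locally_finite_pattern_def by blast
  then obtain x where x: "x \<in> fst t" by blast
  define r where "r = norm x + 1"
  have r: "fst t \<inter> ball 0 r \<noteq> {}" "r > 0" using x unfolding r_def
    by (auto simp: disjoint_iff dist_norm intro!: exI[of _ x] add_nonneg_pos)
  let ?F = "patch T 0 (r + 1)"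
  have fin: "finite ?F" using assms unfolding locally_finite_pattern_def by blast
  have near: "\<exists>t'\<in>?F. tile_close m e t t'" if e: "0 < e" "e \<le> 1/2" "e \<le> 1/r" for e
  proof -
    obtain S0 T0 f where *: "patch S 0 (1/e) \<subseteq> S0" "S0 \<subseteq> S" "T0 \<subseteq> T"
        "bij_betw f S0 T0" "\<forall>t\<in>S0. tile_close m e t (f t)"
      using cl[of e] e unfolding close_iff by blast
    have "r \<le> 1/e" using e r by (simp add: field_simps)
    then have "t \<in> patch S 0 (1/e)" using t r(1) subset_ball[of r "1/e"] unfolding patch_def by blast
    then have "t \<in> S0" using * by blast
    then have ft: "f t \<in> T" "tile_close m e t (f t)" using * bij_betwE by blast+
    have "fst (f t) \<inter> ball 0 (r + 1) \<noteq> {}"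
      using assms t ft r e unfolding locally_finite_pattern_def tile_close_def
      by (intro meets_ball_of_hausdorff_near[of "fst t" "fst (f t)" e _ r]) auto
    then show ?thesis using ft unfolding patch_def by blast
  qed
  show "t \<in> T"
  proof (rule ccontr)
    assume nt: "t \<notin> T"
    define D where "D = (\<lambda>t'. max (hausdorff_dist (fst t) (fst t')) (mdist m (snd t) (snd t')))"
    have pos: "D t' > 0" if "t' \<in> ?F" for t'
    proof -
      have t': "t' \<in> T" using that unfolding patch_def by blast
      then have "t \<noteq> t'" using nt by blast
      then have "fst t \<noteq> fst t' \<or> snd t \<noteq> snd t'" by (metis prod_eqI)
      moreover have "hausdorff_dist (fst t) (fst t') = 0 \<longleftrightarrow> fst t = fst t'"
        using t t' assms Metric_space.zero[OF Metric_space_hausdorff, of "fst t" "fst t'"]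
        unfolding locally_finite_pattern_def by auto
      moreover have "mdist m (snd t) (snd t') = 0 \<longleftrightarrow> snd t = snd t'"
        using t t' assms unfolding locally_finite_pattern_def by auto
      ultimately show ?thesis
        unfolding D_def using hausdorff_dist_nonneg[of "fst t" "fst t'"] mdist_nonneg[of m "snd t" "snd t'"]
        by linarith
    qed
    define e where "e = Min ({1/2, 1/r} \<union> D ` ?F)"
    have "\<And>x. x \<in> {1/2, 1/r} \<union> D ` ?F \<Longrightarrow> e \<le> x"
      unfolding e_def by (rule Min_le) (use fin in auto)
    moreover have "e > 0"
      unfolding e_def using fin pos r by (subst Min_gr_iff) auto
    ultimately have e: "e > 0" "e \<le> 1/2" "e \<le> 1/r" "\<And>t'. t' \<in> ?F \<Longrightarrow> e \<le> D t'" by blast+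
    then obtain t' where "t' \<in> ?F" "tile_close m e t t'" using near by blast
    then show False using e(4)[of t'] unfolding D_def tile_close_def by auto
  qed
qed

text \<open>
  Closeness is transitive only while the two scales add up to at most one; cutting the distance off at
  \<open>1/2\<close> turns this into the triangle inequality.
\<close>

definition pattern_dist :: "'l metric \<Rightarrow> ('n::finite, 'l) pattern \<Rightarrow> ('n, 'l) pattern \<Rightarrow> real" where
  "pattern_dist m S T = Inf (insert (1/2) {e. 0 < e \<and> close m e S T})"

lemma pattern_dist_bdd: "bdd_below (insert (1/2) {e. 0 < e \<and> close m e S T})"
  by (rule bdd_belowI[of _ 0]) auto

lemma pattern_dist_le: "0 < e \<Longrightarrow> close m e S T \<Longrightarrow> pattern_dist m S T \<le> e"
  unfolding pattern_dist_def by (intro cInf_lower pattern_dist_bdd) auto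

lemma pattern_dist_le_half: "pattern_dist m S T \<le> 1/2"
  unfolding pattern_dist_def by (intro cInf_lower pattern_dist_bdd) auto

lemma pattern_dist_less_imp_close:
  assumes "pattern_dist m S T < e" "e \<le> 1/2" shows "close m e S T"
proof -
  obtain e' where "e' < e" "e' = 1/2 \<or> 0 < e' \<and> close m e' S T"
    using assms cInf_lessD[of "insert (1/2) {e. 0 < e \<and> close m e S T}" e]
    unfolding pattern_dist_def by auto
  then show ?thesis using assms close_mono[of m e' S T e] by auto
qed

lemma pattern_dist_nonneg: "0 \<le> pattern_dist m S T"
  unfolding pattern_dist_def by (intro cInf_greatest) auto

lemma Metric_space_pattern_dist:
  fixes \<Omega> :: "('n::finite, 'l) pattern set"
  assumes nice: "\<And>S. S \<in> \<Omega> \<Longrightarrow> locally_finite_pattern m S"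
  shows "Metric_space \<Omega> (pattern_dist m)"
proof
  fix S T V :: "('n, 'l) pattern"
  show "0 \<le> pattern_dist m S T" by (rule pattern_dist_nonneg)
  show "pattern_dist m S T = pattern_dist m T S"
    unfolding pattern_dist_def using close_sym[of m _ S T] close_sym[of m _ T S]
    by (intro arg_cong[where f=Inf]) auto
  assume S: "S \<in> \<Omega>" and T: "T \<in> \<Omega>"
  show "pattern_dist m S T = 0 \<longleftrightarrow> S = T"
  proof
    assume 0: "pattern_dist m S T = 0"
    have "close m e S T" if "0 < e" "e \<le> 1/2" for e
      using that 0 pattern_dist_less_imp_close[of m S T e] by auto
    then show "S = T"
      using close_all_imp_subset[of m S T] close_all_imp_subset[of m T S] nice S T close_sym by blast
  next
    assume "S = T"
    have "pattern_dist m S T \<le> 0 + e" if "0 < e" for e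
      using that close_refl[of m S e] nice[OF S] \<open>S = T\<close> pattern_dist_le[of e m S T] by simp
    then have "pattern_dist m S T \<le> 0"
      by (rule field_le_epsilon)
    then show "pattern_dist m S T = 0" using pattern_dist_nonneg[of m S T] by simp
  qed
  assume V: "V \<in> \<Omega>"
  show "pattern_dist m S V \<le> pattern_dist m S T + pattern_dist m T V"
  proof (rule field_le_epsilon)
    fix e :: real assume "e > 0"
    show "pattern_dist m S V \<le> pattern_dist m S T + pattern_dist m T V + e"
    proof (cases "pattern_dist m S T + e/2 \<le> 1/2 \<and> pattern_dist m T V + e/2 \<le> 1/2")
      case True
      let ?a = "pattern_dist m S T + e/2" and ?b = "pattern_dist m T V + e/2"
      have "close m (?a + ?b) S V"
        using True S T V \<open>e > 0\<close> pattern_dist_nonneg[of m S T] pattern_dist_nonneg[of m T V]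
        by (intro close_trans[of m S T V] nice pattern_dist_less_imp_close) auto
      then show ?thesis
        using pattern_dist_le[of "?a+?b" m S V] \<open>e > 0\<close> pattern_dist_nonneg[of m S T]
          pattern_dist_nonneg[of m T V] by auto
    next
      case False
      then show ?thesis
        using pattern_dist_le_half[of m S V] pattern_dist_nonneg[of m S T] pattern_dist_nonneg[of m T V]
          \<open>e > 0\<close> by auto
    qed
  qed
qed

lemma tiling_topology_eq_mtopology:
  assumes nice: "\<And>S. S \<in> \<Omega> \<Longrightarrow> locally_finite_pattern m S"
  shows "tiling_topology m \<Omega> = Metric_space.mtopology \<Omega> (pattern_dist m)"
proof -
  interpret Metric_space \<Omega> "pattern_dist m" by (rule Metric_space_pattern_dist[OF nice])
  have "(\<exists>\<epsilon>>0. \<forall>T\<in>\<Omega>. close m \<epsilon> S T \<longrightarrow> T \<in> U) \<longleftrightarrow> (\<exists>r>0. mball S r \<subseteq> U)" if "S \<in> \<Omega>" for S U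
  proof
    assume "\<exists>\<epsilon>>0. \<forall>T\<in>\<Omega>. close m \<epsilon> S T \<longrightarrow> T \<in> U"
    then obtain e where e: "e > 0" "\<forall>T\<in>\<Omega>. close m e S T \<longrightarrow> T \<in> U" by blast
    have "mball S (min e (1/2)) \<subseteq> U"
    proof
      fix T assume T: "T \<in> mball S (min e (1/2))"
      then have "close m (min e (1/2)) S T" by (intro pattern_dist_less_imp_close) auto
      then have "close m e S T" using e close_mono[of m "min e (1/2)" S T e] by auto
      then show "T \<in> U" using e T by auto
    qed
    then show "\<exists>r>0. mball S r \<subseteq> U" using e by (intro exI[of _ "min e (1/2)"]) auto
  next
    assume "\<exists>r>0. mball S r \<subseteq> U"
    then obtain r where r: "r > 0" "mball S r \<subseteq> U" by blast
    have "T \<in> U" if "T \<in> \<Omega>" "close m (r/2) S T" for T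
      using r that \<open>S \<in> \<Omega>\<close> pattern_dist_le[of "r/2" m S T] by auto
    then show "\<exists>\<epsilon>>0. \<forall>T\<in>\<Omega>. close m \<epsilon> S T \<longrightarrow> T \<in> U" using r by (intro exI[of _ "r/2"]) auto
  qed
  then have "openin (tiling_topology m \<Omega>) U \<longleftrightarrow> openin mtopology U" for U
    unfolding openin_tiling_topology openin_mtopology by (auto simp: subset_iff)
  then show ?thesis unfolding topology_eq by blast
qed

lemma limitin_tiling_topology:
  assumes nice: "\<And>S. S \<in> \<Omega> \<Longrightarrow> locally_finite_pattern m S" 
  shows "limitin (tiling_topology m \<Omega>) \<sigma> T F \<longleftrightarrow>
     T \<in> \<Omega> \<and> (\<forall>e>0. \<forall>\<^sub>F n in F. \<sigma> n \<in> \<Omega> \<and> close m e (\<sigma> n) T)"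
proof -
  interpret Metric_space \<Omega> "pattern_dist m" by (rule Metric_space_pattern_dist[OF nice])
  have "(\<forall>e>0. \<forall>\<^sub>F n in F. \<sigma> n \<in> \<Omega> \<and> pattern_dist m (\<sigma> n) T < e) \<longleftrightarrow>
        (\<forall>e>0. \<forall>\<^sub>F n in F. \<sigma> n \<in> \<Omega> \<and> close m e (\<sigma> n) T)" (is "?L = ?R")
  proof
    assume L: ?L
    show ?R
    proof (intro allI impI)
      fix e :: real assume "e > 0"
      then have "0 < min e (1/2)" by simp
      then have "\<forall>\<^sub>F n in F. \<sigma> n \<in> \<Omega> \<and> pattern_dist m (\<sigma> n) T < min e (1/2)" using L by blast
      then show "\<forall>\<^sub>F n in F. \<sigma> n \<in> \<Omega> \<and> close m e (\<sigma> n) T"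
        by (rule eventually_mono)
           (use \<open>e > 0\<close> close_mono[of m "min e (1/2)" _ T e] pattern_dist_less_imp_close[of m _ T "min e (1/2)"] in auto)
    qed
  next
    assume R: ?R
    show ?L
    proof (intro allI impI)
      fix e :: real assume "e > 0"
      have "0 < e/2" using \<open>e > 0\<close> by simp
      then have "\<forall>\<^sub>F n in F. \<sigma> n \<in> \<Omega> \<and> close m (e/2) (\<sigma> n) T" using R by blast
      then show "\<forall>\<^sub>F n in F. \<sigma> n \<in> \<Omega> \<and> pattern_dist m (\<sigma> n) T < e"
      proof (rule eventually_mono)
        fix n assume n: "\<sigma> n \<in> \<Omega> \<and> close m (e/2) (\<sigma> n) T"
        then have "pattern_dist m (\<sigma> n) T \<le> e/2" using \<open>e > 0\<close> by (intro pattern_dist_le) auto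
        then show "\<sigma> n \<in> \<Omega> \<and> pattern_dist m (\<sigma> n) T < e" using n \<open>e > 0\<close> by linarith
      qed
    qed
  qed
  then show ?thesis
    by (simp only: tiling_topology_eq_mtopology[OF nice] limitin_metric)
qed

section \<open>Translations and uniform Delone constants\<close>

lemma shift_tile_0 [simp]: "shift_tile 0 t = t"
  unfolding shift_tile_def by simp

lemma shift_tile_add: "shift_tile x (shift_tile y t) = shift_tile (x + y) t"
  unfolding shift_tile_def by (auto simp: image_image algebra_simps)

lemma fst_shift_tile: "fst (shift_tile x t) = (\<lambda>y. y - x) ` fst t"
  and snd_shift_tile [simp]: "snd (shift_tile x t) = snd t"
  unfolding shift_tile_def by auto

lemma shift_0 [simp]: "shift 0 T = T"
  unfolding shift_def by (simp add: image_def)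

lemma shift_add: "shift x (shift y T) = shift (x + y) T"
  unfolding shift_def by (simp add: image_image shift_tile_add)

lemma shift_tile_cancel [simp]:
  "shift_tile x (shift_tile (- x) t) = t" "shift_tile (- x) (shift_tile x t) = t"
  by (simp_all add: shift_tile_add)

lemma mem_shift_iff: "t \<in> shift x T \<longleftrightarrow> shift_tile (- x) t \<in> T"
proof
  assume "t \<in> shift x T"
  then obtain s where "s \<in> T" "t = shift_tile x s" unfolding shift_def by blast
  then show "shift_tile (- x) t \<in> T" by simp
next
  assume "shift_tile (- x) t \<in> T"
  then have "shift_tile x (shift_tile (- x) t) \<in> shift x T" unfolding shift_def by (rule imageI)
  then show "t \<in> shift x T" by simp
qed

lemma shift_tile_mem_shift [simp]: "shift_tile x t \<in> shift x T \<longleftrightarrow> t \<in> T"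
  by (simp add: mem_shift_iff)

lemma shift_tile_inject [simp]: "shift_tile x s = shift_tile x t \<longleftrightarrow> s = t"
  by (metis shift_tile_cancel(2))

lemma shift_tile_meets_ball:
  fixes x :: "real ^ 'n"
  shows "fst (shift_tile x t) \<inter> ball y r \<noteq> {} \<longleftrightarrow> fst t \<inter> ball (x + y) r \<noteq> {}"
proof -
  have "dist y (z - x) = dist (x + y) z" for z :: "real ^ 'n"
    by (simp add: dist_norm algebra_simps)
  then show ?thesis by (auto simp: fst_shift_tile disjoint_iff)
qed

lemma patch_shift: "patch (shift x T) y R = shift x (patch T (x + y) R)"
proof (intro set_eqI)
  fix t show "t \<in> patch (shift x T) y R \<longleftrightarrow> t \<in> shift x (patch T (x + y) R)"
    using shift_tile_meets_ball[of x "shift_tile (-x) t" y R] by (simp add: patch_def mem_shift_iff)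
qed

lemma ball_subset_ball_origin:
  fixes x :: "'a::real_normed_vector"
  assumes "norm x + r \<le> R" shows "ball x r \<subseteq> ball 0 R"
proof
  fix y assume "y \<in> ball x r"
  then show "y \<in> ball 0 R" using assms norm_triangle_sub[of y x] by (auto simp: dist_norm norm_minus_commute)
qed

lemma patch_eq_mono:
  assumes "patch S 0 R = patch T 0 R" "norm x + r \<le> R"
  shows "patch S x r = patch T x r"
proof -
  have sub: "ball x r \<subseteq> ball 0 R" using ball_subset_ball_origin assms(2) .
  have "patch S x r = {t \<in> patch S 0 R. fst t \<inter> ball x r \<noteq> {}}" 
       "patch T x r = {t \<in> patch T 0 R. fst t \<inter> ball x r \<noteq> {}}" 
    using sub unfolding patch_def by blast+
  with assms(1) show ?thesis by simp
qed

lemma patch_shift_eq_mono: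
  assumes "patch S 0 R = patch T 0 R" "norm x + r \<le> R"
  shows "patch (shift x S) 0 r = patch (shift x T) 0 r"
  using patch_eq_mono[OF assms] by (simp add: patch_shift)

lemma hausdorff_dist_translate2_le:
  fixes A B :: "(real ^ 'n) set"
  assumes "compact A" "A \<noteq> {}" "compact B" "B \<noteq> {}"
  shows "hausdorff_dist ((\<lambda>y. y - a) ` A) ((\<lambda>y. y - b) ` B) \<le> hausdorff_dist A B + norm (a - b)"
proof (rule hausdorff_dist_le)
  have *: "infdist (z - a) ((\<lambda>y. y - b) ` B) \<le> hausdorff_dist A B + norm (a - b)"
    if AB: "compact A" "A \<noteq> {}" "compact B" "B \<noteq> {}" and z: "z \<in> A"
    for A B :: "(real ^ 'n) set" and z a b
  proof -
    obtain w where w: "w \<in> B" "dist z w \<le> hausdorff_dist A B"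
      using hausdorff_dist_near_point[OF AB z] by blast
    have "infdist (z - a) ((\<lambda>y. y - b) ` B) \<le> dist (z - a) (w - b)"
      using w by (intro infdist_le) auto
    also have "\<dots> = norm ((z - w) - (a - b))" by (simp add: dist_norm algebra_simps)
    also have "\<dots> \<le> norm (z - w) + norm (a - b)" by (rule norm_triangle_ineq4)
    finally show ?thesis using w by (simp add: dist_norm)
  qed
  show "infdist x ((\<lambda>y. y - b) ` B) \<le> hausdorff_dist A B + norm (a - b)" if "x \<in> (\<lambda>y. y - a) ` A" for x
    using that *[of A B _ a b] assms by auto
  show "infdist x ((\<lambda>y. y - a) ` A) \<le> hausdorff_dist A B + norm (a - b)" if "x \<in> (\<lambda>y. y - b) ` B" for x
    using that *[of B A _ b a] assms by (auto simp: hausdorff_dist_commute norm_minus_commute)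
qed (use assms compact_translation_subtract in auto)

text \<open>A nonzero translation moves an extreme point of a compact set away from the whole set.\<close>

lemma norm_le_hausdorff_dist_translate:
  fixes A :: "(real ^ 'n) set"
  assumes "compact A" "A \<noteq> {}"
  shows "norm u \<le> hausdorff_dist A ((\<lambda>y. y - u) ` A)"
proof (cases "u = 0")
  case True then show ?thesis by (simp add: hausdorff_dist_nonneg)
next
  case False
  have "continuous_on A (\<lambda>y. y \<bullet> u)" by (intro continuous_intros)
  then obtain x where x: "x \<in> A" "\<forall>y\<in>A. x \<bullet> u \<le> y \<bullet> u"
    using continuous_attains_inf assms by metis
  obtain y where y: "y \<in> A" "dist (x - u) y \<le> hausdorff_dist ((\<lambda>y. y - u) ` A) A"
    by (rule hausdorff_dist_near_point[of "(\<lambda>y. y - u) ` A" A "x - u"])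
       (use assms x(1) compact_translation_subtract[of A u] in auto)
  have "u \<bullet> u \<le> (y - (x - u)) \<bullet> u" using x y by (simp add: inner_diff_left)
  also have "\<dots> \<le> norm (y - (x - u)) * norm u" by (rule norm_cauchy_schwarz)
  finally have "norm u * norm u \<le> norm (y - (x - u)) * norm u"
    by (simp add: dot_square_norm power2_eq_square)
  then have "norm u \<le> norm (y - (x - u))" using False by simp
  then show ?thesis using y by (simp add: dist_norm norm_minus_commute hausdorff_dist_commute)
qed

lemma tile_close_shift:
  assumes "tile_close m e s t" "compact (fst s)" "fst s \<noteq> {}" "compact (fst t)" "fst t \<noteq> {}"
    "e + norm (x - y) \<le> e'"
  shows "tile_close m e' (shift_tile x s) (shift_tile y t)"
  using assms hausdorff_dist_translate2_le[of "fst s" "fst t" x y] norm_ge_zero[of "x - y"]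
  unfolding tile_close_def by (auto simp: fst_shift_tile simp del: norm_ge_zero)

text \<open>
  Recentring by a vector of length at most \<open>b\<close> costs \<open>b\<close> in the radius of the matched ball, and a
  discrepancy \<open>x - y\<close> of the two translations costs its length in the distance of matched tiles.
\<close>

lemma close_shift:
  fixes S T :: "('n::finite, 'l) pattern"
  assumes S: "locally_finite_pattern m S" and T: "locally_finite_pattern m T" and cl: "close m e S T"
    and b: "norm x \<le> b" "norm y \<le> b" and e: "e + norm (x - y) \<le> e'" "1/e' + b \<le> 1/e"
  shows "close m e' (shift x S) (shift y T)"
proof -
  obtain S0 T0 f where *: "patch S 0 (1/e) \<subseteq> S0" "S0 \<subseteq> S" "patch T 0 (1/e) \<subseteq> T0" "T0 \<subseteq> T"
      "bij_betw f S0 T0" "\<forall>t\<in>S0. tile_close m e t (f t)"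
    using cl unfolding close_iff by blast
  have sub: "shift_tile (-z) t \<in> patch P 0 (1/e)" if "t \<in> patch (shift z P) 0 (1/e')" "norm z \<le> b" for z t P
  proof -
    have "ball z (1/e') \<subseteq> ball 0 (1/e)"
      by (rule ball_subset_ball_origin) (use that(2) e in linarith)
    then show ?thesis
      using that(1) shift_tile_meets_ball[of z "shift_tile (-z) t" 0 "1/e'"]
      unfolding patch_def by (auto simp: mem_shift_iff)
  qed
  let ?g = "shift_tile y \<circ> f \<circ> shift_tile (- x)"
  have bx: "bij_betw (shift_tile (- x)) (shift_tile x ` S0) S0"
    by (rule bij_betw_byWitness[where f' = "shift_tile x"]) auto
  have bij: "bij_betw ?g (shift_tile x ` S0) (shift_tile y ` T0)"
    using bij_betw_trans[OF bx bij_betw_trans[OF *(5)], of "shift_tile y" "shift_tile y ` T0"]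
    by (simp add: bij_betw_def inj_on_def comp_assoc)
  have tc: "tile_close m e' t (?g t)" if t: "t \<in> shift_tile x ` S0" for t
  proof -
    obtain s where s: "t = shift_tile x s" "s \<in> S0" using t by (rule imageE)
    then have "s \<in> S" "f s \<in> T" using *(2,4) bij_betwE[OF *(5)] by blast+
    then have "tile_close m e' (shift_tile x s) (shift_tile y (f s))"
      using S T e *(6) s(2) unfolding locally_finite_pattern_def by (intro tile_close_shift[of m e]) blast+
    then show ?thesis using s by simp
  qed
  have sub': "patch (shift z P) 0 (1/e') \<subseteq> shift_tile z ` P0"
    if "patch P 0 (1/e) \<subseteq> P0" "norm z \<le> b" for z P and P0 :: "('n, 'l) pattern"
  proof
    fix t assume "t \<in> patch (shift z P) 0 (1/e')"
    then have "shift_tile (- z) t \<in> P0" using sub that by blast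
    then have "shift_tile z (shift_tile (- z) t) \<in> shift_tile z ` P0" by (rule imageI)
    then show "t \<in> shift_tile z ` P0" by simp
  qed
  have "patch (shift x S) 0 (1/e') \<subseteq> shift_tile x ` S0" "patch (shift y T) 0 (1/e') \<subseteq> shift_tile y ` T0"
    using sub' *(1,3) b by blast+
  moreover have "shift_tile x ` S0 \<subseteq> shift x S" "shift_tile y ` T0 \<subseteq> shift y T"
    using *(2,4) unfolding shift_def by blast+
  ultimately show ?thesis
    unfolding close_iff using bij tc
    by (intro exI[of _ "shift_tile x ` S0"] exI[of _ "shift_tile y ` T0"] exI[of _ ?g] conjI ballI)
qed

lemma finite_separated_bounded:
  fixes A :: "'a::euclidean_space set"
  assumes "bounded A" "0 < r" "\<And>x y. x \<in> A \<Longrightarrow> y \<in> A \<Longrightarrow> x \<noteq> y \<Longrightarrow> r \<le> dist x y"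
  shows "finite A"
proof (rule ccontr)
  assume "infinite A"
  then obtain l where "l islimpt A" using assms(1) bounded_infinite_imp_islimpt by blast
  then have "\<exists>x\<in>A. x \<noteq> l \<and> dist x l < e" if "0 < e" for e using that unfolding islimpt_approachable by blast
  then obtain x y where "x \<in> A" "x \<noteq> l" "dist x l < r/2" "y \<in> A" "y \<noteq> l" "dist y l < min (r/2) (dist x l)"
    using assms(2) by (metis half_gt_zero min_less_iff_conj zero_less_dist_iff)
  then show False
    using assms(3)[of x y] dist_triangle2[of x y l] by auto
qed

lemma locally_finite_delone_pattern:
  assumes "delone_pattern m T" shows "locally_finite_pattern m T"
proof -
  obtain \<Lambda> lab where *: "delone \<Lambda>" "lab ` \<Lambda> \<subseteq> mspace m" "T = (\<lambda>p. ({p}, lab p)) ` \<Lambda>"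
    using assms unfolding delone_pattern_def by blast
  obtain r where r: "r > 0" "\<forall>p\<in>\<Lambda>. \<forall>q\<in>\<Lambda>. p \<noteq> q \<longrightarrow> r \<le> dist p q" using *(1) unfolding delone_def by blast
  have "finite (patch T 0 R)" for R
  proof -
    have "finite (\<Lambda> \<inter> ball 0 R)"
      using r by (intro finite_separated_bounded[of _ r]) (auto intro: bounded_subset[OF bounded_ball])
    moreover have "patch T 0 R \<subseteq> (\<lambda>p. ({p}, lab p)) ` (\<Lambda> \<inter> ball 0 R)"
      using *(3) unfolding patch_def by auto
    ultimately show ?thesis using finite_surj by blast
  qed
  then show ?thesis using * unfolding locally_finite_pattern_def by auto
qed

text \<open>
  The common ground of tiling spaces and spaces of Delone patterns: every tile carries a control
  point, and separation and density hold with constants that do not depend on the pattern.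
\<close>

locale pattern_space =
  fixes m :: "'l metric" and \<Omega> :: "('n::finite, 'l) pattern set"
    and c :: "('n, 'l) tile \<Rightarrow> real ^ 'n" and \<kappa> D :: real
  assumes shift_closed: "T \<in> \<Omega> \<Longrightarrow> shift x T \<in> \<Omega>"
    and tiles: "T \<in> \<Omega> \<Longrightarrow> t \<in> T \<Longrightarrow> compact (fst t) \<and> fst t \<noteq> {} \<and> snd t \<in> mspace m"
    and control: "control_points m \<Omega> c"
    and \<kappa>_pos: "0 < \<kappa>"
    and control_sep: "T \<in> \<Omega> \<Longrightarrow> s \<in> T \<Longrightarrow> t \<in> T \<Longrightarrow> s \<noteq> t \<Longrightarrow> \<kappa> \<le> dist (c s) (c t)"
    and tile_sep: "T \<in> \<Omega> \<Longrightarrow> s \<in> T \<Longrightarrow> t \<in> T \<Longrightarrow> s \<noteq> t \<Longrightarrow> \<kappa> \<le> hausdorff_dist (fst s) (fst t)"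
    and control_dense: "T \<in> \<Omega> \<Longrightarrow> \<exists>t\<in>T. dist x (c t) \<le> D"
    and tile_diam: "T \<in> \<Omega> \<Longrightarrow> t \<in> T \<Longrightarrow> x \<in> fst t \<Longrightarrow> dist x (c t) \<le> D"
    and compact_\<Omega>: "compact_space (tiling_topology m \<Omega>)"
    and compact_labels: "compact_space (mtopology_of m)"
begin

lemma control_shift: "T \<in> \<Omega> \<Longrightarrow> t \<in> T \<Longrightarrow> c (shift_tile x t) = c t - x"
  using control unfolding control_points_def by blast

lemma control_mem: "T \<in> \<Omega> \<Longrightarrow> t \<in> T \<Longrightarrow> c t \<in> fst t"
  using control rel_interior_subset unfolding control_points_def by blast

lemma control_inj: "T \<in> \<Omega> \<Longrightarrow> s \<in> T \<Longrightarrow> t \<in> T \<Longrightarrow> c s = c t \<Longrightarrow> s = t"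
  using control_sep[of T s t] \<kappa>_pos by auto

lemma D_nonneg: "T \<in> \<Omega> \<Longrightarrow> 0 \<le> D"
  using control_dense[of T 0] zero_le_dist order_trans by blast

lemma finite_patch: 
  assumes "T \<in> \<Omega>" shows "finite (patch T x R)"
proof -
  have "inj_on c (patch T x R)"
    using control_inj[OF assms] unfolding patch_def inj_on_def by blast
  moreover have "c ` patch T x R \<subseteq> cball x (R + D)"
  proof
    fix p assume "p \<in> c ` patch T x R"
    then obtain t where t0: "t \<in> T" "p = c t" "fst t \<inter> ball x R \<noteq> {}" unfolding patch_def by blast
    then obtain y where t: "t \<in> T" "p = c t" "y \<in> fst t" "dist x y < R" by auto
    then show "p \<in> cball x (R + D)"
      using tile_diam[OF assms t(1,3)] dist_triangle[of x "c t" y] by auto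
  qed
  then have "bounded (c ` patch T x R)" by (rule bounded_subset[OF bounded_cball])
  then have "finite (c ` patch T x R)"
  proof (rule finite_separated_bounded[OF _ \<kappa>_pos])
    fix p q assume "p \<in> c ` patch T x R" "q \<in> c ` patch T x R" "p \<noteq> q"
    then obtain s t where "s \<in> T" "t \<in> T" "s \<noteq> t" "p = c s" "q = c t" unfolding patch_def by blast
    then show "\<kappa> \<le> dist p q" using control_sep[OF assms] by blast
  qed
  ultimately show ?thesis using finite_imageD by blast
qed

lemma locally_finite: "T \<in> \<Omega> \<Longrightarrow> locally_finite_pattern m T"
  unfolding locally_finite_pattern_def using tiles finite_patch by blast

sublocale metric: Metric_space \<Omega> "pattern_dist m"
  by (rule Metric_space_pattern_dist[OF locally_finite])

lemma topology_eq: "tiling_topology m \<Omega> = metric.mtopology"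
  by (rule tiling_topology_eq_mtopology[OF locally_finite])

lemma limitin_iff:
  "limitin metric.mtopology \<sigma> T F \<longleftrightarrow> T \<in> \<Omega> \<and> (\<forall>e>0. \<forall>\<^sub>F n in F. \<sigma> n \<in> \<Omega> \<and> close m e (\<sigma> n) T)"
  using limitin_tiling_topology[of \<Omega> m \<sigma> T F] locally_finite unfolding topology_eq by blast

lemma limitin_shift:
  assumes "limitin metric.mtopology \<sigma> T F" "(x \<longlongrightarrow> a) F"
  shows "limitin metric.mtopology (\<lambda>n. shift (x n) (\<sigma> n)) (shift a T) F"
  unfolding limitin_iff
proof (intro conjI allI impI)
  have T: "T \<in> \<Omega>" and ev: "\<And>e. e > 0 \<Longrightarrow> \<forall>\<^sub>F n in F. \<sigma> n \<in> \<Omega> \<and> close m e (\<sigma> n) T"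
    using assms(1) unfolding limitin_iff by auto
  show "shift a T \<in> \<Omega>" using T shift_closed by blast
  fix e :: real assume "e > 0"
  \<comment> \<open>\<open>e1\<close> leaves room for a recentring by at most \<open>b\<close>: its ball has radius at least \<open>1/e + b\<close>\<close>
  define b where "b = norm a + 1"
  define e1 where "e1 = min (e/2) (1 / (1/e + b))"
  have b: "b > 0" unfolding b_def by (simp add: add_nonneg_pos)
  have e1: "e1 > 0" "e1 \<le> e/2" unfolding e1_def using \<open>e > 0\<close> b by (auto intro: add_pos_pos)
  have "e1 \<le> 1 / (1/e + b)" unfolding e1_def by simp
  then have e1': "1/e + b \<le> 1/e1" using e1(1) b \<open>e > 0\<close> by (simp add: field_simps add_pos_pos)
  have "\<forall>\<^sub>F n in F. dist (x n) a < min 1 (e/2)" using assms(2) \<open>e > 0\<close> by (intro tendstoD) auto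
  then show "\<forall>\<^sub>F n in F. shift (x n) (\<sigma> n) \<in> \<Omega> \<and> close m e (shift (x n) (\<sigma> n)) (shift a T)"
    using ev[OF e1(1)]
  proof eventually_elim
    case (elim n)
    have "norm (x n) \<le> b" "norm a \<le> b" "norm (x n - a) \<le> e/2"
      using elim norm_triangle_sub[of "x n" a] unfolding b_def by (auto simp: dist_norm)
    then have "close m e (shift (x n) (\<sigma> n)) (shift a T)"
      using elim T e1 e1' by (intro close_shift[where e = e1 and b = b] locally_finite) auto
    then show ?case using elim shift_closed by blast
  qed
qed

text \<open>
  A translation shorter than the separation of the tiles can only match a tile with its own translate,
  and this moves it by exactly the length of the translation.
\<close>

lemma near_period_small:
  assumes S: "S \<in> \<Omega>" and cl: "close m e S (shift u S)" and e: "0 < e" "e * (D + 1) \<le> 1" "norm u + e \<le> \<kappa>"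
  shows "norm u < e"
proof -
  obtain S0 T0 f where *: "patch S 0 (1/e) \<subseteq> S0" "S0 \<subseteq> S" "T0 \<subseteq> shift u S"
      "bij_betw f S0 T0" "\<forall>t\<in>S0. tile_close m e t (f t)"
    using cl unfolding close_iff by blast
  obtain t where t: "t \<in> S" "dist 0 (c t) \<le> D" using control_dense[OF S] by blast
  have "D < 1/e" using e by (simp add: field_simps)
  then have "t \<in> patch S 0 (1/e)" using t control_mem[OF S t(1)] unfolding patch_def by auto
  then have ft: "f t \<in> shift u S" "tile_close m e t (f t)" using * bij_betwE[OF *(4)] by blast+
  define t' where "t' = shift_tile (- u) (f t)"
  have t': "t' \<in> S" "f t = shift_tile u t'" using ft unfolding t'_def by (simp_all add: mem_shift_iff)
  have ct: "compact (fst t)" "fst t \<noteq> {}" "compact (fst t')" "fst t' \<noteq> {}" using tiles[OF S] t t' by auto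
  have h: "hausdorff_dist (fst t) ((\<lambda>y. y - u) ` fst t') < e"
    using ft t' unfolding tile_close_def by (simp add: fst_shift_tile)
  have "hausdorff_dist (fst t) (fst t') < e + norm u"
    using hausdorff_dist_translate2_le[of "fst t" "(\<lambda>y. y - u) ` fst t'" 0 "-u"] ct h compact_translation_subtract[of "fst t'" u]
    by (simp add: image_image)
  then have "t = t'" using tile_sep[OF S t(1) t'(1)] e by auto
  then show ?thesis using h norm_le_hausdorff_dist_translate[of "fst t" u] ct by auto
qed

end

section \<open>Control points and uniform constants\<close>

lemma (in Metric_space) continuous_map_sequentially:
  assumes "\<And>\<sigma> l. limitin mtopology \<sigma> l sequentially \<Longrightarrow> range \<sigma> \<subseteq> M \<Longrightarrow> limitin Y (\<lambda>n. f (\<sigma> n)) (f l) sequentially"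
  shows "continuous_map mtopology Y f"
  unfolding continuous_map_closedin
proof (intro conjI allI impI)
  have const: "limitin mtopology (\<lambda>n::nat. l) l sequentially" if "l \<in> M" for l
    using that by (simp add: limitin_const_iff)
  show "f \<in> topspace mtopology \<rightarrow> topspace Y"
  proof
    fix l assume "l \<in> topspace mtopology"
    then have "limitin Y (\<lambda>n::nat. f l) (f l) sequentially" using assms[OF const[of l]] by auto
    then show "f l \<in> topspace Y" by (rule limitin_topspace)
  qed
  fix C assume C: "closedin Y C"
  show "closedin mtopology {x \<in> topspace mtopology. f x \<in> C}"
    unfolding metric_closedin_iff_sequentially_closed
  proof (intro conjI allI impI)
    fix \<sigma> l assume *: "range \<sigma> \<subseteq> {x \<in> topspace mtopology. f x \<in> C} \<and> limitin mtopology \<sigma> l sequentially"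
    then have "limitin Y (\<lambda>n. f (\<sigma> n)) (f l) sequentially" by (intro assms) auto
    moreover have "\<forall>\<^sub>F n in sequentially. f (\<sigma> n) \<in> C" using * by (auto simp: image_subset_iff)
    ultimately have "f l \<in> C" by (intro limitin_closedin[OF _ C]) auto
    then show "l \<in> {x \<in> topspace mtopology. f x \<in> C}" using * limitin_mspace by auto
  qed auto
qed

lemma continuous_map_mtopology_of_sequentially:
  fixes f :: "'a \<Rightarrow> 'b::topological_space"
  assumes "\<And>\<sigma> l. \<lbrakk>l \<in> mspace M; \<And>n. \<sigma> n \<in> mspace M; (\<lambda>n. mdist M (\<sigma> n) l) \<longlonglongrightarrow> 0\<rbrakk> \<Longrightarrow> (\<lambda>n. f (\<sigma> n)) \<longlonglongrightarrow> f l"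
  shows "continuous_map (mtopology_of M) euclidean f"
proof -
  interpret Metric_space "mspace M" "mdist M" by simp
  have "continuous_map mtopology euclidean f"
  proof (rule continuous_map_sequentially)
    fix \<sigma> l assume *: "limitin mtopology \<sigma> l sequentially" "range \<sigma> \<subseteq> mspace M"
    then have "(\<lambda>n. mdist M (\<sigma> n) l) \<longlonglongrightarrow> 0" unfolding limitin_metric_dist_null by auto
    then show "limitin euclidean (\<lambda>n. f (\<sigma> n)) (f l) sequentially"
      using * assms[of l \<sigma>] limitin_mspace by (auto simp: image_subset_iff)
  qed
  then show ?thesis by (simp add: mtopology_of_def)
qed

lemma tendsto_zero_le:
  fixes f g :: "'a \<Rightarrow> real"
  assumes "\<And>n. 0 \<le> f n" "\<And>n. f n \<le> g n" "(g \<longlongrightarrow> 0) F"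
  shows "(f \<longlongrightarrow> 0) F"
  by (rule tendsto_sandwich[OF _ _ tendsto_const assms(3)]) (simp_all add: assms(1,2))

definition centroid :: "(real ^ 'n::finite) set \<Rightarrow> real ^ 'n" where
  "centroid K = (\<integral>x. indicator K x *\<^sub>R x \<partial>lborel) /\<^sub>R measure lborel K"

lemma centroid_integrable:
  fixes K :: "(real ^ 'n) set"
  assumes "compact K" shows "integrable lborel (\<lambda>x. indicator K x *\<^sub>R x)"
  using borel_integrable_compact[OF assms, of "\<lambda>x. x"] by (simp add: set_integrable_def)

lemma compact_emeasure_finite: "compact K \<Longrightarrow> emeasure lborel K < \<infinity>"
  using emeasure_bounded_finite compact_imp_bounded by blast

lemma measure_pos_of_interior:
  fixes K :: "(real ^ 'n) set"
  assumes "compact K" "interior K \<noteq> {}"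
  shows "0 < measure lborel K"
proof -
  obtain x e where e: "e > 0" "ball x e \<subseteq> K" using assms(2) mem_interior by blast
  have "0 < measure lborel (ball x e)" using content_ball_pos[OF e(1), of x] by (simp add: content_ball_pos e)
  also have "\<dots> \<le> measure lborel K"
    using assms(1) e compact_emeasure_finite[of K] by (intro measure_mono_fmeasurable) (auto simp: fmeasurable_def borel_compact)
  finally show ?thesis .
qed

lemma centroid_translate:
  fixes K :: "(real ^ 'n) set"
  assumes "compact K" "interior K \<noteq> {}"
  shows "centroid ((\<lambda>y. y - x) ` K) = centroid K - x"
proof -
  let ?K = "(\<lambda>y. y - x) ` K"
  have mem: "- x + y \<in> ?K \<longleftrightarrow> y \<in> K" for y
  proof
    assume "- x + y \<in> ?K" then show "y \<in> K" by (auto simp: algebra_simps)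
  next
    assume "y \<in> K" then show "- x + y \<in> ?K" by (auto intro!: image_eqI[of _ _ y])
  qed
  have K: "?K \<in> sets borel" "K \<in> sets borel"
    using compact_translation_subtract[OF assms(1), of x] assms(1) borel_compact by auto
  have lb: "(lborel :: (real^'n) measure) = distr lborel borel ((+) (- x))" by (rule lborel_distr_plus[symmetric])
  have "measure lborel ?K = measure (distr lborel borel ((+) (- x))) ?K" using lb by simp
  also have "\<dots> = measure lborel K"
    using K mem by (subst measure_distr) (auto intro!: arg_cong[where f = "measure lborel"])
  finally have 1: "measure lborel ?K = measure lborel K" .
  have "(\<integral>y. indicator ?K y *\<^sub>R y \<partial>lborel) = (\<integral>y. indicator ?K y *\<^sub>R y \<partial>distr lborel borel ((+) (- x)))"
    using lb by simp
  also have "\<dots> = (\<integral>y. indicator ?K (- x + y) *\<^sub>R (- x + y) \<partial>lborel)"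
    using K by (subst integral_distr) auto
  also have "\<dots> = (\<integral>y. indicator K y *\<^sub>R y - indicator K y *\<^sub>R x \<partial>lborel)"
    using mem by (intro Bochner_Integration.integral_cong) (auto simp: indicator_def)
  also have "\<dots> = (\<integral>y. indicator K y *\<^sub>R y \<partial>lborel) - measure lborel K *\<^sub>R x"
    using K centroid_integrable[OF assms(1)] compact_emeasure_finite[OF assms(1)]
    by (subst Bochner_Integration.integral_diff) auto
  finally show ?thesis
    using 1 measure_pos_of_interior[OF assms] unfolding centroid_def by (simp add: scaleR_diff_right)
qed

text \<open>
  If the centroid were not interior, a hyperplane through it would bound \<open>K\<close>, and the mean of the
  corresponding linear functional over \<open>K\<close> would be strictly less than its maximum.
\<close>

lemma centroid_interior:
  fixes K :: "(real ^ 'n) set"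
  assumes K: "compact K" "convex K" "interior K \<noteq> {}"
  shows "centroid K \<in> interior K"
proof (rule ccontr)
  assume "centroid K \<notin> interior K"
  then obtain a b where ab: "a \<noteq> 0" "\<And>x. x \<in> interior K \<Longrightarrow> inner a x \<le> b" "b \<le> inner a (centroid K)"
    using separating_hyperplane_sets[of "interior K" "{centroid K}"] K convex_interior by auto
  have "closure (interior K) = K"
    using convex_closure_interior[OF K(2,3)] closure_closed[OF compact_imp_closed[OF K(1)]] by simp
  moreover have "closure (interior K) \<subseteq> {x. inner a x \<le> b}"
    using ab(2) closed_halfspace_le by (intro closure_minimal) auto
  ultimately have le: "inner a x \<le> b" if "x \<in> K" for x using that by blast
  \<comment> \<open>\<open>g\<close> is nonnegative with nonpositive integral, hence zero almost everywhere, although it is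
    positive on a ball in \<open>K\<close>\<close>
  define g where "g = (\<lambda>x. indicator K x * (b - inner a x))"
  have Kb: "K \<in> sets borel" using K(1) borel_compact by blast
  have int: "integrable lborel g" and ig: "integral\<^sup>L lborel g = measure lborel K * b - inner a (\<integral>x. indicator K x *\<^sub>R x \<partial>lborel)"
  proof -
    have i1: "integrable lborel (\<lambda>x. indicator K x * b)"
      using Kb compact_emeasure_finite[OF K(1)] by (intro integrable_mult_left) auto
    have i2: "integrable lborel (\<lambda>x. inner a (indicator K x *\<^sub>R x))"
      using centroid_integrable[OF K(1)] by (intro integrable_inner_right) auto
    have g: "g = (\<lambda>x. indicator K x * b - inner a (indicator K x *\<^sub>R x))"
      unfolding g_def by (auto simp: algebra_simps)
    show "integrable lborel g" unfolding g using i1 i2 by (rule Bochner_Integration.integrable_diff)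
    show "integral\<^sup>L lborel g = measure lborel K * b - inner a (\<integral>x. indicator K x *\<^sub>R x \<partial>lborel)"
      unfolding g using centroid_integrable[OF K(1)] Kb
      by (subst Bochner_Integration.integral_diff[OF i1 i2])
         (simp del: inner_scaleR_right add: compact_emeasure_finite[OF K(1)])
  qed
  have mK: "0 < measure lborel K" using measure_pos_of_interior K by blast
  have "inner a (\<integral>x. indicator K x *\<^sub>R x \<partial>lborel) = measure lborel K * inner a (centroid K)"
    unfolding centroid_def using mK by simp
  then have "integral\<^sup>L lborel g \<le> 0"
    using ig ab(3) mK by simp
  moreover have g0: "0 \<le> g x" for x unfolding g_def using le by (auto simp: indicator_def)
  then have "0 \<le> integral\<^sup>L lborel g" by (intro Bochner_Integration.integral_nonneg) auto
  ultimately have "integral\<^sup>L lborel g = 0" by simp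
  then have "AE x in lborel. g x = 0"
    using integral_nonneg_eq_0_iff_AE[OF int] g0 by auto
  then obtain N where "N \<in> null_sets lborel" "{x. g x \<noteq> 0} \<subseteq> N"
    unfolding eventually_ae_filter by auto
  then have neg: "negligible {x. g x \<noteq> 0}"
    using null_sets_completionI[of N lborel] negligible_iff_null_sets[of N] negligible_subset[of N] by blast
  obtain x0 where "x0 \<in> interior K" using K(3) by blast
  then obtain e where e: "e > 0" "ball x0 e \<subseteq> interior K" using open_contains_ball[of "interior K"] by auto
  have "a \<bullet> x < b" if x: "x \<in> ball x0 e" for x
  proof -
    obtain d where d: "d > 0" "ball x d \<subseteq> ball x0 e" using x open_ball open_contains_ball by blast
    have "x + (d / (2 * norm a)) *\<^sub>R a \<in> ball x d" using d ab(1) by (simp add: dist_norm)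
    then have "a \<bullet> (x + (d / (2 * norm a)) *\<^sub>R a) \<le> b" using ab(2) d e by blast
    moreover have "0 < (d / (2 * norm a)) * (a \<bullet> a)" using d ab(1) by simp
    ultimately show ?thesis by (simp add: inner_add_right)
  qed
  then have "ball x0 e \<subseteq> {x. g x \<noteq> 0}" using e interior_subset[of K] unfolding g_def by (fastforce simp: indicator_def)
  then have "negligible (ball x0 e)" using neg negligible_subset by blast
  then show False using open_not_negligible[of "ball x0 e"] e by auto
qed

text \<open>Convexity turns Hausdorff closeness into containment of slightly smaller balls.\<close>

lemma cball_in_hausdorff_near_convex:
  fixes K L :: "(real ^ 'n) set"
  assumes "compact K" "compact L" "L \<noteq> {}" "convex L" "cball x r \<subseteq> K" "hausdorff_dist K L + s < r"
    and "0 \<le> s"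
  shows "cball x s \<subseteq> L"
proof
  fix w assume w: "w \<in> cball x s"
  define q where "q = r - s"
  have "cball w q \<subseteq> cball x r"
  proof
    fix z assume "z \<in> cball w q" then show "z \<in> cball x r"
      using w dist_triangle[of x z w] unfolding q_def by auto
  qed
  then have q: "cball w q \<subseteq> K" "hausdorff_dist K L < q" "q > 0"
    using assms hausdorff_dist_nonneg[of K L] unfolding q_def by auto
  show "w \<in> L"
  proof (rule ccontr)
    assume "w \<notin> L"
    obtain p where p: "p \<in> L" "\<forall>z\<in>L. dist w p \<le> dist w z"
      using distance_attains_inf[of L w] assms compact_imp_closed by metis
    \<comment> \<open>\<open>p\<close> is the point of \<open>L\<close> nearest to \<open>w\<close>; going from \<open>w\<close> straight away from \<open>p\<close> leads to a point
      \<open>y\<close> that is still in \<open>K\<close> but farther from \<open>L\<close> than the Hausdorff distance allows\<close>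
    define a where "a = (w - p) /\<^sub>R norm (w - p)"
    have wp: "norm (w - p) > 0" using \<open>w \<notin> L\<close> p by auto
    have na: "norm a = 1" unfolding a_def using wp by simp
    define y where "y = w + q *\<^sub>R a"
    have "y \<in> cball w q" unfolding y_def using na q by (simp add: dist_norm)
    then have "y \<in> K" using q by blast
    moreover have "K \<noteq> {}" using \<open>y \<in> K\<close> by blast
    ultimately obtain z where z: "z \<in> L" "dist y z \<le> hausdorff_dist K L"
      using hausdorff_dist_near_point[of K L y] assms by blast
    have "inner (w - p) (z - p) \<le> 0"
      using any_closest_point_dot[of L p z w] assms p z compact_imp_closed by blast
    then have "inner a (z - p) \<le> 0" unfolding a_def using wp by (simp add: divide_simps mult_le_0_iff)
    moreover have "inner a (w - p) = norm (w - p)"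
      unfolding a_def using wp by (simp add: dot_square_norm power2_eq_square)
    moreover have "y - z = (w - p) + q *\<^sub>R a - (z - p)" unfolding y_def by simp
    ultimately have "inner a (y - z) \<ge> norm (w - p) + q"
      using na by (simp add: inner_add_right inner_diff_right dot_square_norm)
    moreover have "inner a (y - z) \<le> norm (y - z)" using norm_cauchy_schwarz[of a "y - z"] na by simp
    ultimately show False using z q wp by (simp add: dist_norm)
  qed
qed

lemma hausdorff_limit_bounded:
  fixes K :: "(real ^ 'n) set"
  assumes "compact K" "K \<noteq> {}" "compact L" "L \<noteq> {}" "hausdorff_dist L K < 1" "K \<subseteq> cball 0 B"
  shows "L \<subseteq> cball 0 (B + 1)"
proof
  fix x assume "x \<in> L"
  then obtain y where "y \<in> K" "dist x y \<le> hausdorff_dist L K" using hausdorff_dist_near_point assms by metis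
  then have "norm y \<le> B" "dist x y \<le> 1" using assms by auto
  then show "x \<in> cball 0 (B + 1)" using norm_triangle_ineq2[of x y] by (simp add: dist_norm)
qed

text \<open>
  Off the frontier of \<open>K\<close>, which is negligible because \<open>K\<close> is convex, the indicators of the sets \<open>L n\<close>
  converge to that of \<open>K\<close>; dominated convergence does the rest.
\<close>

lemma centroid_tendsto:
  fixes K :: "(real ^ 'n) set"
  assumes K: "compact K" "convex K" "interior K \<noteq> {}"
    and L: "\<And>n::nat. compact (L n) \<and> convex (L n) \<and> interior (L n) \<noteq> {}"
    and lim: "(\<lambda>n. hausdorff_dist (L n) K) \<longlonglongrightarrow> 0"
  shows "(\<lambda>n. centroid (L n)) \<longlonglongrightarrow> centroid K"
proof -
  have ne: "K \<noteq> {}" "L n \<noteq> {}" for n using K(3) L[of n] by auto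
  have Kb: "K \<in> sets borel" "L n \<in> sets borel" for n using K(1) L[of n] borel_compact by auto
  obtain B where B: "B > 0" "K \<subseteq> cball 0 B" 
    using compact_imp_bounded[OF K(1)] unfolding bounded_pos by (auto simp: subset_iff)
  have ev1: "\<forall>\<^sub>F n in sequentially. hausdorff_dist (L n) K < e" if "e > 0" for e
    using lim that order_tendstoD(2) by blast
  obtain N where N: "\<And>n. n \<ge> N \<Longrightarrow> hausdorff_dist (L n) K < 1"
    using ev1[of 1] by (auto simp: eventually_sequentially)
  define M where "M = (\<lambda>n. L (n + N))"
  have M: "M n \<subseteq> cball 0 (B + 1)" for n
    unfolding M_def using hausdorff_limit_bounded[of K "L (n + N)" B] K ne L[of "n+N"] N[of "n+N"] B by auto
  have pw: "(\<lambda>n. indicat_real (M n) x) \<longlonglongrightarrow> indicat_real K x" if x: "x \<notin> frontier K" for x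
  proof -
    have "\<forall>\<^sub>F n in sequentially. indicat_real (L n) x = indicat_real K x"
    proof (cases "x \<in> K")
      case True
      then have "x \<in> interior K" using x closure_subset[of K] by (auto simp: frontier_def)
      then obtain r where r: "r > 0" "cball x r \<subseteq> K" using mem_interior_cball by blast
      show ?thesis using ev1[OF r(1)]
      proof eventually_elim
        case (elim n)
        then have "cball x 0 \<subseteq> L n"
          using K r L[of n] ne by (intro cball_in_hausdorff_near_convex[of K "L n" x r 0]) (auto simp: hausdorff_dist_commute)
        then show ?case using True by simp
      qed
    next
      case False
      then have "0 < infdist x K"
        using in_closed_iff_infdist_zero[of K x] compact_imp_closed[OF K(1)] ne infdist_nonneg[of x K] by auto
      from ev1[OF this] show ?thesis
      proof eventually_elim
        case (elim n)
        have "x \<notin> L n" using infdist_le_hausdorff_dist[of "L n" K x] elim L[of n] K ne by auto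
        then show ?case using False by simp
      qed
    qed
    then have "(\<lambda>n. indicat_real (L n) x) \<longlonglongrightarrow> indicat_real K x" by (rule tendsto_eventually)
    then show ?thesis unfolding M_def by (rule LIMSEQ_ignore_initial_segment)
  qed
  have "frontier K \<in> null_sets lborel"
    using negligible_convex_frontier[OF K(2)] null_sets_completion_iff[of "frontier K" lborel]
    by (simp add: negligible_iff_null_sets frontier_closed)
  then have ae: "AE x in lborel. x \<notin> frontier K" by (rule AE_not_in)
  let ?w = "\<lambda>x::real^'n. indicat_real (cball 0 (B + 1)) x * (B + 1)"
  have w: "integrable lborel ?w"
    using emeasure_bounded_finite[of "cball (0::real^'n) (B+1)"] by (intro integrable_mult_left integrable_real_indicator) auto
  have "(\<lambda>n. \<integral>x. indicator (M n) x *\<^sub>R x \<partial>lborel) \<longlonglongrightarrow> (\<integral>x. indicator K x *\<^sub>R x \<partial>lborel)"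
  proof (rule integral_dominated_convergence[where w = ?w])
    show "AE x in lborel. (\<lambda>n. indicat_real (M n) x *\<^sub>R x) \<longlonglongrightarrow> indicat_real K x *\<^sub>R x"
      using ae by eventually_elim (intro tendsto_intros pw)
    show "AE x in lborel. norm (indicat_real (M n) x *\<^sub>R x) \<le> ?w x" for n
      using M[of n] B(1) by (intro AE_I2) (auto simp: indicator_def subset_iff)
  qed (use w Kb in \<open>auto simp: M_def\<close>)
  moreover have "(\<lambda>n. \<integral>x. indicat_real (M n) x \<partial>lborel) \<longlonglongrightarrow> (\<integral>x. indicat_real K x \<partial>lborel)"
  proof (rule integral_dominated_convergence[where w = ?w])
    show "AE x in lborel. (\<lambda>n. indicat_real (M n) x) \<longlonglongrightarrow> indicat_real K x"
      using ae by eventually_elim (intro tendsto_intros pw)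
    show "AE x in lborel. norm (indicat_real (M n) x) \<le> ?w x" for n
      using M[of n] B(1) by (intro AE_I2) (auto simp: indicator_def subset_iff)
  qed (use w Kb in \<open>auto simp: M_def\<close>)
  then have "(\<lambda>n. measure lborel (M n)) \<longlonglongrightarrow> measure lborel K"
    by simp
  ultimately have "(\<lambda>n. centroid (M n)) \<longlonglongrightarrow> centroid K"
    unfolding centroid_def using measure_pos_of_interior[OF K(1,3)] by (intro tendsto_intros) auto
  then show ?thesis unfolding M_def by (rule LIMSEQ_offset)
qed


lemma hausdorff_le_prod_metric:
  "hausdorff_dist (fst s) (fst t) \<le> mdist (prod_metric hausdorff_metric m) s t"
  by (simp add: prod_dist_def case_prod_beta real_le_rsqrt)

lemma control_points_tiling:
  assumes "\<And>T t. T \<in> \<Omega> \<Longrightarrow> t \<in> T \<Longrightarrow> convex_tile m t"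
  shows "control_points m \<Omega> (\<lambda>t. centroid (fst t))"
  unfolding control_points_def
proof (intro conjI ballI allI)
  have tile: "compact (fst t) \<and> convex (fst t) \<and> interior (fst t) \<noteq> {}" if "t \<in> \<Union>\<Omega>" for t
    using assms that polytope_imp_compact polytope_imp_convex unfolding convex_tile_def by blast
  have "continuous_map (mtopology_of (submetric (prod_metric hausdorff_metric m) (\<Union>\<Omega>))) euclidean (\<lambda>t. centroid (fst t))"
  proof (rule continuous_map_mtopology_of_sequentially)
    fix \<sigma> :: "nat \<Rightarrow> ('a, 'b) tile" and l :: "('a, 'b) tile"
    assume *: "l \<in> mspace (submetric (prod_metric hausdorff_metric m) (\<Union>\<Omega>))"
      "\<And>n. \<sigma> n \<in> mspace (submetric (prod_metric hausdorff_metric m) (\<Union>\<Omega>))"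
      "(\<lambda>n. mdist (submetric (prod_metric hausdorff_metric m) (\<Union>\<Omega>)) (\<sigma> n) l) \<longlonglongrightarrow> 0"
    then have mem: "l \<in> \<Union>\<Omega>" "\<And>n. \<sigma> n \<in> \<Union>\<Omega>" by (simp_all only: mspace_submetric Int_iff)
    have "(\<lambda>n. hausdorff_dist (fst (\<sigma> n)) (fst l)) \<longlonglongrightarrow> 0"
      using *(3) unfolding mdist_submetric
      by (rule tendsto_zero_le[OF hausdorff_dist_nonneg hausdorff_le_prod_metric])
    then show "(\<lambda>n. centroid (fst (\<sigma> n))) \<longlonglongrightarrow> centroid (fst l)"
      using tile mem by (intro centroid_tendsto) blast+
  qed
  then show "continuous_map (subtopology (mtopology_of (prod_metric hausdorff_metric m)) (\<Union>\<Omega>)) euclidean (\<lambda>t. centroid (fst t))"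
    by (simp only: mtopology_of_submetric)
  fix t assume t: "t \<in> \<Union>\<Omega>"
  show "centroid (fst t) \<in> rel_interior (fst t)"
    using tile[OF t] centroid_interior[of "fst t"] interior_subset_rel_interior by blast
  show "centroid (fst (shift_tile x t)) = centroid (fst t) - x" for x
    using tile[OF t] by (simp add: fst_shift_tile centroid_translate)
qed

text \<open>
  The centroid is interior and depends continuously on the tile, so a sequence of prototiles violating
  ever weaker bounds would have a limit that violates them all.
\<close>

lemma prototile_constants:
  fixes P :: "('n::finite, 'l) tile set"
  assumes P: "compactin (mtopology_of (prod_metric hausdorff_metric m)) P" and conv: "\<forall>t\<in>P. convex_tile m t"
  shows "\<exists>r D. r > 0 \<and> (\<forall>t\<in>P. cball (centroid (fst t)) r \<subseteq> fst t \<and> (\<forall>x\<in>fst t. dist x (centroid (fst t)) \<le> D))"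
proof -
  interpret Metric_space "mspace (prod_metric hausdorff_metric m)" "mdist (prod_metric hausdorff_metric m)"
    by (rule Metric_space_mspace_mdist)
  have tile: "compact (fst t) \<and> convex (fst t) \<and> interior (fst t) \<noteq> {} \<and> fst t \<noteq> {}" if "t \<in> P" for t
    using conv that polytope_imp_compact polytope_imp_convex interior_subset unfolding convex_tile_def by blast
  have sub: "\<exists>l s. l \<in> P \<and> strict_mono s \<and> (\<lambda>n. hausdorff_dist (fst (\<sigma> (s n))) (fst l)) \<longlonglongrightarrow> 0"
    if \<sigma>: "\<And>n. \<sigma> n \<in> P" for \<sigma> :: "nat \<Rightarrow> _"
  proof -
    obtain l s where ls: "l \<in> P" "strict_mono s" "limitin mtopology (\<sigma> \<circ> s) l sequentially"
      using P \<sigma> unfolding mtopology_of_def compactin_sequentially by (metis image_subset_iff)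
    then have "(\<lambda>n. mdist (prod_metric hausdorff_metric m) (\<sigma> (s n)) l) \<longlonglongrightarrow> 0"
      unfolding limitin_metric_dist_null by auto
    then have "(\<lambda>n. hausdorff_dist (fst (\<sigma> (s n))) (fst l)) \<longlonglongrightarrow> 0"
      by (rule tendsto_zero_le[OF hausdorff_dist_nonneg hausdorff_le_prod_metric])
    then show ?thesis using ls by blast
  qed
  have "\<exists>n. \<forall>t\<in>P. cball (centroid (fst t)) (inverse (real (Suc n))) \<subseteq> fst t"
  proof (rule ccontr)
    assume "\<not> ?thesis"
    then have "\<forall>n. \<exists>t. t \<in> P \<and> \<not> cball (centroid (fst t)) (inverse (real (Suc n))) \<subseteq> fst t" by blast
    then obtain \<sigma> where \<sigma>: "\<And>n. \<sigma> n \<in> P" "\<And>n. \<not> cball (centroid (fst (\<sigma> n))) (inverse (real (Suc n))) \<subseteq> fst (\<sigma> n)"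
      by metis
    obtain l s where ls: "l \<in> P" "strict_mono s" "(\<lambda>n. hausdorff_dist (fst (\<sigma> (s n))) (fst l)) \<longlonglongrightarrow> 0"
      using sub[of \<sigma>] \<sigma>(1) by blast
    have c: "(\<lambda>n. centroid (fst (\<sigma> (s n)))) \<longlonglongrightarrow> centroid (fst l)"
      using tile ls \<sigma>(1) by (intro centroid_tendsto) blast+
    have "centroid (fst l) \<in> interior (fst l)" using centroid_interior tile ls(1) by blast
    then obtain q where q: "q > 0" "cball (centroid (fst l)) q \<subseteq> fst l" using mem_interior_cball by blast
    have "(\<lambda>n. inverse (real (Suc (s n)))) \<longlonglongrightarrow> 0"
      using LIMSEQ_subseq_LIMSEQ[OF LIMSEQ_inverse_real_of_nat ls(2)] by (simp add: o_def)
    then have "\<forall>\<^sub>F n in sequentially. inverse (real (Suc (s n))) < q/4"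
      using q order_tendstoD(2)[of _ 0 sequentially "q/4"] by auto
    moreover have "\<forall>\<^sub>F n in sequentially. hausdorff_dist (fst (\<sigma> (s n))) (fst l) < q/4"
      using q order_tendstoD(2)[OF ls(3), of "q/4"] by auto
    moreover have "\<forall>\<^sub>F n in sequentially. dist (centroid (fst (\<sigma> (s n)))) (centroid (fst l)) < q/4"
      using c q by (intro tendstoD) auto
    ultimately have "\<forall>\<^sub>F n in sequentially. False"
    proof eventually_elim
      case (elim n)
      have "cball (centroid (fst l)) (q/2) \<subseteq> fst (\<sigma> (s n))"
        using tile[OF ls(1)] tile[OF \<sigma>(1)[of "s n"]] q elim
        by (intro cball_in_hausdorff_near_convex[of "fst l" "fst (\<sigma> (s n))" _ q]) (auto simp: hausdorff_dist_commute)
      moreover have "cball (centroid (fst (\<sigma> (s n)))) (inverse (real (Suc (s n)))) \<subseteq> cball (centroid (fst l)) (q/2)"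
      proof
        fix z assume "z \<in> cball (centroid (fst (\<sigma> (s n)))) (inverse (real (Suc (s n))))"
        then show "z \<in> cball (centroid (fst l)) (q/2)"
          using elim dist_triangle[of "centroid (fst l)" z "centroid (fst (\<sigma> (s n)))"] by (simp add: dist_commute del: of_nat_Suc)
      qed
      ultimately show False using \<sigma>(2) by blast
    qed
    then show False by simp
  qed
  moreover have "\<exists>n. \<forall>t\<in>P. \<forall>x\<in>fst t. dist x (centroid (fst t)) \<le> real n"
  proof (rule ccontr)
    assume "\<not> ?thesis"
    then have "\<forall>n. \<exists>t. t \<in> P \<and> (\<exists>x\<in>fst t. \<not> dist x (centroid (fst t)) \<le> real n)" by blast
    then obtain \<sigma> where \<sigma>: "\<And>n. \<sigma> n \<in> P" "\<And>n. \<exists>x\<in>fst (\<sigma> n). \<not> dist x (centroid (fst (\<sigma> n))) \<le> real n" by metis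
    obtain l s where ls: "l \<in> P" "strict_mono s" "(\<lambda>n. hausdorff_dist (fst (\<sigma> (s n))) (fst l)) \<longlonglongrightarrow> 0"
      using sub[of \<sigma>] \<sigma>(1) by blast
    obtain B where B: "fst l \<subseteq> cball 0 B"
      using tile[OF ls(1)] compact_imp_bounded[of "fst l"] unfolding bounded_pos by (auto simp: subset_iff)
    obtain N where N: "hausdorff_dist (fst (\<sigma> (s n))) (fst l) < 1" if "n \<ge> N" for n
      using order_tendstoD(2)[OF ls(3), of 1] by (auto simp: eventually_sequentially)
    obtain k where k: "real k > 2 * (B + 1)" using reals_Archimedean2 by blast
    define n where "n = max N k"
    have "fst (\<sigma> (s n)) \<subseteq> cball 0 (B + 1)"
      using tile[OF ls(1)] tile[OF \<sigma>(1)[of "s n"]] N[of n] B unfolding n_def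
      by (intro hausdorff_limit_bounded[of "fst l"]) auto
    moreover have "centroid (fst (\<sigma> (s n))) \<in> fst (\<sigma> (s n))"
      using centroid_interior[of "fst (\<sigma> (s n))"] tile[OF \<sigma>(1)[of "s n"]] interior_subset by blast
    moreover obtain x where x: "x \<in> fst (\<sigma> (s n))" "dist x (centroid (fst (\<sigma> (s n)))) > real (s n)"
      using \<sigma>(2)[of "s n"] by auto
    ultimately have "norm x \<le> B + 1" "norm (centroid (fst (\<sigma> (s n)))) \<le> B + 1" by auto
    then have "dist x (centroid (fst (\<sigma> (s n)))) \<le> 2 * (B + 1)"
      using norm_triangle_ineq4[of x "centroid (fst (\<sigma> (s n)))"] by (simp add: dist_norm)
    moreover have "real k \<le> real (s n)" using seq_suble[OF ls(2), of n] unfolding n_def by simp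
    ultimately show False using x(2) k by linarith
  qed
  ultimately obtain n k where nk: "\<forall>t\<in>P. cball (centroid (fst t)) (inverse (real (Suc n))) \<subseteq> fst t"
    "\<forall>t\<in>P. \<forall>x\<in>fst t. dist x (centroid (fst t)) \<le> real k" by blast
  show ?thesis
    by (rule exI[of _ "inverse (real (Suc n))"], rule exI[of _ "real k"]) (use nk in \<open>simp del: of_nat_Suc\<close>)
qed

text \<open>
  Each tile contains the ball of radius \<open>r\<close> about its centroid and meets other tiles only in its
  frontier, so a centroid keeps distance \<open>r\<close> from all other tiles.
\<close>

lemma pattern_space_of_tilings:
  fixes m :: "'l metric" and \<Omega> :: "('n::finite, 'l) pattern set"
  assumes til: "\<forall>T\<in>\<Omega>. tiling m T" and "compact_prototiles m \<Omega>"
    and shift: "\<forall>T\<in>\<Omega>. \<forall>x. shift x T \<in> \<Omega>"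
    and comp: "compact_space (tiling_topology m \<Omega>)" "compact_space (mtopology_of m)"
  obtains \<kappa> D where "pattern_space m \<Omega> (\<lambda>t. centroid (fst t)) \<kappa> D"
proof -
  obtain P where P: "compactin (mtopology_of (prod_metric hausdorff_metric m)) P" "\<forall>t\<in>P. convex_tile m t"
      "\<forall>T\<in>\<Omega>. \<forall>t\<in>T. \<exists>x. shift_tile x t \<in> P"
    using assms(2) unfolding compact_prototiles_def by blast
  obtain r D where rD: "r > 0" "\<And>t. t \<in> P \<Longrightarrow> cball (centroid (fst t)) r \<subseteq> fst t"
    "\<And>t x. t \<in> P \<Longrightarrow> x \<in> fst t \<Longrightarrow> dist x (centroid (fst t)) \<le> D"
    using prototile_constants[OF P(1,2)] by metis
  have conv: "convex_tile m t" if "T \<in> \<Omega>" "t \<in> T" for T t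
    using bspec[OF til that(1)] that(2) unfolding tiling_def by (elim conjE bspec)
  have tile: "compact (fst t) \<and> convex (fst t) \<and> interior (fst t) \<noteq> {}" if "T \<in> \<Omega>" "t \<in> T" for T t
    using conv[OF that] polytope_imp_compact polytope_imp_convex unfolding convex_tile_def by blast
  have ball: "cball (centroid (fst t)) r \<subseteq> fst t" and diam: "x \<in> fst t \<Longrightarrow> dist x (centroid (fst t)) \<le> D"
    if t: "T \<in> \<Omega>" "t \<in> T" for T t x
  proof -
    obtain y where y: "shift_tile y t \<in> P" using P(3) t by blast
    have ceq: "centroid (fst (shift_tile y t)) = centroid (fst t) - y"
      using tile[OF t] by (simp add: fst_shift_tile centroid_translate)
    show "cball (centroid (fst t)) r \<subseteq> fst t"
    proof
      fix z assume "z \<in> cball (centroid (fst t)) r"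
      then have "z - y \<in> cball (centroid (fst (shift_tile y t))) r" unfolding ceq by (simp add: dist_norm)
      then have "z - y \<in> fst (shift_tile y t)" using rD(2)[OF y] by blast
      then show "z \<in> fst t" by (auto simp: fst_shift_tile)
    qed
    assume "x \<in> fst t"
    then have "x - y \<in> fst (shift_tile y t)" by (auto simp: fst_shift_tile)
    then show "dist x (centroid (fst t)) \<le> D" using rD(3)[OF y, of "x - y"] ceq by (simp add: dist_norm)
  qed
  have overlap: "centroid (fst t) \<notin> fst s" "centroid (fst t) \<notin> interior (fst s)"
    if t: "T \<in> \<Omega>" "s \<in> T" "t \<in> T" "s \<noteq> t" for T s t
  proof -
    have ci: "centroid (fst t) \<in> interior (fst t)" using centroid_interior tile t by blast
    then show "centroid (fst t) \<notin> fst s"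
    proof (rule contrapos_pn)
      assume "centroid (fst t) \<in> fst s"
      moreover have "fst s \<inter> fst t \<subseteq> frontier (fst s) \<inter> frontier (fst t)"
        using tiling_def[THEN iffD1, OF bspec[OF til t(1)], THEN conjunct2, THEN conjunct2, rule_format, OF t(2,3,4)] .
      ultimately show "centroid (fst t) \<notin> interior (fst t)"
        using ci interior_subset[of "fst t"] unfolding frontier_def by blast
    qed
    then show "centroid (fst t) \<notin> interior (fst s)" using interior_subset by blast
  qed
  have "pattern_space m \<Omega> (\<lambda>t. centroid (fst t)) r D"
  proof
    show "compact (fst t) \<and> fst t \<noteq> {} \<and> snd t \<in> mspace m" if "T \<in> \<Omega>" "t \<in> T" for T t
      using tile[OF that] conv[OF that] interior_subset unfolding convex_tile_def by blast
    show "control_points m \<Omega> (\<lambda>t. centroid (fst t))" by (rule control_points_tiling[OF conv])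
    show "r \<le> dist (centroid (fst s)) (centroid (fst t))" if "T \<in> \<Omega>" "s \<in> T" "t \<in> T" "s \<noteq> t" for T s t
      using overlap(1)[OF that] ball[OF that(1,2)] by force
    show "r \<le> hausdorff_dist (fst s) (fst t)" if t: "T \<in> \<Omega>" "s \<in> T" "t \<in> T" "s \<noteq> t" for T s t
    proof (rule ccontr)
      assume "\<not> ?thesis"
      then have "cball (centroid (fst s)) 0 \<subseteq> fst t"
        using tile[OF t(1,2)] tile[OF t(1,3)] ball[OF t(1,2)]
        by (intro cball_in_hausdorff_near_convex[of "fst s" "fst t" _ r]) auto
      then show False using overlap(1)[OF t(1,3,2)] t(4) by auto
    qed
    show "\<exists>t\<in>T. dist x (centroid (fst t)) \<le> D" if "T \<in> \<Omega>" for T x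
    proof -
      have "x \<in> \<Union>(fst ` T)" using bspec[OF til that] unfolding tiling_def by simp
      then show ?thesis using diam[OF that] by blast
    qed
    show "dist x (centroid (fst t)) \<le> D" if "T \<in> \<Omega>" "t \<in> T" "x \<in> fst t" for T t x
      using diam that by blast
  qed (use rD shift comp in auto)
  then show thesis by (rule that)
qed

lemma hausdorff_dist_singleton: "hausdorff_dist {p} {q} = dist p (q :: 'a::heine_borel)"
  unfolding hausdorff_dist_def by (simp add: dist_commute)

text \<open>
  By minimality each pattern is a limit of translates of a single Delone pattern, and therefore
  inherits its separation, and its density up to a loss of \<open>1\<close>.
\<close>

lemma pattern_space_of_delone:
  fixes m :: "'l metric" and \<Omega> :: "('n::finite, 'l) pattern set"
  assumes del: "\<forall>T\<in>\<Omega>. delone_pattern m T" and "minimal m \<Omega>"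
    and shift: "\<forall>T\<in>\<Omega>. \<forall>x. shift x T \<in> \<Omega>" and ne: "\<Omega> \<noteq> {}"
    and comp: "compact_space (tiling_topology m \<Omega>)" "compact_space (mtopology_of m)"
  obtains \<kappa> D where "pattern_space m \<Omega> (\<lambda>t. the_elem (fst t)) \<kappa> D"
proof -
  obtain T0 where T0: "T0 \<in> \<Omega>" using ne by blast
  have lf: "locally_finite_pattern m T" if "T \<in> \<Omega>" for T using locally_finite_delone_pattern del that by blast
  interpret Metric_space \<Omega> "pattern_dist m" by (rule Metric_space_pattern_dist[OF lf])
  have single: "fst t = {the_elem (fst t)}" "snd t \<in> mspace m" if T: "T \<in> \<Omega>" "t \<in> T" for T t
  proof -
    obtain \<Lambda> lab where "lab ` \<Lambda> \<subseteq> mspace m" "T = (\<lambda>p. ({p}, lab p)) ` \<Lambda>"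
      using bspec[OF del T(1)] unfolding delone_pattern_def by blast
    moreover from this obtain p where "p \<in> \<Lambda>" "t = ({p}, lab p)" using T(2) by blast
    ultimately show "fst t = {the_elem (fst t)}" "snd t \<in> mspace m" by (simp_all add: image_subset_iff)
  qed
  have c_shift: "the_elem (fst (shift_tile x t)) = the_elem (fst t) - x" if "T \<in> \<Omega>" "t \<in> T" for T t x
  proof -
    have "fst (shift_tile x t) = (\<lambda>y. y - x) ` {the_elem (fst t)}" using single(1)[OF that] fst_shift_tile by metis
    then show ?thesis by simp
  qed
  have hd: "hausdorff_dist (fst s) (fst t) = dist (the_elem (fst s)) (the_elem (fst t))"
    if "S \<in> \<Omega>" "T \<in> \<Omega>" "s \<in> S" "t \<in> T" for S T s t
    using single(1)[OF that(1,3)] single(1)[OF that(2,4)] hausdorff_dist_singleton by metis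
  obtain \<Lambda> lab where \<Lambda>: "delone \<Lambda>" "T0 = (\<lambda>p. ({p}, lab p)) ` \<Lambda>"
    using bspec[OF del T0] unfolding delone_pattern_def by blast
  obtain r R where r: "r > 0" "\<forall>p\<in>\<Lambda>. \<forall>q\<in>\<Lambda>. p \<noteq> q \<longrightarrow> r \<le> dist p q" and R: "\<forall>x. \<exists>p\<in>\<Lambda>. dist x p \<le> R"
    using \<Lambda>(1) unfolding delone_def by blast
  have near: "\<exists>y. close m e S (shift y T0)" if Se: "S \<in> \<Omega>" "e > 0" for S e
  proof -
    have "S \<in> mtopology closure_of orbit T0"
      using assms(2) T0 that(1) tiling_topology_eq_mtopology[OF lf] unfolding minimal_def by fastforce
    moreover have "0 < min e (1/2)" using Se by simp
    ultimately have "\<exists>V\<in>orbit T0. V \<in> mball S (min e (1/2))" unfolding metric_closure_of by blast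
    then obtain V where "V \<in> orbit T0" "pattern_dist m S V < min e (1/2)" by auto
    then have "close m (min e (1/2)) S V" by (intro pattern_dist_less_imp_close) auto
    then have "close m e S V" using that close_mono[of m "min e (1/2)" S V e] by auto
    then show ?thesis using \<open>V \<in> orbit T0\<close> unfolding orbit_def by blast
  qed
  have sep0: "r \<le> dist (the_elem (fst s)) (the_elem (fst t))" if "s \<in> shift y T0" "t \<in> shift y T0" "s \<noteq> t" for y s t
  proof -
    have "shift_tile (-y) s \<in> T0" "shift_tile (-y) t \<in> T0" using that by (simp_all add: mem_shift_iff)
    then obtain p q where pq: "p \<in> \<Lambda>" "q \<in> \<Lambda>" "shift_tile (-y) s = ({p}, lab p)" "shift_tile (-y) t = ({q}, lab q)"
      using \<Lambda>(2) by blast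
    have "s = shift_tile y ({p}, lab p)" "t = shift_tile y ({q}, lab q)" using pq(3,4) by (metis shift_tile_cancel(1))+
    then have "s = ({p - y}, lab p)" "t = ({q - y}, lab q)" by (auto simp: shift_tile_def)
    then show ?thesis using r(2) pq(1,2) that(3) by (auto simp: dist_norm)
  qed
  have sep: "r \<le> dist (the_elem (fst s)) (the_elem (fst t))" if S: "S \<in> \<Omega>" and st: "s \<in> S" "t \<in> S" "s \<noteq> t" for S s t
  proof (rule ccontr)
    assume not: "\<not> ?thesis"
    define p q where "p = the_elem (fst s)" and "q = the_elem (fst t)"
    \<comment> \<open>near enough to match both points with points of a translate of \<open>T0\<close>, which would then be too
      close to each other\<close>
    define e where "e = min (1 / (norm p + norm q + 1)) ((r - dist p q) / 3)"
    have pos: "0 < norm p + norm q + 1" by (intro add_nonneg_pos) auto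
    have e: "e > 0" "e \<le> (r - dist p q) / 3" "e \<le> 1 / (norm p + norm q + 1)"
      unfolding e_def using not pos by (simp_all only: p_def q_def min.cobounded1 min.cobounded2) (simp add: p_def q_def)
    have big: "norm p + norm q + 1 \<le> 1/e" using e pos by (simp add: field_simps)
    obtain y where y: "close m e S (shift y T0)" using near S e by blast
    then obtain S0 V0 f where *: "patch S 0 (1/e) \<subseteq> S0" "S0 \<subseteq> S" "V0 \<subseteq> shift y T0"
      "bij_betw f S0 V0" "\<forall>t\<in>S0. tile_close m e t (f t)" unfolding close_iff by blast
    have "p \<in> fst s" "q \<in> fst t" using single(1)[OF S st(1)] single(1)[OF S st(2)] unfolding p_def q_def by auto
    moreover have pq: "norm p < 1/e" "norm q < 1/e" using big norm_ge_zero[of p] norm_ge_zero[of q] by linarith+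
    moreover from pq have "p \<in> ball 0 (1/e)" "q \<in> ball 0 (1/e)" by simp_all
    ultimately have "s \<in> S0" "t \<in> S0" using *(1) st unfolding patch_def by blast+
    then have f: "f s \<in> shift y T0" "f t \<in> shift y T0" "f s \<noteq> f t" "tile_close m e s (f s)" "tile_close m e t (f t)"
      using * st(3) unfolding bij_betw_def inj_on_def by blast+
    have "dist p (the_elem (fst (f s))) < e" "dist q (the_elem (fst (f t))) < e"
      using f hd[OF S _ st(1) f(1)] hd[OF S _ st(2) f(2)] shift T0 unfolding tile_close_def p_def q_def by auto
    then have "r < dist p q + 2 * e"
      using sep0[OF f(1,2,3)] dist_triangle[of "the_elem (fst (f s))" "the_elem (fst (f t))" p]
        dist_triangle[of p "the_elem (fst (f t))" q] by (simp add: dist_commute)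
    then show False using e by simp
  qed
  have dense: "\<exists>t\<in>S. dist x (the_elem (fst t)) \<le> R + 1" if S: "S \<in> \<Omega>" for S x
  proof -
    have pos: "0 < norm x + \<bar>R\<bar> + 1" by (intro add_nonneg_pos) auto
    define e where "e = 1 / (norm x + \<bar>R\<bar> + 1)"
    have e: "e > 0" "e \<le> 1" "1/e = norm x + \<bar>R\<bar> + 1" unfolding e_def using pos by (auto simp: field_simps)
    obtain y where "close m e S (shift y T0)" using near S e by blast
    then have "close m e (shift y T0) S" by (rule close_sym)
    then obtain V0 S0 f where *: "patch (shift y T0) 0 (1/e) \<subseteq> V0" "V0 \<subseteq> shift y T0" "S0 \<subseteq> S"
      "bij_betw f V0 S0" "\<forall>t\<in>V0. tile_close m e t (f t)" unfolding close_iff by blast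
    obtain p where p: "p \<in> \<Lambda>" "dist (x + y) p \<le> R" using R by blast
    define t where "t = shift_tile y ({p}, lab p)"
    have "({p}, lab p) \<in> T0" using p \<Lambda>(2) by blast
    then have t: "t \<in> shift y T0" "fst t = {p - y}" unfolding t_def by (auto simp: fst_shift_tile)
    have xp: "dist x (p - y) \<le> R" using p(2) by (simp add: dist_norm algebra_simps)
    then have "norm (p - y) < 1/e"
      unfolding e(3) using norm_triangle_sub[of "p - y" x] by (simp add: dist_norm norm_minus_commute)
    then have "t \<in> V0" using *(1) t unfolding patch_def by auto
    then have ft: "f t \<in> S" "tile_close m e t (f t)" using * bij_betwE by blast+
    then have "dist (p - y) (the_elem (fst (f t))) < 1"
      using hd[of "shift y T0" S t "f t"] S T0 shift t e unfolding tile_close_def by auto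
    then show ?thesis using ft(1) xp dist_triangle[of x "the_elem (fst (f t))" "p - y"] by force
  qed
  have control: "control_points m \<Omega> (\<lambda>t. the_elem (fst t))"
    unfolding control_points_def
  proof (intro conjI ballI allI)
    have "continuous_map (mtopology_of (submetric (prod_metric hausdorff_metric m) (\<Union>\<Omega>))) euclidean (\<lambda>t. the_elem (fst t))"
    proof (rule continuous_map_mtopology_of_sequentially)
      fix \<sigma> :: "nat \<Rightarrow> ('n, 'l) tile" and l :: "('n, 'l) tile"
      assume *: "l \<in> mspace (submetric (prod_metric hausdorff_metric m) (\<Union>\<Omega>))"
        "\<And>n. \<sigma> n \<in> mspace (submetric (prod_metric hausdorff_metric m) (\<Union>\<Omega>))"
        "(\<lambda>n. mdist (submetric (prod_metric hausdorff_metric m) (\<Union>\<Omega>)) (\<sigma> n) l) \<longlonglongrightarrow> 0"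
      then have mem: "l \<in> \<Union>\<Omega>" "\<And>n. \<sigma> n \<in> \<Union>\<Omega>" by (simp_all only: mspace_submetric Int_iff)
      then have "dist (the_elem (fst (\<sigma> n))) (the_elem (fst l)) \<le> mdist (prod_metric hausdorff_metric m) (\<sigma> n) l" for n
        using hausdorff_le_prod_metric[of "\<sigma> n" l m] hd by (metis UnionE)
      then show "(\<lambda>n. the_elem (fst (\<sigma> n))) \<longlonglongrightarrow> the_elem (fst l)"
        unfolding tendsto_dist_iff[of _ "the_elem (fst l)"] using *(3) unfolding mdist_submetric
        by (rule tendsto_zero_le[OF zero_le_dist])
    qed
    then show "continuous_map (subtopology (mtopology_of (prod_metric hausdorff_metric m)) (\<Union>\<Omega>)) euclidean (\<lambda>t. the_elem (fst t))"
      by (simp only: mtopology_of_submetric)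
    fix t assume "t \<in> \<Union>\<Omega>"
    then obtain T where T: "T \<in> \<Omega>" "t \<in> T" by blast
    show "the_elem (fst t) \<in> rel_interior (fst t)"
      using single(1)[OF T] rel_interior_sing by (metis singletonI)
    show "the_elem (fst (shift_tile x t)) = the_elem (fst t) - x" for x using c_shift[OF T] .
  qed
  have "pattern_space m \<Omega> (\<lambda>t. the_elem (fst t)) r (\<bar>R\<bar> + 1)"
  proof
    show "compact (fst t) \<and> fst t \<noteq> {} \<and> snd t \<in> mspace m" if "T \<in> \<Omega>" "t \<in> T" for T t
      using single[OF that] by (metis compact_sing insert_not_empty)
    show "r \<le> hausdorff_dist (fst s) (fst t)" if "T \<in> \<Omega>" "s \<in> T" "t \<in> T" "s \<noteq> t" for T s t
      using hd sep that by simp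
    show "\<exists>t\<in>T. dist x (the_elem (fst t)) \<le> \<bar>R\<bar> + 1" if "T \<in> \<Omega>" for T x
      using dense[OF that, of x] by (meson abs_ge_self add_right_mono order_trans)
    show "dist x (the_elem (fst t)) \<le> \<bar>R\<bar> + 1" if "T \<in> \<Omega>" "t \<in> T" "x \<in> fst t" for T t x
    proof -
      have "x = the_elem (fst t)" using single(1)[OF that(1,2)] that(3) by blast
      then show ?thesis by simp
    qed
  qed (use r sep shift comp control in auto)
  then show thesis by (rule that)
qed

lemma pattern_space_exists:
  fixes m :: "'l metric" and \<Omega> :: "('n::finite, 'l) pattern set"
  assumes "tiling_space m \<Omega>" "minimal m \<Omega>" "\<Omega> \<noteq> {}"
  obtains c \<kappa> D where "pattern_space m \<Omega> c \<kappa> D"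
  using assms pattern_space_of_tilings[of \<Omega> m] pattern_space_of_delone[of \<Omega> m]
  unfolding tiling_space_def by metis

section \<open>Positive functionals on a compact metric space\<close>

locale compact_metric = Metric_space M d for M :: "'a set" and d +
  assumes compact_M: "compact_space mtopology"
begin

abbreviation cont :: "('a \<Rightarrow> real) \<Rightarrow> bool" where
  "cont f \<equiv> continuous_map mtopology euclideanreal f"

lemma cont_limit:
  assumes "continuous_map mtopology euclidean f" "limitin mtopology \<sigma> l F"
  shows "((\<lambda>n. f (\<sigma> n)) \<longlongrightarrow> f l) F"
  using continuous_map_limit[OF assms] by (simp add: o_def)

lemma contI:
  fixes f :: "'a \<Rightarrow> 'b::topological_space"
  assumes "\<And>\<sigma> l. limitin mtopology \<sigma> l sequentially \<Longrightarrow> range \<sigma> \<subseteq> M \<Longrightarrow> (\<lambda>n. f (\<sigma> n)) \<longlonglongrightarrow> f l"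
  shows "continuous_map mtopology euclidean f"
  by (rule continuous_map_sequentially) (simp add: assms)

lemma compact_subsequence:
  assumes "\<And>n::nat. \<sigma> n \<in> M"
  obtains l r where "l \<in> M" "strict_mono r" "limitin mtopology (\<sigma> \<circ> r) l sequentially"
  using assms compact_M unfolding compact_space_sequentially by (metis image_subset_iff)

lemma cont_bounded:
  fixes f :: "'a \<Rightarrow> 'b::real_normed_vector"
  assumes "continuous_map mtopology euclidean f"
  shows "\<exists>B>0. \<forall>s\<in>M. norm (f s) \<le> B"
proof -
  have "compactin euclidean (f ` M)"
    using image_compactin[OF _ assms, of M] compact_M by (simp add: compact_space_def)
  then have "bounded (f ` M)" using compact_imp_bounded by (simp add: compactin_euclidean_iff)
  then show ?thesis unfolding bounded_pos by auto
qed

lemma cont_max: "cont f \<Longrightarrow> cont g \<Longrightarrow> cont (\<lambda>s. max (f s) (g s))"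
  and cont_min: "cont f \<Longrightarrow> cont g \<Longrightarrow> cont (\<lambda>s. min (f s) (g s))"
  by (auto intro: continuous_map_real_max continuous_map_real_min)

lemma opens_Pow: "{U. openin mtopology U} \<subseteq> Pow M"
  using openin_subset by fastforce

lemma borel_measurable_cont:
  assumes "continuous_map mtopology euclidean f" "space \<nu> = M" "sets \<nu> = sigma_sets M {U. openin mtopology U}"
  shows "f \<in> borel_measurable \<nu>"
proof (rule borel_measurableI)
  fix V :: "'b::topological_space set" assume "open V"
  then have "openin mtopology {s \<in> topspace mtopology. f s \<in> V}"
    by (intro openin_continuous_map_preimage[OF assms(1)]) simp
  then show "f -` V \<inter> space \<nu> \<in> sets \<nu>"
    unfolding assms(2,3) by (intro sigma_sets.Basic) (simp add: vimage_def Int_def conj_commute)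
qed

text \<open>
  Daniell's upper integral for a functional \<open>\<Lambda>\<close>.  Its subadditivity is built in, and the measure
  below is its restriction to indicator functions.
\<close>

definition upper :: "(('a \<Rightarrow> real) \<Rightarrow> real) \<Rightarrow> ('a \<Rightarrow> ennreal) \<Rightarrow> ennreal" where
  "upper \<Lambda> F = Inf {(\<Sum>n. ennreal (\<Lambda> (g n))) | g. (\<forall>n. cont (g n) \<and> (\<forall>s\<in>M. 0 \<le> g n s)) \<and>
     (\<forall>s\<in>M. F s \<le> (\<Sum>n. ennreal (g n s)))}"

definition state :: "(('a \<Rightarrow> real) \<Rightarrow> real) \<Rightarrow> bool" where
  "state \<Lambda> \<longleftrightarrow> (\<forall>f g. cont f \<longrightarrow> cont g \<longrightarrow> \<Lambda> (\<lambda>s. f s + g s) = \<Lambda> f + \<Lambda> g) \<and>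
     (\<forall>r f. cont f \<longrightarrow> \<Lambda> (\<lambda>s. r * f s) = r * \<Lambda> f) \<and>
     (\<forall>f. cont f \<longrightarrow> (\<forall>s\<in>M. 0 \<le> f s) \<longrightarrow> 0 \<le> \<Lambda> f) \<and> \<Lambda> (\<lambda>s. 1) = 1"

context
  fixes \<Lambda> assumes st: "state \<Lambda>"
begin

lemma st_add: "cont f \<Longrightarrow> cont g \<Longrightarrow> \<Lambda> (\<lambda>s. f s + g s) = \<Lambda> f + \<Lambda> g"
  and st_mult: "cont f \<Longrightarrow> \<Lambda> (\<lambda>s. r * f s) = r * \<Lambda> f"
  and st_nonneg: "cont f \<Longrightarrow> (\<And>s. s \<in> M \<Longrightarrow> 0 \<le> f s) \<Longrightarrow> 0 \<le> \<Lambda> f"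
  and st_one: "\<Lambda> (\<lambda>s. 1) = 1"
  using st unfolding state_def by blast+

lemma st_const: "\<Lambda> (\<lambda>s. r) = r"
  using st_mult[of "\<lambda>s. 1" r] st_one by simp

lemma st_mono:
  assumes "cont f" "cont g" "\<And>s. s \<in> M \<Longrightarrow> f s \<le> g s" shows "\<Lambda> f \<le> \<Lambda> g"
proof -
  have c: "cont (\<lambda>s. g s - f s)" using assms by (intro continuous_map_diff)
  then have "0 \<le> \<Lambda> (\<lambda>s. g s - f s)" using assms(3) by (intro st_nonneg) auto
  moreover have "\<Lambda> (\<lambda>s. (g s - f s) + f s) = \<Lambda> (\<lambda>s. g s - f s) + \<Lambda> f" using c assms by (intro st_add)
  ultimately show ?thesis by simp
qed

lemma st_sum:
  assumes "finite I" "\<And>i. i \<in> I \<Longrightarrow> cont (f i)" shows "\<Lambda> (\<lambda>s. \<Sum>i\<in>I. f i s) = (\<Sum>i\<in>I. \<Lambda> (f i))"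
  using assms
proof (induction I rule: finite_induct)
  case empty then show ?case using st_const[of 0] by simp
next
  case (insert i I)
  have "\<Lambda> (\<lambda>s. f i s + (\<Sum>i\<in>I. f i s)) = \<Lambda> (f i) + \<Lambda> (\<lambda>s. \<Sum>i\<in>I. f i s)"
    using insert by (intro st_add continuous_map_sum) auto
  then show ?case using insert by simp
qed

lemma upper_le:
  assumes "\<And>n. cont (g n)" "\<And>n s. s \<in> M \<Longrightarrow> 0 \<le> g n s" "\<And>s. s \<in> M \<Longrightarrow> F s \<le> (\<Sum>n. ennreal (g n s))"
  shows "upper \<Lambda> F \<le> (\<Sum>n. ennreal (\<Lambda> (g n)))"
  unfolding upper_def using assms by (intro Inf_lower) blast

lemma upper_greatest:
  assumes "\<And>g. (\<And>n. cont (g n)) \<Longrightarrow> (\<And>n s. s \<in> M \<Longrightarrow> 0 \<le> g n s) \<Longrightarrow> (\<And>s. s \<in> M \<Longrightarrow> F s \<le> (\<Sum>n. ennreal (g n s)))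
     \<Longrightarrow> b \<le> (\<Sum>n. ennreal (\<Lambda> (g n)))"
  shows "b \<le> upper \<Lambda> F"
  unfolding upper_def using assms by (intro Inf_greatest) blast

lemma upper_mono: "(\<And>s. s \<in> M \<Longrightarrow> F s \<le> G s) \<Longrightarrow> upper \<Lambda> F \<le> upper \<Lambda> G"
proof (rule upper_greatest)
  fix g assume FG: "\<And>s. s \<in> M \<Longrightarrow> F s \<le> G s" and g: "\<And>n. cont (g n)" "\<And>n s. s \<in> M \<Longrightarrow> 0 \<le> g n s"
    and cov: "\<And>s. s \<in> M \<Longrightarrow> G s \<le> (\<Sum>n. ennreal (g n s))"
  show "upper \<Lambda> F \<le> (\<Sum>n. ennreal (\<Lambda> (g n)))"
    by (rule upper_le[OF g]) (use FG cov order_trans in blast)+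
qed

lemma upper_cont_le: 
  assumes "cont f" "\<And>s. s \<in> M \<Longrightarrow> 0 \<le> f s"
  shows "upper \<Lambda> (\<lambda>s. ennreal (f s)) \<le> ennreal (\<Lambda> f)"
proof -
  let ?g = "\<lambda>n::nat. if n = 0 then f else (\<lambda>s. 0)"
  have single: "(\<Sum>n. if n = 0 then a else 0) = (a::ennreal)" for a
    using suminf_finite[of "{0::nat}" "\<lambda>n. if n = 0 then a else 0"] by auto
  have "upper \<Lambda> (\<lambda>s. ennreal (f s)) \<le> (\<Sum>n. ennreal (\<Lambda> (?g n)))"
  proof (rule upper_le)
    fix s
    have "(\<Sum>n. ennreal (?g n s)) = (\<Sum>n::nat. if n = 0 then ennreal (f s) else 0)"
      by (intro suminf_cong) auto
    then show "ennreal (f s) \<le> (\<Sum>n. ennreal (?g n s))" by (simp add: single)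
  qed (use assms in auto)
  also have "\<dots> = (\<Sum>n::nat. if n = 0 then ennreal (\<Lambda> f) else 0)"
    using st_const[of 0] by (intro suminf_cong) auto
  finally show ?thesis by (simp add: single)
qed

text \<open>Dini's argument: a countable cover of a continuous function may be truncated up to \<open>\<epsilon>\<close>.\<close>

lemma upper_cont_ge:
  assumes f: "cont f" shows "ennreal (\<Lambda> f) \<le> upper \<Lambda> (\<lambda>s. ennreal (f s))"
proof (rule upper_greatest)
  fix g assume g: "\<And>n. cont (g n)" "\<And>n s. s \<in> M \<Longrightarrow> 0 \<le> g n s"
    and cov: "\<And>s. s \<in> M \<Longrightarrow> ennreal (f s) \<le> (\<Sum>n. ennreal (g n s))"
  show "ennreal (\<Lambda> f) \<le> (\<Sum>n. ennreal (\<Lambda> (g n)))"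
  proof (rule ennreal_le_epsilon)
    fix e :: real assume e: "e > 0"
    define h where "h = (\<lambda>N s. (\<Sum>n<N. g n s) - f s)"
    have ch: "cont (h N)" for N
      unfolding h_def using f g by (intro continuous_map_diff continuous_map_sum) auto
    define U where "U = (\<lambda>N. {s \<in> topspace mtopology. h N s \<in> {-e<..}})"
    have Uo: "openin mtopology (U N)" for N
      unfolding U_def by (rule openin_continuous_map_preimage[OF ch]) simp
    have Um: "U N \<subseteq> U N'" if "N \<le> N'" for N N'
    proof
      fix s assume s: "s \<in> U N"
      have "(\<Sum>n<N. g n s) \<le> (\<Sum>n<N'. g n s)"
        using that g(2) s by (intro sum_mono2) (auto simp: U_def)
      then show "s \<in> U N'" using s unfolding U_def h_def by auto
    qed
    have "M \<subseteq> \<Union>(range U)"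
    proof
      fix s assume s: "s \<in> M"
      have "\<exists>N. f s - e < (\<Sum>n<N. g n s)"
      proof (rule ccontr)
        assume "\<not> ?thesis"
        then have le: "(\<Sum>n<N. g n s) \<le> f s - e" for N by (simp add: not_less)
        have fe: "0 \<le> f s - e" using le[of 0] by simp
        have "(\<Sum>n. ennreal (g n s)) \<le> ennreal (f s - e)"
        proof (rule suminf_le_const)
          show "(\<Sum>n<N. ennreal (g n s)) \<le> ennreal (f s - e)" for N
            using le[of N] g(2)[OF s] by (subst sum_ennreal) (auto intro: ennreal_leI)
        qed simp
        then have "ennreal (f s) \<le> ennreal (f s - e)" using cov[OF s] by (rule order_trans[rotated])
        then show False using e fe by (simp add: ennreal_le_iff)
      qed
      then obtain N where "- e < (\<Sum>n<N. g n s) - f s" by (auto simp: algebra_simps)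
      then show "s \<in> \<Union>(range U)" using s unfolding U_def h_def by auto
    qed
    then obtain \<F> where \<F>: "finite \<F>" "\<F> \<subseteq> range U" "M \<subseteq> \<Union>\<F>"
      using compact_M Uo unfolding compact_space_def compactin_def
      by (metis (no_types, lifting) imageE topspace_mtopology)
    then obtain J where J: "finite J" "\<F> = U ` J" by (meson finite_subset_image)
    define N where "N = Max (insert 0 J)"
    have "M \<subseteq> U N"
    proof
      fix s assume "s \<in> M"
      then obtain j where "j \<in> J" "s \<in> U j" using \<F>(3) J by auto
      then show "s \<in> U N" using Um[of j N] J unfolding N_def by auto
    qed
    then have "f s \<le> (\<Sum>n<N. g n s) + e" if "s \<in> M" for s
      using that unfolding U_def h_def by fastforce
    then have "\<Lambda> f \<le> \<Lambda> (\<lambda>s. (\<Sum>n<N. g n s) + e)"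
      using f g by (intro st_mono continuous_map_add continuous_map_sum) auto
    also have "\<dots> = (\<Sum>n<N. \<Lambda> (g n)) + e"
      using g by (subst st_add) (auto simp: st_const st_sum intro!: continuous_map_sum)
    finally have "ennreal (\<Lambda> f) \<le> ennreal (\<Sum>n<N. \<Lambda> (g n)) + ennreal e"
      using e st_nonneg[OF g(1,2)] by (subst ennreal_plus[symmetric]) (auto intro!: ennreal_leI sum_nonneg)
    also have "ennreal (\<Sum>n<N. \<Lambda> (g n)) = (\<Sum>n<N. ennreal (\<Lambda> (g n)))"
      using st_nonneg[OF g(1,2)] by (subst sum_ennreal) auto
    also have "\<dots> \<le> (\<Sum>n. ennreal (\<Lambda> (g n)))" by (intro sum_le_suminf) auto
    finally show "ennreal (\<Lambda> f) \<le> (\<Sum>n. ennreal (\<Lambda> (g n))) + ennreal e" by (simp add: add_right_mono)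
  qed
qed

lemma upper_countably_subadditive:
  "upper \<Lambda> (\<lambda>s. \<Sum>k. F k s) \<le> (\<Sum>k. upper \<Lambda> (F k))"
proof (cases "(\<Sum>k. upper \<Lambda> (F k)) = \<infinity>")
  case False
  then have fin: "upper \<Lambda> (F k) < \<infinity>" for k
    using ennreal_suminf_lessD[of "\<lambda>k. upper \<Lambda> (F k)" \<infinity> k] by (simp add: top.not_eq_extremum)
  show ?thesis
  proof (rule ennreal_le_epsilon)
    fix e :: real assume e: "e > 0"
    define q where "q = (\<lambda>k::nat. e * (1/2) ^ Suc k)"
    have q: "q k > 0" for k unfolding q_def using e by simp
    have "\<exists>g. (\<forall>n. cont (g n) \<and> (\<forall>s\<in>M. 0 \<le> g n s)) \<and> (\<forall>s\<in>M. F k s \<le> (\<Sum>n. ennreal (g n s))) \<and>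
        (\<Sum>n. ennreal (\<Lambda> (g n))) < upper \<Lambda> (F k) + q k" for k
    proof -
      have "upper \<Lambda> (F k) < upper \<Lambda> (F k) + q k"
        using fin[of k] q[of k] by (simp add: ennreal_add_left_cancel_less)
      then show ?thesis unfolding upper_def Inf_less_iff by blast
    qed
    then obtain g where g: "\<And>k n. cont (g k n)" "\<And>k n s. s \<in> M \<Longrightarrow> 0 \<le> g k n s"
        "\<And>k s. s \<in> M \<Longrightarrow> F k s \<le> (\<Sum>n. ennreal (g k n s))"
        "\<And>k. (\<Sum>n. ennreal (\<Lambda> (g k n))) < upper \<Lambda> (F k) + q k" by metis
    have "upper \<Lambda> (\<lambda>s. \<Sum>k. F k s) \<le> (\<Sum>i. ennreal (\<Lambda> (case prod_decode i of (k, n) \<Rightarrow> g k n)))"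
    proof (rule upper_le)
      fix s assume s: "s \<in> M"
      have "(\<Sum>k. F k s) \<le> (\<Sum>k. \<Sum>n. ennreal (g k n s))" using g(3)[OF s] by (intro suminf_le) auto
      also have "\<dots> = (\<Sum>i. (\<lambda>(k, n). ennreal (g k n s)) (prod_decode i))"
        by (rule suminf_ennreal_2dimen[symmetric]) simp
      finally show "(\<Sum>k. F k s) \<le> (\<Sum>i. ennreal ((case prod_decode i of (k, n) \<Rightarrow> g k n) s))"
        by (simp add: case_prod_beta)
    qed (use g in \<open>auto simp: case_prod_beta\<close>)
    also have "\<dots> = (\<Sum>k. \<Sum>n. ennreal (\<Lambda> (g k n)))"
      using suminf_ennreal_2dimen[of "\<lambda>k. \<Sum>n. ennreal (\<Lambda> (g k n))" "\<lambda>(k, n). ennreal (\<Lambda> (g k n))"]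
      by (simp add: case_prod_beta)
    also have "\<dots> \<le> (\<Sum>k. upper \<Lambda> (F k) + q k)" using g(4) by (intro suminf_le) (auto intro: less_imp_le)
    also have "\<dots> = (\<Sum>k. upper \<Lambda> (F k)) + (\<Sum>k. ennreal (q k))" by (rule suminf_add[symmetric]) auto
    also have "(\<Sum>k. ennreal (q k)) = ennreal e"
    proof -
      have "q sums (e * 1)" unfolding q_def by (intro sums_mult power_half_series)
      then show ?thesis using q by (intro suminf_ennreal_eq) (auto intro: less_imp_le)
    qed
    finally show "upper \<Lambda> (\<lambda>s. \<Sum>k. F k s) \<le> (\<Sum>k. upper \<Lambda> (F k)) + ennreal e" .
  qed
qed simp

text \<open>A cover of \<open>F\<close> splits along a partition of unity, so \<open>upper\<close> is superadditive along one.\<close>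

lemma upper_split:
  assumes "finite I" "\<And>i. i \<in> I \<Longrightarrow> cont (\<psi> i)" "\<And>i s. i \<in> I \<Longrightarrow> s \<in> M \<Longrightarrow> 0 \<le> \<psi> i s"
    and one: "\<And>s. s \<in> M \<Longrightarrow> (\<Sum>i\<in>I. \<psi> i s) \<le> 1"
  shows "(\<Sum>i\<in>I. upper \<Lambda> (\<lambda>s. F s * ennreal (\<psi> i s))) \<le> upper \<Lambda> F"
proof (rule upper_greatest)
  fix g assume g: "\<And>n. cont (g n)" "\<And>n s. s \<in> M \<Longrightarrow> 0 \<le> g n s"
    and cov: "\<And>s. s \<in> M \<Longrightarrow> F s \<le> (\<Sum>n. ennreal (g n s))"
  have gp: "cont (\<lambda>s. g n s * \<psi> i s)" if "i \<in> I" for n i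
    using g assms(2) that by (intro continuous_map_real_mult) auto
  have nn: "0 \<le> \<Lambda> (\<lambda>s. g n s * \<psi> i s)" if "i \<in> I" for n i
    using g(2) assms(3) that by (intro st_nonneg[OF gp]) auto
  have "(\<Sum>i\<in>I. upper \<Lambda> (\<lambda>s. F s * ennreal (\<psi> i s))) \<le> (\<Sum>i\<in>I. \<Sum>n. ennreal (\<Lambda> (\<lambda>s. g n s * \<psi> i s)))"
  proof (rule sum_mono)
    fix i assume i: "i \<in> I"
    show "upper \<Lambda> (\<lambda>s. F s * ennreal (\<psi> i s)) \<le> (\<Sum>n. ennreal (\<Lambda> (\<lambda>s. g n s * \<psi> i s)))"
    proof (rule upper_le[OF gp[OF i]])
      fix s assume s: "s \<in> M"
      have "F s * ennreal (\<psi> i s) \<le> (\<Sum>n. ennreal (g n s)) * ennreal (\<psi> i s)"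
        using cov[OF s] by (rule mult_right_mono) simp
      also have "\<dots> = (\<Sum>n. ennreal (g n s) * ennreal (\<psi> i s))" by (rule ennreal_suminf_multc[symmetric])
      also have "\<dots> = (\<Sum>n. ennreal (g n s * \<psi> i s))"
        using g(2)[OF s] assms(3)[OF i s] by (simp add: ennreal_mult)
      finally show "F s * ennreal (\<psi> i s) \<le> (\<Sum>n. ennreal (g n s * \<psi> i s))" .
    qed (use g(2) assms(3)[OF i] in auto)
  qed
  also have "\<dots> = (\<Sum>n. \<Sum>i\<in>I. ennreal (\<Lambda> (\<lambda>s. g n s * \<psi> i s)))"
    by (rule suminf_sum[symmetric]) auto
  also have "\<dots> \<le> (\<Sum>n. ennreal (\<Lambda> (g n)))"
  proof (rule suminf_le)
    fix n
    have "(\<Sum>i\<in>I. \<Lambda> (\<lambda>s. g n s * \<psi> i s)) = \<Lambda> (\<lambda>s. \<Sum>i\<in>I. g n s * \<psi> i s)"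
      using st_sum[OF assms(1), of "\<lambda>i s. g n s * \<psi> i s"] gp by simp
    also have "\<dots> \<le> \<Lambda> (g n)"
    proof (rule st_mono)
      fix s assume s: "s \<in> M"
      have "g n s * (\<Sum>i\<in>I. \<psi> i s) \<le> g n s * 1" using one[OF s] g(2)[OF s] by (intro mult_left_mono)
      then show "(\<Sum>i\<in>I. g n s * \<psi> i s) \<le> g n s" by (simp add: sum_distrib_left)
    qed (use g gp assms(1) in \<open>auto intro: continuous_map_sum\<close>)
    finally show "(\<Sum>i\<in>I. ennreal (\<Lambda> (\<lambda>s. g n s * \<psi> i s))) \<le> ennreal (\<Lambda> (g n))"
      using nn by (subst sum_ennreal) (auto intro: ennreal_leI)
  qed auto
  finally show "(\<Sum>i\<in>I. upper \<Lambda> (\<lambda>s. F s * ennreal (\<psi> i s))) \<le> (\<Sum>n. ennreal (\<Lambda> (g n)))" .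
qed

definition outer :: "'a set \<Rightarrow> ennreal" where
  "outer E = upper \<Lambda> (indicator E)"

text \<open>The distance from the complement of \<open>U\<close>, scaled by \<open>k\<close> and capped at one.\<close>

lemma exhausting_functions:
  assumes U: "openin mtopology U"
  obtains \<phi> :: "nat \<Rightarrow> 'a \<Rightarrow> real" where "\<And>k. cont (\<phi> k)" "\<And>s. \<phi> 0 s = 0" "\<And>k s. s \<in> M \<Longrightarrow> \<phi> k s \<le> \<phi> (Suc k) s"
    "\<And>k s. s \<in> M \<Longrightarrow> \<phi> k s \<le> 1" "\<And>k s. s \<in> M - U \<Longrightarrow> \<phi> k s = 0" "\<And>s. s \<in> U \<Longrightarrow> (\<lambda>k. \<phi> k s) \<longlonglongrightarrow> 1"
proof (cases "U = M")
  case True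
  have "(\<lambda>k. if k = (0::nat) then 0 else 1) \<longlonglongrightarrow> (1::real)"
    by (rule tendsto_eventually) (auto intro: eventually_sequentiallyI[of 1])
  then show thesis using True by (intro that[of "\<lambda>k s. if k = 0 then 0 else 1"]) auto
next
  case False
  define C where "C = M - U"
  have UM: "U \<subseteq> M" using openin_subset[OF U] by simp
  then have C: "C \<noteq> {}" "C \<subseteq> M" unfolding C_def using False by auto
  define D where "D = (\<lambda>s. INF y\<in>C. d s y)"
  have bdd: "bdd_below (d s ` C)" for s by (rule bdd_belowI[of _ 0]) auto
  have D0: "0 \<le> D s" for s unfolding D_def using C by (intro cINF_greatest) auto
  have Dlip: "D s \<le> D t + d s t" if "s \<in> M" "t \<in> M" for s t
  proof -
    have "D s - d s t \<le> d t y" if y: "y \<in> C" for y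
    proof -
      have "D s \<le> d s y" unfolding D_def using y bdd by (intro cINF_lower)
      also have "\<dots> \<le> d s t + d t y" using triangle that y C \<open>s \<in> M\<close> \<open>t \<in> M\<close> by blast
      finally show ?thesis by simp
    qed
    then have "D s - d s t \<le> D t" unfolding D_def[of] using C(1) by (intro cINF_greatest) auto
    then show ?thesis by simp
  qed
  have contD: "cont D"
  proof (rule contI)
    fix \<sigma> l assume *: "limitin mtopology \<sigma> l sequentially" "range \<sigma> \<subseteq> M"
    then have lM: "l \<in> M" and "(\<lambda>n. d (\<sigma> n) l) \<longlonglongrightarrow> 0" using limitin_metric_dist_null by auto
    moreover have "dist (D (\<sigma> n)) (D l) \<le> d (\<sigma> n) l" for n
      using Dlip[of "\<sigma> n" l] Dlip[of l "\<sigma> n"] lM *(2) commute[of l "\<sigma> n"] by (auto simp: dist_real_def abs_le_iff image_subset_iff)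
    ultimately show "(\<lambda>n. D (\<sigma> n)) \<longlonglongrightarrow> D l"
      unfolding tendsto_dist_iff[of _ "D l"] by (intro tendsto_zero_le[OF zero_le_dist])
  qed
  have Dpos: "D s > 0" if s: "s \<in> U" for s
  proof -
    obtain r where r: "r > 0" "mball s r \<subseteq> U" using U s unfolding openin_mtopology by blast
    have "r \<le> d s y" if "y \<in> C" for y using r(2) that s UM C unfolding C_def by (force simp: not_less)
    then have "r \<le> D s" unfolding D_def using C by (intro cINF_greatest) auto
    then show ?thesis using r by simp
  qed
  have Dzero: "D s = 0" if "s \<in> C" for s
  proof -
    have "D s \<le> d s s" unfolding D_def using that bdd by (intro cINF_lower)
    then show ?thesis using D0[of s] that C by auto
  qed
  show thesis
  proof (rule that[of "\<lambda>k s. min 1 (real k * D s)"])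
    show "cont (\<lambda>s. min 1 (real k * D s))" for k
      using contD by (intro cont_min continuous_map_real_mult) auto
    show "min 1 (real k * D s) \<le> min 1 (real (Suc k) * D s)" for k s
      using D0[of s] by (intro min.mono) (auto intro: mult_right_mono)
    fix s assume s: "s \<in> U"
    obtain K :: nat where K: "1 / D s < real K" using reals_Archimedean2 by blast
    show "(\<lambda>k. min 1 (real k * D s)) \<longlonglongrightarrow> 1"
    proof (rule tendsto_eventually, rule eventually_sequentiallyI[of K])
      fix k assume "K \<le> k"
      then have "1 / D s \<le> real k" using K by (meson less_imp_le of_nat_mono order_less_le_trans)
      then show "min 1 (real k * D s) = 1" using Dpos[OF s] by (simp add: field_simps)
    qed
  qed (use Dzero C_def in auto)
qed

text \<open>
  Caratheodory's condition for an open set \<open>U\<close>: \<open>A\<close> is split by \<open>1 - \<phi> K\<close> and the increments of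
  functions \<open>\<phi> k\<close> increasing to the indicator of \<open>U\<close>, and then \<open>K\<close> tends to infinity.
\<close>

lemma open_in_lambda_system:
  assumes U: "openin mtopology U" shows "U \<in> lambda_system M (Pow M) outer"
proof -
  have UM: "U \<subseteq> M" using openin_subset[OF U] by simp
  obtain \<phi> :: "nat \<Rightarrow> 'a \<Rightarrow> real" where \<phi>: "\<And>k. cont (\<phi> k)" "\<And>s. \<phi> 0 s = 0" "\<And>k s. s \<in> M \<Longrightarrow> \<phi> k s \<le> \<phi> (Suc k) s"
    "\<And>k s. s \<in> M \<Longrightarrow> \<phi> k s \<le> 1" "\<And>k s. s \<in> M - U \<Longrightarrow> \<phi> k s = 0" "\<And>s. s \<in> U \<Longrightarrow> (\<lambda>k. \<phi> k s) \<longlonglongrightarrow> 1"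
    using exhausting_functions[OF U] by metis
  define \<psi> where "\<psi> = (\<lambda>k s. \<phi> (Suc k) s - \<phi> k s)"
  have \<psi>: "cont (\<psi> k)" "s \<in> M \<Longrightarrow> 0 \<le> \<psi> k s" for k s
    unfolding \<psi>_def using \<phi> by (auto intro: continuous_map_diff)
  have tele: "(\<Sum>k<K. \<psi> k s) = \<phi> K s" for K s
    unfolding \<psi>_def using \<phi>(2)[of s] by (induction K) auto
  have ge: "outer (A \<inter> U) + outer (A - U) \<le> outer A" if A: "A \<subseteq> M" for A
  proof -
    have "outer (A \<inter> U) \<le> upper \<Lambda> (\<lambda>s. \<Sum>k. indicator A s * ennreal (\<psi> k s))"
      unfolding outer_def
    proof (rule upper_mono)
      fix s assume s: "s \<in> M"
      show "indicator (A \<inter> U) s \<le> (\<Sum>k. indicator A s * ennreal (\<psi> k s))"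
      proof (cases "s \<in> A \<inter> U")
        case True
        then have "(\<lambda>k. \<psi> k s) sums 1" using \<phi>(6)[of s] unfolding sums_def tele by auto
        then have "(\<Sum>k. ennreal (\<psi> k s)) = ennreal 1" using \<psi>(2)[OF s] by (intro suminf_ennreal_eq) auto
        then show ?thesis using True by simp
      qed simp
    qed
    also have "\<dots> \<le> (\<Sum>k. upper \<Lambda> (\<lambda>s. indicator A s * ennreal (\<psi> k s)))"
      by (rule upper_countably_subadditive)
    finally have "outer (A \<inter> U) + outer (A - U) \<le> (\<Sum>k. upper \<Lambda> (\<lambda>s. indicator A s * ennreal (\<psi> k s))) + outer (A - U)"
      by (rule add_right_mono)
    also have "\<dots> \<le> outer A"
    proof (rule ennreal_suminf_bound_add)
      fix K
      let ?\<psi> = "\<lambda>k. if k < K then \<psi> k else (\<lambda>s. 1 - \<phi> K s)"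
      have "outer (A - U) \<le> upper \<Lambda> (\<lambda>s. indicator A s * ennreal (1 - \<phi> K s))"
        unfolding outer_def using \<phi>(5) by (intro upper_mono) (auto simp: indicator_def)
      then have "(\<Sum>k<K. upper \<Lambda> (\<lambda>s. indicator A s * ennreal (\<psi> k s))) + outer (A - U) \<le>
          (\<Sum>k<Suc K. upper \<Lambda> (\<lambda>s. indicator A s * ennreal (?\<psi> k s)))"
        by (simp add: add_left_mono)
      also have "\<dots> \<le> upper \<Lambda> (indicator A)"
      proof (rule upper_split)
        show "cont (?\<psi> k)" for k using \<psi> \<phi> by (auto intro: continuous_map_diff)
        show "0 \<le> ?\<psi> k s" if "s \<in> M" for k s using that \<psi> \<phi>(4) by auto
        show "(\<Sum>k<Suc K. ?\<psi> k s) \<le> 1" for s using tele[of s K] by simp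
      qed auto
      finally show "(\<Sum>k<K. upper \<Lambda> (\<lambda>s. indicator A s * ennreal (\<psi> k s))) + outer (A - U) \<le> outer A"
        unfolding outer_def .
    qed
    finally show ?thesis .
  qed
  have le: "outer A \<le> outer (A \<inter> U) + outer (A - U)" for A
  proof -
    let ?F = "\<lambda>k::nat. if k = 0 then indicator (A \<inter> U) else if k = 1 then indicator (A - U) else (\<lambda>s. 0 :: ennreal)"
    have two: "(\<Sum>k. f k) = f 0 + f 1" if "\<And>k. k \<ge> 2 \<Longrightarrow> f k = 0" for f :: "nat \<Rightarrow> ennreal"
      using suminf_finite[of "{0,1::nat}" f] that by force
    have z: "upper \<Lambda> (\<lambda>s. 0) = 0" using upper_cont_le[of "\<lambda>s. 0"] st_const[of 0] by simp
    have "outer A \<le> upper \<Lambda> (\<lambda>s. \<Sum>k. ?F k s)"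
      unfolding outer_def
    proof (rule upper_mono)
      fix s show "indicator A s \<le> (\<Sum>k. ?F k s)"
        using two[of "\<lambda>k. ?F k s"] by (auto simp: indicator_def)
    qed
    also have "\<dots> \<le> (\<Sum>k. upper \<Lambda> (?F k))" by (rule upper_countably_subadditive)
    also have "\<dots> = outer (A \<inter> U) + outer (A - U)"
      using two[of "\<lambda>k. upper \<Lambda> (?F k)"] z by (simp add: outer_def)
    finally show ?thesis .
  qed
  show ?thesis
    using UM ge le algebra.lambda_system_eq[of M "Pow M" outer] sigma_algebra_Pow[of M]
    unfolding sigma_algebra_def by (auto intro!: antisym)
qed

lemma outer_measure_space_outer: "outer_measure_space (Pow M) outer"
  unfolding outer_measure_space_def
proof (intro conjI)
  show "positive (Pow M) outer"
    unfolding positive_def outer_def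
    using upper_cont_le[of "\<lambda>s. 0"] st_const[of 0]
    by (simp add: fun_eq_iff[of "indicator {}" "\<lambda>s. 0", THEN iffD2])
  show "increasing (Pow M) outer"
    unfolding increasing_def outer_def by (auto intro!: upper_mono simp: indicator_def)
  show "countably_subadditive (Pow M) outer"
    unfolding countably_subadditive_def
  proof (intro allI impI)
    fix A :: "nat \<Rightarrow> 'a set" assume "disjoint_family A"
    then have "outer (\<Union>i. A i) = upper \<Lambda> (\<lambda>s. \<Sum>i. indicator (A i) s)"
      unfolding outer_def by (simp add: suminf_indicator)
    then show "outer (\<Union>i. A i) \<le> (\<Sum>i. outer (A i))"
      unfolding outer_def using upper_countably_subadditive[of "\<lambda>i. indicator (A i)"] by simp
  qed
qed

definition riesz_measure :: "'a measure" where
  "riesz_measure = measure_of M (sigma_sets M {U. openin mtopology U}) outer"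

lemma space_riesz [simp]: "space riesz_measure = M"
  and sets_riesz: "sets riesz_measure = sigma_sets M {U. openin mtopology U}"
  unfolding riesz_measure_def using sigma_algebra_sigma_sets[OF opens_Pow]
  by (simp_all add: sigma_algebra.sets_measure_of_eq sigma_algebra.space_measure_of_eq)

lemma emeasure_riesz:
  assumes "E \<in> sigma_sets M {U. openin mtopology U}" shows "emeasure riesz_measure E = outer E"
proof -
  interpret P: sigma_algebra M "Pow M" by (rule sigma_algebra_Pow)
  have ms: "measure_space M (lambda_system M (Pow M) outer) outer"
    by (rule P.caratheodory_lemma[OF outer_measure_space_outer])
  then interpret L: sigma_algebra M "lambda_system M (Pow M) outer" unfolding measure_space_def by blast
  have sub: "sigma_sets M {U. openin mtopology U} \<subseteq> lambda_system M (Pow M) outer"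
    by (rule L.sigma_sets_subset) (use open_in_lambda_system in auto)
  show ?thesis
    unfolding riesz_measure_def
  proof (rule emeasure_measure_of_sigma[OF sigma_algebra_sigma_sets[OF opens_Pow] _ _ assms])
    show "positive (sigma_sets M {U. openin mtopology U}) outer"
      using ms unfolding measure_space_def positive_def by blast
    show "countably_additive (sigma_sets M {U. openin mtopology U}) outer"
      using ms sub unfolding measure_space_def countably_additive_def by blast
  qed
qed

lemma prob_space_riesz: "prob_space riesz_measure"
proof
  have "openin mtopology M" by simp
  then have "emeasure riesz_measure M = outer M" by (intro emeasure_riesz) (auto intro: sigma_sets.Basic)
  also have "\<dots> = upper \<Lambda> (\<lambda>s. ennreal 1)"
    unfolding outer_def by (intro antisym upper_mono) auto
  also have "\<dots> = 1"
    using upper_cont_le[of "\<lambda>s. 1"] upper_cont_ge[of "\<lambda>s. 1"] st_one by (intro antisym) auto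
  finally show "emeasure riesz_measure (space riesz_measure) = 1" by simp
qed

lemma layer_sum_min: "0 \<le> y \<Longrightarrow> (\<Sum>k<n. min (max (y - real k) 0) 1) = min y (real n)"
  by (induction n) (auto simp: min_def max_def)

lemma layer_sum_count: "0 \<le> y \<Longrightarrow> (\<Sum>k<n. of_bool (real k < y) :: real) \<le> min (y + 1) (real n)"
proof (induction n)
  case (Suc n)
  then have "(\<Sum>k<n. of_bool (real k < y)) \<le> min (y + 1) (real n)" by simp
  moreover have "(\<Sum>k<Suc n. of_bool (real k < y)) = (\<Sum>k<n. of_bool (real k < y)) + (of_bool (real n < y) :: real)"
    by (rule sum.lessThan_Suc)
  ultimately show ?case by (auto simp: min_def split: if_splits)
qed simp

text \<open>Compare \<open>f\<close> with its \<open>n\<close> layers, each of which is dominated by an indicator.\<close>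

lemma riesz_integral_ge:
  assumes f: "cont f" shows "\<Lambda> f \<le> (\<integral>s. f s \<partial>riesz_measure)"
proof -
  interpret prob_space riesz_measure by (rule prob_space_riesz)
  have meas: "g \<in> borel_measurable riesz_measure" if "cont g" for g
    using borel_measurable_cont[OF that] sets_riesz by simp
  have int: "integrable riesz_measure g" if g: "cont g" for g
  proof -
    obtain B where "\<forall>s\<in>M. norm (g s) \<le> B" using cont_bounded[OF g] by blast
    then show ?thesis using meas[OF g] by (intro integrable_const_bound[of _ B]) auto
  qed
  \<comment> \<open>the layer \<open>h k\<close> of \<open>n g\<close> between heights \<open>k\<close> and \<open>k + 1\<close> lies below the indicator of \<open>E k\<close>, and
    the indicators of all \<open>E k\<close> add up to at most \<open>n g + 1\<close>\<close>
  have unit: "\<Lambda> g \<le> (\<integral>s. g s \<partial>riesz_measure)" if g: "cont g" "\<And>s. s \<in> M \<Longrightarrow> 0 \<le> g s \<and> g s \<le> 1" for g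
  proof (rule field_le_epsilon)
    fix e :: real assume e: "e > 0"
    obtain n :: nat where n: "1 / e < real n" using reals_Archimedean2 by blast
    then have n0: "n > 0" using e by (metis divide_pos_pos gr0I less_asym of_nat_0 zero_less_one)
    define h where "h = (\<lambda>k s. min (max (real n * g s - real k) 0) 1)"
    define E where "E = (\<lambda>k. {s \<in> topspace mtopology. real n * g s - real k \<in> {0<..}})"
    have ch0: "cont (\<lambda>s. real n * g s - real k)" for k :: nat
      using g(1) by (intro continuous_map_diff continuous_map_real_mult) auto
    then have ch: "cont (h k)" for k
      unfolding h_def by (intro cont_max cont_min) auto
    have Eo: "openin mtopology (E k)" for k
      unfolding E_def by (rule openin_continuous_map_preimage[OF ch0]) simp
    then have Es: "E k \<in> sets riesz_measure" for k unfolding sets_riesz by (auto intro: sigma_sets.Basic)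
    have hE: "\<Lambda> (h k) \<le> measure riesz_measure (E k)" for k
    proof -
      have "ennreal (\<Lambda> (h k)) \<le> upper \<Lambda> (\<lambda>s. ennreal (h k s))" by (rule upper_cont_ge[OF ch])
      also have "\<dots> \<le> outer (E k)" unfolding outer_def
        by (intro upper_mono) (auto simp: h_def E_def indicator_def ennreal_le_1 min_def max_def)
      also have "\<dots> = ennreal (measure riesz_measure (E k))"
        using emeasure_riesz[of "E k"] Es sets_riesz by (simp add: emeasure_eq_measure)
      finally show ?thesis by simp
    qed
    have "real n * \<Lambda> g = \<Lambda> (\<lambda>s. real n * g s)" using st_mult[OF g(1)] by simp
    also have "\<dots> \<le> \<Lambda> (\<lambda>s. \<Sum>k<n. h k s)"
    proof (rule st_mono)
      fix s assume s: "s \<in> M"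
      have "real n * g s \<le> real n" using g(2)[OF s] n0 by simp
      then show "real n * g s \<le> (\<Sum>k<n. h k s)"
        unfolding h_def using g(2)[OF s] by (subst layer_sum_min) auto
    qed (use g ch in \<open>auto intro!: continuous_map_sum continuous_map_real_mult\<close>)
    also have "\<dots> = (\<Sum>k<n. \<Lambda> (h k))" using ch by (intro st_sum) auto
    also have "\<dots> \<le> (\<Sum>k<n. measure riesz_measure (E k))" using hE by (intro sum_mono)
    also have "\<dots> = (\<integral>s. (\<Sum>k<n. indicator (E k) s) \<partial>riesz_measure)"
    proof -
      have "E k \<inter> M = E k" for k unfolding E_def by auto
      then show ?thesis
        using Es by (subst Bochner_Integration.integral_sum) (auto simp: emeasure_eq_measure)
    qed
    also have "\<dots> \<le> (\<integral>s. real n * g s + 1 \<partial>riesz_measure)"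
    proof (rule integral_mono)
      fix s assume s: "s \<in> space riesz_measure"
      have "(\<Sum>k<n. indicat_real (E k) s) = (\<Sum>k<n. of_bool (real k < real n * g s))"
        using s by (intro sum.cong) (auto simp: E_def indicator_def)
      also have "\<dots> \<le> real n * g s + 1" using layer_sum_count[of "real n * g s" n] g(2) s by auto
      finally show "(\<Sum>k<n. indicat_real (E k) s) \<le> real n * g s + 1" .
    qed (use Es int[OF g(1)] in \<open>auto intro!: Bochner_Integration.integrable_sum simp: emeasure_eq_measure\<close>)
    also have "\<dots> = real n * (\<integral>s. g s \<partial>riesz_measure) + 1"
      using int[OF g(1)] prob_space by simp
    finally have "\<Lambda> g \<le> (\<integral>s. g s \<partial>riesz_measure) + 1 / real n" using n0 by (simp add: field_simps)
    also have "1 / real n \<le> e" using n n0 e by (simp add: field_simps)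
    finally show "\<Lambda> g \<le> (\<integral>s. g s \<partial>riesz_measure) + e" by simp
  qed
  obtain B where B: "B > 0" "\<forall>s\<in>M. norm (f s) \<le> B" using cont_bounded[OF f] by blast
  define g where "g = (\<lambda>s. 1/2 + 1 / (2 * B) * f s)"
  have cg: "cont g" unfolding g_def using f by (intro continuous_map_add continuous_map_real_mult) auto
  have "0 \<le> g s \<and> g s \<le> 1" if "s \<in> M" for s
  proof -
    have "\<bar>f s\<bar> \<le> B" using B that by auto
    then show ?thesis unfolding g_def using B(1) by (simp add: field_simps abs_le_iff)
  qed
  then have "\<Lambda> g \<le> (\<integral>s. g s \<partial>riesz_measure)" by (rule unit[OF cg])
  moreover have "\<Lambda> g = 1/2 + 1 / (2 * B) * \<Lambda> f"
    unfolding g_def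
  proof (subst st_add)
    show "cont (\<lambda>s. 1 / (2 * B) * f s)" using f by (intro continuous_map_real_mult) auto
    show "\<Lambda> (\<lambda>s. 1/2) + \<Lambda> (\<lambda>s. 1 / (2 * B) * f s) = 1/2 + 1 / (2 * B) * \<Lambda> f"
      by (simp only: st_const st_mult[OF f])
  qed auto
  moreover have "(\<integral>s. g s \<partial>riesz_measure) = 1/2 + 1 / (2 * B) * (\<integral>s. f s \<partial>riesz_measure)"
    unfolding g_def using int[OF f] prob_space by simp
  ultimately show ?thesis using B(1) by (simp add: field_simps)
qed

end

end

section \<open>Uniform averages in a uniquely ergodic flow\<close>

locale compact_flow = compact_metric M d for M :: "'a set" and d +
  fixes act :: "real ^ 'n::finite \<Rightarrow> 'a \<Rightarrow> 'a"
  assumes act_mem: "s \<in> M \<Longrightarrow> act x s \<in> M"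
    and act_0: "s \<in> M \<Longrightarrow> act 0 s = s"
    and act_add: "s \<in> M \<Longrightarrow> act x (act y s) = act (x + y) s"
    and act_limit: "limitin mtopology \<sigma> l sequentially \<Longrightarrow> z \<longlonglongrightarrow> a \<Longrightarrow>
       limitin mtopology (\<lambda>n. act (z n) (\<sigma> n)) (act a l) sequentially"
begin

definition avg :: "(real ^ 'n) list \<Rightarrow> ('a \<Rightarrow> 'b::real_vector) \<Rightarrow> 'a \<Rightarrow> 'b" where
  "avg xs g s = (\<Sum>x\<leftarrow>xs. g (act x s)) /\<^sub>R real (length xs)"

definition invariant_measure :: "'a measure \<Rightarrow> bool" where
  "invariant_measure \<nu> \<longleftrightarrow> prob_space \<nu> \<and> space \<nu> = M \<and> sets \<nu> = sigma_sets M {U. openin mtopology U} \<and>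
     (\<forall>x. \<forall>E\<in>sets \<nu>. emeasure \<nu> (act x ` E) = emeasure \<nu> E)"

lemma act_cancel: "s \<in> M \<Longrightarrow> act x (act (- x) s) = s" "s \<in> M \<Longrightarrow> act (- x) (act x s) = s"
  by (simp_all add: act_add act_0)

lemma cont_act:
  assumes "continuous_map mtopology euclidean g" shows "continuous_map mtopology euclidean (\<lambda>s. g (act x s))"
  by (rule contI) (rule cont_limit[OF assms act_limit[OF _ tendsto_const]])

lemma sum_list_commute:
  fixes F :: "'c \<Rightarrow> 'd \<Rightarrow> 'e::comm_monoid_add"
  shows "(\<Sum>x\<leftarrow>xs. \<Sum>y\<leftarrow>ys. F x y) = (\<Sum>y\<leftarrow>ys. \<Sum>x\<leftarrow>xs. F x y)"
  by (induction xs) (simp_all add: sum_list_addf)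

lemma scaleR_sum_list: "r *\<^sub>R (\<Sum>x\<leftarrow>xs. f x) = (\<Sum>x\<leftarrow>xs. r *\<^sub>R (f x :: 'b::real_vector))"
  by (induction xs) (simp_all add: scaleR_add_right)

lemma avg_avg:
  "avg xs (avg ys g) s = (\<Sum>x\<leftarrow>xs. \<Sum>y\<leftarrow>ys. g (act y (act x s))) /\<^sub>R (real (length xs) * real (length ys))"
proof -
  have "(\<Sum>x\<leftarrow>xs. (\<Sum>y\<leftarrow>ys. g (act y (act x s))) /\<^sub>R real (length ys))
      = (\<Sum>x\<leftarrow>xs. \<Sum>y\<leftarrow>ys. g (act y (act x s))) /\<^sub>R real (length ys)"
    by (rule scaleR_sum_list[symmetric])
  then show ?thesis unfolding avg_def by simp
qed

lemma avg_commute: "s \<in> M \<Longrightarrow> avg xs (avg ys g) s = avg ys (avg xs g) s"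
  unfolding avg_avg by (subst sum_list_commute) (simp add: act_add add.commute mult.commute)

definition sum_pairs :: "(real ^ 'n) list \<Rightarrow> (real ^ 'n) list \<Rightarrow> (real ^ 'n) list" where
  "sum_pairs xs ys = concat (map (\<lambda>x. map (\<lambda>y. x + y) ys) xs)"

lemma sum_pairs_nonempty: "xs \<noteq> [] \<Longrightarrow> ys \<noteq> [] \<Longrightarrow> sum_pairs xs ys \<noteq> []"
  unfolding sum_pairs_def by (cases xs; cases ys) auto

lemma avg_sum_pairs: "s \<in> M \<Longrightarrow> avg (sum_pairs xs ys) g s = avg xs (avg ys g) s"
proof -
  assume s: "s \<in> M"
  have "length (sum_pairs xs ys) = length xs * length ys"
    unfolding sum_pairs_def by (induction xs) auto
  moreover have "(\<Sum>z\<leftarrow>sum_pairs xs ys. g (act z s)) = (\<Sum>x\<leftarrow>xs. \<Sum>y\<leftarrow>ys. g (act (x + y) s))"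
    unfolding sum_pairs_def by (induction xs) (simp_all add: o_def)
  ultimately show ?thesis
    unfolding avg_avg using s by (simp add: avg_def act_add add.commute)
qed

lemma avg_le:
  fixes g :: "'a \<Rightarrow> real"
  assumes "xs \<noteq> []" "s \<in> M" "\<And>t. t \<in> M \<Longrightarrow> g t \<le> b" shows "avg xs g s \<le> b"
proof -
  have "(\<Sum>x\<leftarrow>xs. g (act x s)) \<le> (\<Sum>x\<leftarrow>xs. b)" using assms act_mem by (intro sum_list_mono) auto
  then show ?thesis using assms(1) unfolding avg_def by (simp add: field_simps sum_list_triv)
qed

lemma avg_add: "avg xs (\<lambda>s. f s + g s) s = avg xs f s + avg xs g s"
  and avg_mult: "avg xs (\<lambda>s. r *\<^sub>R f s) s = r *\<^sub>R avg xs f s"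
  unfolding avg_def by (simp_all add: sum_list_addf scaleR_add_right scaleR_sum_list[symmetric])

lemma avg_minus:
  fixes f :: "'a \<Rightarrow> real" shows "avg xs (\<lambda>s. - f s) s = - avg xs f s"
  using avg_mult[of xs "-1" f s] by simp

lemma avg_ge:
  fixes g :: "'a \<Rightarrow> real"
  assumes "xs \<noteq> []" "s \<in> M" "\<And>t. t \<in> M \<Longrightarrow> b \<le> g t" shows "b \<le> avg xs g s"
  using avg_le[of xs s "\<lambda>s. - g s" "- b"] assms by (simp add: avg_minus)

lemma avg_abs_le:
  fixes g :: "'a \<Rightarrow> real"
  assumes "xs \<noteq> []" "s \<in> M" "\<And>t. t \<in> M \<Longrightarrow> \<bar>g t\<bar> \<le> b" shows "\<bar>avg xs g s\<bar> \<le> b"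
  using avg_le[of xs s g b] avg_ge[of xs s "-b" g] assms by (force simp: abs_le_iff)

lemma avg_cong: "s \<in> M \<Longrightarrow> (\<And>t. t \<in> M \<Longrightarrow> f t = g t) \<Longrightarrow> avg xs f s = avg xs g s"
  unfolding avg_def using act_mem by (metis (no_types, lifting) map_eq_conv)

lemma avg_const: "xs \<noteq> [] \<Longrightarrow> avg xs (\<lambda>s. b) s = (b::real)"
  unfolding avg_def by (simp add: sum_list_triv)

text \<open>Averages over the multiples of \<open>x\<close> telescope, so a long one is nearly invariant under \<open>x\<close>.\<close>

lemma avg_multiples:
  fixes g :: "'a \<Rightarrow> real" and x :: "real ^ 'n" and n :: nat
  assumes "s \<in> M" "n > 0"
  defines "xs \<equiv> map (\<lambda>k. real k *\<^sub>R x) [0..<n]"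
  shows "avg xs (\<lambda>t. g (act x t)) s - avg xs g s = (g (act (real n *\<^sub>R x) s) - g s) / real n"
proof -
  have "(\<Sum>y\<leftarrow>xs. g (act x (act y s))) = (\<Sum>k<n. g (act (real (Suc k) *\<^sub>R x) s))"
    unfolding xs_def using assms(1)
    by (simp add: interv_sum_list_conv_sum_set_nat atLeast0LessThan o_def act_add algebra_simps)
  moreover have "(\<Sum>y\<leftarrow>xs. g (act y s)) = (\<Sum>k<n. g (act (real k *\<^sub>R x) s))"
    unfolding xs_def by (simp add: interv_sum_list_conv_sum_set_nat atLeast0LessThan o_def)
  moreover have "(\<Sum>k<n. g (act (real (Suc k) *\<^sub>R x) s)) - (\<Sum>k<n. g (act (real k *\<^sub>R x) s)) = g (act (real n *\<^sub>R x) s) - g s"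
    using sum_lessThan_telescope[of "\<lambda>k. g (act (real k *\<^sub>R x) s)" n] assms(1)
    by (simp add: sum_subtractf act_0)
  ultimately show ?thesis
    unfolding avg_def using assms(2) by (simp add: xs_def field_simps)
qed

text \<open>
  Averages commute and compose, so near invariance under several translations is achieved one
  translation at a time.
\<close>

lemma almost_invariant_avg:
  fixes J :: "((real ^ 'n) \<times> nat \<times> ('a \<Rightarrow> real)) set"
  assumes "finite J" and b: "\<And>x n g. (x, n, g) \<in> J \<Longrightarrow> n > 0 \<and> (\<forall>s\<in>M. \<bar>g s\<bar> \<le> b g)"
  shows "\<exists>xs. xs \<noteq> [] \<and> (\<forall>x n g s. (x, n, g) \<in> J \<longrightarrow> s \<in> M \<longrightarrow> \<bar>avg xs (\<lambda>t. g (act x t)) s - avg xs g s\<bar> \<le> 2 * b g / real n)"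
  using assms
proof (induction J rule: finite_induct)
  case empty show ?case by (intro exI[of _ "[0]"]) auto
next
  case (insert j J)
  obtain x n g where j: "j = (x, n, g)" using prod_cases3 by blast
  have n: "n > 0" and bg: "\<And>s. s \<in> M \<Longrightarrow> \<bar>g s\<bar> \<le> b g" using insert.prems[of x n g] j by auto
  obtain xs where xs: "xs \<noteq> []"
    "\<And>x n g s. (x, n, g) \<in> J \<Longrightarrow> s \<in> M \<Longrightarrow> \<bar>avg xs (\<lambda>t. g (act x t)) s - avg xs g s\<bar> \<le> 2 * b g / real n"
    using insert.IH insert.prems by (metis insertI2)
  define ys where "ys = map (\<lambda>k. real k *\<^sub>R x) [0..<n]"
  have ys: "ys \<noteq> []" unfolding ys_def using n by simp
  have old: "\<bar>avg (sum_pairs ys xs) (\<lambda>t. g' (act x' t)) s - avg (sum_pairs ys xs) g' s\<bar> \<le> 2 * b g' / real n'"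
    if J: "(x', n', g') \<in> J" and s: "s \<in> M" for x' n' g' s
  proof -
    have "\<bar>avg ys (\<lambda>s. avg xs (\<lambda>t. g' (act x' t)) s + - avg xs g' s) s\<bar> \<le> 2 * b g' / real n'"
      using xs(2)[OF J] by (intro avg_abs_le[OF ys s]) auto
    then show ?thesis using s unfolding avg_add avg_minus by (simp add: avg_sum_pairs)
  qed
  have new: "\<bar>avg (sum_pairs ys xs) (\<lambda>t. g (act x t)) s - avg (sum_pairs ys xs) g s\<bar> \<le> 2 * b g / real n"
    if s: "s \<in> M" for s
  proof -
    have G: "\<bar>avg xs g t\<bar> \<le> b g" if "t \<in> M" for t using avg_abs_le[OF xs(1) that bg] .
    have "avg xs (\<lambda>t. g (act x t)) t = avg xs g (act x t)" if "t \<in> M" for t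
      using that unfolding avg_def by (simp add: act_add act_mem add.commute)
    then have "avg ys (avg xs (\<lambda>t. g (act x t))) s = avg ys (\<lambda>t. avg xs g (act x t)) s" by (intro avg_cong[OF s])
    then have "avg (sum_pairs ys xs) (\<lambda>t. g (act x t)) s - avg (sum_pairs ys xs) g s
        = (avg xs g (act (real n *\<^sub>R x) s) - avg xs g s) / real n"
      using avg_multiples[OF s n, of x "avg xs g"] s unfolding ys_def by (simp add: avg_sum_pairs)
    moreover have "\<bar>avg xs g (act (real n *\<^sub>R x) s) - avg xs g s\<bar> \<le> 2 * b g"
      using G[OF s] G[OF act_mem[OF s], of "real n *\<^sub>R x"] by linarith
    ultimately show ?thesis using n by (simp add: divide_right_mono)
  qed
  show ?case
    by (rule exI[of _ "sum_pairs ys xs"]) (use sum_pairs_nonempty[OF ys xs(1)] old new j in auto)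
qed

text \<open>
  A translation invariant state that is large on \<open>f\<close>, found as a cluster point of point
  evaluations of finite averages; the product of the intervals \<open>[-b g, b g]\<close> is compact.
\<close>

lemma invariant_state_exists:
  assumes f: "cont f" and large: "\<And>xs. xs \<noteq> [] \<Longrightarrow> \<exists>s\<in>M. c \<le> avg xs f s"
  shows "\<exists>\<Lambda>. state \<Lambda> \<and> (\<forall>x g. cont g \<longrightarrow> \<Lambda> (\<lambda>s. g (act x s)) = \<Lambda> g) \<and> c \<le> \<Lambda> f"
proof -
  have "\<forall>g. \<exists>b>0. cont g \<longrightarrow> (\<forall>s\<in>M. \<bar>g s\<bar> \<le> b)"
  proof
    fix g :: "'a \<Rightarrow> real" show "\<exists>b>0. cont g \<longrightarrow> (\<forall>s\<in>M. \<bar>g s\<bar> \<le> b)"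
      using cont_bounded[of g] by (cases "cont g") (auto intro: exI[of _ 1])
  qed
  then obtain b :: "('a \<Rightarrow> real) \<Rightarrow> real" where b: "\<And>g. b g > 0" "\<And>g s. cont g \<Longrightarrow> s \<in> M \<Longrightarrow> \<bar>g s\<bar> \<le> b g" by metis
  define box where "box = (PiE UNIV (\<lambda>g. {- b g .. b g}))"
  have "compactin (product_topology (\<lambda>g::'a \<Rightarrow> real. euclideanreal) UNIV) box"
    unfolding box_def by (subst compactin_PiE) (auto simp: compactin_euclidean_iff)
  then have box: "compact box" by (simp add: euclidean_product_topology compactin_euclidean_iff)
  have coord: "continuous_on UNIV (\<lambda>\<Lambda>::('a \<Rightarrow> real) \<Rightarrow> real. \<Lambda> g)" for g
    by (rule continuous_on_product_coordinates)
  define S where "S = {\<Lambda>. state \<Lambda> \<and> c \<le> \<Lambda> f}"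
  have "S = (\<Inter>(g, h)\<in>{(g, h). cont g \<and> cont h}. {\<Lambda>. \<Lambda> (\<lambda>s. g s + h s) = \<Lambda> g + \<Lambda> h}) \<inter>
      (\<Inter>(r, g)\<in>{(r, g). cont g}. {\<Lambda>. \<Lambda> (\<lambda>s. r * g s) = r * \<Lambda> g}) \<inter>
      (\<Inter>g\<in>{g. cont g \<and> (\<forall>s\<in>M. 0 \<le> g s)}. {\<Lambda>. 0 \<le> \<Lambda> g}) \<inter> {\<Lambda>. \<Lambda> (\<lambda>s. 1) = 1} \<inter> {\<Lambda>. c \<le> \<Lambda> f}"
    unfolding S_def state_def by auto
  also have "closed \<dots>"
    by (intro closed_Int closed_INT ballI)
       (auto intro!: closed_Collect_eq closed_Collect_le coord continuous_intros split: prod.splits)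
  finally have "closed S" .
  then have comp: "compact (box \<inter> S)" using box by (intro compact_Int_closed)
  \<comment> \<open>invariance is imposed as the intersection of the approximate conditions \<open>I\<close>, finitely many of
    which are met by the value of one average at one point\<close>
  define J where "J = {(x :: (real ^ 'n), n :: nat, g :: 'a \<Rightarrow> real). n > 0 \<and> cont g}"
  define I where "I = (\<lambda>(x :: (real ^ 'n), n :: nat, g :: 'a \<Rightarrow> real). {\<Lambda>. \<bar>\<Lambda> (\<lambda>s. g (act x s)) - \<Lambda> g\<bar> \<le> 2 * b g / real n})"
  have "box \<inter> S \<inter> (\<Inter>j\<in>J. I j) \<noteq> {}"
  proof (rule compact_imp_fip_image[OF comp])
    show "closed (I j)" if "j \<in> J" for j
      unfolding I_def by (cases j) (auto intro!: closed_Collect_le coord continuous_intros)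
    fix J' assume J': "finite J'" "J' \<subseteq> J"
    have bJ: "n > 0 \<and> (\<forall>s\<in>M. \<bar>g s\<bar> \<le> b g)" if "(x, n, g) \<in> J'" for x n g
    proof -
      have "(x, n, g) \<in> J" using that J'(2) by (rule subsetD[rotated])
      then show ?thesis using b(2) unfolding J_def by simp
    qed
    have "\<exists>xs. xs \<noteq> [] \<and> (\<forall>x n g s. (x, n, g) \<in> J' \<longrightarrow> s \<in> M \<longrightarrow>
        \<bar>avg xs (\<lambda>t. g (act x t)) s - avg xs g s\<bar> \<le> 2 * b g / real n)"
      by (rule almost_invariant_avg[OF J'(1)]) (rule bJ)
    then obtain xs where xs: "xs \<noteq> []" "\<forall>x n g s. (x, n, g) \<in> J' \<longrightarrow> s \<in> M \<longrightarrow>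
        \<bar>avg xs (\<lambda>t. g (act x t)) s - avg xs g s\<bar> \<le> 2 * b g / real n"
      by (elim exE conjE)
    obtain s where s: "s \<in> M" "c \<le> avg xs f s" using large[OF xs(1)] by blast
    define \<Lambda> where "\<Lambda> = (\<lambda>g :: 'a \<Rightarrow> real. if cont g then avg xs g s else 0)"
    have "\<Lambda> \<in> box"
      unfolding box_def \<Lambda>_def using avg_abs_le[OF xs(1) s(1)] b by (auto simp: abs_le_iff less_imp_le) (meson minus_le_iff)+
    moreover have "state \<Lambda>"
      unfolding state_def \<Lambda>_def
    proof (intro conjI allI impI)
      fix g h assume gh: "cont g" "cont h"
      then have "cont (\<lambda>s. g s + h s)" by (intro continuous_map_add)
      then show "(if cont (\<lambda>s. g s + h s) then avg xs (\<lambda>s. g s + h s) s else 0) =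
          (if cont g then avg xs g s else 0) + (if cont h then avg xs h s else 0)"
        using gh avg_add[of xs g h s] by simp
    next
      fix r g assume g: "cont g"
      then have "cont (\<lambda>s. r * g s)" by (intro continuous_map_real_mult) auto
      then show "(if cont (\<lambda>s. r * g s) then avg xs (\<lambda>s. r * g s) s else 0) = r * (if cont g then avg xs g s else 0)"
        using g avg_mult[of xs r g s] by simp
    next
      fix g assume "cont g" "\<forall>s\<in>M. 0 \<le> g s"
      then show "0 \<le> (if cont g then avg xs g s else 0)" using avg_ge[OF xs(1) s(1), of 0 g] by simp
    next
      have "avg xs (\<lambda>s. 1) s = (1::real)" using avg_const[OF xs(1)] .
      then show "(if cont (\<lambda>s. 1) then avg xs (\<lambda>s. 1) s else 0) = (1::real)" by simp
    qed
    moreover have "c \<le> \<Lambda> f" unfolding \<Lambda>_def using f s by simp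
    moreover have "\<Lambda> \<in> I j" if j: "j \<in> J'" for j
    proof -
      obtain x n g where jx: "j = (x, n, g)" using prod_cases3 by blast
      then have g: "cont g" using j J'(2) unfolding J_def by auto
      then show ?thesis using xs(2)[rule_format, of x n g s] j s cont_act[OF g] unfolding jx I_def \<Lambda>_def by simp
    qed
    ultimately show "box \<inter> S \<inter> (\<Inter>j\<in>J'. I j) \<noteq> {}" unfolding S_def by blast
  qed
  then obtain \<Lambda> where \<Lambda>: "\<Lambda> \<in> S" "\<And>j. j \<in> J \<Longrightarrow> \<Lambda> \<in> I j" by blast
  have "\<Lambda> (\<lambda>s. g (act x s)) = \<Lambda> g" if g: "cont g" for x g
  proof -
    have "\<bar>\<Lambda> (\<lambda>s. g (act x s)) - \<Lambda> g\<bar> \<le> 2 * b g / real (Suc n)" for n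
      using \<Lambda>(2)[of "(x, Suc n, g)"] g unfolding J_def I_def by simp
    moreover have "(\<lambda>n. 2 * b g / real (Suc n)) \<longlonglongrightarrow> 0"
      by (rule LIMSEQ_Suc[OF lim_const_over_n])
    ultimately have "\<bar>\<Lambda> (\<lambda>s. g (act x s)) - \<Lambda> g\<bar> \<le> 0" by (intro LIMSEQ_le_const) auto
    then show ?thesis by simp
  qed
  then show ?thesis using \<Lambda>(1) unfolding S_def by blast
qed

text \<open>
  The outer measure inherits the invariance of the functional: translating a cover of \<open>E\<close> by functions
  gives a cover of the translate with the same cost.
\<close>

lemma invariant_riesz:
  assumes st: "state \<Lambda>" and inv: "\<And>x g. cont g \<Longrightarrow> \<Lambda> (\<lambda>s. g (act x s)) = \<Lambda> g"
  shows "invariant_measure (riesz_measure \<Lambda>)"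
proof -
  have le: "outer \<Lambda> (act x ` E) \<le> outer \<Lambda> E" if E: "E \<subseteq> M" for x E
    unfolding outer_def[OF st]
  proof (rule upper_greatest[OF st])
    fix g assume g: "\<And>n. cont (g n)" "\<And>n s. s \<in> M \<Longrightarrow> 0 \<le> g n s"
      and cov: "\<And>s. s \<in> M \<Longrightarrow> indicator E s \<le> (\<Sum>n. ennreal (g n s))"
    have "upper \<Lambda> (indicator (act x ` E)) \<le> (\<Sum>n. ennreal (\<Lambda> (\<lambda>s. g n (act (- x) s))))"
    proof (rule upper_le[OF st])
      fix s assume s: "s \<in> M"
      show "indicator (act x ` E) s \<le> (\<Sum>n. ennreal (g n (act (- x) s)))"
      proof (cases "s \<in> act x ` E")
        case True
        then have "act (- x) s \<in> E" using E act_cancel(2) by auto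
        then show ?thesis using cov[of "act (- x) s"] E True by auto
      qed simp
    qed (use g act_mem cont_act[OF g(1)] in auto)
    then show "upper \<Lambda> (indicator (act x ` E)) \<le> (\<Sum>n. ennreal (\<Lambda> (g n)))" using inv g by simp
  qed
  have sub: "E \<subseteq> M" if "E \<in> sigma_sets M {U. openin mtopology U}" for E
    using that sigma_sets_into_sp[OF opens_Pow] by blast
  have act_sets: "act x ` E \<in> sigma_sets M {U. openin mtopology U}" if "E \<in> sigma_sets M {U. openin mtopology U}" for x E
  proof -
    have eq: "act x ` E = {s \<in> M. act (- x) s \<in> E}" if "E \<subseteq> M" for E
      using that act_mem act_cancel by (auto simp: image_iff) (metis subsetD)
    have "act x ` E \<in> sigma_sets M {U. openin mtopology U} \<and> E \<subseteq> M"
      using that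
    proof (induction rule: sigma_sets.induct)
      case (Basic U)
      then have U: "openin mtopology U" by simp
      have "continuous_map mtopology mtopology (act (- x))"
        by (rule continuous_map_sequentially) (rule act_limit[OF _ tendsto_const])
      then have "openin mtopology {s \<in> topspace mtopology. act (- x) s \<in> U}"
        using U by (rule openin_continuous_map_preimage)
      then show ?case using eq[of U] openin_subset[OF U] by (auto intro: sigma_sets.Basic)
    next
      case Empty then show ?case by (auto intro: sigma_sets.Empty)
    next
      case (Compl E)
      then have "act x ` (M - E) = M - act x ` E" using eq[of E] eq[of "M - E"] act_mem by auto
      then show ?case using Compl by (auto intro: sigma_sets.Compl)
    next
      case (Union E)
      then have "act x ` (\<Union>i. E i) = (\<Union>i. act x ` E i)" by blast
      then show ?case using Union by (auto intro: sigma_sets.Union)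
    qed
    then show ?thesis by blast
  qed
  have "emeasure (riesz_measure \<Lambda>) (act x ` E) = emeasure (riesz_measure \<Lambda>) E"
    if E: "E \<in> sigma_sets M {U. openin mtopology U}" for x E
  proof -
    have "act (- x) (act x s) = s" if "s \<in> E" for s using that sub[OF E] act_cancel(2) by blast
    then have "E = act (- x) ` act x ` E" by (simp add: image_image)
    then have "outer \<Lambda> E \<le> outer \<Lambda> (act x ` E)" using le[of "act x ` E" "- x"] sub[OF act_sets[OF E, of x]] by metis
    then have "outer \<Lambda> (act x ` E) = outer \<Lambda> E" using le[OF sub[OF E]] by (intro antisym)
    then show ?thesis using E act_sets[OF E] by (simp add: emeasure_riesz[OF st])
  qed
  then show ?thesis
    unfolding invariant_measure_def using prob_space_riesz[OF st] space_riesz[OF st] sets_riesz[OF st] by simp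
qed

context
  fixes \<mu> :: "'a measure"
  assumes inv: "invariant_measure \<mu>" and uniq: "\<And>\<nu>. invariant_measure \<nu> \<Longrightarrow> \<nu> = \<mu>"
begin

text \<open>
  If all averages of \<open>f\<close> were somewhere larger than the integral by \<open>e\<close>, there would be a second
  invariant measure giving \<open>f\<close> a larger integral.
\<close>

lemma average_le:
  assumes f: "cont f" and e: "e > 0"
  shows "\<exists>xs. xs \<noteq> [] \<and> (\<forall>s\<in>M. avg xs f s \<le> (\<integral>s. f s \<partial>\<mu>) + e)"
proof (rule ccontr)
  assume "\<not> ?thesis"
  then have "\<exists>s\<in>M. (\<integral>s. f s \<partial>\<mu>) + e \<le> avg xs f s" if "xs \<noteq> []" for xs
    using that by (meson less_imp_le not_le)
  then obtain \<Lambda> where \<Lambda>: "state \<Lambda>" "\<And>x g. cont g \<Longrightarrow> \<Lambda> (\<lambda>s. g (act x s)) = \<Lambda> g" "(\<integral>s. f s \<partial>\<mu>) + e \<le> \<Lambda> f"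
    using invariant_state_exists[OF f] by blast
  have "riesz_measure \<Lambda> = \<mu>" by (rule uniq[OF invariant_riesz[OF \<Lambda>(1,2)]])
  then show False using riesz_integral_ge[OF \<Lambda>(1) f] \<Lambda>(3) e by simp
qed

lemma average_near:
  assumes f: "cont f" and e: "e > 0"
  shows "\<exists>xs. xs \<noteq> [] \<and> (\<forall>s\<in>M. \<bar>avg xs f s - (\<integral>s. f s \<partial>\<mu>)\<bar> \<le> e)"
proof -
  obtain xs where xs: "xs \<noteq> []" "\<And>s. s \<in> M \<Longrightarrow> avg xs f s \<le> (\<integral>s. f s \<partial>\<mu>) + e"
    using average_le[OF f e] by blast
  have "cont (\<lambda>s. - f s)" using f by (rule continuous_map_minus)
  then obtain ys where ys: "ys \<noteq> []" "\<And>s. s \<in> M \<Longrightarrow> avg ys (\<lambda>s. - f s) s \<le> (\<integral>s. - f s \<partial>\<mu>) + e"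
    using average_le[OF _ e] by blast
  then have ys': "(\<integral>s. f s \<partial>\<mu>) - e \<le> avg ys f s" if "s \<in> M" for s
    using ys(2)[OF that] by (simp add: avg_minus)
  have "\<bar>avg (sum_pairs xs ys) f s - (\<integral>s. f s \<partial>\<mu>)\<bar> \<le> e" if s: "s \<in> M" for s
  proof -
    have "avg (sum_pairs xs ys) f s \<le> (\<integral>s. f s \<partial>\<mu>) + e"
      using avg_le[OF ys(1) s, of "avg xs f"] xs(2) avg_commute[OF s, of xs ys f] s by (simp add: avg_sum_pairs)
    moreover have "(\<integral>s. f s \<partial>\<mu>) - e \<le> avg (sum_pairs xs ys) f s"
      using avg_ge[OF xs(1) s ys'] s by (simp add: avg_sum_pairs)
    ultimately show ?thesis by linarith
  qed
  then show ?thesis using sum_pairs_nonempty[OF xs(1) ys(1)] by blast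
qed

text \<open>Averaging once more does not spoil an estimate already achieved.\<close>

lemma simultaneous_averages:
  assumes "finite \<F>" "\<And>f. f \<in> \<F> \<Longrightarrow> cont f" and e: "e > 0"
  shows "\<exists>xs. xs \<noteq> [] \<and> (\<forall>f\<in>\<F>. \<forall>s\<in>M. \<bar>avg xs f s - (\<integral>s. f s \<partial>\<mu>)\<bar> \<le> e)"
  using assms(1,2)
proof (induction \<F> rule: finite_induct)
  case empty show ?case by (intro exI[of _ "[0]"]) auto
next
  case (insert f \<F>)
  obtain xs where xs: "xs \<noteq> []" "\<And>f s. f \<in> \<F> \<Longrightarrow> s \<in> M \<Longrightarrow> \<bar>avg xs f s - (\<integral>s. f s \<partial>\<mu>)\<bar> \<le> e"
    using insert by (metis insertI2)
  obtain ys where ys: "ys \<noteq> []" "\<And>s. s \<in> M \<Longrightarrow> \<bar>avg ys f s - (\<integral>s. f s \<partial>\<mu>)\<bar> \<le> e"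
    using average_near[OF _ e, of f] insert.prems by blast
  have keep: "\<bar>avg zs (avg ws g) s - c\<bar> \<le> e"
    if "zs \<noteq> []" "s \<in> M" "\<And>s. s \<in> M \<Longrightarrow> \<bar>avg ws g s - c\<bar> \<le> e" for zs ws g s and c :: real
  proof -
    have "avg zs (\<lambda>s. avg ws g s + - c) s = avg zs (avg ws g) s - c"
      unfolding avg_add using avg_const[OF that(1), of "- c"] by simp
    then show ?thesis using avg_abs_le[OF that(1,2), of "\<lambda>s. avg ws g s + - c" e] that(3) by simp
  qed
  have "\<bar>avg (sum_pairs xs ys) g s - (\<integral>s. g s \<partial>\<mu>)\<bar> \<le> e" if g: "g \<in> insert f \<F>" and s: "s \<in> M" for g s
  proof (cases "g = f")
    case True then show ?thesis using keep[OF xs(1) s ys(2)] s by (simp add: avg_sum_pairs)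
  next
    case False
    then have "g \<in> \<F>" using g by simp
    then show ?thesis using keep[OF ys(1) s xs(2)] s by (simp add: avg_sum_pairs avg_commute[of _ xs ys])
  qed
  then show ?case using sum_pairs_nonempty[OF xs(1) ys(1)] by blast
qed

end

end

section \<open>Mollification\<close>

text \<open>
  The smooth functions \<open>p(1/t) exp(-1/t)\<close>, flat at zero.  They are closed under differentiation, which
  makes smoothness at zero a matter of one limit.
\<close>

definition exp_recip :: "real poly \<Rightarrow> real \<Rightarrow> real" where
  "exp_recip p t = (if t > 0 then poly p (1 / t) * exp (- (1 / t)) else 0)"

lemma poly_times_exp_neg_tendsto: "((\<lambda>x. poly p x * exp (- x)) \<longlongrightarrow> (0::real)) at_top"
proof -
  have "((\<lambda>x. \<Sum>i\<le>degree p. coeff p i * (x ^ i / exp x)) \<longlongrightarrow> (\<Sum>i\<le>degree p. coeff p i * 0)) at_top"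
    by (intro tendsto_sum tendsto_mult tendsto_const tendsto_power_div_exp_0)
  then show ?thesis
    by (simp add: poly_altdef exp_minus field_simps sum_divide_distrib sum_distrib_right)
qed

lemma exp_recip_deriv:
  "(exp_recip p has_real_derivative exp_recip ([:0, 0, 1:] * (p - pderiv p)) t) (at t)"
proof (cases t "0::real" rule: linorder_cases)
  case greater
  have "((\<lambda>t. poly p (1 / t) * exp (- (1 / t))) has_real_derivative
      exp_recip ([:0, 0, 1:] * (p - pderiv p)) t) (at t)"
    using greater by (auto intro!: derivative_eq_intros simp: exp_recip_def field_simps power2_eq_square)
  moreover have "\<forall>\<^sub>F x in nhds t. exp_recip p x = poly p (1 / x) * exp (- (1 / x))"
    using eventually_nhds_in_open[of "{0<..}" t] greater by (auto simp: exp_recip_def elim: eventually_mono)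
  ultimately show ?thesis by (subst DERIV_cong_ev[OF refl _ refl]) auto
next
  case less
  have "\<forall>\<^sub>F x in nhds t. exp_recip p x = 0"
    using eventually_nhds_in_open[of "{..<0}" t] less by (auto simp: exp_recip_def elim: eventually_mono)
  then show ?thesis using less by (subst DERIV_cong_ev[OF refl _ refl]) (auto simp: exp_recip_def)
next
  case equal
  have "((\<lambda>h. exp_recip p h / h) \<longlongrightarrow> 0) (at_right 0)"
  proof -
    have "((\<lambda>h. poly (pCons 0 p) (inverse h) * exp (- inverse h)) \<longlongrightarrow> 0) (at_right 0)"
      by (rule filterlim_compose[OF poly_times_exp_neg_tendsto filterlim_inverse_at_top_right])
    moreover have "\<forall>\<^sub>F h in at_right 0. poly (pCons 0 p) (inverse h) * exp (- inverse h) = exp_recip p h / h"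
      by (simp add: eventually_at_filter exp_recip_def field_simps)
    ultimately show ?thesis by (rule Lim_transform_eventually)
  qed
  moreover have "((\<lambda>h. exp_recip p h / h) \<longlongrightarrow> 0) (at_left 0)"
    by (rule tendsto_eventually) (simp add: eventually_at_filter exp_recip_def)
  ultimately have "((\<lambda>h. exp_recip p h / h) \<longlongrightarrow> 0) (at 0)" by (simp add: filterlim_split_at)
  then show ?thesis using equal by (simp add: has_field_derivative_iff exp_recip_def)
qed

text \<open>An algebra of functions closed under differentiation; all its members are therefore smooth.\<close>

inductive bump_algebra :: "(real \<Rightarrow> real) \<Rightarrow> bool" where
  const: "bump_algebra (\<lambda>t. c)"
| left: "bump_algebra (\<lambda>t. exp_recip p (1 + t))"
| right: "bump_algebra (\<lambda>t. exp_recip p (1 - t))"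
| add: "bump_algebra f \<Longrightarrow> bump_algebra g \<Longrightarrow> bump_algebra (\<lambda>t. f t + g t)"
| mult: "bump_algebra f \<Longrightarrow> bump_algebra g \<Longrightarrow> bump_algebra (\<lambda>t. f t * g t)"

lemma bump_algebra_deriv:
  "bump_algebra f \<Longrightarrow> \<exists>g. bump_algebra g \<and> (\<forall>t. (f has_real_derivative g t) (at t))"
proof (induction rule: bump_algebra.induct)
  case (const c)
  show ?case by (rule exI[of _ "\<lambda>t. 0"]) (auto intro: bump_algebra.const)
next
  case (left p)
  show ?case
    by (rule exI[of _ "\<lambda>t. exp_recip ([:0, 0, 1:] * (p - pderiv p)) (1 + t)"])
       (auto intro!: bump_algebra.left DERIV_chain'[OF _ exp_recip_deriv, THEN DERIV_cong] derivative_eq_intros)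
next
  case (right p)
  have "bump_algebra (\<lambda>t. (-1) * exp_recip ([:0, 0, 1:] * (p - pderiv p)) (1 - t))"
    by (intro bump_algebra.mult bump_algebra.const bump_algebra.right)
  moreover have "((\<lambda>t. exp_recip p (1 - t)) has_real_derivative (-1) * exp_recip ([:0, 0, 1:] * (p - pderiv p)) (1 - t)) (at t)" for t
    by (rule DERIV_chain'[OF _ exp_recip_deriv, THEN DERIV_cong]) (auto intro!: derivative_eq_intros)
  ultimately show ?case by (intro exI conjI allI)
next
  case (add f g)
  then obtain f' g' where "bump_algebra f'" "bump_algebra g'"
    "\<And>t. (f has_real_derivative f' t) (at t)" "\<And>t. (g has_real_derivative g' t) (at t)" by blast
  then show ?case by (intro exI[of _ "\<lambda>t. f' t + g' t"]) (auto intro: bump_algebra.add DERIV_add)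
next
  case (mult f g)
  then obtain f' g' where *: "bump_algebra f'" "bump_algebra g'"
    "\<And>t. (f has_real_derivative f' t) (at t)" "\<And>t. (g has_real_derivative g' t) (at t)" by blast
  have "bump_algebra (\<lambda>t. f' t * g t + g' t * f t)"
    using mult.hyps * by (intro bump_algebra.add bump_algebra.mult)
  then show ?case using DERIV_mult[OF *(3,4)] by (intro exI[of _ "\<lambda>t. f' t * g t + g' t * f t"]) auto
qed

definition bump :: "nat \<Rightarrow> real \<Rightarrow> real" where
  "bump k = (deriv ^^ k) (\<lambda>t. exp_recip 1 (1 + t) * exp_recip 1 (1 - t))"

lemma bump_algebra_bump: "bump_algebra (bump k)"
proof (induction k)
  case 0
  show ?case unfolding bump_def by (auto intro: bump_algebra.intros)
next
  case (Suc k)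
  then obtain g where g: "bump_algebra g" "\<And>t. (bump k has_real_derivative g t) (at t)"
    using bump_algebra_deriv by blast
  then have "deriv (bump k) = g" by (auto intro: DERIV_imp_deriv)
  then show ?case using g(1) by (simp add: bump_def)
qed

lemma bump_deriv: "(bump k has_real_derivative bump (Suc k) t) (at t)"
proof -
  obtain g where g: "\<And>t. (bump k has_real_derivative g t) (at t)"
    using bump_algebra_deriv[OF bump_algebra_bump] by blast
  then have "deriv (bump k) = g" by (auto intro: DERIV_imp_deriv)
  then show ?thesis using g by (simp add: bump_def)
qed

lemma bump_cont: "continuous_on A (bump k)"
  by (rule DERIV_continuous_on) (rule DERIV_subset[OF bump_deriv], simp)

lemma bump_outside: "1 < \<bar>t\<bar> \<Longrightarrow> bump k t = 0"
proof (induction k arbitrary: t)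
  case 0 then show ?case by (auto simp: bump_def exp_recip_def)
next
  case (Suc k)
  have "\<forall>\<^sub>F x in nhds t. bump k x = 0"
  proof -
    have "open {x::real. 1 < \<bar>x\<bar>}" by (intro open_Collect_less continuous_intros)
    then have "\<forall>\<^sub>F x in nhds t. x \<in> {x. 1 < \<bar>x\<bar>}" using Suc.prems by (intro eventually_nhds_in_open) auto
    then show ?thesis by eventually_elim (use Suc.IH in auto)
  qed
  then have "(bump k has_real_derivative 0) (at t)" by (subst DERIV_cong_ev[OF refl _ refl]) auto
  then show ?case using bump_deriv DERIV_unique by blast
qed

lemma bump_0_nonneg: "0 \<le> bump 0 t" and bump_0_pos: "0 < bump 0 0"
  by (auto simp: bump_def exp_recip_def)

abbreviation ones :: "real ^ 'n" where "ones \<equiv> (\<chi> i. 1)"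

definition bump_mass :: "'n::finite itself \<Rightarrow> real" where
  "bump_mass _ = integral (cbox (- ones) ones) (\<lambda>u::real ^ 'n. \<Prod>i\<in>UNIV. bump 0 (- u $ i))"

text \<open>The mollifier with mass one, differentiated \<open>k i\<close> times in the \<open>i\<close>-th coordinate.\<close>

definition mollifier :: "('n::finite \<Rightarrow> nat) \<Rightarrow> real ^ 'n \<Rightarrow> real" where
  "mollifier k x = (\<Prod>i\<in>UNIV. bump (k i) (x $ i)) / bump_mass TYPE('n)"

definition bump_index :: "'n \<Rightarrow> ('n \<Rightarrow> nat) \<Rightarrow> 'n \<Rightarrow> nat" where
  "bump_index j k = k(j := Suc (k j))"

lemma bump_index_commute: "bump_index i (bump_index j k) = bump_index j (bump_index i k)"
  unfolding bump_index_def by auto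

lemma bump_mass_pos: "0 < bump_mass TYPE('n::finite)"
proof -
  let ?f = "\<lambda>u::real ^ 'n. \<Prod>i\<in>UNIV. bump 0 (- u $ i)"
  have c: "continuous_on (cbox (- ones) ones) ?f"
    by (intro continuous_on_prod continuous_on_compose2[OF bump_cont[of UNIV 0]] continuous_intros) auto
  have nn: "0 \<le> ?f u" for u by (intro prod_nonneg) (auto simp: bump_0_nonneg)
  have ge: "0 \<le> integral (cbox (- ones) ones) ?f"
    using c nn by (intro integral_nonneg integrable_continuous) auto
  have "integral (cbox (- ones) ones) ?f \<noteq> 0"
  proof
    assume "integral (cbox (- ones) ones) ?f = 0"
    then have "(?f has_integral 0) (cbox (- ones) ones)"
      using c integrable_continuous has_integral_integral by metis
    moreover have "box (- ones) (ones :: real ^ 'n) \<noteq> {}"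
      by (auto simp: box_ne_empty Basis_vec_def inner_axis)
    moreover have "(0 :: real ^ 'n) \<in> cbox (- ones) ones" by (simp add: mem_box_cart)
    ultimately have "?f 0 = 0" by (intro has_integral_0_cbox_imp_0[where f = ?f, OF c nn])
    then show False using bump_0_pos by simp
  qed
  then show ?thesis using ge unfolding bump_mass_def by simp
qed

lemma mollifier_cont:
  fixes A :: "(real ^ 'n::finite) set" shows "continuous_on A (mollifier k)"
  unfolding mollifier_def using bump_mass_pos[where 'n = 'n]
  by (intro continuous_intros continuous_on_compose2[OF bump_cont[of UNIV]]) auto

lemma mollifier_outside: "x \<notin> cbox (- ones) ones \<Longrightarrow> mollifier k x = 0"
proof -
  assume "x \<notin> cbox (- ones) ones"
  then obtain i where "\<not> (- 1 \<le> x $ i \<and> x $ i \<le> 1)" by (auto simp: mem_box_cart)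
  then have "1 < \<bar>x $ i\<bar>" by linarith
  then have "bump (k i) (x $ i) = 0" by (rule bump_outside)
  then have "(\<Prod>i\<in>UNIV. bump (k i) (x $ i)) = 0" by (intro prod_zero) auto
  then show ?thesis unfolding mollifier_def by simp
qed

lemma mollifier_has_derivative:
  fixes x :: "real ^ 'n::finite"
  shows "(mollifier k has_derivative (\<lambda>v. \<Sum>j\<in>UNIV. v $ j * mollifier (bump_index j k) x)) (at x)"
proof -
  have 1: "((\<lambda>x::real^'n. bump (k i) (x $ i)) has_derivative (\<lambda>v. bump (Suc (k i)) (x $ i) * v $ i)) (at x)" for i
    by (rule has_derivative_compose[where f = "\<lambda>x. x $ i", OF bounded_linear.has_derivative[OF bounded_linear_vec_nth has_derivative_ident]
          bump_deriv[unfolded has_field_derivative_def]])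
  have "((\<lambda>x::real^'n. \<Prod>i\<in>UNIV. bump (k i) (x $ i)) has_derivative
      (\<lambda>v. \<Sum>j\<in>UNIV. bump (Suc (k j)) (x $ j) * v $ j * (\<Prod>i\<in>UNIV - {j}. bump (k i) (x $ i)))) (at x)"
    by (rule has_derivative_prod[OF 1])
  moreover have "bump (Suc (k j)) (x $ j) * v $ j * (\<Prod>i\<in>UNIV - {j}. bump (k i) (x $ i))
      = v $ j * (\<Prod>i\<in>UNIV. bump (bump_index j k i) (x $ i))" for v j
    by (subst prod.remove[of UNIV j]) (auto simp: bump_index_def intro!: prod.cong)
  ultimately have "((\<lambda>x::real^'n. \<Prod>i\<in>UNIV. bump (k i) (x $ i)) has_derivative
      (\<lambda>v. \<Sum>j\<in>UNIV. v $ j * (\<Prod>i\<in>UNIV. bump (bump_index j k i) (x $ i)))) (at x)" by simp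
  from bounded_linear.has_derivative[OF bounded_linear_divide this, of "bump_mass TYPE('n)"]
  have "((\<lambda>x::real^'n. (\<Prod>i\<in>UNIV. bump (k i) (x $ i)) / bump_mass TYPE('n)) has_derivative
      (\<lambda>v. (\<Sum>j\<in>UNIV. v $ j * (\<Prod>i\<in>UNIV. bump (bump_index j k i) (x $ i))) / bump_mass TYPE('n))) (at x)" .
  then show ?thesis by (simp add: mollifier_def[abs_def] sum_divide_distrib)
qed

definition mollify :: "('n::finite \<Rightarrow> nat) \<Rightarrow> (real ^ 'n \<Rightarrow> real) \<Rightarrow> real ^ 'n \<Rightarrow> real" where
  "mollify k B x = integral (cbox (- ones) ones) (\<lambda>u. mollifier k (- u) * B (x + u))"

text \<open>Allows a domain of integration that moves with \<open>x\<close> to be replaced by a fixed one.\<close>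

lemma integral_eq_of_support:
  fixes f :: "'a::euclidean_space \<Rightarrow> real"
  assumes "\<And>x. x \<notin> S \<Longrightarrow> f x = 0" "S \<subseteq> T" shows "integral T f = integral S f"
proof -
  have "(\<lambda>x. if x \<in> T then f x else 0) = (\<lambda>x. if x \<in> S then f x else 0)" using assms by (auto simp: fun_eq_iff)
  then show ?thesis by (metis Henstock_Kurzweil_Integration.integral_restrict_UNIV)
qed

lemma mollify_eq:
  fixes x x0 :: "real ^ 'n::finite"
  assumes B: "continuous_on UNIV B" and x: "x \<in> cbox (x0 - ones) (x0 + ones)"
  shows "mollify k B x = integral (cbox (x0 - 2 *\<^sub>R ones) (x0 + 2 *\<^sub>R ones)) (\<lambda>y. mollifier k (x - y) * B y)"
proof -
  let ?g = "\<lambda>y. mollifier k (x - y) * B y"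
  have cont: "continuous_on A ?g" for A
    by (intro continuous_intros continuous_on_compose2[OF mollifier_cont[of UNIV k]] continuous_on_subset[OF B]) auto
  have "(?g has_integral integral (cbox (x - ones) (x + ones)) ?g) (cbox (x - ones) (x + ones))"
    by (intro integrable_integral integrable_continuous cont)
  from has_integral_affinity'[OF this, of 1 x]
  have "((\<lambda>u. mollifier k (- u) * B (x + u)) has_integral integral (cbox (x - ones) (x + ones)) ?g) (cbox (- ones) ones)"
    by (simp add: add.commute)
  then have "mollify k B x = integral (cbox (x - ones) (x + ones)) ?g" unfolding mollify_def by (rule integral_unique)
  also have "\<dots> = integral (cbox (x0 - 2 *\<^sub>R ones) (x0 + 2 *\<^sub>R ones)) ?g"
  proof (rule integral_eq_of_support[symmetric])
    fix y assume "y \<notin> cbox (x - ones) (x + ones)"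
    then have "x - y \<notin> cbox (- ones) ones" by (auto simp: mem_box_cart not_le) (smt (verit))+
    then show "?g y = 0" by (simp add: mollifier_outside)
  next
    show "cbox (x - ones) (x + ones) \<subseteq> cbox (x0 - 2 *\<^sub>R ones) (x0 + 2 *\<^sub>R ones)"
      using x by (auto simp: mem_box_cart) (smt (verit))+
  qed
  finally show ?thesis .
qed

text \<open>Differentiating under the integral sign moves all derivatives onto the mollifier.\<close>

lemma mollify_has_derivative:
  fixes x :: "real ^ 'n::finite"
  assumes B: "continuous_on UNIV B"
  shows "(mollify k B has_derivative (\<lambda>v. \<Sum>j\<in>UNIV. v $ j * mollify (bump_index j k) B x)) (at x)"
proof -
  let ?Q = "cbox (x - 2 *\<^sub>R ones) (x + 2 *\<^sub>R ones)"
  let ?U = "box (x - ones) (x + ones)"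
  define gr where "gr = (\<lambda>z y. (\<chi> j. mollifier (bump_index j k) (z - y) * B y) :: real ^ 'n)"
  define fx where "fx = (\<lambda>z y. blinfun_inner_right (gr z y))"
  have cgr: "continuous_on A (\<lambda>(z, y). gr z y)" for A
    unfolding gr_def case_prod_beta
    by (intro continuous_intros continuous_on_compose2[OF mollifier_cont[of UNIV]] continuous_on_compose2[OF B]) auto
  have xU: "x \<in> ?U" by (simp add: mem_box_cart)
  have cK: "continuous_on A (\<lambda>y. mollifier k (z - y) * B y)" for A k z
    by (intro continuous_intros continuous_on_compose2[OF mollifier_cont[of UNIV]] continuous_on_subset[OF B]) auto
  have igr: "gr x integrable_on ?Q"
  proof (rule integrable_continuous)
    have "continuous_on ?Q (\<lambda>y. (x, y))" by (intro continuous_intros)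
    from continuous_on_compose2[OF cgr[of UNIV] this] show "continuous_on ?Q (gr x)" by simp
  qed
  have "((\<lambda>z. integral ?Q (\<lambda>y. mollifier k (z - y) * B y)) has_derivative blinfun_apply (integral ?Q (fx x))) (at x within ?U)"
  proof (rule leibniz_rule[OF _ _ _ xU convex_box(2)])
    fix z y
    have "((\<lambda>z. mollifier k (z - y)) has_derivative (\<lambda>v. \<Sum>j\<in>UNIV. v $ j * mollifier (bump_index j k) (z - y))) (at z)"
      by (rule has_derivative_compose[OF _ mollifier_has_derivative]) (auto intro!: derivative_eq_intros)
    then have "((\<lambda>z. mollifier k (z - y) * B y) has_derivative (\<lambda>v. (\<Sum>j\<in>UNIV. v $ j * mollifier (bump_index j k) (z - y)) * B y)) (at z)"
      by (rule has_derivative_mult_left)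
    moreover have "(\<lambda>v. (\<Sum>j\<in>UNIV. v $ j * mollifier (bump_index j k) (z - y)) * B y) = blinfun_apply (fx z y)"
      by (rule ext) (simp add: fx_def gr_def inner_vec_def sum_distrib_left mult_ac)
    ultimately show "((\<lambda>z. mollifier k (z - y) * B y) has_derivative blinfun_apply (fx z y)) (at z within ?U)"
      by (simp add: has_derivative_at_withinI)
  next
    show "(\<lambda>y. mollifier k (z - y) * B y) integrable_on ?Q" for z
      by (intro integrable_continuous cK)
    show "continuous_on (?U \<times> ?Q) (\<lambda>(z, y). fx z y)"
      unfolding fx_def case_prod_beta
      by (rule bounded_linear.continuous_on[OF bounded_linear_blinfun_inner_right cgr[unfolded case_prod_beta]])
  qed
  moreover have "integral ?Q (fx x) = blinfun_inner_right (integral ?Q (gr x))"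
    unfolding fx_def using integral_linear[OF igr bounded_linear_blinfun_inner_right] by (simp add: o_def)
  moreover have "integral ?Q (gr x) $ j = mollify (bump_index j k) B x" for j
  proof -
    have "integral ?Q (gr x) $ j = integral ?Q (\<lambda>y. gr x y $ j)"
      using integral_linear[OF igr bounded_linear_vec_nth[of j]] by (simp add: o_def)
    also have "\<dots> = mollify (bump_index j k) B x"
      unfolding gr_def by (subst mollify_eq[OF B, of x x]) (auto simp: mem_box_cart)
    finally show ?thesis .
  qed
  then have "(\<bullet>) (integral ?Q (gr x)) = (\<lambda>v. \<Sum>j\<in>UNIV. v $ j * mollify (bump_index j k) B x)"
    by (auto simp: fun_eq_iff inner_vec_def mult.commute)
  ultimately have "((\<lambda>z. integral ?Q (\<lambda>y. mollifier k (z - y) * B y)) has_derivative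
      (\<lambda>v. \<Sum>j\<in>UNIV. v $ j * mollify (bump_index j k) B x)) (at x within ?U)"
    by (simp add: mult.commute)
  then have "((\<lambda>z. integral ?Q (\<lambda>y. mollifier k (z - y) * B y)) has_derivative
      (\<lambda>v. \<Sum>j\<in>UNIV. v $ j * mollify (bump_index j k) B x)) (at x)"
    unfolding at_within_open[OF xU open_box] .
  then show ?thesis
  proof (rule has_derivative_transform_within_open[OF _ open_box xU])
    fix z assume "z \<in> ?U"
    then have "z \<in> cbox (x - ones) (x + ones)" using box_subset_cbox by blast
    then show "integral ?Q (\<lambda>y. mollifier k (z - y) * B y) = mollify k B z"
      using mollify_eq[OF B, of z x k] by simp
  qed
qed

lemma partial_deriv_mollify:
  assumes "continuous_on UNIV B"
  shows "partial_deriv j (mollify k B) = mollify (bump_index j k) B"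
proof
  fix x
  have "frechet_derivative (mollify k B) (at x) = (\<lambda>v. \<Sum>j\<in>UNIV. v $ j * mollify (bump_index j k) B x)"
    using frechet_derivative_at[OF mollify_has_derivative[OF assms]] by metis
  then show "partial_deriv j (mollify k B) x = mollify (bump_index j k) B x"
    unfolding partial_deriv_def by (simp add: axis_def if_distrib[of "\<lambda>z. z * _"] sum.delta cong: if_cong)
qed

lemma partial_derivs_mollify:
  assumes "continuous_on UNIV B"
  shows "partial_derivs js (mollify k B) = mollify (foldr bump_index js k) B"
  unfolding partial_derivs_def using partial_deriv_mollify[OF assms] by (induction js) simp_all

text \<open>
  Each iterated derivative is again a mollification of the continuous function \<open>B\<close>, with a derivative
  of the mollifier as kernel.
\<close>

lemma smooth_mollify:
  assumes "continuous_on UNIV B" shows "smooth_fun (mollify k B)"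
  unfolding smooth_fun_def partial_derivs_mollify[OF assms]
  using mollify_has_derivative[OF assms] unfolding differentiable_def by blast

lemma mollifier_integral_0: "integral (cbox (- ones) ones) (\<lambda>u::real^'n. mollifier (\<lambda>_. 0) (- u)) = 1"
proof -
  have "integral (cbox (- ones) ones) (\<lambda>u::real^'n. mollifier (\<lambda>_. 0) (- u)) = bump_mass TYPE('n) / bump_mass TYPE('n)"
    unfolding mollifier_def by (subst bump_mass_def) simp
  then show ?thesis using bump_mass_pos[where 'n='n] by simp
qed

lemma mollifier_integral_deriv: "integral (cbox (- ones) ones) (\<lambda>u. mollifier (bump_index j k) (- u)) = 0"
proof -
  have "mollify k (\<lambda>_. 1) = (\<lambda>_. mollify k (\<lambda>_. 1) 0)" unfolding mollify_def by simp
  then have "partial_deriv j (mollify k (\<lambda>_. 1)) = (\<lambda>_. 0)"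
    unfolding partial_deriv_def by (metis frechet_derivative_const)
  then have "mollify (bump_index j k) (\<lambda>_. 1) 0 = 0"
    using partial_deriv_mollify[of "\<lambda>_. 1" j k] by (metis continuous_on_const)
  then show ?thesis unfolding mollify_def by simp
qed

text \<open>Derivatives of the mollifier integrate to zero, so only increments of \<open>B\<close> matter.\<close>

lemma mollify_minus_const:
  fixes x :: "real ^ 'n::finite"
  assumes B: "continuous_on UNIV B"
  shows "integral (cbox (- ones) ones) (\<lambda>u. mollifier k (- u) * (B (x + u) - B x))
    = mollify k B x - integral (cbox (- ones) ones) (\<lambda>u. mollifier k (- u)) * B x"
proof -
  have c: "continuous_on A (\<lambda>u::real^'n. mollifier k (- u))" for A
    by (intro continuous_on_compose2[OF mollifier_cont[of UNIV]] continuous_intros) auto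
  have B': "continuous_on A (\<lambda>u. B (x + u))" for A
    by (intro continuous_on_compose2[OF B] continuous_intros) auto
  have "integral (cbox (- ones) ones) (\<lambda>u. mollifier k (- u) * B (x + u) - mollifier k (- u) * B x)
      = mollify k B x - integral (cbox (- ones) ones) (\<lambda>u. mollifier k (- u) * B x)"
    unfolding mollify_def
    by (rule Henstock_Kurzweil_Integration.integral_diff; rule integrable_continuous; intro continuous_intros c B')
  then show ?thesis by (simp add: right_diff_distrib)
qed

section \<open>Smoothing a cocycle and making its derivative nearly constant\<close>

locale flow_cocycle = compact_flow M d act for M :: "'a set" and d and act :: "real ^ 'n::finite \<Rightarrow> 'a \<Rightarrow> 'a" +
  fixes \<alpha> :: "'a \<Rightarrow> real ^ 'n \<Rightarrow> real ^ 'n"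
  assumes cocycle: "s \<in> M \<Longrightarrow> \<alpha> s (x + y) = \<alpha> s x + \<alpha> (act x s) y"
    and cocycle_limit: "limitin mtopology \<sigma> l sequentially \<Longrightarrow> z \<longlonglongrightarrow> a \<Longrightarrow> (\<lambda>n. \<alpha> (\<sigma> n) (z n)) \<longlonglongrightarrow> \<alpha> l a"

text \<open>
  The data of a shape deformation, for all base points at once: on the orbit of \<open>s\<close> the form has the
  coefficient matrix \<open>W (act x s)\<close> at \<open>x\<close>, and \<open>\<beta> s\<close> is its primitive.
\<close>

locale flow_deformation = flow_cocycle M d act \<beta> for M :: "'a set" and d and act :: "real ^ 'n::finite \<Rightarrow> 'a \<Rightarrow> 'a" and \<beta> +
  fixes W :: "'a \<Rightarrow> real ^ 'n ^ 'n" and c C :: real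
  assumes c_pos: "0 < c"
    and lower: "s \<in> M \<Longrightarrow> c * norm (x - y) \<le> norm (\<beta> s x - \<beta> s y)"
    and upper_lip: "s \<in> M \<Longrightarrow> norm (\<beta> s x - \<beta> s y) \<le> C * norm (x - y)"
    and surj_\<beta>: "s \<in> M \<Longrightarrow> surj (\<beta> s)"
    and form_smooth: "s \<in> M \<Longrightarrow> smooth_form (\<lambda>x. W (act x s))"
    and form_closed: "s \<in> M \<Longrightarrow> closed_form (\<lambda>x. W (act x s))"
    and form_primitive_eq: "s \<in> M \<Longrightarrow> form_primitive (\<lambda>x. W (act x s)) = \<beta> s"
    and form_weakly_PE: "s \<in> M \<Longrightarrow> \<exists>F. continuous_map mtopology euclideanreal F \<and>
      (\<forall>x. partial_derivs js (\<lambda>x. W (act x s) $ i $ j) x = F (act x s))"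

lemma (in flow_cocycle) cocycle_0: "s \<in> M \<Longrightarrow> \<alpha> s 0 = 0"
  using cocycle[of s 0 0] act_0 by simp

lemma (in flow_cocycle) cocycle_diff: "s \<in> M \<Longrightarrow> \<alpha> s (x + u) - \<alpha> s x = \<alpha> (act x s) u"
  by (simp add: cocycle)

lemma (in flow_cocycle) cocycle_continuous_on: 
  assumes "s \<in> M" shows "continuous_on A (\<alpha> s)"
  by (rule continuous_on_sequentiallyI) (rule cocycle_limit, use assms in auto)

lemma (in flow_cocycle) cocycle_cont: "continuous_map mtopology euclidean (\<lambda>s. \<alpha> s x)"
  by (rule contI) (rule cocycle_limit[OF _ tendsto_const])

text \<open>A cocycle is continuous on the compact product of \<open>M\<close> with a ball.\<close>

lemma (in flow_cocycle) cocycle_bounded: "\<exists>B>0. \<forall>s\<in>M. \<forall>v. norm v \<le> V \<longrightarrow> norm (\<alpha> s v) \<le> B"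
proof (rule ccontr)
  assume "\<not> ?thesis"
  then have "\<forall>n. \<exists>s v. s \<in> M \<and> norm v \<le> V \<and> real (Suc n) < norm (\<alpha> s v)"
    by (metis not_le of_nat_0_less_iff zero_less_Suc)
  then obtain s v where sv: "\<And>n. s n \<in> M" "\<And>n. norm (v n) \<le> V" "\<And>n. real (Suc n) < norm (\<alpha> (s n) (v n))" by metis
  obtain l r where l: "strict_mono r" "limitin mtopology (s \<circ> r) l sequentially"
    using compact_subsequence[of s] sv(1) by blast
  have "bounded (range (v \<circ> r))" using sv(2) unfolding bounded_iff by auto
  then obtain a q where a: "strict_mono q" "((v \<circ> r) \<circ> q) \<longlonglongrightarrow> a"
    using bounded_imp_convergent_subsequence by blast
  have "limitin mtopology ((s \<circ> r) \<circ> q) l sequentially" by (rule limitin_subsequence[OF a(1) l(2)])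
  then have "(\<lambda>n. \<alpha> (((s \<circ> r) \<circ> q) n) (((v \<circ> r) \<circ> q) n)) \<longlonglongrightarrow> \<alpha> l a" by (rule cocycle_limit[OF _ a(2)])
  then have "Bseq (\<lambda>n. \<alpha> (s (r (q n))) (v (r (q n))))" by (simp add: o_def convergent_imp_Bseq convergentI)
  then obtain K where K: "\<And>n. norm (\<alpha> (s (r (q n))) (v (r (q n)))) \<le> K" unfolding Bseq_def by blast
  obtain n where n: "K < real n" using reals_Archimedean2 by blast
  have "n \<le> r (q n)" using seq_suble[OF l(1)] seq_suble[OF a(1)] order_trans by blast
  then show False using K[of n] sv(3)[of "r (q n)"] n by linarith
qed

lemma cube_norm_le:
  fixes u :: "real ^ 'n::finite"
  assumes "u \<in> cbox (- ones) ones" shows "norm u \<le> real CARD('n)"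
proof -
  have "\<bar>u $ i\<bar> \<le> 1" for i using assms by (intro abs_leI) (auto simp: mem_box_cart minus_le_iff)
  then have "(\<Sum>i\<in>UNIV. \<bar>u $ i\<bar>) \<le> (\<Sum>i\<in>(UNIV :: 'n set). 1)" by (intro sum_mono)
  then show ?thesis using norm_le_l1_cart[of u] by simp
qed

context flow_cocycle
begin

text \<open>Integrals of the cocycle against the derivatives of the mollifier.\<close>

definition smear :: "('n \<Rightarrow> nat) \<Rightarrow> 'a \<Rightarrow> real ^ 'n" where
  "smear k s = (\<chi> i. integral (cbox (- ones) ones) (\<lambda>u. mollifier k (- u) * \<alpha> s u $ i))"

definition coeff_matrix :: "'a \<Rightarrow> real ^ 'n ^ 'n" where
  "coeff_matrix s = (\<chi> i j. smear (bump_index j (\<lambda>_. 0)) s $ i)"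

text \<open>
  Convolving \<open>\<alpha>\<close> along orbits with the mollifier changes it by a coboundary, and its derivative at \<open>x\<close> is
  the value of \<open>coeff_matrix\<close> at the translate by \<open>x\<close>.
\<close>

definition smoothed :: "'a \<Rightarrow> real ^ 'n \<Rightarrow> real ^ 'n" where
  "smoothed s x = \<alpha> s x + smear (\<lambda>_. 0) (act x s) - smear (\<lambda>_. 0) s"

lemma mollifier_minus_cont: "continuous_on A (\<lambda>u. mollifier k (- u))"
  by (intro continuous_on_compose2[OF mollifier_cont[of UNIV]] continuous_intros) auto

lemma smear_integrable: "s \<in> M \<Longrightarrow> (\<lambda>u. mollifier k (- u) * \<alpha> s u $ i) integrable_on cbox (- ones) ones"
  by (intro integrable_continuous continuous_intros mollifier_minus_cont cocycle_continuous_on)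

lemma mollify_cocycle:
  assumes "s \<in> M"
  shows "mollify (bump_index j k) (\<lambda>x. \<alpha> s x $ i) x = smear (bump_index j k) (act x s) $ i"
    and "mollify (\<lambda>_. 0) (\<lambda>x. \<alpha> s x $ i) x = \<alpha> s x $ i + smear (\<lambda>_. 0) (act x s) $ i"
proof -
  have "continuous_on UNIV (\<lambda>x. \<alpha> s x $ i)" by (intro continuous_intros cocycle_continuous_on[OF assms])
  note mi = mollify_minus_const[OF this, of _ x]
  have *: "\<alpha> s (x + u) $ i - \<alpha> s x $ i = \<alpha> (act x s) u $ i" for u
    using cocycle_diff[OF assms, of x u] by (metis vector_minus_component)
  show "mollify (bump_index j k) (\<lambda>x. \<alpha> s x $ i) x = smear (bump_index j k) (act x s) $ i"
    using mi[of "bump_index j k"] by (simp add: * smear_def mollifier_integral_deriv)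
  show "mollify (\<lambda>_. 0) (\<lambda>x. \<alpha> s x $ i) x = \<alpha> s x $ i + smear (\<lambda>_. 0) (act x s) $ i"
    using mi[of "\<lambda>_. 0"] by (simp add: * smear_def mollifier_integral_0)
qed

lemma smear_cont: "continuous_map mtopology euclidean (smear k)"
proof (rule contI)
  fix \<sigma> l assume lim: "limitin mtopology \<sigma> l sequentially" and \<sigma>: "range \<sigma> \<subseteq> M"
  then have lM: "l \<in> M" using limitin_mspace by blast
  obtain B where B: "B > 0" "\<And>s v. s \<in> M \<Longrightarrow> norm v \<le> real CARD('n) \<Longrightarrow> norm (\<alpha> s v) \<le> B"
    using cocycle_bounded by blast
  show "(\<lambda>n. smear k (\<sigma> n)) \<longlonglongrightarrow> smear k l"
  proof (rule vec_tendstoI)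
    fix i
    have "(\<lambda>n. integral (cbox (- ones) ones) (\<lambda>u. mollifier k (- u) * \<alpha> (\<sigma> n) u $ i))
        \<longlonglongrightarrow> integral (cbox (- ones) ones) (\<lambda>u. mollifier k (- u) * \<alpha> l u $ i)"
    proof (rule dominated_convergence(2))
      show "(\<lambda>u. mollifier k (- u) * \<alpha> (\<sigma> n) u $ i) integrable_on cbox (- ones) ones" for n
        using \<sigma> by (intro smear_integrable) auto
      show "(\<lambda>u. \<bar>mollifier k (- u)\<bar> * B) integrable_on cbox (- ones) ones"
        by (intro integrable_continuous continuous_intros mollifier_minus_cont)
      show "norm (mollifier k (- u) * \<alpha> (\<sigma> n) u $ i) \<le> \<bar>mollifier k (- u)\<bar> * B" if "u \<in> cbox (- ones) ones" for n u
        using B(2)[OF subsetD[OF \<sigma> rangeI], of u n] cube_norm_le[OF that] component_le_norm_cart[of "\<alpha> (\<sigma> n) u" i]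
        by (auto simp: abs_mult intro!: mult_left_mono)
      show "(\<lambda>n. mollifier k (- u) * \<alpha> (\<sigma> n) u $ i) \<longlonglongrightarrow> mollifier k (- u) * \<alpha> l u $ i" for u
        by (intro tendsto_intros cocycle_limit[OF lim])
    qed
    then show "(\<lambda>n. smear k (\<sigma> n) $ i) \<longlonglongrightarrow> smear k l $ i" by (simp add: smear_def)
  qed
qed

lemma smear_component_cont: "cont (\<lambda>s. smear k s $ i)"
  by (rule contI) (intro tendsto_intros cont_limit[OF smear_cont])

lemma smoothed_component:
  assumes "s \<in> M"
  shows "smoothed s x $ i = mollify (\<lambda>_. 0) (\<lambda>x. \<alpha> s x $ i) x - mollify (\<lambda>_. 0) (\<lambda>x. \<alpha> s x $ i) 0"
  using assms by (simp add: mollify_cocycle smoothed_def cocycle_0 act_0)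

lemma has_derivative_vecI:
  fixes f :: "real ^ 'n \<Rightarrow> real ^ 'n"
  assumes "\<And>i. ((\<lambda>x. f x $ i) has_derivative (\<lambda>v. f' v $ i)) (at x)"
  shows "(f has_derivative f') (at x)"
  using assms by (subst has_derivative_componentwise_within) (auto simp: Basis_vec_def inner_axis)

lemma smoothed_has_derivative:
  assumes s: "s \<in> M"
  shows "(smoothed s has_derivative (\<lambda>v. coeff_matrix (act x s) *v v)) (at x)"
proof (rule has_derivative_vecI)
  fix i
  have "continuous_on UNIV (\<lambda>x. \<alpha> s x $ i)" by (intro continuous_intros cocycle_continuous_on[OF s])
  from mollify_has_derivative[OF this, of "\<lambda>_. 0" x]
  have "((\<lambda>x. mollify (\<lambda>_. 0) (\<lambda>x. \<alpha> s x $ i) x - mollify (\<lambda>_. 0) (\<lambda>x. \<alpha> s x $ i) 0) has_derivative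
      (\<lambda>v. (\<Sum>j\<in>UNIV. v $ j * mollify (bump_index j (\<lambda>_. 0)) (\<lambda>x. \<alpha> s x $ i) x) - 0)) (at x)"
    by (intro has_derivative_diff has_derivative_const)
  then show "((\<lambda>x. smoothed s x $ i) has_derivative (\<lambda>v. (coeff_matrix (act x s) *v v) $ i)) (at x)"
    by (simp add: smoothed_component[OF s] mollify_cocycle[OF s] matrix_vector_mult_def coeff_matrix_def mult.commute)
qed

lemma coeff_matrix_entry:
  assumes "s \<in> M"
  shows "(\<lambda>x. coeff_matrix (act x s) $ i $ j) = mollify (bump_index j (\<lambda>_. 0)) (\<lambda>x. \<alpha> s x $ i)"
  using mollify_cocycle(1)[OF assms] by (auto simp: coeff_matrix_def)

lemma coeff_matrix_smooth: "s \<in> M \<Longrightarrow> smooth_form (\<lambda>x. coeff_matrix (act x s))"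
  unfolding smooth_form_def coeff_matrix_entry
  by (intro allI smooth_mollify continuous_intros cocycle_continuous_on)

lemma coeff_matrix_partial_derivs:
  assumes s: "s \<in> M"
  shows "\<exists>F. cont F \<and> (\<forall>x. partial_derivs js (\<lambda>x. coeff_matrix (act x s) $ i $ j) x = F (act x s))"
proof -
  have c: "continuous_on UNIV (\<lambda>x. \<alpha> s x $ i)" by (intro continuous_intros cocycle_continuous_on[OF s])
  obtain j' k' where k: "foldr bump_index js (bump_index j (\<lambda>_. 0)) = bump_index j' k'"
    by (cases js) auto
  have "partial_derivs js (\<lambda>x. coeff_matrix (act x s) $ i $ j) x = smear (bump_index j' k') (act x s) $ i" for x
    using mollify_cocycle(1)[OF s] by (simp add: coeff_matrix_entry[OF s] partial_derivs_mollify[OF c] k)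
  then show ?thesis using smear_component_cont by blast
qed

lemma coeff_matrix_closed: 
  assumes s: "s \<in> M" shows "closed_form (\<lambda>x. coeff_matrix (act x s))"
  unfolding closed_form_def
proof (intro allI)
  fix i j k x
  have c: "continuous_on UNIV (\<lambda>x. \<alpha> s x $ i)" by (intro continuous_intros cocycle_continuous_on[OF s])
  show "partial_deriv k (\<lambda>x. coeff_matrix (act x s) $ i $ j) x = partial_deriv j (\<lambda>x. coeff_matrix (act x s) $ i $ k) x"
    unfolding coeff_matrix_entry[OF s] partial_deriv_mollify[OF c] by (simp add: bump_index_commute)
qed

lemma coeff_matrix_primitive:
  assumes s: "s \<in> M" shows "form_primitive (\<lambda>x. coeff_matrix (act x s)) = smoothed s"
proof
  fix x
  have "((\<lambda>t. coeff_matrix (act (t *\<^sub>R x) s) *v x) has_integral smoothed s (1 *\<^sub>R x) - smoothed s (0 *\<^sub>R x)) {0..1}"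
  proof (rule fundamental_theorem_of_calculus)
    fix t :: real assume "t \<in> {0..1}"
    have "((\<lambda>t. smoothed s (t *\<^sub>R x)) has_derivative (\<lambda>h. coeff_matrix (act (t *\<^sub>R x) s) *v (h *\<^sub>R x))) (at t within {0..1})"
      by (rule has_derivative_compose[OF _ smoothed_has_derivative[OF s]]) (auto intro!: derivative_eq_intros)
    then show "((\<lambda>t. smoothed s (t *\<^sub>R x)) has_vector_derivative coeff_matrix (act (t *\<^sub>R x) s) *v x) (at t within {0..1})"
      unfolding has_vector_derivative_def by (simp add: matrix_vector_mult_scaleR)
  qed simp
  moreover have "smoothed s 0 = 0" using s by (simp add: smoothed_def cocycle_0 act_0)
  ultimately show "form_primitive (\<lambda>x. coeff_matrix (act x s)) x = smoothed s x"
    unfolding form_primitive_def by (simp add: integral_unique)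
qed

lemma flow_cocycle_coboundary:
  assumes "continuous_map mtopology euclidean f"
  shows "flow_cocycle M d act (\<lambda>s x. \<alpha> s x + f (act x s) - f s)"
proof
  fix s x y assume "s \<in> M"
  then show "\<alpha> s (x + y) + f (act (x + y) s) - f s = \<alpha> s x + f (act x s) - f s + (\<alpha> (act x s) y + f (act y (act x s)) - f (act x s))"
    by (simp add: cocycle act_add add.commute)
next
  fix \<sigma> l and z :: "nat \<Rightarrow> real ^ 'n" and a assume lim: "limitin mtopology \<sigma> l sequentially" "z \<longlonglongrightarrow> a"
  show "(\<lambda>n. \<alpha> (\<sigma> n) (z n) + f (act (z n) (\<sigma> n)) - f (\<sigma> n)) \<longlonglongrightarrow> \<alpha> l a + f (act a l) - f l"
    by (intro tendsto_intros cocycle_limit[OF lim] cont_limit[OF assms] act_limit[OF lim] lim(1))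
qed

text \<open>Averaging translates of a cocycle changes it by the coboundary of \<open>shift_mean xs\<close>.\<close>

definition shift_mean :: "(real ^ 'n) list \<Rightarrow> 'a \<Rightarrow> real ^ 'n" where
  "shift_mean xs s = (\<Sum>y\<leftarrow>xs. \<alpha> s y) /\<^sub>R real (length xs)"

lemma shift_mean_cont: "continuous_map mtopology euclidean (shift_mean xs)"
proof -
  have "(\<lambda>n. (\<Sum>y\<leftarrow>xs. \<alpha> (\<sigma> n) y)) \<longlonglongrightarrow> (\<Sum>y\<leftarrow>xs. \<alpha> l y)" if "limitin mtopology \<sigma> l sequentially" for \<sigma> l
    using cocycle_limit[OF that tendsto_const] by (induction xs) (auto intro!: tendsto_add)
  then show ?thesis unfolding shift_mean_def by (intro contI tendsto_intros)
qed

lemma avg_cocycle_eq: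
  assumes xs: "xs \<noteq> []" and s: "s \<in> M"
  shows "\<alpha> s x + shift_mean xs (act x s) - shift_mean xs s = (\<Sum>y\<leftarrow>xs. \<alpha> (act y s) x) /\<^sub>R real (length xs)"
proof -
  have "\<alpha> (act y s) x = \<alpha> s x + \<alpha> (act x s) y - \<alpha> s y" for y
    using cocycle[OF s, of x y] cocycle[OF s, of y x] by (simp add: add.commute algebra_simps)
  then have "(\<Sum>y\<leftarrow>xs. \<alpha> (act y s) x) = (\<Sum>y\<leftarrow>xs. \<alpha> s x + \<alpha> (act x s) y - \<alpha> s y)" by simp
  also have "\<dots> = real (length xs) *\<^sub>R \<alpha> s x + (\<Sum>y\<leftarrow>xs. \<alpha> (act x s) y) - (\<Sum>y\<leftarrow>xs. \<alpha> s y)"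
    by (induction xs) (simp_all add: algebra_simps)
  finally show ?thesis
    using xs by (simp add: shift_mean_def scaleR_add_right scaleR_diff_right)
qed

end

text \<open>Invertibility survives a small perturbation of the derivative.\<close>

lemma near_linear_bi_lipschitz:
  fixes f :: "real ^ 'n::finite \<Rightarrow> real ^ 'n" and L :: "real ^ 'n ^ 'n"
  assumes b: "b > 0" "\<And>v. b * norm v \<le> norm (L *v v)"
    and f: "\<And>x. (f has_derivative (\<lambda>v. F x *v v)) (at x)"
    and near: "\<And>x v. norm ((F x - L) *v v) \<le> b / 2 * norm v"
  shows "b / 2 * norm (x - y) \<le> norm (f x - f y)"
    and "norm (f x - f y) \<le> (onorm (\<lambda>v. L *v v) + b / 2) * norm (x - y)"
    and "surj f"
proof -
  \<comment> \<open>\<open>g\<close> is a contraction relative to \<open>L\<close>, so \<open>f x = y\<close> is the fixed point equation of the contraction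
    \<open>x \<mapsto> L\<^sup>-\<^sup>1 (y - g x)\<close>\<close>
  define g where "g = (\<lambda>x. f x - L *v x)"
  have gd: "(g has_derivative (\<lambda>v. (F x - L) *v v)) (at x)" for x
    unfolding g_def matrix_vector_mult_diff_rdistrib
    by (intro has_derivative_diff f bounded_linear.has_derivative[OF matrix_vector_mul_bounded_linear] has_derivative_ident)
  have g: "norm (g x - g y) \<le> b / 2 * norm (x - y)" for x y
  proof (rule differentiable_bound[of UNIV g "\<lambda>x v. (F x - L) *v v"])
    show "onorm (\<lambda>v. (F x - L) *v v) \<le> b / 2" for x using near[of x] by (rule onorm_le)
  qed (use gd in auto)
  have fd: "f x - f y = L *v (x - y) + (g x - g y)" for x y
    unfolding g_def by (simp add: matrix_vector_mult_diff_distrib)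
  show low: "b / 2 * norm (x - y) \<le> norm (f x - f y)" for x y
    using b(2)[of "x - y"] g[of x y] norm_diff_ineq[of "L *v (x - y)" "g x - g y"] unfolding fd[of x y] by simp
  have "norm (L *v (x - y)) \<le> onorm (\<lambda>v. L *v v) * norm (x - y)"
    by (rule onorm[OF matrix_vector_mul_bounded_linear])
  then show "norm (f x - f y) \<le> (onorm (\<lambda>v. L *v v) + b / 2) * norm (x - y)"
    using norm_triangle_ineq[of "L *v (x - y)" "g x - g y"] g[of x y] unfolding fd[of x y] by (simp add: algebra_simps)
  show "surj f"
  proof (rule surjI)
    fix y
    have "inj ((*v) L)"
    proof (rule injI)
      fix v w assume "L *v v = L *v w"
      then show "v = w" using b(2)[of "v - w"] b(1) by (simp add: matrix_vector_mult_diff_distrib mult_le_0_iff)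
    qed
    then have "surj ((*v) L)" using linear_injective_imp_surjective[OF matrix_vector_mul_linear[of L]] by blast
    then obtain inv where inv: "\<And>w. L *v inv w = w" by (metis surjD)
    have inv_bound: "b * norm (inv w - inv w') \<le> norm (w - w')" for w w'
      using b(2)[of "inv w - inv w'"] by (simp add: matrix_vector_mult_diff_distrib inv)
    have "dist (inv (y - g x)) (inv (y - g x')) \<le> 1/2 * dist x x'" for x x'
    proof -
      have "b * norm (inv (y - g x) - inv (y - g x')) \<le> norm (g x' - g x)"
        using inv_bound[of "y - g x" "y - g x'"] by simp
      also have "\<dots> \<le> b / 2 * norm (x' - x)" by (rule g)
      finally show ?thesis using b(1) by (simp add: dist_norm norm_minus_commute field_simps)
    qed
    then have "\<exists>!x. inv (y - g x) = x" by (intro banach_fix_type[of "1/2"]) auto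
    then obtain x where "inv (y - g x) = x" by blast
    then have "y - g x = L *v x" using inv by metis
    then have "f x = y" unfolding g_def by (simp add: algebra_simps)
    then show "f (SOME x. f x = y) = y" by (rule someI)
  qed
qed

lemma norm_matrix_vector_mult_le:
  fixes A :: "real ^ 'n::finite ^ 'n"
  assumes "\<And>i j. \<bar>A $ i $ j\<bar> \<le> e" "0 \<le> e"
  shows "norm (A *v v) \<le> real CARD('n) * (real CARD('n) * e) * norm v"
proof -
  have "\<bar>(A *v v) $ i\<bar> \<le> real CARD('n) * e * norm v" for i
  proof -
    have "\<bar>(A *v v) $ i\<bar> \<le> (\<Sum>j\<in>UNIV. \<bar>A $ i $ j * v $ j\<bar>)" unfolding matrix_vector_mult_def by (simp add: sum_abs)
    also have "\<dots> \<le> (\<Sum>j\<in>(UNIV::'n set). e * norm v)"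
      using assms component_le_norm_cart[of v] by (intro sum_mono) (simp add: abs_mult mult_mono)
    finally show ?thesis by simp
  qed
  then have "(\<Sum>i\<in>UNIV. \<bar>(A *v v) $ i\<bar>) \<le> (\<Sum>i\<in>(UNIV::'n set). real CARD('n) * e * norm v)" by (intro sum_mono)
  then show ?thesis using norm_le_l1_cart[of "A *v v"] by simp
qed

context flow_cocycle
begin

context
  fixes \<mu> :: "'a measure"
  assumes inv: "invariant_measure \<mu>"
begin

lemma prob_\<mu>: "prob_space \<mu>" and space_\<mu>: "space \<mu> = M"
  and sets_\<mu>: "sets \<mu> = sigma_sets M {U. openin mtopology U}"
  using inv unfolding invariant_measure_def by auto

lemma cont_integrable:
  fixes f :: "'a \<Rightarrow> 'b::euclidean_space"
  assumes "continuous_map mtopology euclidean f" shows "integrable \<mu> f"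
proof -
  interpret prob_space \<mu> by (rule prob_\<mu>)
  obtain B where "\<forall>s\<in>M. norm (f s) \<le> B" using cont_bounded[OF assms] by blast
  then show ?thesis
    using borel_measurable_cont[OF assms space_\<mu> sets_\<mu>] space_\<mu> by (intro integrable_const_bound[of _ B]) auto
qed

lemma integral_act:
  fixes f :: "'a \<Rightarrow> 'b::euclidean_space"
  assumes f: "continuous_map mtopology euclidean f"
  shows "(\<integral>s. f (act x s) \<partial>\<mu>) = (\<integral>s. f s \<partial>\<mu>)"
proof -
  have "continuous_map mtopology mtopology (act x)"
    by (rule continuous_map_sequentially) (rule act_limit[OF _ tendsto_const])
  then have op: "openin mtopology {s \<in> M. act x s \<in> U}" if "openin mtopology U" for U
    using openin_continuous_map_preimage[OF _ that] by fastforce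
  have "act x \<in> measurable \<mu> \<mu>"
  proof (rule measurable_sigma_sets[OF sets_\<mu>])
    fix U assume "U \<in> {U. openin mtopology U}"
    then have "{s \<in> M. act x s \<in> U} \<in> sigma_sets M {U. openin mtopology U}" using op by (auto intro: sigma_sets.Basic)
    then show "act x -` U \<inter> space \<mu> \<in> sets \<mu>" unfolding space_\<mu> sets_\<mu> by (simp add: vimage_def Int_def conj_commute)
  next
    show "{U. openin mtopology U} \<subseteq> Pow M" by (rule opens_Pow)
    show "act x \<in> space \<mu> \<rightarrow> M" using act_mem by (auto simp: space_\<mu>)
  qed
  note meas = this
  have "distr \<mu> \<mu> (act x) = \<mu>"
  proof (rule measure_eqI)
    fix E assume "E \<in> sets (distr \<mu> \<mu> (act x))"
    then have E: "E \<in> sets \<mu>" by simp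
    then have EM: "E \<subseteq> M" using sets.sets_into_space space_\<mu> by blast
    have "act x -` E \<inter> M = act (- x) ` E"
    proof (intro set_eqI iffI)
      fix s assume s: "s \<in> act x -` E \<inter> M"
      then have "s = act (- x) (act x s)" using act_cancel(2) by auto
      then show "s \<in> act (- x) ` E" using s by blast
    next
      fix s assume "s \<in> act (- x) ` E"
      then show "s \<in> act x -` E \<inter> M" using EM act_mem act_cancel(1) by auto
    qed
    then have "emeasure (distr \<mu> \<mu> (act x)) E = emeasure \<mu> (act (- x) ` E)"
      using E meas space_\<mu> by (simp add: emeasure_distr)
    also have "\<dots> = emeasure \<mu> E" using inv E unfolding invariant_measure_def by blast
    finally show "emeasure (distr \<mu> \<mu> (act x)) E = emeasure \<mu> E" .
  qed simp
  then show ?thesis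
    using integral_distr[OF meas borel_measurable_cont[OF f space_\<mu> sets_\<mu>]] by simp
qed

text \<open>
  The mean of the derivative is the mean of the cocycle: both are limits of the means of
  difference quotients.
\<close>

lemma integral_coeff_matrix:
  "(\<integral>s. coeff_matrix s *v v \<partial>\<mu>) = (\<integral>s. \<alpha> s v \<partial>\<mu>)"
proof -
  let ?L = "\<lambda>v. \<integral>s. \<alpha> s v \<partial>\<mu>"
  interpret prob_space \<mu> by (rule prob_\<mu>)
  have L_add: "?L (x + y) = ?L x + ?L y" for x y
  proof -
    have "?L (x + y) = (\<integral>s. \<alpha> s x + \<alpha> (act x s) y \<partial>\<mu>)"
      using cocycle space_\<mu> by (intro Bochner_Integration.integral_cong) auto
    also have "\<dots> = ?L x + (\<integral>s. \<alpha> (act x s) y \<partial>\<mu>)"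
      by (intro Bochner_Integration.integral_add cont_integrable cocycle_cont cont_act[OF cocycle_cont])
    finally show ?thesis using integral_act[OF cocycle_cont] by simp
  qed
  have L_mult: "?L (real n *\<^sub>R x) = real n *\<^sub>R ?L x" for n x
  proof (induction n)
    case 0
    have "?L 0 = (\<integral>s. 0 \<partial>\<mu>)" using cocycle_0 space_\<mu> by (intro Bochner_Integration.integral_cong) auto
    then show ?case by simp
  next
    case (Suc n) then show ?case using L_add[of x "real n *\<^sub>R x"] by (simp add: algebra_simps)
  qed
  have smooth_mean: "(\<integral>s. smoothed s x \<partial>\<mu>) = ?L x" for x
  proof -
    have "(\<integral>s. smoothed s x \<partial>\<mu>) = ?L x + (\<integral>s. smear (\<lambda>_. 0) (act x s) \<partial>\<mu>) - (\<integral>s. smear (\<lambda>_. 0) s \<partial>\<mu>)"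
      unfolding smoothed_def
      by (simp add: cont_integrable cocycle_cont cont_act smear_cont)
    then show ?thesis using integral_act[OF smear_cont] by simp
  qed
  have cm: "continuous_map mtopology euclidean (\<lambda>s. coeff_matrix s *v w)" for w
  proof (rule contI, rule vec_tendstoI)
    fix \<sigma> l i assume "limitin mtopology \<sigma> l sequentially"
    then show "(\<lambda>n. (coeff_matrix (\<sigma> n) *v w) $ i) \<longlonglongrightarrow> (coeff_matrix l *v w) $ i"
      unfolding matrix_vector_mult_def coeff_matrix_def by (simp, intro tendsto_intros cont_limit[OF smear_cont])
  qed
  have smooth_cont: "continuous_map mtopology euclidean (\<lambda>s. smoothed s x)" for x
    unfolding smoothed_def by (intro continuous_map_diff continuous_map_add cocycle_cont cont_act smear_cont)
  obtain B where B: "\<And>s. s \<in> M \<Longrightarrow> norm (coeff_matrix s *v v) \<le> B"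
    using cont_bounded[OF cm[of v]] by blast
  \<comment> \<open>difference quotients at zero, bounded by the derivative; each of them has mean \<open>?L v\<close>, since
    coboundaries have mean zero and the mean of \<open>\<alpha>\<close> is additive\<close>
  define q where "q = (\<lambda>n s. real (Suc n) *\<^sub>R smoothed s (v /\<^sub>R real (Suc n)))"
  have bound: "norm (q n s) \<le> B" if s: "s \<in> M" for n s
  proof -
    have d: "((\<lambda>t. smoothed s (t *\<^sub>R v)) has_derivative (\<lambda>h. coeff_matrix (act (t *\<^sub>R v) s) *v (h *\<^sub>R v))) (at t within UNIV)" for t
      by (rule has_derivative_compose[OF _ smoothed_has_derivative[OF s]]) (auto intro!: derivative_eq_intros)
    have le: "norm (smoothed s (inverse (real (Suc n)) *\<^sub>R v) - smoothed s (0 *\<^sub>R v)) \<le> B * norm (inverse (real (Suc n)) - 0)"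
      by (rule differentiable_bound[OF convex_UNIV d])
         (auto intro!: onorm_le simp: matrix_vector_mult_scaleR mult.commute[of B] mult_left_mono B act_mem[OF s])
    have "smoothed s 0 = 0" using s by (simp add: smoothed_def cocycle_0 act_0)
    then have "norm (smoothed s (v /\<^sub>R real (Suc n))) \<le> B * inverse (real (Suc n))" using le by simp
    then show ?thesis unfolding q_def by (simp add: field_simps del: of_nat_Suc)
  qed
  have lim: "(\<lambda>n. q n s) \<longlonglongrightarrow> coeff_matrix s *v v" if s: "s \<in> M" for s
  proof -
    let ?w = "coeff_matrix s *v v"
    have "((\<lambda>t::real. t *\<^sub>R v) has_derivative (\<lambda>h. h *\<^sub>R v)) (at 0)" by (auto intro!: derivative_eq_intros)
    from has_derivative_compose[OF this smoothed_has_derivative[OF s]]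
    have "((\<lambda>t. smoothed s (t *\<^sub>R v)) has_derivative (\<lambda>h. h *\<^sub>R ?w)) (at 0)"
      using s by (simp add: act_0 matrix_vector_mult_scaleR)
    then have "((\<lambda>h. norm (smoothed s (h *\<^sub>R v) - h *\<^sub>R ?w) / norm h) \<longlongrightarrow> 0) (at 0)"
      using s by (simp add: has_derivative_at smoothed_def cocycle_0 act_0)
    moreover have "filterlim (\<lambda>n. inverse (real (Suc n))) (at 0) sequentially"
      using LIMSEQ_inverse_real_of_nat by (auto simp: filterlim_at)
    ultimately have "(\<lambda>n. norm (smoothed s (inverse (real (Suc n)) *\<^sub>R v) - inverse (real (Suc n)) *\<^sub>R ?w) / norm (inverse (real (Suc n)))) \<longlonglongrightarrow> 0"
      by (rule filterlim_compose)
    moreover have "norm (smoothed s (inverse (real (Suc n)) *\<^sub>R v) - inverse (real (Suc n)) *\<^sub>R ?w) / norm (inverse (real (Suc n)))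
        = norm (q n s - ?w)" for n
    proof -
      have "q n s - ?w = real (Suc n) *\<^sub>R (smoothed s (inverse (real (Suc n)) *\<^sub>R v) - inverse (real (Suc n)) *\<^sub>R ?w)"
        unfolding q_def by (simp add: scaleR_diff_right del: of_nat_Suc)
      then show ?thesis by (simp add: divide_inverse mult.commute del: of_nat_Suc)
    qed
    ultimately have "(\<lambda>n. norm (q n s - ?w)) \<longlonglongrightarrow> 0" by simp
    then show ?thesis by (simp add: LIM_zero_iff tendsto_norm_zero_iff)
  qed
  have "(\<lambda>n. \<integral>s. q n s \<partial>\<mu>) \<longlonglongrightarrow> (\<integral>s. coeff_matrix s *v v \<partial>\<mu>)"
  proof (rule integral_dominated_convergence[where w = "\<lambda>_. B"])
    show "(\<lambda>s. coeff_matrix s *v v) \<in> borel_measurable \<mu>" by (rule borel_measurable_cont[OF cm space_\<mu> sets_\<mu>])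
    show "q n \<in> borel_measurable \<mu>" for n
      unfolding q_def using borel_measurable_cont[OF smooth_cont space_\<mu> sets_\<mu>] by measurable
  qed (use lim bound space_\<mu> in \<open>auto intro!: AE_I2\<close>)
  moreover have "(\<integral>s. q n s \<partial>\<mu>) = ?L v" for n
    using L_mult[of "Suc n" "v /\<^sub>R real (Suc n)"] unfolding q_def by (simp add: smooth_mean)
  ultimately have "(\<lambda>n::nat. ?L v) \<longlonglongrightarrow> (\<integral>s. coeff_matrix s *v v \<partial>\<mu>)" by simp
  then show ?thesis by (simp add: LIMSEQ_const_iff)
qed

end

text \<open>
  The derivative of the smoothed cocycle is a continuous function on a uniquely ergodic space, so
  suitable finite averages of its translates are uniformly close to its mean.
\<close>

theorem deformation_exists:
  assumes inv: "invariant_measure \<mu>" and uniq: "\<And>\<nu>. invariant_measure \<nu> \<Longrightarrow> \<nu> = \<mu>"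
    and det: "det (matrix (\<lambda>v. \<integral>s. \<alpha> s v \<partial>\<mu>)) \<noteq> 0"
  shows "\<exists>f W c C V. continuous_map mtopology euclidean f \<and>
    flow_deformation M d act (\<lambda>s x. \<alpha> s x + f (act x s) - f s) W c C \<and>
    (\<forall>s\<in>M. \<forall>t\<in>M. (\<forall>v. norm v \<le> V \<longrightarrow> \<alpha> s v = \<alpha> t v) \<longrightarrow> f s = f t \<and> W s = W t)"
proof -
  let ?mean = "\<lambda>v. \<integral>s. \<alpha> s v \<partial>\<mu>"
  define L where "L = matrix ?mean"
  have "inj ((*v) L)" using det unfolding L_def[symmetric]
    by (metis invertible_det_nz invertible_left_inverse matrix_left_invertible_injective)
  then obtain b where b: "b > 0" "\<And>v. b * norm v \<le> norm (L *v v)"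
    using linear_inj_bounded_below_pos[OF matrix_vector_mul_linear[of L]] by blast
  define e where "e = b / (2 * real CARD('n) * real CARD('n))"
  have e: "e > 0" "real CARD('n) * (real CARD('n) * e) = b / 2" unfolding e_def using b(1) by (auto simp: field_simps)
  define entries where "entries = (\<lambda>(i, j) s. coeff_matrix s $ i $ j)"
  have ce: "cont (entries p)" for p
    unfolding entries_def coeff_matrix_def by (cases p) (simp add: smear_component_cont)
  have "\<exists>xs. xs \<noteq> [] \<and> (\<forall>g\<in>range entries. \<forall>s\<in>M. \<bar>avg xs g s - (\<integral>s. g s \<partial>\<mu>)\<bar> \<le> e)"
    by (rule simultaneous_averages[OF inv uniq _ _ e(1)]) (use ce in auto)
  then obtain xs where xs: "xs \<noteq> []"
    and near: "\<And>i j s. s \<in> M \<Longrightarrow> \<bar>avg xs (\<lambda>s. coeff_matrix s $ i $ j) s - (\<integral>s. coeff_matrix s $ i $ j \<partial>\<mu>)\<bar> \<le> e"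
    unfolding entries_def by force
  have mean: "(\<integral>s. coeff_matrix s $ i $ j \<partial>\<mu>) = L $ i $ j" for i j
  proof -
    have cm: "continuous_map mtopology euclidean (\<lambda>s. coeff_matrix s *v axis j 1)"
    proof (rule contI, rule vec_tendstoI)
      fix \<sigma> l i assume "limitin mtopology \<sigma> l sequentially"
      then show "(\<lambda>n. (coeff_matrix (\<sigma> n) *v axis j 1) $ i) \<longlonglongrightarrow> (coeff_matrix l *v axis j 1) $ i"
        unfolding matrix_vector_mult_def coeff_matrix_def by (simp, intro tendsto_intros cont_limit[OF smear_cont])
    qed
    have "(coeff_matrix s *v axis j 1) $ i = coeff_matrix s $ i $ j" for s
      by (simp add: matrix_vector_mul_component inner_axis)
    then have "(\<integral>s. coeff_matrix s $ i $ j \<partial>\<mu>) = (\<integral>s. coeff_matrix s *v axis j 1 \<partial>\<mu>) $ i"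
      using integral_bounded_linear[OF bounded_linear_vec_nth[of i] cont_integrable[OF inv cm]] by simp
    then show ?thesis unfolding integral_coeff_matrix[OF inv] L_def matrix_def by simp
  qed
  define \<gamma> where "\<gamma> = (\<lambda>s x. \<alpha> s x + shift_mean xs (act x s) - shift_mean xs s)"
  interpret G: flow_cocycle M d act \<gamma>
    unfolding \<gamma>_def by (rule flow_cocycle_coboundary[OF shift_mean_cont])
  \<comment> \<open>smoothing commutes with averaging, so the derivative of the averaged cocycle is the average of
    the derivative\<close>
  have smear_avg: "G.smear k s $ i = avg xs (\<lambda>s. smear k s $ i) s" if s: "s \<in> M" for k s i
  proof -
    have ys: "((\<lambda>u. mollifier k (- u) * (\<Sum>y\<leftarrow>ys. \<alpha> (act y s) u $ i)) has_integral
        (\<Sum>y\<leftarrow>ys. smear k (act y s) $ i)) (cbox (- ones) ones)" for ys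
    proof (induction ys)
      case (Cons y ys)
      have "((\<lambda>u. mollifier k (- u) * \<alpha> (act y s) u $ i) has_integral smear k (act y s) $ i) (cbox (- ones) ones)"
        using smear_integrable[OF act_mem[OF s]] unfolding smear_def by (simp add: integrable_integral)
      from has_integral_add[OF this Cons] show ?case by (simp add: algebra_simps)
    qed simp
    have comp: "(\<Sum>y\<leftarrow>ys. \<alpha> (act y s) u) $ i = (\<Sum>y\<leftarrow>ys. \<alpha> (act y s) u $ i)" for u ys
      by (induction ys) auto
    have "G.smear k s $ i = integral (cbox (- ones) ones) (\<lambda>u. (mollifier k (- u) * (\<Sum>y\<leftarrow>xs. \<alpha> (act y s) u $ i)) / real (length xs))"
      using avg_cocycle_eq[OF xs s] unfolding G.smear_def by (simp add: \<gamma>_def comp divide_inverse mult_ac)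
    also have "\<dots> = (\<Sum>y\<leftarrow>xs. smear k (act y s) $ i) / real (length xs)"
      by (rule integral_unique[OF has_integral_divide[OF ys]])
    finally show ?thesis unfolding avg_def by (simp add: divide_inverse mult.commute)
  qed
  have Wnear: "norm ((G.coeff_matrix s - L) *v v) \<le> b / 2 * norm v" if s: "s \<in> M" for s v
  proof -
    have "\<bar>(G.coeff_matrix s - L) $ i $ j\<bar> \<le> e" for i j
      using near[OF s, of i j] mean[of i j] smear_avg[OF s, of "bump_index j (\<lambda>_. 0)" i]
      by (simp add: G.coeff_matrix_def coeff_matrix_def)
    from norm_matrix_vector_mult_le[OF this] e show ?thesis by simp
  qed
  define f where "f = (\<lambda>s. shift_mean xs s + G.smear (\<lambda>_. 0) s)"
  have f: "continuous_map mtopology euclidean f"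
    unfolding f_def by (intro continuous_map_add shift_mean_cont G.smear_cont)
  have eq: "(\<lambda>s x. \<alpha> s x + f (act x s) - f s) = G.smoothed"
    by (intro ext) (simp add: f_def G.smoothed_def \<gamma>_def[THEN fun_cong, THEN fun_cong])
  interpret F: flow_cocycle M d act G.smoothed
    unfolding eq[symmetric] by (rule flow_cocycle_coboundary[OF f])
  note bl = near_linear_bi_lipschitz[OF b G.smoothed_has_derivative Wnear[OF act_mem]]
  have "flow_deformation M d act G.smoothed G.coeff_matrix (b / 2) (onorm (\<lambda>v. L *v v) + b / 2)"
    by unfold_locales
       (use b(1) bl G.coeff_matrix_smooth G.coeff_matrix_closed G.coeff_matrix_primitive G.coeff_matrix_partial_derivs in auto)
  \<comment> \<open>only displacements within the support of the mollifier about the points of \<open>xs\<close> enter \<open>f\<close> and \<open>W\<close>\<close>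
  moreover have "f s = f t \<and> G.coeff_matrix s = G.coeff_matrix t"
    if st: "s \<in> M" "t \<in> M" and ag: "\<forall>v. norm v \<le> Max (insert 0 (norm ` set xs)) + real CARD('n) \<longrightarrow> \<alpha> s v = \<alpha> t v" for s t
  proof -
    have big: "norm y \<le> Max (insert 0 (norm ` set xs))" if "y \<in> set xs" for y using that by (intro Max_ge) auto
    have "\<alpha> s y = \<alpha> t y" if "y \<in> set xs" for y using ag big[OF that] by (simp add: add_increasing2)
    then have sm: "shift_mean xs s = shift_mean xs t" unfolding shift_mean_def by (simp cong: map_cong)
    have "\<gamma> s u = \<gamma> t u" if u: "u \<in> cbox (- ones) ones" for u
    proof -
      have "\<alpha> (act y s) u = \<alpha> (act y t) u" if y: "y \<in> set xs" for y
      proof -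
        have "norm (y + u) \<le> Max (insert 0 (norm ` set xs)) + real CARD('n)"
          using norm_triangle_ineq[of y u] big[OF y] cube_norm_le[OF u] by linarith
        moreover have "norm y \<le> Max (insert 0 (norm ` set xs)) + real CARD('n)"
          using big[OF y] by (simp add: add_increasing2)
        ultimately show ?thesis using cocycle_diff[OF st(1), of y u] cocycle_diff[OF st(2), of y u] ag by metis
      qed
      then show ?thesis unfolding \<gamma>_def avg_cocycle_eq[OF xs st(1)] avg_cocycle_eq[OF xs st(2)] by (simp cong: map_cong)
    qed
    then have "G.smear k s = G.smear k t" for k
      unfolding G.smear_def by (auto simp: vec_eq_iff intro!: Henstock_Kurzweil_Integration.integral_cong)
    then show ?thesis using sm unfolding f_def G.coeff_matrix_def by simp
  qed
  ultimately show ?thesis using f unfolding eq[symmetric] by blast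
qed

end

section \<open>Continuity of the orbit cocycle\<close>

context pattern_space
begin

sublocale flow: compact_flow \<Omega> "pattern_dist m" shift
proof
  show "compact_space metric.mtopology" using compact_\<Omega> topology_eq by simp
qed (rule shift_closed shift_0 shift_add limitin_shift; assumption)+

lemma close_trans_\<Omega>:
  "S \<in> \<Omega> \<Longrightarrow> T \<in> \<Omega> \<Longrightarrow> V \<in> \<Omega> \<Longrightarrow> close m a S T \<Longrightarrow> close m b T V \<Longrightarrow> 0 < a \<Longrightarrow> 0 < b \<Longrightarrow> a + b \<le> 1
    \<Longrightarrow> close m (a + b) S V"
  by (rule close_trans[OF locally_finite locally_finite locally_finite])

lemma limitin_close: "limitin metric.mtopology \<sigma> l F \<Longrightarrow> 0 < e \<Longrightarrow> \<forall>\<^sub>F n in F. \<sigma> n \<in> \<Omega> \<and> close m e (\<sigma> n) l"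
  unfolding limitin_iff by blast

lemma close_both_limits:
  assumes "limitin metric.mtopology \<sigma> l F" "limitin metric.mtopology \<tau> l F" "0 < e" "e \<le> 1"
  shows "\<forall>\<^sub>F n in F. close m e (\<sigma> n) (\<tau> n)"
proof -
  have "0 < e / 2" using assms by simp
  from limitin_close[OF assms(1) this] limitin_close[OF assms(2) this] show ?thesis
  proof eventually_elim
    case (elim n)
    have "l \<in> \<Omega>" using assms(1) unfolding limitin_iff by blast
    then have "close m (e / 2 + e / 2) (\<sigma> n) (\<tau> n)"
      using elim assms by (intro close_trans_\<Omega>[where T = l] close_sym[of m "e/2" "\<tau> n"]) auto
    then show ?case by simp
  qed
qed

end

lemma aperiodic_shift_inject:
  assumes "aperiodic \<Omega>" "X \<in> \<Omega>" "shift v X = shift w X" shows "v = w"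
proof -
  have "shift (- w) (shift v X) = shift (- w) (shift w X)" using assms(3) by simp
  then have "shift (v - w) X = X" by (simp add: shift_add)
  then have "v - w = 0" by (rule assms(1)[unfolded aperiodic_def, rule_format, OF assms(2)])
  then show ?thesis by simp
qed

lemma bounded_tendsto_if_subsequential_limits:
  fixes f :: "nat \<Rightarrow> 'a::heine_borel"
  assumes "bounded (range f)" and "\<And>r w. strict_mono r \<Longrightarrow> (f \<circ> r) \<longlonglongrightarrow> w \<Longrightarrow> w = L"
  shows "f \<longlonglongrightarrow> L"
proof (rule ccontr)
  assume "\<not> f \<longlonglongrightarrow> L"
  then obtain e where e: "e > 0" "\<And>N. \<exists>n\<ge>N. \<not> dist (f n) L < e"
    unfolding lim_sequentially by blast
  then have inf: "\<exists>\<^sub>F n in sequentially. \<not> dist (f n) L < e" unfolding frequently_sequentially by blast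
  obtain r :: "nat \<Rightarrow> nat" where r: "strict_mono r" "\<And>n. \<not> dist (f (r n)) L < e"
  proof -
    have "infinite {n. \<not> dist (f n) L < e}" using inf by (simp add: frequently_cofinite[symmetric] cofinite_eq_sequentially)
    then show thesis
      by (rule infinite_enumerate[THEN exE]) (use that in auto)
  qed
  have "bounded (range (f \<circ> r))" using assms(1) by (rule bounded_subset) auto
  then obtain w q where q: "strict_mono q" "((f \<circ> r) \<circ> q) \<longlonglongrightarrow> w"
    using bounded_imp_convergent_subsequence by blast
  then have "w = L" using assms(2)[of "r \<circ> q" w] strict_mono_o[OF r(1) q(1)] by (simp add: o_assoc)
  then have "\<forall>\<^sub>F n in sequentially. dist (f (r (q n))) L < e" using q(2) e(1) by (auto simp: o_def dest: tendstoD)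
  then show False using r(2) by (auto simp: eventually_sequentially)
qed

locale orbit_map = S: pattern_space m \<Omega> c \<kappa> D + T: pattern_space m' \<Omega>' c' \<kappa>' D'
  for m :: "'l metric" and \<Omega> :: "('n::finite, 'l) pattern set" and c \<kappa> D
    and m' :: "'k metric" and \<Omega>' :: "('n, 'k) pattern set" and c' \<kappa>' D' +
  fixes h :: "('n, 'l) pattern \<Rightarrow> ('n, 'k) pattern"
  assumes h_cont: "tiling_map m \<Omega> m' \<Omega>' h"
    and h_orbit: "orbit_preserving \<Omega> h"
    and aper: "aperiodic \<Omega>'"
begin

lemma h_limit: "limitin S.metric.mtopology \<sigma> l F \<Longrightarrow> limitin T.metric.mtopology (\<lambda>n. h (\<sigma> n)) (h l) F"
  using continuous_map_limit[OF h_cont[unfolded tiling_map_def], of \<sigma> l F]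
  by (simp add: S.topology_eq T.topology_eq o_def)

lemma h_mem: "X \<in> \<Omega> \<Longrightarrow> h X \<in> \<Omega>'"
  using continuous_map_image_subset_topspace[OF h_cont[unfolded tiling_map_def]] by auto

abbreviation \<alpha> where "\<alpha> \<equiv> orbit_cocycle h"

lemma h_shift: 
  assumes "X \<in> \<Omega>" shows "h (shift v X) = shift (\<alpha> X v) (h X)"
proof -
  have "h (shift v X) \<in> orbit (h X)" using h_orbit assms unfolding orbit_preserving_def orbit_def by blast
  then obtain w where w: "h (shift v X) = shift w (h X)" unfolding orbit_def by blast
  then show ?thesis unfolding orbit_cocycle_def
    by (rule theI[where P = "\<lambda>w. h (shift v X) = shift w (h X)"])
       (use w aperiodic_shift_inject[OF aper h_mem[OF assms]] in metis)
qed

lemma \<alpha>_cocycle: "X \<in> \<Omega> \<Longrightarrow> \<alpha> X (x + y) = \<alpha> X x + \<alpha> (shift x X) y"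
proof (rule aperiodic_shift_inject[OF aper h_mem[of X]])
  assume X: "X \<in> \<Omega>"
  have "shift (\<alpha> X (x + y)) (h X) = h (shift y (shift x X))" using h_shift[OF X] by (simp add: shift_add add.commute)
  also have "\<dots> = shift (\<alpha> (shift x X) y + \<alpha> X x) (h X)"
    using h_shift[OF S.shift_closed[OF X]] h_shift[OF X] by (simp add: shift_add)
  finally show "shift (\<alpha> X (x + y)) (h X) = shift (\<alpha> X x + \<alpha> (shift x X) y) (h X)" by (simp add: add.commute)
qed

lemma \<alpha>_0: "X \<in> \<Omega> \<Longrightarrow> \<alpha> X 0 = 0"
  using \<alpha>_cocycle[of X 0 0] by simp

text \<open>
  Any cluster point of the displacements translates \<open>h l\<close> to \<open>h (shift a l)\<close> by continuity of \<open>h\<close>, and by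
  aperiodicity only one vector does.
\<close>

lemma \<alpha>_limit_if_bounded:
  assumes lim: "limitin S.metric.mtopology \<sigma> l sequentially" "z \<longlonglongrightarrow> a" and \<sigma>: "\<And>n. \<sigma> n \<in> \<Omega>"
    and bd: "bounded (range (\<lambda>n. \<alpha> (\<sigma> n) (z n)))"
  shows "(\<lambda>n. \<alpha> (\<sigma> n) (z n)) \<longlonglongrightarrow> \<alpha> l a"
proof (rule bounded_tendsto_if_subsequential_limits[OF bd])
  fix r w assume r: "strict_mono r" and w: "((\<lambda>n. \<alpha> (\<sigma> n) (z n)) \<circ> r) \<longlonglongrightarrow> w"
  have l: "l \<in> \<Omega>" using lim(1) S.limitin_iff by blast
  have s: "limitin S.metric.mtopology (\<sigma> \<circ> r) l sequentially" by (rule limitin_subsequence[OF r lim(1)])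
  have z: "(z \<circ> r) \<longlonglongrightarrow> a" by (rule LIMSEQ_subseq_LIMSEQ[OF lim(2) r])
  have "limitin T.metric.mtopology (\<lambda>n. h (shift ((z \<circ> r) n) ((\<sigma> \<circ> r) n))) (h (shift a l)) sequentially"
    by (rule h_limit[OF S.limitin_shift[OF s z]])
  moreover have "limitin T.metric.mtopology (\<lambda>n. shift (((\<lambda>n. \<alpha> (\<sigma> n) (z n)) \<circ> r) n) (h ((\<sigma> \<circ> r) n))) (shift w (h l)) sequentially"
    by (rule T.limitin_shift[OF h_limit[OF s] w])
  ultimately have "h (shift a l) = shift w (h l)"
    using h_shift[OF \<sigma>] T.metric.limitin_metric_unique[of _ "h (shift a l)" sequentially "shift w (h l)"] by (simp add: o_def)
  then have "shift (\<alpha> l a) (h l) = shift w (h l)" using h_shift[OF l] by simp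
  then show "w = \<alpha> l a" using aperiodic_shift_inject[OF aper h_mem[OF l]] by metis
qed

lemma h_uniform:
  assumes e: "0 < e" "e \<le> 1"
  shows "\<exists>\<delta>>0. \<forall>X\<in>\<Omega>. \<forall>v. norm v < \<delta> \<longrightarrow> close m' e (h X) (h (shift v X))"
proof (rule ccontr)
  assume "\<not> ?thesis"
  then have "\<forall>n. \<exists>X v. X \<in> \<Omega> \<and> norm v < inverse (real (Suc n)) \<and> \<not> close m' e (h X) (h (shift v X))"
    by (metis inverse_positive_iff_positive of_nat_0_less_iff zero_less_Suc)
  then obtain X v where Xv: "\<And>n. X n \<in> \<Omega>" "\<And>n. norm (v n) < inverse (real (Suc n))"
    "\<And>n. \<not> close m' e (h (X n)) (h (shift (v n) (X n)))" by metis
  obtain l r where l: "l \<in> \<Omega>" "strict_mono r" "limitin S.metric.mtopology (X \<circ> r) l sequentially"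
    using S.flow.compact_subsequence[of X] Xv(1) by blast
  have "v \<longlonglongrightarrow> 0"
    by (rule Lim_null_comparison[OF always_eventually LIMSEQ_inverse_real_of_nat]) (use Xv(2) less_imp_le in blast)
  then have "(v \<circ> r) \<longlonglongrightarrow> 0" by (rule LIMSEQ_subseq_LIMSEQ[OF _ l(2)])
  from h_limit[OF S.limitin_shift[OF l(3) this]] h_limit[OF l(3)]
  have "\<forall>\<^sub>F n in sequentially. close m' e (h ((X \<circ> r) n)) (h (shift ((v \<circ> r) n) ((X \<circ> r) n)))"
    by (intro T.close_both_limits[OF _ _ e]) auto
  then show False using Xv(3) by (auto simp: eventually_sequentially)
qed

text \<open>
  Along a short segment the displacements \<open>\<alpha> X (t v)\<close> fall into countably many separated
  clusters, and each cluster is attained on a closed set of parameters.  By Sierpinski's theorem an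
  interval is not a countable disjoint union of two or more nonempty closed sets.
\<close>

lemma \<alpha>_small: "\<exists>\<delta>>0. \<forall>X\<in>\<Omega>. \<forall>v. norm v < \<delta> \<longrightarrow> norm (\<alpha> X v) < \<kappa>'"
proof -
  define e where "e = min (\<kappa>' / 4) (1 / (\<bar>D'\<bar> + 1))"
  have e: "0 < e" "e \<le> \<kappa>' / 4" "e \<le> 1" "e * (D' + 1) \<le> 1"
  proof -
    show "0 < e" "e \<le> \<kappa>' / 4" unfolding e_def using T.\<kappa>_pos by auto
    have "e \<le> 1 / (\<bar>D'\<bar> + 1)" unfolding e_def by simp
    then have "e * (\<bar>D'\<bar> + 1) \<le> 1" by (simp add: field_simps)
    moreover have "e * (D' + 1) \<le> e * (\<bar>D'\<bar> + 1)" "e * 1 \<le> e * (\<bar>D'\<bar> + 1)"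
      using \<open>0 < e\<close> by (intro mult_left_mono; simp)+
    ultimately show "e * (D' + 1) \<le> 1" "e \<le> 1" by linarith+
  qed
  obtain \<delta> where \<delta>: "\<delta> > 0" "\<And>X v. X \<in> \<Omega> \<Longrightarrow> norm v < \<delta> \<Longrightarrow> close m' e (h X) (h (shift v X))"
    using h_uniform[OF e(1,3)] by blast
  have "norm (\<alpha> X v) < \<kappa>'" if X: "X \<in> \<Omega>" and v: "norm v < \<delta>" for X v
  proof -
    \<comment> \<open>the differences of \<open>p\<close> are near periods of patterns in the image, so they are either small or large;
      being at small distance is therefore an equivalence relation\<close>
    define p where "p = (\<lambda>t::real. \<alpha> X (t *\<^sub>R v))"
    define rel where "rel = (\<lambda>t t'. norm (p t - p t') < \<kappa>' / 4)"
    have dich: "rel t t' \<or> 3 * \<kappa>' / 4 < norm (p t - p t')" if t: "t \<in> {0..1}" "t' \<in> {0..1}" for t t'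
    proof -
      have eq: "p t' - p t = \<alpha> (shift (t *\<^sub>R v) X) ((t' - t) *\<^sub>R v)"
        using \<alpha>_cocycle[OF X, of "t *\<^sub>R v" "(t' - t) *\<^sub>R v"] unfolding p_def by (simp add: scaleR_diff_left)
      have Y: "shift (t *\<^sub>R v) X \<in> \<Omega>" by (rule S.shift_closed[OF X])
      have "norm ((t' - t) *\<^sub>R v) \<le> norm v"
        using t mult_right_mono[of "\<bar>t' - t\<bar>" 1 "norm v"] by (auto simp: abs_le_iff)
      then have "close m' e (h (shift (t *\<^sub>R v) X)) (h (shift ((t' - t) *\<^sub>R v) (shift (t *\<^sub>R v) X)))"
        using v by (intro \<delta>(2)[OF Y]) simp
      then have cl: "close m' e (h (shift (t *\<^sub>R v) X)) (shift (p t' - p t) (h (shift (t *\<^sub>R v) X)))"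
        unfolding h_shift[OF Y, of "(t' - t) *\<^sub>R v"] eq .
      show ?thesis
      proof (rule disjCI)
        assume "\<not> 3 * \<kappa>' / 4 < norm (p t - p t')"
        then have "norm (p t' - p t) + e \<le> \<kappa>'" using e(2) by (simp add: norm_minus_commute)
        from T.near_period_small[OF h_mem[OF Y] cl e(1,4) this] show "rel t t'"
          using e(2) unfolding rel_def by (simp add: norm_minus_commute)
      qed
    qed
    have sym: "rel t t' \<Longrightarrow> rel t' t" for t t' unfolding rel_def by (simp add: norm_minus_commute)
    have trans: "rel t u" if "rel t t'" "rel t' u" "t \<in> {0..1}" "u \<in> {0..1}" for t t' u
      using dich[OF that(3,4)] that(1,2) norm_triangle_ineq[of "p t - p t'" "p t' - p u"] T.\<kappa>_pos unfolding rel_def by auto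
    have refl: "rel t t" for t unfolding rel_def using T.\<kappa>_pos by simp
    define cls where "cls = (\<lambda>t. {t' \<in> {0..1}. rel t t'})"
    have cls_eq: "cls t = cls t'" if "rel t t'" "t \<in> {0..1}" "t' \<in> {0..1}" for t t'
      unfolding cls_def using that trans sym by blast
    have "cls ` {0..1} = {{0..1}}"
    proof (rule real_Sierpinski_lemma)
      obtain Q :: "(real ^ 'n) set" where Q: "countable Q" "\<And>U. open U \<Longrightarrow> U \<noteq> {} \<Longrightarrow> \<exists>q\<in>Q. q \<in> U"
        using countable_dense_exists by blast
      \<comment> \<open>values in different classes keep a distance, so points of a countable dense set tell them apart\<close>
      define pick where "pick = (\<lambda>q. cls (SOME t. t \<in> {0..1} \<and> norm (p t - q) < \<kappa>' / 8))"
      have "cls ` {0..1} \<subseteq> pick ` Q"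
      proof
        fix E assume "E \<in> cls ` {0..1}"
        then obtain t where t: "t \<in> {0..1}" "E = cls t" by blast
        obtain q where q: "q \<in> Q" "q \<in> ball (p t) (\<kappa>' / 8)" using Q(2)[of "ball (p t) (\<kappa>' / 8)"] T.\<kappa>_pos by auto
        then have ex: "t \<in> {0..1} \<and> norm (p t - q) < \<kappa>' / 8" using t by (simp add: dist_norm)
        define t' where "t' = (SOME t. t \<in> {0..1} \<and> norm (p t - q) < \<kappa>' / 8)"
        have t': "t' \<in> {0..1} \<and> norm (p t' - q) < \<kappa>' / 8" unfolding t'_def by (rule someI[of _ t]) (rule ex)
        have "rel t t'" using ex t' norm_triangle_ineq4[of "p t - q" "p t' - q"] unfolding rel_def by simp
        then have "E = pick q" unfolding pick_def t'_def[symmetric] using cls_eq t t' by blast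
        then show "E \<in> pick ` Q" using q(1) by blast
      qed
      then show "countable (cls ` {0..1})" by (rule countable_subset[OF _ countable_image[OF Q(1)]])
      show "pairwise disjnt (cls ` {0..1})"
      proof (rule pairwiseI)
        fix A B assume AB: "A \<in> cls ` {0..1}" "B \<in> cls ` {0..1}" "A \<noteq> B"
        then obtain t u where tu: "t \<in> {0..1}" "u \<in> {0..1}" "A = cls t" "B = cls u" by blast
        show "disjnt A B"
        proof (rule ccontr)
          assume "\<not> disjnt A B"
          then obtain z where "z \<in> {0..1} \<and> rel t z \<and> rel u z" unfolding disjnt_iff tu cls_def by auto
          moreover from this have "rel t u" using trans[of t z u] sym[of u z] tu by simp
          ultimately show False using AB(3) tu cls_eq[of t u] by simp
        qed
      qed
      show "\<Union> (cls ` {0..1}) = {0..1}" using refl unfolding cls_def by blast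
      fix A assume "A \<in> cls ` {0..1}"
      then obtain t where t: "t \<in> {0..1}" "A = cls t" by blast
      \<comment> \<open>on one class the displacements are bounded, so \<open>p\<close> is continuous along sequences in it\<close>
      have "closed A"
        unfolding closed_sequential_limits
      proof (intro allI impI)
        fix x l assume x: "(\<forall>n. x n \<in> A) \<and> x \<longlonglongrightarrow> l"
        then have l: "l \<in> {0..1}" using closed_sequentially[of "{0..1}" x l] unfolding t cls_def by auto
        have "norm (p (x n)) \<le> norm (p t) + \<kappa>'" for n
          using x norm_triangle_ineq3[of "p (x n)" "p t"] T.\<kappa>_pos sym[of t "x n"] unfolding t cls_def rel_def by force
        then have "bounded (range (\<lambda>n. \<alpha> X (x n *\<^sub>R v)))" unfolding p_def bounded_iff by blast
        then have "(\<lambda>n. p (x n)) \<longlonglongrightarrow> p l"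
          unfolding p_def using X x by (intro \<alpha>_limit_if_bounded) (auto intro!: tendsto_intros)
        then have "(\<lambda>n. norm (p t - p (x n))) \<longlonglongrightarrow> norm (p t - p l)" by (intro tendsto_intros)
        moreover have "norm (p t - p (x n)) \<le> \<kappa>' / 4" for n using x unfolding t cls_def rel_def by (simp add: less_imp_le)
        ultimately have "norm (p t - p l) \<le> \<kappa>' / 4" by (meson LIMSEQ_le_const2)
        then have "rel t l" using dich[OF t(1) l] T.\<kappa>_pos by auto
        then show "l \<in> A" using l unfolding t cls_def by blast
      qed
      then show "closed A \<and> A \<noteq> {}" using t refl unfolding cls_def by blast
    qed simp
    then have "1 \<in> cls 0" by force
    then have "norm (p 0 - p 1) < \<kappa>' / 4" unfolding cls_def rel_def by simp
    then show ?thesis unfolding p_def using \<alpha>_0[OF X] T.\<kappa>_pos by simp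
  qed
  then show ?thesis using \<delta>(1) by blast
qed

text \<open>Cut the displacement into steps for which the previous lemma gives the bound \<open>\<kappa>'\<close>.\<close>

lemma \<alpha>_bounded: "\<exists>B. \<forall>X\<in>\<Omega>. \<forall>v. norm v \<le> V \<longrightarrow> norm (\<alpha> X v) \<le> B"
proof -
  obtain \<delta> where \<delta>: "\<delta> > 0" "\<And>X v. X \<in> \<Omega> \<Longrightarrow> norm v < \<delta> \<Longrightarrow> norm (\<alpha> X v) < \<kappa>'" using \<alpha>_small by blast
  obtain N :: nat where N: "\<bar>V\<bar> / \<delta> < real N" using reals_Archimedean2 by blast
  moreover have "0 \<le> \<bar>V\<bar> / \<delta>" using \<delta>(1) by simp
  ultimately have N0: "real N > 0" by linarith
  have steps: "norm (\<alpha> X (real k *\<^sub>R u)) \<le> real k * \<kappa>'" if X: "X \<in> \<Omega>" and u: "norm u < \<delta>" for X u k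
  proof (induction k)
    case 0 then show ?case using \<alpha>_0[OF X] by simp
  next
    case (Suc k)
    have "\<alpha> X (real (Suc k) *\<^sub>R u) = \<alpha> X (real k *\<^sub>R u) + \<alpha> (shift (real k *\<^sub>R u) X) u"
      using \<alpha>_cocycle[OF X, of "real k *\<^sub>R u" u] by (simp add: algebra_simps)
    then have "norm (\<alpha> X (real (Suc k) *\<^sub>R u)) \<le> norm (\<alpha> X (real k *\<^sub>R u)) + norm (\<alpha> (shift (real k *\<^sub>R u) X) u)"
      by (simp only: norm_triangle_ineq)
    also have "\<dots> \<le> real k * \<kappa>' + \<kappa>'"
      using Suc \<delta>(2)[OF S.shift_closed[OF X] u, of "real k *\<^sub>R u"] by simp
    finally show ?case by (simp add: algebra_simps)
  qed
  have "norm (\<alpha> X v) \<le> real N * \<kappa>'" if X: "X \<in> \<Omega>" and v: "norm v \<le> V" for X v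
  proof -
    have "norm v < \<delta> * real N" using N v \<delta>(1) by (simp add: field_simps)
    then have "norm (v /\<^sub>R real N) < \<delta>" using N0 by (simp add: field_simps)
    from steps[OF X this, of N] show ?thesis using N0 by simp
  qed
  then show ?thesis by blast
qed

sublocale cocycle: flow_cocycle \<Omega> "pattern_dist m" shift \<alpha>
proof
  show "\<alpha> X (x + y) = \<alpha> X x + \<alpha> (shift x X) y" if "X \<in> \<Omega>" for X x y by (rule \<alpha>_cocycle[OF that])
  fix \<sigma> l and z :: "nat \<Rightarrow> real ^ 'n" and a
  assume lim: "limitin S.metric.mtopology \<sigma> l sequentially" "z \<longlonglongrightarrow> a"
  obtain N where N: "\<And>n. n \<ge> N \<Longrightarrow> \<sigma> n \<in> \<Omega>"
    using S.limitin_close[OF lim(1), of 1] by (auto simp: eventually_sequentially)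
  obtain V where V: "\<And>n. norm (z n) \<le> V" using convergent_imp_Bseq[OF convergentI[OF lim(2)]] unfolding Bseq_def by blast
  obtain B where "\<And>X v. X \<in> \<Omega> \<Longrightarrow> norm v \<le> V \<Longrightarrow> norm (\<alpha> X v) \<le> B" using \<alpha>_bounded by blast
  then have "bounded (range (\<lambda>n. \<alpha> (\<sigma> (n + N)) (z (n + N))))" unfolding bounded_iff using N V by (intro exI[of _ B]) auto
  moreover have "limitin S.metric.mtopology (\<lambda>n. \<sigma> (n + N)) l sequentially"
    using limitin_subsequence[OF _ lim(1), of "\<lambda>n. n + N"] by (simp add: o_def strict_mono_def)
  ultimately have "(\<lambda>n. \<alpha> (\<sigma> (n + N)) (z (n + N))) \<longlonglongrightarrow> \<alpha> l a"
    using N lim(2) by (intro \<alpha>_limit_if_bounded LIMSEQ_ignore_initial_segment) auto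
  then show "(\<lambda>n. \<alpha> (\<sigma> n) (z n)) \<longlonglongrightarrow> \<alpha> l a" by (rule LIMSEQ_offset)
qed

end

section \<open>Finite local complexity\<close>

text \<open>The exact form of closeness that finite local complexity provides, with no displacement of tiles.\<close>

definition agree :: "real \<Rightarrow> ('n::finite, 'l) pattern \<Rightarrow> ('n, 'l) pattern \<Rightarrow> bool" where
  "agree R X Y \<longleftrightarrow> patch X 0 R = patch Y 0 R"

lemma agree_sym: "agree R X Y \<Longrightarrow> agree R Y X"
  and agree_trans: "agree R X Y \<Longrightarrow> agree R Y Z \<Longrightarrow> agree R X Z"
  and agree_refl [simp]: "agree R X X"
  unfolding agree_def by auto

lemma agree_shift: "agree R X Y \<Longrightarrow> norm x + r \<le> R \<Longrightarrow> agree r (shift x X) (shift x Y)"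
  unfolding agree_def by (rule patch_shift_eq_mono)

lemma agree_mono: "agree R X Y \<Longrightarrow> r \<le> R \<Longrightarrow> agree r X Y"
  using agree_shift[of R X Y 0 r] by simp

lemma agree_mem: "agree R X Y \<Longrightarrow> t \<in> X \<Longrightarrow> fst t \<inter> ball 0 R \<noteq> {} \<Longrightarrow> t \<in> Y"
  unfolding agree_def patch_def by blast

text \<open>
  An equivariant reference point of a compact set that is Lipschitz for the Hausdorff distance.  Once
  a pattern is recentred at such a point, only finitely many patches remain possible about the origin.
\<close>

definition corner :: "(real ^ 'n::finite) set \<Rightarrow> real ^ 'n" where
  "corner K = (\<chi> i. INF x\<in>K. x $ i)"

lemma corner_bdd: 
  fixes K :: "(real ^ 'n::finite) set"
  assumes "compact K" shows "bdd_below ((\<lambda>x. x $ i) ` K)"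
proof -
  obtain B where "\<forall>x\<in>K. norm x \<le> B" using compact_imp_bounded[OF assms] unfolding bounded_iff by blast
  then have "- B \<le> x $ i" if "x \<in> K" for x using component_le_norm_cart[of x i] that by force
  then show ?thesis by (intro bdd_belowI[of _ "- B"]) auto
qed

lemma corner_translate:
  fixes K :: "(real ^ 'n::finite) set"
  assumes "compact K" "K \<noteq> {}" shows "corner ((\<lambda>y. y - x) ` K) = corner K - x"
proof -
  have "(INF y\<in>K. y $ i - x $ i) = (INF y\<in>K. y $ i) - x $ i" for i
  proof (rule antisym)
    have bdd': "bdd_below ((\<lambda>y. y $ i - x $ i) ` K)"
      using corner_bdd[OF compact_translation_subtract[OF assms(1), of x], of i] by (simp add: image_image)
    then have "(INF y\<in>K. y $ i - x $ i) + x $ i \<le> y $ i" if "y \<in> K" for y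
      using cINF_lower[OF bdd' that] by simp
    then have "(INF y\<in>K. y $ i - x $ i) + x $ i \<le> (INF y\<in>K. y $ i)"
      using assms(2) by (intro cINF_greatest)
    then show "(INF y\<in>K. y $ i - x $ i) \<le> (INF y\<in>K. y $ i) - x $ i" by simp
    show "(INF y\<in>K. y $ i) - x $ i \<le> (INF y\<in>K. y $ i - x $ i)"
      using assms(2) cINF_lower[OF corner_bdd[OF assms(1)]] by (intro cINF_greatest) auto
  qed
  then show ?thesis unfolding corner_def by (simp add: image_image vec_eq_iff)
qed

lemma corner_lipschitz:
  fixes K L :: "(real ^ 'n::finite) set"
  assumes "compact K" "K \<noteq> {}" "compact L" "L \<noteq> {}"
  shows "norm (corner K - corner L) \<le> real CARD('n) * hausdorff_dist K L"
proof -
  have *: "corner L $ i \<le> corner K $ i + hausdorff_dist K L"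
    if KL: "compact K" "K \<noteq> {}" "compact L" "L \<noteq> {}" for K L :: "(real ^ 'n::finite) set" and i
  proof -
    have "corner L $ i - hausdorff_dist K L \<le> x $ i" if x: "x \<in> K" for x
    proof -
      obtain y where y: "y \<in> L" "dist x y \<le> hausdorff_dist K L" using hausdorff_dist_near_point[OF KL x] by blast
      have "corner L $ i \<le> y $ i" unfolding corner_def using cINF_lower[OF corner_bdd[OF KL(3)] y(1)] by simp
      moreover have "y $ i - x $ i \<le> dist x y" using component_le_norm_cart[of "x - y" i] by (simp add: dist_norm)
      ultimately show ?thesis using y(2) by linarith
    qed
    then have "corner L $ i - hausdorff_dist K L \<le> corner K $ i"
      unfolding corner_def[of K] using KL(2) by (simp add: cINF_greatest)
    then show ?thesis by simp
  qed
  have "norm (corner K - corner L) \<le> (\<Sum>i\<in>UNIV. \<bar>(corner K - corner L) $ i\<bar>)" by (rule norm_le_l1_cart)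
  also have "\<dots> \<le> (\<Sum>i\<in>(UNIV :: 'n set). hausdorff_dist K L)"
  proof (rule sum_mono)
    fix i show "\<bar>(corner K - corner L) $ i\<bar> \<le> hausdorff_dist K L"
      using *[OF assms, of i] *[OF assms(3,4,1,2), of i] by (simp add: hausdorff_dist_commute abs_le_iff)
  qed
  finally show ?thesis by simp
qed

context pattern_space
begin

abbreviation pin :: "('n, 'l) tile \<Rightarrow> real ^ 'n" where "pin t \<equiv> corner (fst t)"

definition pin_dist :: real where "pin_dist = real CARD('n) * (2 * \<bar>D\<bar>) + 1"

lemma pin_dist_pos: "0 < pin_dist"
  unfolding pin_dist_def by (intro add_nonneg_pos) auto

lemma pin_shift: "X \<in> \<Omega> \<Longrightarrow> t \<in> X \<Longrightarrow> pin (shift_tile x t) = pin t - x"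
  using tiles[of X t] corner_translate[of "fst t" x] unfolding fst_shift_tile by blast

lemma pin_near:
  assumes X: "X \<in> \<Omega>" and t: "t \<in> X" and x: "x \<in> fst t" shows "dist (pin t) x < pin_dist"
proof -
  have "\<bar>pin t $ i - x $ i\<bar> \<le> 2 * \<bar>D\<bar>" for i
  proof -
    have ct: "compact (fst t)" "fst t \<noteq> {}" using tiles[OF X t] by auto
    have le: "\<bar>x $ i - y $ i\<bar> \<le> 2 * \<bar>D\<bar>" if y: "y \<in> fst t" for y
    proof -
      have "\<bar>x $ i - y $ i\<bar> \<le> dist x y" using component_le_norm_cart[of "x - y" i] by (simp add: dist_norm)
      also have "\<dots> \<le> 2 * \<bar>D\<bar>"
        using dist_triangle2[of x y "c t"] tile_diam[OF X t x] tile_diam[OF X t y] by linarith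
      finally show ?thesis .
    qed
    have "pin t $ i \<le> x $ i" unfolding corner_def using cINF_lower[OF corner_bdd[OF ct(1)] x] by simp
    moreover have "x $ i - 2 * \<bar>D\<bar> \<le> y $ i" if "y \<in> fst t" for y using le[OF that] by linarith
    then have "x $ i - 2 * \<bar>D\<bar> \<le> pin t $ i" unfolding corner_def using ct(2) by (simp add: cINF_greatest)
    ultimately show ?thesis by linarith
  qed
  then have "(\<Sum>i\<in>UNIV. \<bar>(pin t - x) $ i\<bar>) \<le> (\<Sum>i\<in>(UNIV :: 'n set). 2 * \<bar>D\<bar>)" by (intro sum_mono) simp
  then show ?thesis using norm_le_l1_cart[of "pin t - x"] unfolding pin_dist_def by (simp add: dist_norm)
qed

lemma pin_meets: "X \<in> \<Omega> \<Longrightarrow> t \<in> X \<Longrightarrow> norm (pin t) + pin_dist \<le> R \<Longrightarrow> fst t \<inter> ball 0 R \<noteq> {}"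
proof -
  assume X: "X \<in> \<Omega>" "t \<in> X" and R: "norm (pin t) + pin_dist \<le> R"
  obtain x where x: "x \<in> fst t" using tiles[OF X] by blast
  have "norm x \<le> norm (pin t) + dist (pin t) x" using norm_triangle_sub[of x "pin t"] by (simp add: dist_norm norm_minus_commute)
  then have "x \<in> ball 0 R" using pin_near[OF X x] R by simp
  then show ?thesis using x by blast
qed

lemma pin_exists:
  assumes X: "X \<in> \<Omega>" shows "\<exists>t\<in>X. c t \<in> fst t \<and> norm (c t) \<le> D \<and> norm (pin t) < \<bar>D\<bar> + pin_dist"
proof -
  obtain t where t: "t \<in> X" "dist 0 (c t) \<le> D" using control_dense[OF X] by blast
  have c: "c t \<in> fst t" by (rule control_mem[OF X t(1)])
  have "norm (pin t) \<le> norm (c t) + dist (pin t) (c t)" using norm_triangle_sub[of "pin t" "c t"] by (simp add: dist_norm)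
  then show ?thesis using pin_near[OF X t(1) c] t c by (intro bexI[of _ t]) auto
qed

lemma agree_imp_close:
  assumes X: "X \<in> \<Omega>" "agree R X Y" "0 < e" "1 / e \<le> R" shows "close m e X Y"
proof -
  have sub: "patch X 0 R \<subseteq> Y" using X(2) patch_subset[of Y 0 R] unfolding agree_def by simp
  have "tile_close m e t t" if "t \<in> patch X 0 R" for t
    using tiles[OF X(1)] that X(3) Metric_space.mdist_zero[OF Metric_space_hausdorff, of "fst t"]
    unfolding tile_close_def patch_def by (auto simp: mdist_self)
  moreover have "patch X 0 (1/e) \<subseteq> patch X 0 R" "patch Y 0 (1/e) \<subseteq> patch X 0 R"
    using patch_mono[OF X(4), of X 0] patch_mono[OF X(4), of Y 0] X(2) unfolding agree_def by simp_all
  ultimately show ?thesis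
    unfolding close_iff using sub patch_subset[of X 0 R]
    by (intro exI[of _ "patch X 0 R"] exI[of _ "\<lambda>t. t"] conjI ballI) (simp_all add: bij_betw_def)
qed

text \<open>
  A patch may occur in many positions relative to the origin, but a reference point \<open>q t\<close> at the origin
  fixes the position up to the choice of the tile \<open>t\<close>.
\<close>

lemma finite_pinned_patches:
  assumes flc: "FLC \<Omega>"
    and q: "\<And>X t x. X \<in> \<Omega> \<Longrightarrow> t \<in> X \<Longrightarrow> q (shift_tile x t) = q t - x"
    and qR: "\<And>X t. X \<in> \<Omega> \<Longrightarrow> t \<in> X \<Longrightarrow> fst t \<inter> ball (q t) R \<noteq> {}"
  shows "finite {patch X 0 R | X. X \<in> \<Omega> \<and> (\<exists>t\<in>X. q t = 0)}"
proof -
  obtain F where F: "finite F" "\<And>T x. T \<in> \<Omega> \<Longrightarrow> \<exists>P\<in>F. \<exists>y. patch T x R = shift y P"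
    using flc unfolding FLC_def by meson
  define G where "G = (\<Union>P\<in>{P\<in>F. finite P}. (\<lambda>s. shift (q s) P) ` P)"
  have "finite G" unfolding G_def using F(1) by auto
  moreover have "{patch X 0 R | X. X \<in> \<Omega> \<and> (\<exists>t\<in>X. q t = 0)} \<subseteq> G"
  proof safe
    fix X a b assume X: "X \<in> \<Omega>" and t: "(a, b) \<in> X" "q (a, b) = 0"
    obtain P y where P: "P \<in> F" "patch X 0 R = shift y P" using F(2)[OF X] by blast
    have tp: "(a, b) \<in> patch X 0 R" using qR[OF X t(1)] t unfolding patch_def by simp
    define s where "s = shift_tile (- y) (a, b)"
    have s: "s \<in> P" using tp unfolding P(2) s_def by (simp add: mem_shift_iff)
    have qs: "q s = y" unfolding s_def using q[OF X t(1)] t(2) by simp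
    have "P = shift (- y) (patch X 0 R)" unfolding P(2) by (simp add: shift_add)
    then have "finite P" using finite_patch[OF X, of 0 R] unfolding shift_def by simp
    then show "patch X 0 R \<in> G" unfolding G_def P(2) using P(1) s qs by blast
  qed
  ultimately show ?thesis by (rule finite_subset[rotated])
qed

text \<open>
  Finitely many patches have a positive minimal distance; pinned patterns that are closer than this
  agree exactly.
\<close>

lemma pinned_agree:
  assumes flc: "FLC \<Omega>"
    and q: "\<And>X t x. X \<in> \<Omega> \<Longrightarrow> t \<in> X \<Longrightarrow> q (shift_tile x t) = q t - x"
    and qR: "\<And>X t. X \<in> \<Omega> \<Longrightarrow> t \<in> X \<Longrightarrow> fst t \<inter> ball (q t) \<rho> \<noteq> {}"
  shows "\<exists>e>0. \<forall>X\<in>\<Omega>. \<forall>Y\<in>\<Omega>. (\<exists>t\<in>X. q t = 0) \<longrightarrow> (\<exists>t\<in>Y. q t = 0) \<longrightarrow> close m e X Y \<longrightarrow> agree R X Y"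
proof -
  define R' where "R' = max (R + 1) \<rho>"
  have RR: "ball x \<rho> \<subseteq> ball x R'" for x :: "real ^ 'n" unfolding R'_def by (intro subset_ball) simp
  have meets: "fst t \<inter> ball (q t) R' \<noteq> {}" if "X \<in> \<Omega>" "t \<in> X" for X t using qR[OF that] RR by blast
  define Q where "Q = \<Union>{patch X 0 R' | X. X \<in> \<Omega> \<and> (\<exists>t\<in>X. q t = 0)}"
  have Q: "finite Q" unfolding Q_def
    using finite_pinned_patches[OF flc q meets] finite_patch by (intro finite_Union) auto
  have Qt: "compact (fst t) \<and> fst t \<noteq> {} \<and> snd t \<in> mspace m" if "t \<in> Q" for t
    using that tiles unfolding Q_def patch_def by blast
  \<comment> \<open>finitely many tiles occur near the origin in pinned patterns; \<open>e\<close> is smaller than the distance of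
    any two of them\<close>
  define dd where "dd = (\<lambda>p :: ('n, 'l) tile \<times> ('n, 'l) tile.
    max (hausdorff_dist (fst (fst p)) (fst (snd p))) (mdist m (snd (fst p)) (snd (snd p))))"
  define e where "e = Min ({1, 1 / (\<bar>R\<bar> + 1)} \<union> dd ` {p \<in> Q \<times> Q. fst p \<noteq> snd p})"
  have fin: "finite ({1, 1 / (\<bar>R\<bar> + 1)} \<union> dd ` {p \<in> Q \<times> Q. fst p \<noteq> snd p})" using Q by auto
  have pos: "0 < dd p" if p: "p \<in> Q \<times> Q" "fst p \<noteq> snd p" for p
  proof -
    obtain s t where st: "p = (s, t)" by (cases p)
    have "fst s \<noteq> fst t \<or> snd s \<noteq> snd t" using p st by (metis fst_conv prod_eqI snd_conv)
    moreover have "hausdorff_dist (fst s) (fst t) = 0 \<longleftrightarrow> fst s = fst t"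
      using Qt p st Metric_space.zero[OF Metric_space_hausdorff, of "fst s" "fst t"] by auto
    moreover have "mdist m (snd s) (snd t) = 0 \<longleftrightarrow> snd s = snd t"
      using Qt p st by auto
    ultimately have "hausdorff_dist (fst s) (fst t) \<noteq> 0 \<or> mdist m (snd s) (snd t) \<noteq> 0" by blast
    then show ?thesis
      unfolding dd_def st using hausdorff_dist_nonneg[of "fst s" "fst t"] mdist_nonneg[of m "snd s" "snd t"]
      by (simp only: fst_conv snd_conv) linarith
  qed
  have le: "e \<le> x" if "x \<in> {1, 1 / (\<bar>R\<bar> + 1)} \<union> dd ` {p \<in> Q \<times> Q. fst p \<noteq> snd p}" for x
    unfolding e_def by (rule Min_le[OF fin that])
  have e0: "0 < e" unfolding e_def using fin pos by (subst Min_gr_iff) auto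
  have e1: "e \<le> 1" "e \<le> 1 / (\<bar>R\<bar> + 1)" using le by blast+
  have "e * \<bar>R\<bar> + e \<le> 1" using e1(2) by (simp add: field_simps)
  moreover have "e * R \<le> e * \<bar>R\<bar>" using e0 by (intro mult_left_mono) auto
  ultimately have "e * R \<le> 1" using e0 by linarith
  then have Re: "R \<le> 1 / e" using e0 by (simp add: field_simps)
  have sub: "patch X 0 R \<subseteq> patch Y 0 R"
    if XY: "X \<in> \<Omega>" "Y \<in> \<Omega>" "\<exists>t\<in>X. q t = 0" "\<exists>t\<in>Y. q t = 0" "close m e X Y" for X Y
  proof
    fix t assume t: "t \<in> patch X 0 R"
    obtain S0 T0 f where *: "patch X 0 (1/e) \<subseteq> S0" "S0 \<subseteq> X" "T0 \<subseteq> Y" "bij_betw f S0 T0" "\<forall>t\<in>S0. tile_close m e t (f t)"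
      using XY(5) unfolding close_iff by blast
    have "t \<in> S0" using t *(1) patch_mono[OF Re] by blast
    then have ft: "f t \<in> Y" "tile_close m e t (f t)" "t \<in> X" using * bij_betwE[OF *(4)] by blast+
    have "fst (f t) \<inter> ball 0 (R + 1) \<noteq> {}"
      using tiles[OF XY(1) ft(3)] tiles[OF XY(2) ft(1)] ft(2) t e1 unfolding tile_close_def patch_def
      by (intro meets_ball_of_hausdorff_near[of "fst t" "fst (f t)" e _ R]) auto
    moreover have "ball 0 (R + 1) \<subseteq> ball (0 :: real ^ 'n) R'" "ball 0 R \<subseteq> ball (0 :: real ^ 'n) R'"
      unfolding R'_def by (auto intro!: subset_ball)
    ultimately have "f t \<in> patch Y 0 R'" "t \<in> patch X 0 R'" using ft(1) t unfolding patch_def by blast+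
    then have Qs: "t \<in> Q" "f t \<in> Q" unfolding Q_def using XY by blast+
    have "t = f t"
    proof (rule ccontr)
      assume "t \<noteq> f t"
      then have "(t, f t) \<in> {p \<in> Q \<times> Q. fst p \<noteq> snd p}" using Qs by simp
      then have "e \<le> dd (t, f t)" using le by blast
      then show False using ft(2) unfolding dd_def tile_close_def by (simp add: max_def split: if_splits)
    qed
    then show "t \<in> patch Y 0 R" using ft(1) t unfolding patch_def by auto
  qed
  have "agree R X Y" if XY: "X \<in> \<Omega>" "Y \<in> \<Omega>" "\<exists>t\<in>X. q t = 0" "\<exists>t\<in>Y. q t = 0" "close m e X Y" for X Y
    unfolding agree_def using sub[OF XY] sub[OF XY(2,1,4,3) close_sym[OF XY(5)]] by (rule subset_antisym)
  then show ?thesis using e0 by blast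
qed

lemma pin_properties:
  assumes "X \<in> \<Omega>" "t \<in> X" shows "fst t \<inter> ball (pin t) pin_dist \<noteq> {}"
proof -
  obtain x where "x \<in> fst t" using tiles[OF assms] by blast
  moreover from this have "x \<in> ball (pin t) pin_dist" using pin_near[OF assms] by simp
  ultimately show ?thesis by blast
qed

text \<open>
  Close patterns contain a pair of nearly equal tiles near the origin; recentred at the pins of these
  two tiles, the patterns agree exactly.
\<close>

lemma close_imp_translate_agree:
  assumes flc: "FLC \<Omega>" and \<eta>: "0 < \<eta>"
  shows "\<exists>e>0. \<forall>X\<in>\<Omega>. \<forall>Y\<in>\<Omega>. close m e X Y \<longrightarrow> (\<exists>w. norm w \<le> \<eta> \<and> agree \<rho> (shift w X) Y)"
proof -
  define K where "K = \<bar>D\<bar> + pin_dist + 1"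
  have K: "K > 0" unfolding K_def using pin_dist_pos by simp
  have "\<exists>e>0. \<forall>X\<in>\<Omega>. \<forall>Y\<in>\<Omega>. (\<exists>t\<in>X. pin t = 0) \<longrightarrow> (\<exists>t\<in>Y. pin t = 0) \<longrightarrow> close m e X Y \<longrightarrow> agree (\<bar>\<rho>\<bar> + K) X Y"
    by (rule pinned_agree[OF flc]) (rule pin_shift pin_properties; assumption)+
  then obtain e1 where e1: "e1 > 0"
    "\<And>X Y. X \<in> \<Omega> \<Longrightarrow> Y \<in> \<Omega> \<Longrightarrow> \<exists>t\<in>X. pin t = 0 \<Longrightarrow> \<exists>t\<in>Y. pin t = 0 \<Longrightarrow> close m e1 X Y \<Longrightarrow> agree (\<bar>\<rho>\<bar> + K) X Y"
    by meson
  \<comment> \<open>matched pins differ by at most \<open>n e\<close>; after pinning both patterns at the origin they are \<open>e1\<close>-close and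
    therefore agree\<close>
  define n where "n = real CARD('n)"
  have n: "n > 0" unfolding n_def by simp
  define e where "e = min (min (\<eta> / n) (1 / n)) (min (e1 / (n + 1)) (1 / (1/e1 + K)))"
  have e: "0 < e" "e \<le> \<eta> / n" "e \<le> 1 / n" "e \<le> e1 / (n + 1)" "e \<le> 1 / (1/e1 + K)"
    unfolding e_def using n \<eta> e1(1) K by (auto intro!: divide_pos_pos add_pos_pos)
  have e': "n * e \<le> \<eta>" "n * e \<le> 1" "e + n * e \<le> e1" "1/e1 + K \<le> 1/e"
  proof -
    show "n * e \<le> \<eta>" "n * e \<le> 1" "e + n * e \<le> e1" using e(2-4) n by (simp_all add: field_simps)
    have "0 < 1/e1 + K" using e1(1) K by (intro add_pos_pos) auto
    then show "1/e1 + K \<le> 1/e" using e(1,5) by (simp add: field_simps)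
  qed
  have "\<exists>w. norm w \<le> \<eta> \<and> agree \<rho> (shift w X) Y" if X: "X \<in> \<Omega>" and Y: "Y \<in> \<Omega>" and cl: "close m e X Y" for X Y
  proof -
    obtain S0 T0 f where *: "patch X 0 (1/e) \<subseteq> S0" "S0 \<subseteq> X" "T0 \<subseteq> Y" "bij_betw f S0 T0" "\<forall>t\<in>S0. tile_close m e t (f t)"
      using cl unfolding close_iff by blast
    obtain t where t: "t \<in> X" "c t \<in> fst t" "norm (c t) \<le> D" "norm (pin t) < \<bar>D\<bar> + pin_dist" using pin_exists[OF X] by blast
    have "D < 1 / e" using e'(4) e1(1) pin_dist_pos unfolding K_def by (smt (verit) divide_pos_pos)
    then have "t \<in> patch X 0 (1/e)" using t unfolding patch_def by auto
    then have ft: "f t \<in> Y" "tile_close m e t (f t)" using * bij_betwE[OF *(4)] by blast+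
    define w where "w = pin t - pin (f t)"
    have w: "norm w \<le> n * e"
      using corner_lipschitz[of "fst t" "fst (f t)"] tiles[OF X t(1)] tiles[OF Y ft(1)] ft(2) n
      unfolding w_def n_def tile_close_def by (smt (verit) mult_left_mono)
    have nf: "norm (pin (f t)) \<le> K" using norm_triangle_sub[of "pin (f t)" "pin t"] w e'(2) t(4)
      unfolding w_def K_def by (simp add: norm_minus_commute)
    have "close m e1 (shift (pin t) X) (shift (pin (f t)) Y)"
      by (rule close_shift[OF locally_finite[OF X] locally_finite[OF Y] cl, of _ K])
         (use t(4) nf w e' in \<open>auto simp: K_def w_def\<close>)
    moreover have "\<exists>s\<in>shift (pin t) X. pin s = 0"
      using pin_shift[OF X t(1), of "pin t"] t(1) by (intro bexI[of _ "shift_tile (pin t) t"]) auto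
    moreover have "\<exists>s\<in>shift (pin (f t)) Y. pin s = 0"
      using pin_shift[OF Y ft(1), of "pin (f t)"] ft(1) by (intro bexI[of _ "shift_tile (pin (f t)) (f t)"]) auto
    ultimately have "agree (\<bar>\<rho>\<bar> + K) (shift (pin t) X) (shift (pin (f t)) Y)"
      by (intro e1(2) shift_closed X Y)
    then have "agree \<rho> (shift (- pin (f t)) (shift (pin t) X)) (shift (- pin (f t)) (shift (pin (f t)) Y))"
      by (rule agree_shift) (use nf in auto)
    then have "agree \<rho> (shift w X) Y" unfolding w_def by (simp add: shift_add)
    then show ?thesis using w e'(1) by (intro exI[of _ w]) auto
  qed
  then show ?thesis using e(1) by blast
qed

text \<open>
  A tile in the agreeing region comes from two tiles of \<open>X\<close> that differ by the translation \<open>v - w\<close>; these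
  are too close to be distinct.
\<close>

lemma translate_unique:
  assumes X: "X \<in> \<Omega>" and ag: "agree \<rho> (shift v X) (shift w X)" and \<rho>: "D < \<rho>" and small: "norm (v - w) < \<kappa>"
  shows "v = w"
proof -
  have Y: "shift v X \<in> \<Omega>" by (rule shift_closed[OF X])
  obtain t where t: "t \<in> shift v X" "c t \<in> fst t" "norm (c t) \<le> D" using pin_exists[OF Y] by blast
  then have "fst t \<inter> ball 0 \<rho> \<noteq> {}" using \<rho> by auto
  then have t': "t \<in> shift w X" using agree_mem[OF ag t(1)] by blast
  let ?a = "shift_tile (- v) t" and ?b = "shift_tile (- w) t"
  have ab: "?a \<in> X" "?b \<in> X" using t(1) t' by (simp_all add: mem_shift_iff)
  have ct: "compact (fst t)" "fst t \<noteq> {}" using tiles[OF Y t(1)] by auto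
  have "hausdorff_dist (fst ?a) (fst ?b) \<le> hausdorff_dist (fst t) (fst t) + norm (- v - - w)"
    unfolding fst_shift_tile by (rule hausdorff_dist_translate2_le[OF ct ct])
  also have "hausdorff_dist (fst t) (fst t) = 0"
    using Metric_space.mdist_zero[OF Metric_space_hausdorff, of "fst t"] ct by auto
  finally have "hausdorff_dist (fst ?a) (fst ?b) < \<kappa>" using small by (simp add: norm_minus_commute)
  then have "?a = ?b" using tile_sep[OF X ab] by force
  then have "shift_tile v ?a = shift_tile v ?b" by simp
  then have "t = shift_tile (v - w) t" by (simp add: shift_tile_add)
  then have "fst t = (\<lambda>y. y - (v - w)) ` fst t" using fst_shift_tile by metis
  then have "norm (v - w) \<le> hausdorff_dist (fst t) (fst t)"
    using norm_le_hausdorff_dist_translate[OF ct, of "v - w"] by metis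
  then show ?thesis using Metric_space.mdist_zero[OF Metric_space_hausdorff, of "fst t"] ct by auto
qed

end

section \<open>Making a map local by a small correction\<close>

locale flc_orbit_map = orbit_map m \<Omega> c \<kappa> D m' \<Omega>' c' \<kappa>' D' h
  for m :: "'l metric" and \<Omega> :: "('n::finite, 'l) pattern set" and c \<kappa> D
    and m' :: "'k metric" and \<Omega>' :: "('n, 'k) pattern set" and c' \<kappa>' D' h +
  assumes flc: "FLC \<Omega>" and flc': "FLC \<Omega>'"
begin

text \<open>
  \<open>\<rho>\<close> is large enough for a small translation to be determined by its effect on a ball of this
  radius, and \<open>\<eta>\<close> bounds all the displacements below.
\<close>

definition \<eta> :: real where "\<eta> = min (1/8) (\<kappa>' / 8)"
definition \<rho> :: real where "\<rho> = \<bar>D'\<bar> + 2"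
definition window :: real where "window = \<bar>D\<bar> + S.pin_dist"

lemma \<eta>: "0 < \<eta>" "8 * \<eta> \<le> 1" "8 * \<eta> \<le> \<kappa>'"
  unfolding \<eta>_def using T.\<kappa>_pos by auto

lemma window_pos: "0 < window"
  unfolding window_def using S.pin_dist_pos by simp

text \<open>
  A displacement by less than \<open>\<kappa>'\<close> can be read off a ball that is sure to contain a control point;
  \<open>6 * \<eta>\<close> covers every comparison of composed displacements below.
\<close>

lemma displacement_unique:
  assumes "X \<in> \<Omega>'" "agree r (shift v X) Y" "agree r (shift w X) Y" "\<bar>D'\<bar> + 1 \<le> r" "norm (v - w) \<le> 6 * \<eta>"
  shows "v = w"
proof (rule T.translate_unique[OF assms(1)])
  show "agree r (shift v X) (shift w X)" using assms(2,3) agree_sym agree_trans by blast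
qed (use assms(4,5) \<eta> in auto)

lemma h_uniform_close: "0 < e \<Longrightarrow> e \<le> 1 \<Longrightarrow> \<exists>\<delta>>0. \<forall>X\<in>\<Omega>. \<forall>Y\<in>\<Omega>. close m \<delta> X Y \<longrightarrow> close m' e (h X) (h Y)"
proof (rule ccontr)
  assume e: "0 < e" "e \<le> 1" and "\<not> ?thesis"
  then have "\<forall>n. \<exists>X Y. X \<in> \<Omega> \<and> Y \<in> \<Omega> \<and> close m (inverse (real (Suc n))) X Y \<and> \<not> close m' e (h X) (h Y)"
    by (metis inverse_positive_iff_positive of_nat_0_less_iff zero_less_Suc)
  then obtain X Y where XY: "\<And>n. X n \<in> \<Omega>" "\<And>n. Y n \<in> \<Omega>" "\<And>n. close m (inverse (real (Suc n))) (X n) (Y n)"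
    "\<And>n. \<not> close m' e (h (X n)) (h (Y n))" by metis
  obtain l r where l: "l \<in> \<Omega>" "strict_mono r" "limitin S.metric.mtopology (X \<circ> r) l sequentially"
    using S.flow.compact_subsequence[of X] XY(1) by blast
  have "limitin S.metric.mtopology (Y \<circ> r) l sequentially"
    unfolding S.limitin_iff
  proof (intro conjI allI impI l(1))
    fix q :: real assume "q > 0"
    define p where "p = min q 1 / 2"
    have p: "0 < p" "p + p \<le> q" "p + p \<le> 1" unfolding p_def using \<open>q > 0\<close> by auto
    have "(\<lambda>n. inverse (real (Suc (r n)))) \<longlonglongrightarrow> 0"
      using LIMSEQ_subseq_LIMSEQ[OF LIMSEQ_inverse_real_of_nat l(2)] by (simp add: o_def)
    then have "\<forall>\<^sub>F n in sequentially. inverse (real (Suc (r n))) < p" using p(1) by (rule order_tendstoD(2))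
    then show "\<forall>\<^sub>F n in sequentially. (Y \<circ> r) n \<in> \<Omega> \<and> close m q ((Y \<circ> r) n) l"
      using S.limitin_close[OF l(3) p(1)]
    proof eventually_elim
      case (elim n)
      have "close m p (Y (r n)) (X (r n))"
        using close_mono[OF close_sym[OF XY(3)[of "r n"]], of p] elim(1) by simp
      then have "close m (p + p) (Y (r n)) l" using elim(2) XY(1,2) l(1) p by (intro S.close_trans_\<Omega>[of _ "X (r n)"]) auto
      then show ?case using close_mono[of m "p + p" "Y (r n)" l q] p XY(2) by simp
    qed
  qed
  from T.close_both_limits[OF h_limit[OF l(3)] h_limit[OF this] e] show False
    using XY(4) by (auto simp: eventually_sequentially)
qed

text \<open>
  A continuous map need not be local, but under finite local complexity it fails to be so only by a
  small translation of the image.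
\<close>

lemma agree_imp_h_agree:
  assumes "0 < \<epsilon>" shows "\<exists>M>0. \<forall>X\<in>\<Omega>. \<forall>Y\<in>\<Omega>. agree M X Y \<longrightarrow> (\<exists>w. norm w \<le> \<epsilon> \<and> agree r (shift w (h X)) (h Y))"
proof -
  obtain e where e: "e > 0" "\<And>X Y. X \<in> \<Omega>' \<Longrightarrow> Y \<in> \<Omega>' \<Longrightarrow> close m' e X Y \<Longrightarrow> \<exists>w. norm w \<le> \<epsilon> \<and> agree r (shift w X) Y"
    using T.close_imp_translate_agree[OF flc' assms, of r] by blast
  obtain \<delta> where \<delta>: "\<delta> > 0" "\<And>X Y. X \<in> \<Omega> \<Longrightarrow> Y \<in> \<Omega> \<Longrightarrow> close m \<delta> X Y \<Longrightarrow> close m' (min e 1) (h X) (h Y)"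
    using h_uniform_close[of "min e 1"] e(1) by auto
  have "\<exists>w. norm w \<le> \<epsilon> \<and> agree r (shift w (h X)) (h Y)" if "X \<in> \<Omega>" "Y \<in> \<Omega>" "agree (1/\<delta>) X Y" for X Y
  proof (rule e(2)[OF h_mem[OF that(1)] h_mem[OF that(2)]])
    have "close m' (min e 1) (h X) (h Y)" by (rule \<delta>(2)[OF that(1,2) S.agree_imp_close[OF that(1,3) \<delta>(1)]]) simp
    then show "close m' e (h X) (h Y)" using close_mono[of m' "min e 1" _ _ e] e(1) by simp
  qed
  then show ?thesis using \<delta>(1) by (intro exI[of _ "1/\<delta>"]) auto
qed

definition base_radius :: real where
  "base_radius = (SOME M. 0 < M \<and> (\<forall>X\<in>\<Omega>. \<forall>Y\<in>\<Omega>. agree M X Y \<longrightarrow> (\<exists>w. norm w \<le> \<eta> \<and> agree \<rho> (shift w (h X)) (h Y))))"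

lemma base_radius:
  "0 < base_radius" "X \<in> \<Omega> \<Longrightarrow> Y \<in> \<Omega> \<Longrightarrow> agree base_radius X Y \<Longrightarrow> \<exists>w. norm w \<le> \<eta> \<and> agree \<rho> (shift w (h X)) (h Y)"
  using someI_ex[OF agree_imp_h_agree[OF \<eta>(1), of \<rho>]] unfolding base_radius_def by blast+

definition class_radius :: real where "class_radius = base_radius + window"

text \<open>
  A representative pattern is chosen once for every patch that can be seen from a pin.  Translated
  back, it agrees with \<open>X\<close> about the origin, so that \<open>h X\<close> agrees with its image up to the small
  displacement \<open>disp X t\<close>.
\<close>

definition repr :: "('n, 'l) pattern \<Rightarrow> ('n, 'l) pattern" where
  "repr P = (SOME Y. Y \<in> \<Omega> \<and> patch Y 0 class_radius = P)"

definition model :: "('n, 'l) pattern \<Rightarrow> ('n, 'l) tile \<Rightarrow> ('n, 'l) pattern" where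
  "model X t = shift (- S.pin t) (repr (patch (shift (S.pin t) X) 0 class_radius))"

definition disp :: "('n, 'l) pattern \<Rightarrow> ('n, 'l) tile \<Rightarrow> real ^ 'n" where
  "disp X t = (SOME w. norm w \<le> \<eta> \<and> agree \<rho> (shift w (h X)) (h (model X t)))"

definition visible :: "('n, 'l) pattern \<Rightarrow> ('n, 'l) tile set" where
  "visible X = {t \<in> X. norm (S.pin t) < window}"

text \<open>
  The weights vanish at the edge of the window, so that a tile entering or leaving it does not make
  the average jump.
\<close>

definition weight :: "('n, 'l) tile \<Rightarrow> real" where
  "weight t = max 0 (window - norm (S.pin t))"

definition correction :: "('n, 'l) pattern \<Rightarrow> real ^ 'n" where
  "correction X = (\<Sum>t\<in>visible X. weight t *\<^sub>R disp X t) /\<^sub>R (\<Sum>t\<in>visible X. weight t)"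

lemma repr:
  assumes "X \<in> \<Omega>"
  shows "repr (patch X 0 class_radius) \<in> \<Omega>" "agree class_radius X (repr (patch X 0 class_radius))"
  using someI[of "\<lambda>Y. Y \<in> \<Omega> \<and> patch Y 0 class_radius = patch X 0 class_radius" X] assms
  unfolding repr_def agree_def by auto

lemma model_mem: "X \<in> \<Omega> \<Longrightarrow> model X t \<in> \<Omega>"
  unfolding model_def by (intro S.shift_closed repr)

lemma disp:
  assumes X: "X \<in> \<Omega>" and t: "norm (S.pin t) < window"
  shows "norm (disp X t) \<le> \<eta>" "agree \<rho> (shift (disp X t) (h X)) (h (model X t))"
proof -
  have "agree class_radius (shift (S.pin t) X) (repr (patch (shift (S.pin t) X) 0 class_radius))"
    by (rule repr(2)[OF S.shift_closed[OF X]])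
  then have "agree base_radius (shift (- S.pin t) (shift (S.pin t) X)) (model X t)"
    unfolding model_def by (rule agree_shift) (use t in \<open>simp add: class_radius_def\<close>)
  then have "agree base_radius X (model X t)" by (simp add: shift_add)
  from someI_ex[OF base_radius(2)[OF X model_mem[OF X] this]]
  show "norm (disp X t) \<le> \<eta>" "agree \<rho> (shift (disp X t) (h X)) (h (model X t))" unfolding disp_def by auto
qed

lemma weight_pos: "t \<in> visible X \<Longrightarrow> 0 < weight t"
  unfolding visible_def weight_def by auto

lemma visible_subset: "X \<in> \<Omega> \<Longrightarrow> visible X \<subseteq> patch X 0 (window + S.pin_dist)"
  using S.pin_meets[of X _ "window + S.pin_dist"] unfolding visible_def patch_def by force

lemma finite_visible: "X \<in> \<Omega> \<Longrightarrow> finite (visible X)"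
  using visible_subset S.finite_patch finite_subset by blast

lemma weight_sum_pos:
  assumes X: "X \<in> \<Omega>" shows "0 < (\<Sum>t\<in>visible X. weight t)"
proof -
  have "visible X \<noteq> {}" using S.pin_exists[OF X] unfolding visible_def window_def by blast
  then show ?thesis by (intro sum_pos finite_visible[OF X] weight_pos)
qed

lemma norm_correction:
  assumes X: "X \<in> \<Omega>" shows "norm (correction X) \<le> \<eta>"
proof -
  have "norm (\<Sum>t\<in>visible X. weight t *\<^sub>R disp X t) \<le> (\<Sum>t\<in>visible X. weight t * \<eta>)"
    by (rule sum_norm_le) (use disp(1)[OF X] weight_pos[of _ X] in \<open>auto simp: visible_def less_imp_le intro!: mult_left_mono\<close>)
  also have "\<dots> = (\<Sum>t\<in>visible X. weight t) * \<eta>" by (simp add: sum_distrib_right)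
  finally show ?thesis
    unfolding correction_def using weight_sum_pos[OF X] by (simp add: field_simps)
qed

text \<open>
  If two patterns agree on a large ball, all their displacements differ by the same vector, namely
  the one that matches their images; the average therefore differs by this vector as well.
\<close>

lemma correction_local:
  "\<exists>M>0. \<forall>X\<in>\<Omega>. \<forall>Y\<in>\<Omega>. agree M X Y \<longrightarrow> agree r (shift (correction X) (h X)) (shift (correction Y) (h Y))"
proof -
  define r' where "r' = max r \<rho> + 1"
  obtain M0 where M0: "M0 > 0" "\<And>X Y. X \<in> \<Omega> \<Longrightarrow> Y \<in> \<Omega> \<Longrightarrow> agree M0 X Y \<Longrightarrow> \<exists>w. norm w \<le> \<eta> \<and> agree r' (shift w (h X)) (h Y)"
    using agree_imp_h_agree[OF \<eta>(1), of r'] by blast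
  define M where "M = max M0 (class_radius + window + S.pin_dist)"
  have cr: "0 < class_radius" unfolding class_radius_def using base_radius(1) window_pos by simp
  have main: "agree r (shift (correction X) (h X)) (shift (correction Y) (h Y))"
    if X: "X \<in> \<Omega>" and Y: "Y \<in> \<Omega>" and ag: "agree M X Y" for X Y
  proof -
    obtain w where w: "norm w \<le> \<eta>" "agree r' (shift w (h X)) (h Y)"
      using M0(2)[OF X Y agree_mono[OF ag]] unfolding M_def by auto
    have "patch X 0 (window + S.pin_dist) = patch Y 0 (window + S.pin_dist)"
      using agree_mono[OF ag, of "window + S.pin_dist"] cr unfolding agree_def M_def by simp
    then have vis: "visible X = visible Y"
      using visible_subset[OF X] visible_subset[OF Y] patch_subset[of X] patch_subset[of Y] unfolding visible_def by blast
    have d: "disp X t = disp Y t + w" if t: "t \<in> visible X" for t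
    proof -
      have pt: "norm (S.pin t) < window" using t unfolding visible_def by simp
      have "agree class_radius (shift (S.pin t) X) (shift (S.pin t) Y)"
        by (rule agree_shift[OF ag]) (use pt S.pin_dist_pos in \<open>simp add: M_def\<close>)
      then have "model X t = model Y t" unfolding model_def agree_def by simp
      then have 1: "agree \<rho> (shift (disp X t) (h X)) (h (model Y t))" using disp(2)[OF X pt] by simp
      have "agree (\<bar>D'\<bar> + 1) (shift (disp Y t) (shift w (h X))) (shift (disp Y t) (h Y))"
        by (rule agree_shift[OF w(2)]) (use disp(1)[OF Y pt] \<eta> in \<open>auto simp: r'_def \<rho>_def\<close>)
      moreover have "agree (\<bar>D'\<bar> + 1) (shift (disp Y t) (h Y)) (h (model Y t))"
        by (rule agree_mono[OF disp(2)[OF Y pt]]) (simp add: \<rho>_def)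
      ultimately have 2: "agree (\<bar>D'\<bar> + 1) (shift (disp Y t + w) (h X)) (h (model Y t))"
        unfolding shift_add using agree_trans by blast
      have "agree (\<bar>D'\<bar> + 1) (shift (disp X t) (h X)) (h (model Y t))"
        by (rule agree_mono[OF 1]) (simp add: \<rho>_def)
      then show ?thesis
      proof (rule displacement_unique[OF h_mem[OF X] _ 2])
        show "norm (disp X t - (disp Y t + w)) \<le> 6 * \<eta>"
          using disp(1)[OF X pt] disp(1)[OF Y pt] w(1) norm_triangle_ineq4[of "disp X t" "disp Y t + w"]
            norm_triangle_ineq[of "disp Y t" w] \<eta>(1) by linarith
      qed simp
    qed
    have "(\<Sum>t\<in>visible X. weight t *\<^sub>R disp X t) = (\<Sum>t\<in>visible Y. weight t *\<^sub>R disp Y t) + (\<Sum>t\<in>visible Y. weight t) *\<^sub>R w"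
      using d by (simp add: vis scaleR_add_right sum.distrib scaleR_sum_left)
    then have eq: "correction X = correction Y + w"
      unfolding correction_def using weight_sum_pos[OF Y] by (simp add: vis scaleR_add_right)
    have "agree r (shift (correction Y) (shift w (h X))) (shift (correction Y) (h Y))"
      by (rule agree_shift[OF w(2)]) (use norm_correction[OF Y] \<eta> in \<open>auto simp: r'_def\<close>)
    then show ?thesis unfolding eq by (simp add: shift_add)
  qed
  show ?thesis using main M0(1) by (intro exI[of _ M]) (auto simp: M_def)
qed

text \<open>
  Small displacements between patterns are determined by the patterns they match, and hence depend
  continuously on them.
\<close>

lemma displacement_tendsto:
  assumes P: "limitin T.metric.mtopology P P0 sequentially" and Q: "limitin T.metric.mtopology Q Q0 sequentially"
    and a: "\<forall>\<^sub>F n in sequentially. norm (a n) \<le> \<eta> \<and> agree \<rho> (shift (a n) (P n)) (Q n)"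
    and a0: "norm a0 \<le> \<eta>" "agree \<rho> (shift a0 P0) Q0"
  shows "a \<longlonglongrightarrow> a0"
proof (rule tendstoI)
  fix q :: real assume q: "q > 0"
  define z where "z = min \<eta> (q / 4)"
  have z: "0 < z" "z \<le> \<eta>" "z \<le> q / 4" unfolding z_def using q \<eta> by auto
  obtain e where e: "e > 0" "\<And>X Y. X \<in> \<Omega>' \<Longrightarrow> Y \<in> \<Omega>' \<Longrightarrow> close m' e X Y \<Longrightarrow> \<exists>w. norm w \<le> z \<and> agree \<rho> (shift w X) Y"
    using T.close_imp_translate_agree[OF flc' z(1), of \<rho>] by blast
  have P0: "P0 \<in> \<Omega>'" "Q0 \<in> \<Omega>'" using P Q T.limitin_iff by blast+
  show "\<forall>\<^sub>F n in sequentially. dist (a n) a0 < q"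
    using T.limitin_close[OF P e(1)] T.limitin_close[OF Q e(1)] a
  proof eventually_elim
    case (elim n)
    obtain x where x: "norm x \<le> z" "agree \<rho> (shift x (P n)) P0" using e(2)[of "P n" P0] elim P0 by blast
    obtain y where y: "norm y \<le> z" "agree \<rho> (shift y (Q n)) Q0" using e(2)[of "Q n" Q0] elim P0 by blast
    have "agree (\<bar>D'\<bar> + 1) (shift y (shift (a n) (P n))) (shift y (Q n))"
      by (rule agree_shift[of \<rho>]) (use elim y z \<eta> in \<open>auto simp: \<rho>_def\<close>)
    then have 1: "agree (\<bar>D'\<bar> + 1) (shift (y + a n) (P n)) Q0"
      unfolding shift_add using agree_mono[OF y(2), of "\<bar>D'\<bar> + 1"] agree_trans unfolding \<rho>_def by fastforce
    have "agree (\<bar>D'\<bar> + 1) (shift a0 (shift x (P n))) (shift a0 P0)"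
      by (rule agree_shift[OF x(2)]) (use a0 \<eta> in \<open>auto simp: \<rho>_def\<close>)
    then have 2: "agree (\<bar>D'\<bar> + 1) (shift (a0 + x) (P n)) Q0"
      unfolding shift_add using agree_mono[OF a0(2), of "\<bar>D'\<bar> + 1"] agree_trans unfolding \<rho>_def by fastforce
    have "norm (y + a n - (a0 + x)) \<le> 6 * \<eta>"
      using x(1) y(1) z(2) a0(1) elim norm_triangle_ineq4[of "y + a n" "a0 + x"] norm_triangle_ineq[of y "a n"]
        norm_triangle_ineq[of a0 x] \<eta>(1) by linarith
    then have "y + a n = a0 + x" using displacement_unique[OF _ 1 2] elim by simp
    then have "a n - a0 = x - y" by (simp add: algebra_simps)
    then show ?case using x(1) y(1) z(1,3) norm_triangle_ineq4[of x y] by (simp add: dist_norm)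
  qed
qed

text \<open>
  A convergent sequence eventually agrees with its limit on a large ball after translations tending
  to zero, so its visible tiles are translates of tiles of the limit.
\<close>

lemma correction_cont: "continuous_map S.metric.mtopology euclidean correction"
proof (rule S.flow.contI)
  fix X :: "nat \<Rightarrow> ('n, 'l) pattern" and L
  assume lim: "limitin S.metric.mtopology X L sequentially" and XR: "range X \<subseteq> \<Omega>"
  have X: "X n \<in> \<Omega>" for n using XR by auto
  have L: "L \<in> \<Omega>" using lim S.limitin_iff by blast
  define M where "M = class_radius + window + 1 + S.pin_dist"
  have cr: "0 < class_radius" unfolding class_radius_def using base_radius(1) window_pos by simp
  have ex: "\<forall>\<^sub>F n in sequentially. \<exists>v. norm v \<le> z \<and> agree M (shift v (X n)) L" if z: "z > 0" for z
  proof -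
    obtain e where e: "e > 0" "\<And>X Y. X \<in> \<Omega> \<Longrightarrow> Y \<in> \<Omega> \<Longrightarrow> close m e X Y \<Longrightarrow> \<exists>w. norm w \<le> z \<and> agree M (shift w X) Y"
      using S.close_imp_translate_agree[OF flc z, of M] by blast
    show ?thesis using S.limitin_close[OF lim e(1)] by eventually_elim (use e(2) L in blast)
  qed
  have "\<exists>w. w \<longlonglongrightarrow> 0 \<and> (\<forall>\<^sub>F n in sequentially. agree M (shift (w n) (X n)) L)"
  proof -
    \<comment> \<open>one sequence of translations that works at every scale: nearly minimal ones\<close>
    define G where "G = (\<lambda>n. {v. agree M (shift v (X n)) L})"
    define w where "w = (\<lambda>n. SOME v. v \<in> G n \<and> norm v \<le> 2 * (INF v\<in>G n. norm v) + inverse (real (Suc n)))"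
    have bdd: "bdd_below (norm ` G n)" for n by (rule bdd_belowI[of _ 0]) auto
    have w: "w n \<in> G n \<and> norm (w n) \<le> 2 * (INF v\<in>G n. norm v) + inverse (real (Suc n))" if ne: "G n \<noteq> {}" for n
    proof -
      have "0 \<le> (INF v\<in>G n. norm v)" using ne by (intro cINF_greatest) auto
      moreover have "0 < inverse (real (Suc n))" by simp
      ultimately have "(INF v\<in>G n. norm v) < 2 * (INF v\<in>G n. norm v) + inverse (real (Suc n))" by linarith
      then obtain v where "v \<in> G n" "norm v < 2 * (INF v\<in>G n. norm v) + inverse (real (Suc n))"
        using cINF_less_iff[OF ne bdd] by blast
      then have "\<exists>v. v \<in> G n \<and> norm v \<le> 2 * (INF v\<in>G n. norm v) + inverse (real (Suc n))"
        using less_imp_le by blast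
      then show ?thesis unfolding w_def by (rule someI_ex)
    qed
    have "w \<longlonglongrightarrow> 0"
    proof (rule tendstoI)
      fix q :: real assume "q > 0"
      then have "\<forall>\<^sub>F n in sequentially. inverse (real (Suc n)) < q / 4"
        using order_tendstoD(2)[OF LIMSEQ_inverse_real_of_nat, of "q/4"] by simp
      moreover have "\<forall>\<^sub>F n in sequentially. \<exists>v. norm v \<le> q / 4 \<and> agree M (shift v (X n)) L" using ex[of "q/4"] \<open>q > 0\<close> by simp
      ultimately show "\<forall>\<^sub>F n in sequentially. dist (w n) 0 < q"
      proof eventually_elim
        case (elim n)
        then obtain v where v: "v \<in> G n" "norm v \<le> q / 4" unfolding G_def by blast
        have "(INF v\<in>G n. norm v) \<le> norm v" using v(1) bdd by (intro cINF_lower)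
        moreover have "norm (w n) \<le> 2 * (INF v\<in>G n. norm v) + inverse (real (Suc n))" using w[of n] v(1) by blast
        ultimately have "norm (w n) < q" using v(2) elim(1) \<open>q > 0\<close> by linarith
        then show ?case by simp
      qed
    qed
    moreover have "\<forall>\<^sub>F n in sequentially. agree M (shift (w n) (X n)) L"
      using ex[of 1] by (rule eventually_mono[OF _]) (use w in \<open>auto simp: G_def\<close>)
    ultimately show ?thesis by blast
  qed
  then obtain w where w: "w \<longlonglongrightarrow> 0" "\<forall>\<^sub>F n in sequentially. agree M (shift (w n) (X n)) L" by blast
  define B where "B = {t \<in> L. norm (S.pin t) < window + 1}"
  have "B \<subseteq> patch L 0 M" unfolding B_def patch_def using S.pin_meets[OF L, of _ M] cr by (force simp: M_def)
  then have finB: "finite B" using S.finite_patch[OF L] finite_subset by blast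
  let ?t = "\<lambda>n t. shift_tile (- w n) t"
  have pt: "S.pin (?t n t) = S.pin t + w n" if "t \<in> L" for n t using S.pin_shift[OF L that, of "- w n"] by simp
  define num where "num = (\<lambda>n t. weight (?t n t) *\<^sub>R disp (X n) (?t n t))"
  define good where "good = (\<lambda>n. agree M (shift (w n) (X n)) L \<and> norm (w n) < 1)"
  have evgood: "\<forall>\<^sub>F n in sequentially. good n"
    unfolding good_def using w(2) tendstoD[OF w(1) zero_less_one] by eventually_elim auto
  \<comment> \<open>the visible tiles of \<open>X n\<close> correspond to tiles of the limit near the window, up to tiles of weight zero\<close>
  have sums: "(\<Sum>t\<in>visible (X n). f t) = (\<Sum>t\<in>B. f (?t n t))"
    if g: "good n" and f: "\<And>t. \<not> norm (S.pin t) < window \<Longrightarrow> f t = 0" for n and f :: "('n, 'l) tile \<Rightarrow> 'b::real_vector"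
  proof -
    have "(\<Sum>t\<in>B. f (?t n t)) = sum f (?t n ` B)" by (simp add: sum.reindex inj_on_def)
    also have "\<dots> = (\<Sum>t\<in>visible (X n). f t)"
    proof (rule sum.mono_neutral_right)
      show "visible (X n) \<subseteq> ?t n ` B"
      proof
        fix t assume t: "t \<in> visible (X n)"
        define s where "s = shift_tile (w n) t"
        have tX: "t \<in> X n" "norm (S.pin t) < window" using t unfolding visible_def by auto
        have Y: "shift (w n) (X n) \<in> \<Omega>" by (rule S.shift_closed[OF X])
        have s: "s \<in> shift (w n) (X n)" unfolding s_def using tX by simp
        have ps: "S.pin s = S.pin t - w n" unfolding s_def by (rule S.pin_shift[OF X tX(1)])
        have ns: "norm (S.pin s) < window + 1"
          using ps tX(2) g norm_triangle_ineq4[of "S.pin t" "w n"] unfolding good_def by simp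
        have "fst s \<inter> ball 0 M \<noteq> {}" using S.pin_meets[OF Y s, of M] ns cr by (force simp: M_def)
        then have "s \<in> L" using agree_mem[of M _ L s] g s unfolding good_def by blast
        then have "s \<in> B" using ns unfolding B_def by simp
        then show "t \<in> ?t n ` B" unfolding s_def by (intro image_eqI[of _ _ "shift_tile (w n) t"]) auto
      qed
      show "\<forall>t\<in>?t n ` B - visible (X n). f t = 0"
      proof
        fix t assume t: "t \<in> ?t n ` B - visible (X n)"
        then obtain s where s: "s \<in> L" "norm (S.pin s) < window + 1" "t = ?t n s" unfolding B_def by blast
        have "fst s \<inter> ball 0 M \<noteq> {}" using S.pin_meets[OF L s(1), of M] s(2) cr by (force simp: M_def)
        then have "s \<in> shift (w n) (X n)" using agree_mem[OF agree_sym, of M _ L s] g s unfolding good_def by blast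
        then have "t \<in> X n" unfolding s(3) by (simp add: mem_shift_iff)
        then show "f t = 0" using t f unfolding visible_def by blast
      qed
    qed (use finB in auto)
    finally show ?thesis by simp
  qed
  have wt: "(\<lambda>n. weight (?t n t)) \<longlonglongrightarrow> weight t" if "t \<in> L" for t
  proof -
    have "(\<lambda>n. max 0 (window - norm (S.pin t + w n))) \<longlonglongrightarrow> max 0 (window - norm (S.pin t + 0))"
      by (intro tendsto_intros w)
    then show ?thesis unfolding weight_def pt[OF that] by simp
  qed
  have dt: "(\<lambda>n. num n t) \<longlonglongrightarrow> weight t *\<^sub>R disp L t" if t: "t \<in> L" for t
  proof (cases "norm (S.pin t) < window")
    case True
    have ev: "\<forall>\<^sub>F n in sequentially. norm (S.pin t + w n) < window"
    proof -
      have "(\<lambda>n. norm (S.pin t + w n)) \<longlonglongrightarrow> norm (S.pin t + 0)" by (intro tendsto_intros w)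
      then show ?thesis using True order_tendstoD(2) by fastforce
    qed
    let ?Y = "repr (patch (shift (S.pin t) L) 0 class_radius)"
    have Y: "?Y \<in> \<Omega>" by (rule repr(1)[OF S.shift_closed[OF L]])
    have "(\<lambda>n. disp (X n) (?t n t)) \<longlonglongrightarrow> disp L t"
    proof (rule displacement_tendsto[where P = "\<lambda>n. h (X n)" and Q = "\<lambda>n. h (shift (- (S.pin t + w n)) ?Y)"])
      show "limitin T.metric.mtopology (\<lambda>n. h (X n)) (h L) sequentially" by (rule h_limit[OF lim])
      have "limitin S.metric.mtopology (\<lambda>n. ?Y) ?Y sequentially" using Y by simp
      then have "limitin S.metric.mtopology (\<lambda>n. shift (- (S.pin t + w n)) ?Y) (shift (- (S.pin t + 0)) ?Y) sequentially"
        by (rule S.limitin_shift) (intro tendsto_intros w)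
      from h_limit[OF this] show "limitin T.metric.mtopology (\<lambda>n. h (shift (- (S.pin t + w n)) ?Y)) (h (model L t)) sequentially"
        by (simp add: model_def)
      show "\<forall>\<^sub>F n in sequentially. norm (disp (X n) (?t n t)) \<le> \<eta> \<and>
          agree \<rho> (shift (disp (X n) (?t n t)) (h (X n))) (h (shift (- (S.pin t + w n)) ?Y))"
        using ev evgood
      proof eventually_elim
        case (elim n)
        have n: "norm (S.pin (?t n t)) < window" using elim(1) pt[OF t] by simp
        have "agree class_radius (shift (S.pin t) (shift (w n) (X n))) (shift (S.pin t) L)"
          by (rule agree_shift[of M]) (use elim True S.pin_dist_pos in \<open>auto simp: good_def M_def\<close>)
        then have "model (X n) (?t n t) = shift (- (S.pin t + w n)) ?Y"
          unfolding model_def pt[OF t] agree_def shift_add by simp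
        then show ?case using disp[OF X[of n] n] by simp
      qed
    qed (use disp[OF L True] in auto)
    then show ?thesis unfolding num_def by (intro tendsto_intros wt[OF t])
  next
    case False
    then have w0: "weight t = 0" unfolding weight_def by simp
    have le: "norm (num n t) \<le> weight (?t n t) * \<eta>" for n
    proof (cases "norm (S.pin (?t n t)) < window")
      case True
      then show ?thesis unfolding num_def using disp(1)[OF X True] by (simp add: weight_def mult_left_mono)
    next
      case False then show ?thesis unfolding num_def weight_def by simp
    qed
    have "(\<lambda>n. weight (?t n t) * \<eta>) \<longlonglongrightarrow> 0" using tendsto_mult_right[OF wt[OF t], of \<eta>] w0 by simp
    then have "(\<lambda>n. num n t) \<longlonglongrightarrow> 0" by (rule Lim_null_comparison[OF always_eventually[OF allI[OF le]]])
    then show ?thesis using w0 by simp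
  qed
  have BL: "t \<in> L" if "t \<in> B" for t using that unfolding B_def by simp
  have L_sum: "(\<Sum>t\<in>visible L. f t) = (\<Sum>t\<in>B. f t)" if f: "\<And>t. \<not> norm (S.pin t) < window \<Longrightarrow> f t = 0" for f :: "('n, 'l) tile \<Rightarrow> 'b::real_vector"
    by (rule sum.mono_neutral_left[OF finB]) (use f in \<open>auto simp: visible_def B_def\<close>)
  have w0: "\<not> norm (S.pin t) < window \<Longrightarrow> weight t = 0" for t unfolding weight_def by simp
  have "(\<lambda>n. (\<Sum>t\<in>B. num n t) /\<^sub>R (\<Sum>t\<in>B. weight (?t n t))) \<longlonglongrightarrow> (\<Sum>t\<in>B. weight t *\<^sub>R disp L t) /\<^sub>R (\<Sum>t\<in>B. weight t)"
    using weight_sum_pos[OF L] by (intro tendsto_intros dt wt BL) (auto simp: L_sum w0)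
  moreover have "\<forall>\<^sub>F n in sequentially. (\<Sum>t\<in>B. num n t) /\<^sub>R (\<Sum>t\<in>B. weight (?t n t)) = correction (X n)"
    using evgood by eventually_elim (simp add: correction_def sums w0 num_def)
  ultimately have "(\<lambda>n. correction (X n)) \<longlonglongrightarrow> (\<Sum>t\<in>B. weight t *\<^sub>R disp L t) /\<^sub>R (\<Sum>t\<in>B. weight t)"
    by (rule Lim_transform_eventually)
  then show "(\<lambda>n. correction (X n)) \<longlonglongrightarrow> correction L" by (simp add: correction_def L_sum w0)
qed

end

section \<open>Maps that follow a deformation\<close>

text \<open>Uniform continuity at displacement zero, again by compactness of \<open>M\<close>.\<close>

lemma (in flow_cocycle) cocycle_small:
  assumes e: "0 < e" shows "\<exists>\<delta>>0. \<forall>s\<in>M. \<forall>v. norm v \<le> \<delta> \<longrightarrow> norm (\<alpha> s v) < e"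
proof (rule ccontr)
  assume "\<not> ?thesis"
  then have "\<forall>n. \<exists>s v. s \<in> M \<and> norm v \<le> inverse (real (Suc n)) \<and> \<not> norm (\<alpha> s v) < e"
    by (metis inverse_positive_iff_positive of_nat_0_less_iff zero_less_Suc)
  then obtain s v where sv: "\<And>n. s n \<in> M" "\<And>n. norm (v n) \<le> inverse (real (Suc n))" "\<And>n. \<not> norm (\<alpha> (s n) (v n)) < e"
    by metis
  obtain l r where l: "l \<in> M" "strict_mono r" "limitin mtopology (s \<circ> r) l sequentially"
    using compact_subsequence[of s] sv(1) by blast
  have "v \<longlonglongrightarrow> 0"
    by (rule Lim_null_comparison[OF always_eventually[OF allI[OF sv(2)]] LIMSEQ_inverse_real_of_nat])
  then have "(v \<circ> r) \<longlonglongrightarrow> 0" by (rule LIMSEQ_subseq_LIMSEQ[OF _ l(2)])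
  from tendsto_norm[OF cocycle_limit[OF l(3) this]] have "(\<lambda>n. norm (\<alpha> (s (r n)) (v (r n)))) \<longlonglongrightarrow> 0"
    using cocycle_0[OF l(1)] by (simp add: o_def)
  then have "\<forall>\<^sub>F n in sequentially. norm (\<alpha> (s (r n)) (v (r n))) < e" using e by (rule order_tendstoD(2))
  then show False using sv(3) by (auto simp: eventually_sequentially)
qed

lemma (in pattern_space) invariant_measure_iff: "flow.invariant_measure \<nu> \<longleftrightarrow> invariant_prob m \<Omega> \<nu>"
  unfolding flow.invariant_measure_def invariant_prob_def topology_eq ..

context orbit_map
begin

text \<open>Coboundaries have mean zero because the measure is invariant.\<close>

lemma mean_matrix_coboundary:
  assumes f: "continuous_map S.metric.mtopology euclidean f" and \<mu>: "uniquely_ergodic m \<Omega> \<mu>"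
  shows "(\<lambda>v. \<integral>X. \<alpha> X v + f (shift v X) - f X \<partial>\<mu>) = ruelle_sullivan \<mu> \<alpha>"
proof
  fix v
  have inv: "S.flow.invariant_measure \<mu>" using \<mu> unfolding S.invariant_measure_iff uniquely_ergodic_def by blast
  note int = cocycle.cont_integrable[OF inv]
  have "(\<integral>X. \<alpha> X v + f (shift v X) - f X \<partial>\<mu>) = (\<integral>X. \<alpha> X v \<partial>\<mu>) + (\<integral>X. f (shift v X) \<partial>\<mu>) - (\<integral>X. f X \<partial>\<mu>)"
    by (simp add: int cocycle.cocycle_cont S.flow.cont_act f)
  then show "(\<integral>X. \<alpha> X v + f (shift v X) - f X \<partial>\<mu>) = ruelle_sullivan \<mu> \<alpha> v"
    unfolding cocycle.integral_act[OF inv f] ruelle_sullivan_def by simp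
qed

text \<open>
  The cocycle may first be changed by the coboundary of a given \<open>f\<close>.  In the presence of finite local
  complexity \<open>f\<close> makes it local, and the last clause says that smoothing preserves this.
\<close>

lemma smooth_representative:
  assumes f: "continuous_map S.metric.mtopology euclidean f" and \<mu>: "uniquely_ergodic m \<Omega> \<mu>"
    and det: "det (matrix (ruelle_sullivan \<mu> \<alpha>)) \<noteq> 0"
  shows "\<exists>f' W lo hi V. continuous_map S.metric.mtopology euclidean f' \<and>
    flow_deformation \<Omega> (pattern_dist m) shift (\<lambda>X v. \<alpha> X v + (f (shift v X) + f' (shift v X)) - (f X + f' X)) W lo hi \<and>
    (\<forall>X\<in>\<Omega>. \<forall>Y\<in>\<Omega>. (\<forall>v. norm v \<le> V \<longrightarrow> \<alpha> X v + f (shift v X) - f X = \<alpha> Y v + f (shift v Y) - f Y) \<longrightarrow> f' X = f' Y \<and> W X = W Y)"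
proof -
  interpret G: flow_cocycle \<Omega> "pattern_dist m" shift "\<lambda>X v. \<alpha> X v + f (shift v X) - f X"
    by (rule cocycle.flow_cocycle_coboundary[OF f])
  have "det (matrix (\<lambda>v. \<integral>X. \<alpha> X v + f (shift v X) - f X \<partial>\<mu>)) \<noteq> 0"
    unfolding mean_matrix_coboundary[OF f \<mu>] by (rule det)
  note ex = G.deformation_exists[OF _ _ this]
  have inv: "S.flow.invariant_measure \<mu>" "\<And>\<nu>. S.flow.invariant_measure \<nu> \<Longrightarrow> \<nu> = \<mu>"
    using \<mu> unfolding S.invariant_measure_iff uniquely_ergodic_def by blast+
  obtain f' W lo hi V where *: "continuous_map S.metric.mtopology euclidean f'"
    "flow_deformation \<Omega> (pattern_dist m) shift (\<lambda>X v. \<alpha> X v + f (shift v X) - f X + f' (shift v X) - f' X) W lo hi"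
    "\<forall>X\<in>\<Omega>. \<forall>Y\<in>\<Omega>. (\<forall>v. norm v \<le> V \<longrightarrow> \<alpha> X v + f (shift v X) - f X = \<alpha> Y v + f (shift v Y) - f Y) \<longrightarrow> f' X = f' Y \<and> W X = W Y"
    by (rule exE[OF ex[OF inv]], assumption, elim exE conjE, (rule that; assumption))
  have "(\<lambda>X v. \<alpha> X v + f (shift v X) - f X + f' (shift v X) - f' X) = (\<lambda>X v. \<alpha> X v + (f (shift v X) + f' (shift v X)) - (f X + f' X))"
    by (simp add: algebra_simps)
  from *(2)[unfolded this] show ?thesis
    by (intro exI[of _ f'] exI[of _ W] exI[of _ lo] exI[of _ hi] exI[of _ V] conjI *(1,3))
qed

text \<open>
  Shifting each image by \<open>f X\<close> changes the cocycle of \<open>h\<close> by the coboundary of \<open>f\<close> without leaving the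
  homotopy class.
\<close>

definition follow :: "(('n, 'l) pattern \<Rightarrow> real ^ 'n) \<Rightarrow> ('n, 'l) pattern \<Rightarrow> ('n, 'k) pattern" where
  "follow f X = shift (f X) (h X)"

lemma follow_shift:
  assumes "X \<in> \<Omega>" shows "follow f (shift v X) = shift (\<alpha> X v + f (shift v X) - f X) (follow f X)"
  unfolding follow_def h_shift[OF assms] shift_add by (simp add: algebra_simps)

lemma follow_mem: "X \<in> \<Omega> \<Longrightarrow> follow f X \<in> \<Omega>'"
  unfolding follow_def by (intro T.shift_closed h_mem)

lemma homotopic_follow:
  assumes f: "continuous_map S.metric.mtopology euclidean f"
  shows "homotopic_maps m \<Omega> m' \<Omega>' h (follow f)"
  unfolding homotopic_maps_def homotopic_with_def
proof (intro exI[of _ "\<lambda>p. shift (fst p *\<^sub>R f (snd p)) (h (snd p))"] conjI allI ballI TrueI)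
  show "continuous_map (prod_topology (top_of_set {0..1}) (tiling_topology m \<Omega>)) (tiling_topology m' \<Omega>')
      (\<lambda>p. shift (fst p *\<^sub>R f (snd p)) (h (snd p)))"
    unfolding continuous_map_atin T.topology_eq S.topology_eq
  proof
    fix p assume p: "p \<in> topspace (prod_topology (top_of_set {0..1::real}) S.metric.mtopology)"
    let ?F = "atin (prod_topology (top_of_set {0..1::real}) S.metric.mtopology) p"
    have "limitin (top_of_set {0..1}) fst (fst p) ?F"
      using continuous_map_fst[of "top_of_set {0..1::real}" S.metric.mtopology] p unfolding continuous_map_atin by blast
    then have 1: "(fst \<longlongrightarrow> fst p) ?F" by (simp add: limitin_subtopology)
    have 2: "limitin S.metric.mtopology snd (snd p) ?F"
      using continuous_map_snd[of "top_of_set {0..1::real}" S.metric.mtopology] p unfolding continuous_map_atin by blast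
    show "limitin T.metric.mtopology (\<lambda>p. shift (fst p *\<^sub>R f (snd p)) (h (snd p))) (shift (fst p *\<^sub>R f (snd p)) (h (snd p))) ?F"
      by (rule T.limitin_shift[OF h_limit[OF 2] tendsto_scaleR[OF 1 S.flow.cont_limit[OF f 2]]])
  qed
qed (simp_all add: follow_def)

text \<open>
  The whole orbit of a pattern is reached from the orbit of one preimage, because the corrected cocycle
  takes all values.
\<close>

lemma follow_surj:
  assumes onto: "h ` \<Omega> = \<Omega>'" and surj: "\<And>X. X \<in> \<Omega> \<Longrightarrow> surj (\<lambda>v. \<alpha> X v + f (shift v X) - f X)"
  shows "follow f ` \<Omega> = \<Omega>'"
proof
  show "follow f ` \<Omega> \<subseteq> \<Omega>'" using follow_mem by blast
  show "\<Omega>' \<subseteq> follow f ` \<Omega>"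
  proof
    fix Y assume "Y \<in> \<Omega>'"
    then obtain X where X: "X \<in> \<Omega>" "Y = h X" using onto by blast
    obtain v where "- f X = \<alpha> X v + f (shift v X) - f X" using surj[OF X(1)] unfolding surj_def by blast
    then have "follow f (shift v X) = Y" using follow_shift[OF X(1), of f v] X(2) unfolding follow_def by (simp add: shift_add)
    then show "Y \<in> follow f ` \<Omega>" using S.shift_closed[OF X(1)] by blast
  qed
qed

end

context flc_orbit_map
begin

abbreviation \<gamma> where "\<gamma> X v \<equiv> \<alpha> X v + correction (shift v X) - correction X"

text \<open>
  A local map determines its own cocycle locally: the displacement along a path of short steps is
  recovered step by step from the patterns seen on the way.
\<close>

lemma corrected_cocycle_local: "\<exists>M>0. \<forall>X\<in>\<Omega>. \<forall>Y\<in>\<Omega>. agree M X Y \<longrightarrow> (\<forall>v. norm v \<le> V \<longrightarrow> \<gamma> X v = \<gamma> Y v)"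
proof -
  interpret G: flow_cocycle \<Omega> "pattern_dist m" shift \<gamma>
    by (rule cocycle.flow_cocycle_coboundary[OF correction_cont])
  obtain \<delta> where \<delta>: "\<delta> > 0" "\<And>X v. X \<in> \<Omega> \<Longrightarrow> norm v \<le> \<delta> \<Longrightarrow> norm (\<gamma> X v) < \<kappa>' / 2"
    using G.cocycle_small[of "\<kappa>' / 2"] T.\<kappa>_pos by auto
  obtain B where B: "B > 0" "\<And>X v. X \<in> \<Omega> \<Longrightarrow> norm v \<le> V \<Longrightarrow> norm (\<gamma> X v) \<le> B"
    using G.cocycle_bounded[of V] by blast
  let ?r = "\<bar>D'\<bar> + 1"
  obtain M1 where M1: "M1 > 0" "\<And>X Y. X \<in> \<Omega> \<Longrightarrow> Y \<in> \<Omega> \<Longrightarrow> agree M1 X Y \<Longrightarrow> agree (?r + B) (follow correction X) (follow correction Y)"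
    using correction_local[of "?r + B"] unfolding follow_def by blast
  \<comment> \<open>steps of length at most \<open>\<delta>\<close> displace by less than \<open>\<kappa>' / 2\<close>, so two cocycles that agree so far can differ
    by less than \<open>\<kappa>'\<close> after the next step\<close>
  obtain n :: nat where n: "n > 0" "\<bar>V\<bar> \<le> real n * \<delta>"
  proof -
    obtain k :: nat where "\<bar>V\<bar> / \<delta> \<le> real k" using real_arch_simple by blast
    then have "\<bar>V\<bar> \<le> real (Suc k) * \<delta>" using \<delta>(1) by (simp add: field_simps)
    then show ?thesis using that[of "Suc k"] by blast
  qed
  have main: "\<gamma> X v = \<gamma> Y v" if X: "X \<in> \<Omega>" and Y: "Y \<in> \<Omega>" and ag: "agree (M1 + \<bar>V\<bar>) X Y" and v: "norm v \<le> V" for X Y v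
  proof -
    let ?u = "v /\<^sub>R real n"
    have u: "norm ?u \<le> \<delta>" using v n by (simp add: field_simps)
    have *: "\<gamma> X (real k *\<^sub>R ?u) = \<gamma> Y (real k *\<^sub>R ?u)" if "k \<le> n" for k
      using that
    proof (induction k)
      case 0
      then show ?case using G.cocycle_0[OF X] G.cocycle_0[OF Y] by simp
    next
      case (Suc k)
      let ?w = "real (Suc k) *\<^sub>R ?u" and ?p = "real k *\<^sub>R ?u"
      have w: "?w = ?p + ?u" unfolding of_nat_Suc scaleR_add_left scaleR_one by (rule add.commute)
      have nw: "norm ?w \<le> V"
      proof -
        have "real (Suc k) / real n * norm v \<le> 1 * norm v" using Suc(2) n by (intro mult_right_mono) auto
        then show ?thesis using v by (simp add: field_simps)
      qed
      have step: "norm (\<gamma> Z ?w - \<gamma> Z ?p) < \<kappa>' / 2" if "Z \<in> \<Omega>" for Z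
        unfolding w G.cocycle_diff[OF that] by (rule \<delta>(2)[OF S.shift_closed[OF that] u])
      have eq: "\<gamma> X ?p = \<gamma> Y ?p" by (rule Suc.IH) (use Suc.prems in simp)
      have sm: "norm (\<gamma> X ?w - \<gamma> Y ?w) < \<kappa>'"
        by (rule norm_triangle_half_l[OF step[OF X]]) (unfold eq, rule step[OF Y])
      let ?g = "follow correction"
      have "agree M1 (shift ?w X) (shift ?w Y)" by (rule agree_shift[OF ag]) (use nw in linarith)
      then have "agree (?r + B) (?g (shift ?w X)) (?g (shift ?w Y))" using M1(2) X Y S.shift_closed by blast
      then have 1: "agree ?r (shift (\<gamma> X ?w) (?g X)) (shift (\<gamma> Y ?w) (?g Y))"
        unfolding follow_shift[OF X] follow_shift[OF Y] by (rule agree_mono) (use B(1) in simp)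
      have "agree M1 X Y" by (rule agree_mono[OF ag]) simp
      then have "agree (?r + B) (?g X) (?g Y)" using M1(2) X Y by blast
      then have 2: "agree ?r (shift (\<gamma> Y ?w) (?g X)) (shift (\<gamma> Y ?w) (?g Y))"
        by (rule agree_shift) (use B(2)[OF Y nw] in simp)
      show ?case
      proof (rule T.translate_unique[OF follow_mem[OF X]])
        show "agree ?r (shift (\<gamma> X ?w) (?g X)) (shift (\<gamma> Y ?w) (?g X))" using 1 2 agree_sym agree_trans by blast
      qed (use sm in auto)
    qed
    show ?thesis using *[of n] n(1) by simp
  qed
  have "0 < M1 + \<bar>V\<bar>" using M1(1) by simp
  then show ?thesis by (intro exI[of _ "M1 + \<bar>V\<bar>"] conjI ballI impI allI) (assumption, rule main)
qed

lemma local_smooth_representative: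
  assumes \<mu>: "uniquely_ergodic m \<Omega> \<mu>" and det: "det (matrix (ruelle_sullivan \<mu> \<alpha>)) \<noteq> 0"
  shows "\<exists>f W lo hi R. continuous_map S.metric.mtopology euclidean f \<and>
    flow_deformation \<Omega> (pattern_dist m) shift (\<lambda>X v. \<alpha> X v + f (shift v X) - f X) W lo hi \<and>
    0 < R \<and> (\<forall>X\<in>\<Omega>. \<forall>Y\<in>\<Omega>. agree R X Y \<longrightarrow> W X = W Y) \<and>
    (\<forall>r. \<exists>M. \<forall>X\<in>\<Omega>. \<forall>Y\<in>\<Omega>. agree M X Y \<longrightarrow> agree r (follow f X) (follow f Y))"
proof -
  obtain f' W lo hi V where *: "continuous_map S.metric.mtopology euclidean f'"
    "flow_deformation \<Omega> (pattern_dist m) shift (\<lambda>X v. \<alpha> X v + (correction (shift v X) + f' (shift v X)) - (correction X + f' X)) W lo hi"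
    "\<And>X Y. X \<in> \<Omega> \<Longrightarrow> Y \<in> \<Omega> \<Longrightarrow> (\<forall>v. norm v \<le> V \<longrightarrow> \<gamma> X v = \<gamma> Y v) \<Longrightarrow> f' X = f' Y \<and> W X = W Y"
    using smooth_representative[OF correction_cont \<mu> det] by (elim exE conjE) (rule that, assumption, assumption, blast)
  let ?f = "\<lambda>X. correction X + f' X"
  have cf: "continuous_map S.metric.mtopology euclidean ?f"
    by (rule S.flow.contI) (intro tendsto_intros S.flow.cont_limit[OF correction_cont] S.flow.cont_limit[OF *(1)])
  obtain R where R: "R > 0" "\<And>X Y. X \<in> \<Omega> \<Longrightarrow> Y \<in> \<Omega> \<Longrightarrow> agree R X Y \<Longrightarrow> f' X = f' Y \<and> W X = W Y"
    using corrected_cocycle_local[of V] *(3) by meson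
  obtain B where B: "B > 0" "\<And>X. X \<in> \<Omega> \<Longrightarrow> norm (f' X) \<le> B" using S.flow.cont_bounded[OF *(1)] by blast
  have loc: "\<exists>M. \<forall>X\<in>\<Omega>. \<forall>Y\<in>\<Omega>. agree M X Y \<longrightarrow> agree r (follow ?f X) (follow ?f Y)" for r
  proof -
    obtain M where M: "M > 0" "\<And>X Y. X \<in> \<Omega> \<Longrightarrow> Y \<in> \<Omega> \<Longrightarrow> agree M X Y \<Longrightarrow> agree (r + B) (shift (correction X) (h X)) (shift (correction Y) (h Y))"
      using correction_local[of "r + B"] by blast
    have "agree r (follow ?f X) (follow ?f Y)" if X: "X \<in> \<Omega>" and Y: "Y \<in> \<Omega>" and ag: "agree (max M R) X Y" for X Y
    proof -
      have "agree r (shift (f' X) (shift (correction X) (h X))) (shift (f' X) (shift (correction Y) (h Y)))"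
        by (rule agree_shift[OF M(2)[OF X Y agree_mono[OF ag]]]) (use B(2)[OF X] in auto)
      moreover have "f' X = f' Y" using R(2)[OF X Y agree_mono[OF ag]] by simp
      ultimately show ?thesis unfolding follow_def by (simp add: shift_add add.commute)
    qed
    then show ?thesis by blast
  qed
  show ?thesis
    by (intro exI[of _ ?f] exI[of _ W] exI[of _ lo] exI[of _ hi] exI[of _ R] conjI cf *(2) R(1) allI loc)
       (use R(2) in blast)
qed

end

section \<open>Moving the control points\<close>

context pattern_space
begin

lemma tile_near_unique:
  assumes X: "X \<in> \<Omega>" "s \<in> X" "s' \<in> X" and t: "compact (fst t)" "fst t \<noteq> {}"
    and "tile_close m (\<kappa> / 2) s t" "tile_close m (\<kappa> / 2) s' t"
  shows "s = s'"
proof (rule ccontr)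
  assume "s \<noteq> s'"
  then have "\<kappa> \<le> hausdorff_dist (fst s) (fst s')" by (rule tile_sep[OF X])
  also have "\<dots> \<le> hausdorff_dist (fst s) (fst t) + hausdorff_dist (fst t) (fst s')"
    using tiles[OF X(1,2)] tiles[OF X(1,3)] t by (intro hausdorff_dist_triangle) auto
  finally show False using assms(6,7) unfolding tile_close_def hausdorff_dist_commute[of "fst t"] by linarith
qed

lemma control_tendsto:
  assumes S: "S \<in> \<Omega>" "t \<in> S" and X: "\<forall>\<^sub>F n in F. \<exists>X\<in>\<Omega>. s n \<in> X"
    and cl: "\<And>e. 0 < e \<Longrightarrow> \<forall>\<^sub>F n in F. tile_close m e (s n) t"
  shows "((\<lambda>n. c (s n)) \<longlongrightarrow> c t) F"
proof -
  interpret P: Metric_space "mspace (prod_metric hausdorff_metric m)" "mdist (prod_metric (hausdorff_metric :: (real ^ 'n) set metric) m)"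
    by (rule Metric_space_mspace_mdist)
  have mem: "u \<in> mspace (prod_metric hausdorff_metric m)" if "Y \<in> \<Omega>" "u \<in> Y" for Y u
    using tiles[OF that] by (cases u) simp
  have "limitin P.mtopology s t F"
    unfolding P.limitin_metric
  proof (intro conjI allI impI mem[OF S])
    fix e :: real assume "e > 0"
    then have "\<forall>\<^sub>F n in F. tile_close m (e/2) (s n) t" by (intro cl) simp
    then show "\<forall>\<^sub>F n in F. s n \<in> mspace (prod_metric hausdorff_metric m) \<and> mdist (prod_metric hausdorff_metric m) (s n) t < e"
      using X
    proof eventually_elim
      case (elim n)
      have "mdist (prod_metric hausdorff_metric m) (s n) t \<le> hausdorff_dist (fst (s n)) (fst t) + mdist m (snd (s n)) (snd t)"
        by (simp add: prod_dist_def case_prod_beta sqrt_sum_squares_le_sum hausdorff_dist_nonneg)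
      moreover have "hausdorff_dist (fst (s n)) (fst t) < e / 2" "mdist m (snd (s n)) (snd t) < e / 2"
        using elim(1) unfolding tile_close_def by auto
      moreover have "s n \<in> mspace (prod_metric hausdorff_metric m)" using elim(2) mem by blast
      ultimately show ?case by linarith
    qed
  qed
  moreover have "\<forall>\<^sub>F n in F. s n \<in> \<Union>\<Omega>" using X by eventually_elim blast
  moreover have "t \<in> \<Union>\<Omega>" using S by blast
  ultimately have "limitin (subtopology P.mtopology (\<Union>\<Omega>)) s t F" unfolding limitin_subtopology by blast
  moreover have "continuous_map (subtopology P.mtopology (\<Union>\<Omega>)) euclidean c"
    using control unfolding control_points_def mtopology_of_def by blast
  ultimately show ?thesis using continuous_map_limit[of "subtopology P.mtopology (\<Union>\<Omega>)" euclidean c s t F] by (simp add: o_def)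
qed

text \<open>
  Within \<open>\<kappa> / 2\<close> a tile of the limit has at most one partner in each pattern of the sequence, so a single
  choice \<open>g\<close> of partners serves all scales of closeness.
\<close>

lemma limit_tiles:
  assumes lim: "limitin metric.mtopology \<sigma> S F"
  shows "\<exists>g. (\<forall>t\<in>S. \<forall>e>0. \<forall>\<^sub>F n in F. g n t \<in> \<sigma> n \<and> tile_close m e (g n t) t) \<and>
    (\<forall>K. \<forall>\<^sub>F n in F. \<forall>s\<in>\<sigma> n. norm (c s) < K \<longrightarrow> (\<exists>t\<in>S. norm (c t) \<le> K + 1 + D \<and> s = g n t))"
proof -
  have S: "S \<in> \<Omega>" using lim limitin_iff by blast
  have ct: "compact (fst t)" "fst t \<noteq> {}" if "t \<in> S" for t using tiles[OF S that] by auto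
  define g where "g = (\<lambda>n t. SOME s. s \<in> \<sigma> n \<and> tile_close m (\<kappa> / 2) s t)"
  have g: "g n t = s" if "\<sigma> n \<in> \<Omega>" "s \<in> \<sigma> n" "t \<in> S" "tile_close m (\<kappa> / 2) s t" for n s t
    unfolding g_def by (rule some_equality) (use that tile_near_unique[OF that(1)] ct[OF that(3)] in blast)+
  have mono: "tile_close m d s t" if "tile_close m e s t" "e \<le> d" for d e s t
    using that unfolding tile_close_def by linarith
  have "\<forall>\<^sub>F n in F. (\<forall>t\<in>S. norm (c t) < K \<longrightarrow> g n t \<in> \<sigma> n \<and> tile_close m e (g n t) t) \<and>
      (\<forall>s\<in>\<sigma> n. norm (c s) < K \<longrightarrow> (\<exists>t\<in>S. norm (c t) \<le> K + 1 + D \<and> s = g n t))" if e: "e > 0" for e K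
  proof -
    \<comment> \<open>the ball of radius \<open>1 / d\<close> contains all control points in question\<close>
    define d where "d = min (min e (\<kappa> / 2)) (min 1 (1 / (\<bar>K\<bar> + 1)))"
    have d: "0 < d" "d \<le> e" "d \<le> \<kappa> / 2" "d \<le> 1" "d \<le> 1 / (\<bar>K\<bar> + 1)" unfolding d_def using e \<kappa>_pos by (auto simp: min_le_iff_disj)
    have "\<bar>K\<bar> + 1 \<le> 1 / d" using d(1,5) by (simp add: field_simps)
    then have K: "K \<le> 1 / d" by linarith
    have vis: "fst s \<inter> ball 0 (1 / d) \<noteq> {}" if "X \<in> \<Omega>" "s \<in> X" "norm (c s) < K" for X s
      using control_mem[OF that(1,2)] that(3) K by (force simp: disjoint_iff)
    show ?thesis using limitin_close[OF lim d(1)]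
    proof eventually_elim
      case (elim n)
      obtain S0 T0 f where *: "patch (\<sigma> n) 0 (1/d) \<subseteq> S0" "S0 \<subseteq> \<sigma> n" "patch S 0 (1/d) \<subseteq> T0" "T0 \<subseteq> S"
          "bij_betw f S0 T0" "\<forall>t\<in>S0. tile_close m d t (f t)" using elim unfolding close_iff by blast
      show ?case
      proof (intro conjI ballI impI)
        fix t assume t: "t \<in> S" "norm (c t) < K"
        then have "t \<in> T0" using *(3) vis[OF S] unfolding patch_def by blast
        then obtain s where s: "s \<in> S0" "f s = t" using bij_betw_imp_surj_on[OF *(5)] by blast
        then have s': "s \<in> \<sigma> n" "tile_close m d s t" using * by blast+
        then have "g n t = s" using elim t(1) mono[OF s'(2) d(3)] by (intro g) auto
        then show "g n t \<in> \<sigma> n" "tile_close m e (g n t) t" using s' mono[OF s'(2) d(2)] by auto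
      next
        fix s assume s: "s \<in> \<sigma> n" "norm (c s) < K"
        then have "s \<in> S0" using *(1) vis elim unfolding patch_def by blast
        then have f: "f s \<in> S" "tile_close m d s (f s)" using * bij_betwE[OF *(5)] by blast+
        have "g n (f s) = s" using elim s f mono[OF f(2) d(3)] by (intro g) auto
        moreover obtain b where b: "b \<in> fst (f s)" "dist (c s) b \<le> hausdorff_dist (fst s) (fst (f s))"
          using hausdorff_dist_near_point[of "fst s" "fst (f s)" "c s"] tiles[of "\<sigma> n" s] ct[OF f(1)] control_mem elim s by blast
        have "norm (c (f s)) \<le> norm (c s) + dist (c s) b + dist b (c (f s))"
          using dist_triangle[of 0 "c (f s)" "c s"] dist_triangle[of "c s" "c (f s)" b] by simp
        then have "norm (c (f s)) \<le> K + 1 + D"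
          using b(2) f(2) d(4) s(2) tile_diam[OF S f(1) b(1)] unfolding tile_close_def by linarith
        ultimately show "\<exists>t\<in>S. norm (c t) \<le> K + 1 + D \<and> s = g n t" using f(1) by (intro bexI[of _ "f s"]) auto
      qed
    qed
  qed note key = this
  show ?thesis
  proof (intro exI[of _ g] conjI ballI allI impI)
    fix t e assume t: "t \<in> S" and e: "0 < (e :: real)"
    show "\<forall>\<^sub>F n in F. g n t \<in> \<sigma> n \<and> tile_close m e (g n t) t"
      using key[OF e, of "norm (c t) + 1"] by eventually_elim (use t in auto)
  next
    fix K show "\<forall>\<^sub>F n in F. \<forall>s\<in>\<sigma> n. norm (c s) < K \<longrightarrow> (\<exists>t\<in>S. norm (c t) \<le> K + 1 + D \<and> s = g n t)"
      using key[OF zero_less_one, of K] by (rule eventually_mono) blast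
  qed
qed

lemma finite_controlled: "X \<in> \<Omega> \<Longrightarrow> finite {t \<in> X. norm (c t) \<le> K}"
  by (rule finite_subset[OF _ finite_patch[of X 0 "K + 1"]]) (use control_mem in \<open>force simp: patch_def disjoint_iff\<close>)+

end

text \<open>
  The points of the deformed pattern are the control points moved by \<open>\<beta>\<close>.  The label of a point is
  computed from the pattern recentred at it; \<open>lab\<close> is only meaningful, and only has to be continuous, on
  patterns with a control point at the origin.
\<close>

locale deformed_space = pattern_space m \<Omega> c \<kappa> D + deformation: flow_deformation \<Omega> "pattern_dist m" shift \<beta> W lo hi
  for m :: "'l metric" and \<Omega> :: "('n::finite, 'l) pattern set" and c \<kappa> D \<beta> W lo hi +
  fixes m1 :: "('n, 'l) pattern metric" and lab :: "('n, 'l) pattern \<Rightarrow> ('n, 'l) pattern"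
  assumes lab_mem: "X \<in> \<Omega> \<Longrightarrow> t \<in> X \<Longrightarrow> c t = 0 \<Longrightarrow> lab X \<in> mspace m1"
    and lab_limit: "limitin metric.mtopology \<sigma> X sequentially \<Longrightarrow> \<forall>\<^sub>F n in sequentially. \<exists>t\<in>\<sigma> n. c t = 0 \<Longrightarrow>
      \<exists>t\<in>X. c t = 0 \<Longrightarrow> (\<lambda>n. mdist m1 (lab (\<sigma> n)) (lab X)) \<longlonglongrightarrow> 0"
    and compact_m1: "compact_space (mtopology_of m1)"
begin

definition moved :: "('n, 'l) pattern \<Rightarrow> ('n, 'l) tile \<Rightarrow> ('n, ('n, 'l) pattern) tile" where
  "moved X t = ({\<beta> X (c t)}, lab (shift (c t) X))"

definition deform :: "('n, 'l) pattern \<Rightarrow> ('n, ('n, 'l) pattern) pattern" where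
  "deform X = moved X ` X"

lemma moved_meets: "fst (moved X t) \<inter> ball 0 r \<noteq> {} \<longleftrightarrow> norm (\<beta> X (c t)) < r"
  unfolding moved_def by simp

lemma \<beta>_0: "X \<in> \<Omega> \<Longrightarrow> \<beta> X 0 = 0"
  by (rule deformation.cocycle_0)

lemma \<beta>_shift: "X \<in> \<Omega> \<Longrightarrow> \<beta> (shift v X) u = \<beta> X (v + u) - \<beta> X v"
  by (rule deformation.cocycle_diff[symmetric])

lemma \<beta>_inject: "X \<in> \<Omega> \<Longrightarrow> \<beta> X u = \<beta> X v \<Longrightarrow> u = v"
  using deformation.lower[of X u v] deformation.c_pos by (simp add: mult_le_0_iff)

lemma \<beta>_lower: "X \<in> \<Omega> \<Longrightarrow> lo * norm u \<le> norm (\<beta> X u)"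
  using deformation.lower[of X u 0] \<beta>_0 by simp

lemma \<beta>_upper: "X \<in> \<Omega> \<Longrightarrow> norm (\<beta> X u) \<le> hi * norm u"
  using deformation.upper_lip[of X u 0] \<beta>_0 by simp

lemma hi_pos: assumes "X \<in> \<Omega>" shows "0 < hi"
proof -
  obtain u :: "real ^ 'n" where "norm u = 1" using vector_choose_size[of 1] by auto
  then show ?thesis using \<beta>_lower[OF assms, of u] \<beta>_upper[OF assms, of u] deformation.c_pos by simp
qed

lemma moved_inject: "X \<in> \<Omega> \<Longrightarrow> s \<in> X \<Longrightarrow> t \<in> X \<Longrightarrow> moved X s = moved X t \<Longrightarrow> s = t"
  using control_inj \<beta>_inject unfolding moved_def by blast

lemma pinned_shift: "X \<in> \<Omega> \<Longrightarrow> t \<in> X \<Longrightarrow> \<exists>s\<in>shift (c t) X. c s = 0"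
  using control_shift[of X t "c t"] by (intro bexI[of _ "shift_tile (c t) t"]) auto

lemma lab_shift_mem: 
  assumes "X \<in> \<Omega>" "t \<in> X" shows "lab (shift (c t) X) \<in> mspace m1"
  using pinned_shift[OF assms] lab_mem[OF shift_closed[OF assms(1)]] by blast

text \<open>The cocycle equation for \<open>\<beta>\<close> says exactly that moving the points commutes with translation up to \<open>\<beta>\<close>.\<close>

lemma moved_shift:
  assumes X: "X \<in> \<Omega>" and t: "t \<in> X"
  shows "moved (shift v X) (shift_tile v t) = shift_tile (\<beta> X v) (moved X t)"
proof -
  have "lab (shift (c (shift_tile v t)) (shift v X)) = lab (shift (c t) X)"
    unfolding control_shift[OF X t] shift_add by simp
  then show ?thesis unfolding moved_def control_shift[OF X t] \<beta>_shift[OF X] by (simp add: shift_tile_def)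
qed

lemma deform_shift: "X \<in> \<Omega> \<Longrightarrow> deform (shift v X) = shift (\<beta> X v) (deform X)"
  unfolding deform_def shift_def[of "\<beta> X v"] shift_def[of v X] image_image
  by (intro image_cong refl) (simp add: moved_shift flip: shift_def)

lemma delone_control: assumes X: "X \<in> \<Omega>" shows "delone (c ` X)"
  unfolding delone_def
proof (intro conjI exI allI impI ballI)
  show "0 < \<kappa>" by (rule \<kappa>_pos)
  show "\<kappa> \<le> dist p q" if "p \<in> c ` X" "q \<in> c ` X" "p \<noteq> q" for p q using that control_sep[OF X] by blast
  show "\<exists>p\<in>c ` X. dist x p \<le> D" for x using control_dense[OF X] by blast
qed

lemma deform_delone: assumes X: "X \<in> \<Omega>" shows "delone_pattern m1 (deform X)"
proof -
  let ?P = "\<beta> X ` c ` X" and ?l = "\<lambda>q. lab (shift (inv (\<beta> X) q) X)"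
  have inv: "inv (\<beta> X) (\<beta> X p) = p" for p using \<beta>_inject[OF X] by (intro inv_f_f injI)
  have "delone ?P"
    unfolding delone_def
  proof (intro conjI exI ballI allI impI)
    show "0 < lo * \<kappa>" using deformation.c_pos \<kappa>_pos by simp
    fix p q assume "p \<in> ?P" "q \<in> ?P" "p \<noteq> q"
    then obtain s t where st: "s \<in> X" "t \<in> X" "s \<noteq> t" "p = \<beta> X (c s)" "q = \<beta> X (c t)" by blast
    have "lo * \<kappa> \<le> lo * dist (c s) (c t)"
      using control_sep[OF X st(1-3)] deformation.c_pos by (intro mult_left_mono) auto
    also have "\<dots> \<le> dist p q" unfolding st dist_norm by (rule deformation.lower[OF X])
    finally show "lo * \<kappa> \<le> dist p q" .
  next
    fix x
    obtain y where y: "x = \<beta> X y" using deformation.surj_\<beta>[OF X] unfolding surj_def by blast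
    obtain t where t: "t \<in> X" "dist y (c t) \<le> D" using control_dense[OF X] by blast
    have "dist x (\<beta> X (c t)) \<le> hi * dist y (c t)" unfolding y dist_norm by (rule deformation.upper_lip[OF X])
    also have "\<dots> \<le> hi * D" using t(2) hi_pos[OF X] by (intro mult_left_mono) auto
    finally show "\<exists>p\<in>?P. dist x p \<le> hi * D" using t(1) by blast
  qed
  moreover have "?l ` ?P \<subseteq> mspace m1" using lab_shift_mem[OF X] inv by auto
  moreover have "deform X = (\<lambda>q. ({q}, ?l q)) ` ?P" unfolding deform_def moved_def image_image inv ..
  ultimately show ?thesis unfolding delone_pattern_def by blast
qed

lemma moved_tendsto:
  assumes lim: "limitin metric.mtopology \<sigma> X sequentially" and t: "t \<in> X"
    and g: "\<And>e. e > 0 \<Longrightarrow> \<forall>\<^sub>F n in sequentially. g n \<in> \<sigma> n \<and> tile_close m e (g n) t" and e: "0 < e"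
  shows "\<forall>\<^sub>F n in sequentially. tile_close m1 e (moved (\<sigma> n) (g n)) (moved X t)"
proof -
  have X: "X \<in> \<Omega>" using lim limitin_iff by blast
  have ev: "\<forall>\<^sub>F n in sequentially. \<sigma> n \<in> \<Omega> \<and> g n \<in> \<sigma> n"
    using limitin_close[OF lim, of 1] g[of 1] by (auto elim: eventually_elim2)
  have ct: "(\<lambda>n. c (g n)) \<longlonglongrightarrow> c t"
  proof (rule control_tendsto[OF X t])
    show "\<forall>\<^sub>F n in sequentially. \<exists>X\<in>\<Omega>. g n \<in> X" using ev by eventually_elim blast
    show "\<forall>\<^sub>F n in sequentially. tile_close m e (g n) t" if "e > 0" for e using g[OF that] by eventually_elim blast
  qed
  have "(\<lambda>n. dist (\<beta> (\<sigma> n) (c (g n))) (\<beta> X (c t))) \<longlonglongrightarrow> 0"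
    using deformation.cocycle_limit[OF lim ct] by (rule tendsto_dist_iff[THEN iffD1])
  then have 1: "\<forall>\<^sub>F n in sequentially. dist (\<beta> (\<sigma> n) (c (g n))) (\<beta> X (c t)) < e" using e by (rule order_tendstoD(2))
  have "\<forall>\<^sub>F n in sequentially. \<exists>s\<in>shift (c (g n)) (\<sigma> n). c s = 0"
    using ev by eventually_elim (use pinned_shift in blast)
  from lab_limit[OF limitin_shift[OF lim ct] this pinned_shift[OF X t]]
  have 2: "\<forall>\<^sub>F n in sequentially. mdist m1 (lab (shift (c (g n)) (\<sigma> n))) (lab (shift (c t) X)) < e"
    using e by (rule order_tendstoD(2))
  from 1 2 show ?thesis
    by eventually_elim (simp add: tile_close_def moved_def hausdorff_dist_singleton)
qed

lemma deform_close:
  assumes lim: "limitin metric.mtopology \<sigma> X sequentially" and e: "0 < e"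
  shows "\<forall>\<^sub>F n in sequentially. close m1 e (deform (\<sigma> n)) (deform X)"
proof -
  have X: "X \<in> \<Omega>" using lim limitin_iff by blast
  obtain g where "(\<forall>t\<in>X. \<forall>e>0. \<forall>\<^sub>F n in sequentially. g n t \<in> \<sigma> n \<and> tile_close m e (g n t) t) \<and>
    (\<forall>K. \<forall>\<^sub>F n in sequentially. \<forall>s\<in>\<sigma> n. norm (c s) < K \<longrightarrow> (\<exists>t\<in>X. norm (c t) \<le> K + 1 + D \<and> s = g n t))"
    using limit_tiles[OF lim] by (rule exE)
  then have g: "\<And>t e. t \<in> X \<Longrightarrow> e > 0 \<Longrightarrow> \<forall>\<^sub>F n in sequentially. g n t \<in> \<sigma> n \<and> tile_close m e (g n t) t"
    "\<And>K. \<forall>\<^sub>F n in sequentially. \<forall>s\<in>\<sigma> n. norm (c s) < K \<longrightarrow> (\<exists>t\<in>X. norm (c t) \<le> K + 1 + D \<and> s = g n t)"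
    by simp_all
  \<comment> \<open>a moved point in the ball of radius \<open>1/e\<close> comes from a control point in the ball of radius \<open>K\<close>\<close>
  define K where "K = 1 / (e * lo)"
  define B where "B = {t \<in> X. norm (c t) \<le> K + 1 + D}"
  have finB: "finite B" unfolding B_def by (rule finite_controlled[OF X])
  have small: "norm (c s) < K" if "Y \<in> \<Omega>" "norm (\<beta> Y (c s)) < 1 / e" for Y s
  proof -
    have "lo * norm (c s) < 1 / e" using \<beta>_lower[OF that(1), of "c s"] that(2) by linarith
    then show ?thesis using e deformation.c_pos unfolding K_def by (simp add: field_simps)
  qed
  have "\<forall>\<^sub>F n in sequentially. \<forall>t\<in>B. g n t \<in> \<sigma> n \<and> tile_close m (\<kappa> / 2) (g n t) t"
    using g(1)[of _ "\<kappa> / 2"] \<kappa>_pos finB by (intro eventually_ball_finite) (auto simp: B_def)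
  moreover have "\<forall>\<^sub>F n in sequentially. \<forall>t\<in>B. tile_close m1 e (moved (\<sigma> n) (g n t)) (moved X t)"
    using moved_tendsto[OF lim _ g(1) e] finB by (intro eventually_ball_finite) (auto simp: B_def)
  ultimately show ?thesis using g(2)[of K] limitin_close[OF lim zero_less_one]
  proof eventually_elim
    case (elim n)
    have Y: "\<sigma> n \<in> \<Omega>" using elim by blast
    let ?F = "\<lambda>t. moved (\<sigma> n) (g n t)"
    have BX: "t \<in> X" if "t \<in> B" for t using that unfolding B_def by blast
    have "inj_on ?F B"
    proof (rule inj_onI)
      fix s t assume st: "s \<in> B" "t \<in> B" "?F s = ?F t"
      then have eq: "g n s = g n t" using moved_inject[OF Y] elim by blast
      have "hausdorff_dist (fst s) (fst t) \<le> hausdorff_dist (fst s) (fst (g n t)) + hausdorff_dist (fst (g n t)) (fst t)"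
        using tiles[OF X BX] tiles[OF Y, of "g n t"] elim st by (intro hausdorff_dist_triangle) auto
      moreover have "hausdorff_dist (fst (g n t)) (fst s) < \<kappa> / 2" "hausdorff_dist (fst (g n t)) (fst t) < \<kappa> / 2"
        using elim(1) st eq unfolding tile_close_def by metis+
      ultimately have "hausdorff_dist (fst s) (fst t) < \<kappa>" by (simp add: hausdorff_dist_commute)
      then show "s = t" using tile_sep[OF X BX[OF st(1)] BX[OF st(2)]] by (meson not_less)
    qed
    then have F: "bij_betw (inv_into B ?F) (?F ` B) B" by (intro bij_betw_inv_into) (simp add: bij_betw_def)
    have G: "bij_betw (moved X) B (moved X ` B)"
      unfolding bij_betw_def by (intro conjI refl inj_onI moved_inject[OF X] BX)
    have 1: "patch (deform (\<sigma> n)) 0 (1 / e) \<subseteq> ?F ` B"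
    proof
      fix p assume "p \<in> patch (deform (\<sigma> n)) 0 (1 / e)"
      then obtain s where s: "s \<in> \<sigma> n" "p = moved (\<sigma> n) s" "norm (\<beta> (\<sigma> n) (c s)) < 1 / e"
        unfolding patch_def deform_def moved_meets[symmetric] by blast
      then obtain t where "t \<in> B" "s = g n t" using elim(3) small[OF Y] unfolding B_def by blast
      then show "p \<in> ?F ` B" using s by blast
    qed
    have 2: "patch (deform X) 0 (1 / e) \<subseteq> moved X ` B"
    proof
      fix p assume "p \<in> patch (deform X) 0 (1 / e)"
      then obtain s where s: "s \<in> X" "p = moved X s" "norm (\<beta> X (c s)) < 1 / e"
        unfolding patch_def deform_def moved_meets[symmetric] by blast
      moreover have "norm (c s) < K" by (rule small[OF X s(3)])
      ultimately have "s \<in> B" using D_nonneg[OF X] unfolding B_def by simp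
      then show "p \<in> moved X ` B" using s by blast
    qed
    have 3: "tile_close m1 e (?F t) ((moved X \<circ> inv_into B ?F) (?F t))" if "t \<in> B" for t
      using elim(2) that inv_into_f_f[OF \<open>inj_on ?F B\<close> that] by simp
    show ?case
      unfolding close_iff
    proof (intro exI conjI)
      show "bij_betw (moved X \<circ> inv_into B ?F) (?F ` B) (moved X ` B)" by (rule bij_betw_trans[OF F G])
      show "\<forall>p\<in>?F ` B. tile_close m1 e p ((moved X \<circ> inv_into B ?F) p)" using 3 by blast
      show "?F ` B \<subseteq> deform (\<sigma> n)" using elim(1) unfolding deform_def by blast
      show "moved X ` B \<subseteq> deform X" using BX unfolding deform_def by blast
    qed (rule 1 2)+
  qed
qed

end

context deformed_space
begin

text \<open>Needed to see that the compact image of \<open>\<Omega>\<close> is closed among all Delone patterns.\<close>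

lemma delone_Hausdorff: "Hausdorff_space (tiling_topology m1 {P :: ('n, ('n, 'l) pattern) pattern. delone_pattern m1 P})"
proof -
  have N: "locally_finite_pattern m1 P" if "P \<in> {P :: ('n, ('n, 'l) pattern) pattern. delone_pattern m1 P}" for P
    using that locally_finite_delone_pattern by blast
  show ?thesis
    using Metric_space.Hausdorff_space_mtopology[OF Metric_space_pattern_dist[OF N]] tiling_topology_eq_mtopology[OF N]
    by metis
qed

lemma deform_continuous:
  assumes N: "deform ` \<Omega> \<subseteq> N" "\<And>P. P \<in> N \<Longrightarrow> delone_pattern m1 P"
  shows "continuous_map (tiling_topology m \<Omega>) (tiling_topology m1 N) deform"
  unfolding topology_eq
proof (rule metric.continuous_map_sequentially)
  fix \<sigma> l assume lim: "limitin metric.mtopology \<sigma> l sequentially" and R: "range \<sigma> \<subseteq> \<Omega>"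
  have "\<forall>\<^sub>F n in sequentially. deform (\<sigma> n) \<in> N \<and> close m1 e (deform (\<sigma> n)) (deform l)" if "e > 0" for e
    using deform_close[OF lim that] by eventually_elim (use R N(1) in blast)
  moreover have "deform l \<in> N" using lim limitin_iff N(1) by blast
  ultimately show "limitin (tiling_topology m1 N) (\<lambda>n. deform (\<sigma> n)) (deform l) sequentially"
    using limitin_tiling_topology[of N m1] N(2) locally_finite_delone_pattern by blast
qed

lemma deform_compact:
  assumes N: "deform ` \<Omega> \<subseteq> N" "\<And>P. P \<in> N \<Longrightarrow> delone_pattern m1 P"
  shows "compactin (tiling_topology m1 N) (deform ` \<Omega>)"
  by (rule image_compactin[OF _ deform_continuous[OF N]]) (use compact_\<Omega> in \<open>simp_all add: compact_space_def\<close>)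

text \<open>
  The image of \<open>\<Omega>\<close> is compact and contains the orbit, and by minimality the orbit is dense in it.
\<close>

lemma orbit_closure_deform:
  assumes min: "minimal m \<Omega>" and T: "T \<in> \<Omega>"
  shows "orbit_closure m1 (deform T) = deform ` \<Omega>"
proof
  let ?N = "{P :: ('n, ('n, 'l) pattern) pattern. delone_pattern m1 P}"
  have N: "deform ` \<Omega> \<subseteq> ?N" using deform_delone by blast
  have orb: "orbit (deform T) \<subseteq> deform ` \<Omega>"
  proof
    fix P assume "P \<in> orbit (deform T)"
    then obtain x where x: "P = shift x (deform T)" unfolding orbit_def by blast
    obtain v where "x = \<beta> T v" using deformation.surj_\<beta>[OF T] unfolding surj_def by blast
    then have "P = deform (shift v T)" unfolding x deform_shift[OF T] by simp
    then show "P \<in> deform ` \<Omega>" using shift_closed[OF T] by blast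
  qed
  show "orbit_closure m1 (deform T) \<subseteq> deform ` \<Omega>"
    unfolding orbit_closure_def
    by (rule closure_of_minimal[OF orb compactin_imp_closedin[OF delone_Hausdorff deform_compact[OF N]]]) simp
  have "deform ` orbit T \<subseteq> orbit (deform T)" unfolding orbit_def using deform_shift[OF T] by auto
  then have "tiling_topology m1 ?N closure_of (deform ` orbit T) \<subseteq> orbit_closure m1 (deform T)"
    unfolding orbit_closure_def by (rule closure_of_mono)
  moreover have "continuous_map (tiling_topology m \<Omega>) (tiling_topology m1 ?N) deform"
    by (rule deform_continuous[OF N]) simp
  from continuous_map_image_closure_subset[OF this, of "orbit T"]
  have "deform ` \<Omega> \<subseteq> tiling_topology m1 ?N closure_of (deform ` orbit T)"
    using min T unfolding minimal_def by simp
  ultimately show "deform ` \<Omega> \<subseteq> orbit_closure m1 (deform T)" by blast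
qed

lemma deform_homeomorphic:
  assumes inj: "inj_on deform \<Omega>"
  shows "homeomorphic_map (tiling_topology m \<Omega>) (tiling_topology m1 (deform ` \<Omega>)) deform"
proof (rule continuous_imp_homeomorphic_map)
  have N: "locally_finite_pattern m1 P" if "P \<in> deform ` \<Omega>" for P
    using that deform_delone locally_finite_delone_pattern by blast
  show "continuous_map (tiling_topology m \<Omega>) (tiling_topology m1 (deform ` \<Omega>)) deform"
    by (rule deform_continuous) (use deform_delone in auto)
  show "Hausdorff_space (tiling_topology m1 (deform ` \<Omega>))"
    using Metric_space.Hausdorff_space_mtopology[OF Metric_space_pattern_dist[OF N]] tiling_topology_eq_mtopology[OF N]
    by metis
qed (use compact_\<Omega> inj in simp_all)

lemma deform_tiling_space: "tiling_space m1 (deform ` \<Omega>)"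
  unfolding tiling_space_def
proof (intro conjI disjI2 ballI allI)
  show "compact_space (mtopology_of m1)" by (rule compact_m1)
  show "delone_pattern m1 P" if "P \<in> deform ` \<Omega>" for P using that deform_delone by blast
  have "compactin (tiling_topology m1 (deform ` \<Omega>)) (deform ` \<Omega>)" by (rule deform_compact) (use deform_delone in auto)
  then show "compact_space (tiling_topology m1 (deform ` \<Omega>))" by (simp add: compact_space_def)
  fix P x assume "P \<in> deform ` \<Omega>"
  then obtain X where X: "X \<in> \<Omega>" "P = deform X" by blast
  obtain v where "x = \<beta> X v" using deformation.surj_\<beta>[OF X(1)] unfolding surj_def by blast
  then have "shift x P = deform (shift v X)" unfolding X(2) deform_shift[OF X(1)] by simp
  then show "shift x P \<in> deform ` \<Omega>" using shift_closed[OF X(1)] by blast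
qed

lemma deform_extends:
  assumes inj: "inj_on deform \<Omega>" and T: "T \<in> \<Omega>"
  shows "extends_deformation m \<Omega> m1 (deform ` \<Omega>) T (deform T) (\<beta> T) deform"
  unfolding extends_deformation_def using deform_homeomorphic[OF inj] deform_shift[OF T] by blast

text \<open>
  Both \<open>g\<close> and \<open>deform\<close> turn a translation by \<open>v\<close> into one by \<open>\<beta> X v\<close>; hence \<open>g\<close> composed with the inverse
  of \<open>deform\<close> commutes with translations.
\<close>

lemma factor_through_deform:
  assumes inj: "inj_on deform \<Omega>" and g: "continuous_map (tiling_topology m \<Omega>) (tiling_topology m' \<Omega>') g"
    and onto: "g ` \<Omega> = \<Omega>'" and T': "tiling_space m' \<Omega>'"
    and equiv: "\<And>X v. X \<in> \<Omega> \<Longrightarrow> g (shift v X) = shift (\<beta> X v) (g X)"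
  shows "\<exists>\<phi>. factor_map m1 (deform ` \<Omega>) m' \<Omega>' \<phi> \<and> (\<forall>X\<in>\<Omega>. \<phi> (deform X) = g X)"
proof -
  obtain k where k: "homeomorphic_maps (tiling_topology m \<Omega>) (tiling_topology m1 (deform ` \<Omega>)) deform k"
    using deform_homeomorphic[OF inj] unfolding homeomorphic_map_maps by blast
  then have kd: "k (deform X) = X" if "X \<in> \<Omega>" for X using that unfolding homeomorphic_maps_def by simp
  let ?\<phi> = "g \<circ> k"
  have "tiling_map m1 (deform ` \<Omega>) m' \<Omega>' ?\<phi>"
    unfolding tiling_map_def using k unfolding homeomorphic_maps_def by (intro continuous_map_compose[OF _ g]) blast
  moreover have "?\<phi> ` deform ` \<Omega> = \<Omega>'" using kd onto by (simp add: image_image cong: image_cong)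
  moreover have "?\<phi> (shift x P) = shift x (?\<phi> P)" if P: "P \<in> deform ` \<Omega>" for P x
  proof -
    obtain X where X: "X \<in> \<Omega>" "P = deform X" using P by blast
    obtain v where v: "x = \<beta> X v" using deformation.surj_\<beta>[OF X(1)] unfolding surj_def by blast
    have "shift x P = deform (shift v X)" unfolding X(2) v deform_shift[OF X(1)] by simp
    then show ?thesis using X v kd shift_closed equiv by simp
  qed
  ultimately show ?thesis
    unfolding factor_map_def using deform_tiling_space T' kd by (intro exI[of _ ?\<phi>]) simp
qed

lemma \<beta>_homeomorphism:
  assumes X: "X \<in> \<Omega>" shows "homeomorphic_map euclidean euclidean (\<beta> X)"
proof -
  have inv: "inv (\<beta> X) (\<beta> X p) = p" for p using \<beta>_inject[OF X] by (intro inv_f_f injI)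
  have inv': "\<beta> X (inv (\<beta> X) p) = p" for p by (rule surj_f_inv_f[OF deformation.surj_\<beta>[OF X]])
  have "continuous_on UNIV (inv (\<beta> X))"
  proof (rule lipschitz_on_continuous_on[OF lipschitz_onI])
    show "0 \<le> 1 / lo" using deformation.c_pos by simp
    show "dist (inv (\<beta> X) x) (inv (\<beta> X) y) \<le> 1 / lo * dist x y" for x y
      using deformation.lower[OF X, of "inv (\<beta> X) x" "inv (\<beta> X) y"] deformation.c_pos
      unfolding inv' by (simp add: dist_norm field_simps)
  qed
  then show ?thesis
    unfolding homeomorphic_map_maps homeomorphic_maps_def
    using deformation.cocycle_continuous_on[OF X] inv inv' by (intro exI[of _ "inv (\<beta> X)"]) simp
qed

lemma weakly_PE: 
  assumes X: "X \<in> \<Omega>" shows "weakly_PE_form m \<Omega> X (\<lambda>x. W (shift x X))"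
  unfolding weakly_PE_form_def weakly_PE_fun_def topology_eq
  using deformation.form_smooth[OF X] deformation.form_weakly_PE[OF X] by blast

lemma deformed_pattern_eq: 
  assumes X: "X \<in> \<Omega>" shows "deformed_pattern (\<beta> X) (\<lambda>p. lab (shift p X)) (c ` X) = deform X"
  unfolding deformed_pattern_def deform_def moved_def image_image ..

lemma associated: "X \<in> \<Omega> \<Longrightarrow> associated_delone m \<Omega> X (c ` X)"
  unfolding associated_delone_def using delone_control control by blast

end

context pattern_space
begin

lemma pinned_exists: "\<Omega> \<noteq> {} \<Longrightarrow> \<exists>T\<in>\<Omega>. \<exists>t\<in>T. c t = 0"
proof -
  assume "\<Omega> \<noteq> {}"
  then obtain X where X: "X \<in> \<Omega>" by blast
  obtain t where t: "t \<in> X" using control_dense[OF X] by blast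
  show ?thesis
    using control_shift[OF X t, of "c t"] t by (intro bexI[OF _ shift_closed[OF X, of "c t"]] bexI[of _ "shift_tile (c t) t"]) auto
qed

text \<open>
  In the general case the labels remember the whole pattern, so that a single point of the deformed
  pattern determines the original up to the translation fixed by the position of the point.
\<close>

lemma weak_deformation_exists:
  assumes fd: "flow_deformation \<Omega> (pattern_dist m) shift \<beta> W lo hi"
    and min: "minimal m \<Omega>" and ne: "\<Omega> \<noteq> {}"
    and g: "continuous_map (tiling_topology m \<Omega>) (tiling_topology m' \<Omega>') g"
    and onto: "g ` \<Omega> = \<Omega>'" and T': "tiling_space m' \<Omega>'"
    and equiv: "\<And>X v. X \<in> \<Omega> \<Longrightarrow> g (shift v X) = shift (\<beta> X v) (g X)"
  shows "\<exists>m1 \<Omega>1 h0 \<phi>. weak_shape_deformation m \<Omega> m1 \<Omega>1 h0 \<and> factor_map m1 \<Omega>1 m' \<Omega>' \<phi> \<and> (\<forall>X\<in>\<Omega>. \<phi> (h0 X) = g X)"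
proof -
  let ?m1 = "metric (\<Omega>, pattern_dist m)"
  interpret deformed_space m \<Omega> c \<kappa> D \<beta> W lo hi ?m1 "\<lambda>X. X"
  proof (intro deformed_space.intro pattern_space_axioms fd deformed_space_axioms.intro)
    fix X and \<sigma> :: "nat \<Rightarrow> ('n, 'l) pattern" assume "limitin metric.mtopology \<sigma> X sequentially"
    then show "(\<lambda>n. mdist ?m1 (\<sigma> n) X) \<longlonglongrightarrow> 0"
      by (simp add: metric.mdist_metric metric.limitin_metric_dist_null)
  qed (simp_all add: metric.mspace_metric metric.mtopology_of flow.compact_M)
  have inj: "inj_on deform \<Omega>"
  proof (rule inj_onI)
    fix X Y assume XY: "X \<in> \<Omega>" "Y \<in> \<Omega>" "deform X = deform Y"
    obtain t where t: "t \<in> X" using control_dense[OF XY(1)] by blast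
    then have "moved X t \<in> deform Y" using XY(3) unfolding deform_def by blast
    then obtain s where "s \<in> Y" "moved X t = moved Y s" unfolding deform_def by blast
    then have s: "\<beta> X (c t) = \<beta> Y (c s)" "shift (c t) X = shift (c s) Y" unfolding moved_def by auto
    have "Y = shift (- c s) (shift (c t) X)" unfolding s(2) by (simp add: shift_add)
    then have Y: "Y = shift (c t - c s) X" by (simp add: shift_add)
    then have "\<beta> Y (c s) = \<beta> X (c t) - \<beta> X (c t - c s)" using \<beta>_shift[OF XY(1), of "c t - c s" "c s"] by simp
    then have "\<beta> X (c t - c s) = \<beta> X 0" using s(1) \<beta>_0[OF XY(1)] by simp
    then have "c t - c s = 0" using \<beta>_inject[OF XY(1)] by blast
    then show "X = Y" using Y by simp
  qed
  obtain \<phi> where \<phi>: "factor_map ?m1 (deform ` \<Omega>) m' \<Omega>' \<phi>" "\<forall>X\<in>\<Omega>. \<phi> (deform X) = g X"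
    using factor_through_deform[OF inj g onto T' equiv] by blast
  obtain T where T: "T \<in> \<Omega>" "0 \<in> c ` T" using pinned_exists[OF ne] by (metis image_eqI)
  have "weak_shape_deformation m \<Omega> ?m1 (deform ` \<Omega>) deform"
    unfolding weak_shape_deformation_def
  proof (intro conjI exI)
    show "mspace ?m1 = \<Omega>" by (rule metric.mspace_metric)
    show "mtopology_of ?m1 = tiling_topology m \<Omega>" unfolding topology_eq by (rule metric.mtopology_of)
    show "T \<in> \<Omega>" "0 \<in> c ` T" by (rule T)+
    show "associated_delone m \<Omega> T (c ` T)" by (rule associated[OF T(1)])
    show "weakly_PE_form m \<Omega> T (\<lambda>x. W (shift x T))" by (rule weakly_PE[OF T(1)])
    show "closed_form (\<lambda>x. W (shift x T))" by (rule deformation.form_closed[OF T(1)])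
    show "\<beta> T = form_primitive (\<lambda>x. W (shift x T))" by (rule deformation.form_primitive_eq[OF T(1), symmetric])
    show "homeomorphic_map euclidean euclidean (\<beta> T)" by (rule \<beta>_homeomorphism[OF T(1)])
    show "deform T = deformed_pattern (\<beta> T) (\<lambda>p. shift p T) (c ` T)" using deformed_pattern_eq[OF T(1)] by simp
    show "deform ` \<Omega> = orbit_closure ?m1 (deform T)" by (rule orbit_closure_deform[OF min T(1), symmetric])
    show "extends_deformation m \<Omega> ?m1 (deform ` \<Omega>) T (deform T) (\<beta> T) deform" by (rule deform_extends[OF inj T(1)])
  qed
  then show ?thesis using \<phi> by blast
qed

end

section \<open>Deformations of patterns of finite local complexity\<close>

context pattern_space
begin

lemma control_meets_ball: 
  assumes "X \<in> \<Omega>" "t \<in> X" "dist x (c t) < R" shows "fst t \<inter> ball x R \<noteq> {}"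
proof -
  have "c t \<in> fst t \<inter> ball x R" using control_mem[OF assms(1,2)] assms(3) by simp
  then show ?thesis by blast
qed

lemma control_meets: "X \<in> \<Omega> \<Longrightarrow> t \<in> X \<Longrightarrow> norm (c t) < R \<Longrightarrow> fst t \<inter> ball 0 R \<noteq> {}"
  by (rule control_meets_ball) simp_all

text \<open>Patterns with a control point at the origin cannot approach each other by a small translation.\<close>

lemma pinned_limit_agree:
  assumes flc: "FLC \<Omega>" and lim: "limitin metric.mtopology \<sigma> X sequentially"
    and pin: "\<forall>\<^sub>F n in sequentially. \<exists>t\<in>\<sigma> n. c t = 0" "\<exists>t\<in>X. c t = 0"
  shows "\<forall>\<^sub>F n in sequentially. agree R (\<sigma> n) X"
proof -
  have "\<exists>e>0. \<forall>X\<in>\<Omega>. \<forall>Y\<in>\<Omega>. (\<exists>t\<in>X. c t = 0) \<longrightarrow> (\<exists>t\<in>Y. c t = 0) \<longrightarrow> close m e X Y \<longrightarrow> agree R X Y"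
    by (rule pinned_agree[OF flc, where \<rho> = 1]) (rule control_shift control_meets_ball; simp)+
  then obtain e where e: "e > 0" "\<forall>X\<in>\<Omega>. \<forall>Y\<in>\<Omega>. (\<exists>t\<in>X. c t = 0) \<longrightarrow> (\<exists>t\<in>Y. c t = 0) \<longrightarrow> close m e X Y \<longrightarrow> agree R X Y"
    by blast
  have X: "X \<in> \<Omega>" using lim limitin_iff by blast
  show ?thesis using limitin_close[OF lim e(1)] pin(1) by eventually_elim (use e(2) X pin(2) in blast)
qed

text \<open>
  Patches of any pattern centred at a control point occur in \<open>T\<close>, since the orbit of \<open>T\<close> is dense and a
  convergent sequence can be recentred at control points.
\<close>

lemma pinned_patch_recurs:
  assumes flc: "FLC \<Omega>" and min: "minimal m \<Omega>" and T: "T \<in> \<Omega>" and X: "X \<in> \<Omega>" "\<exists>t\<in>X. c t = 0"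
  shows "\<exists>t\<in>T. agree R X (shift (c t) T)"
proof -
  obtain t where t: "t \<in> X" "c t = 0" using X(2) by blast
  have "X \<in> metric.mtopology closure_of orbit T" using min T X(1) unfolding minimal_def topology_eq by simp
  then obtain \<sigma> where \<sigma>: "range \<sigma> \<subseteq> orbit T \<inter> \<Omega>" "limitin metric.mtopology \<sigma> X sequentially"
    unfolding metric.closure_of_sequentially by blast
  obtain g where g: "\<forall>t\<in>X. \<forall>e>0. \<forall>\<^sub>F n in sequentially. g n t \<in> \<sigma> n \<and> tile_close m e (g n t) t"
    using limit_tiles[OF \<sigma>(2)] by blast
  have gt: "\<forall>e>0. \<forall>\<^sub>F n in sequentially. g n t \<in> \<sigma> n \<and> tile_close m e (g n t) t" using g t(1) by (rule bspec)
  have mem: "\<forall>\<^sub>F n in sequentially. g n t \<in> \<sigma> n"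
    using gt[rule_format, OF zero_less_one] by (rule eventually_mono) blast
  have ct: "(\<lambda>n. c (g n t)) \<longlonglongrightarrow> c t"
  proof (rule control_tendsto[OF X(1) t(1)])
    show "\<forall>\<^sub>F n in sequentially. \<exists>X\<in>\<Omega>. g n t \<in> X" using mem by eventually_elim (use \<sigma>(1) in blast)
    show "\<forall>\<^sub>F n in sequentially. tile_close m e (g n t) t" if e: "e > 0" for e
      using gt[rule_format, OF e] by (rule eventually_mono) blast
  qed
  have lim: "limitin metric.mtopology (\<lambda>n. shift (c (g n t)) (\<sigma> n)) X sequentially"
    using limitin_shift[OF \<sigma>(2) ct] t(2) by simp
  have pinned: "\<exists>u\<in>shift (c s) Y. c u = 0" if "Y \<in> \<Omega>" "s \<in> Y" for Y s
    using control_shift[OF that, of "c s"] that(2) by (intro bexI[of _ "shift_tile (c s) s"]) auto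
  have "\<forall>\<^sub>F n in sequentially. \<exists>u\<in>shift (c (g n t)) (\<sigma> n). c u = 0"
    using mem by eventually_elim (use \<sigma>(1) pinned in blast)
  from pinned_limit_agree[OF flc lim this X(2)]
  have "\<forall>\<^sub>F n in sequentially. agree R (shift (c (g n t)) (\<sigma> n)) X \<and> g n t \<in> \<sigma> n" using mem by (rule eventually_conj)
  then obtain n where n: "agree R (shift (c (g n t)) (\<sigma> n)) X" "g n t \<in> \<sigma> n" by (auto simp: eventually_sequentially)
  obtain x where x: "\<sigma> n = shift x T" using \<sigma>(1) unfolding orbit_def by blast
  let ?s = "shift_tile (- x) (g n t)"
  have s: "?s \<in> T" using n(2) unfolding x by (simp add: mem_shift_iff)
  have "c (shift_tile x ?s) = c ?s - x" by (rule control_shift[OF T s])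
  then have "c (g n t) = c ?s - x" by simp
  then have "shift (c (g n t)) (\<sigma> n) = shift (c ?s) T" unfolding x by (simp add: shift_add)
  then show ?thesis using n(1) s agree_sym by metis
qed

text \<open>The closed Voronoi cells of both points contain \<open>x\<close>, and have radius at most \<open>D\<close>.\<close>

lemma neighbours_dist:
  assumes T: "T \<in> \<Omega>" and "neighbours (c ` T) p q" shows "dist p q \<le> 2 * D"
proof -
  obtain x where x: "dist x p = infdist x (c ` T)" "dist x q = infdist x (c ` T)"
    using assms(2) unfolding neighbours_def by blast
  obtain t where t: "t \<in> T" "dist x (c t) \<le> D" using control_dense[OF T] by blast
  have "infdist x (c ` T) \<le> dist x (c t)" using t(1) by (intro infdist_le) blast
  then show ?thesis using x t(2) dist_triangle3[of p q x] by linarith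
qed

end

lemma (in deformed_space) mem_patch_deform:
  "p \<in> patch (deform X) 0 r \<longleftrightarrow> (\<exists>t\<in>X. p = moved X t \<and> norm (\<beta> X (c t)) < r)"
  unfolding patch_def deform_def moved_meets[symmetric] by blast

text \<open>
  The labels of the deformed pattern are patches so large that the label of a point determines the
  position and the label of the next point on a walk with steps of bounded length.
\<close>

locale flc_deformed_space = deformed_space m \<Omega> c \<kappa> D \<beta> W lo hi m1 "\<lambda>X. patch X 0 R0"
  for m :: "'l metric" and \<Omega> :: "('n::finite, 'l) pattern set" and c \<kappa> D \<beta> W lo hi m1 R0 +
  fixes R :: real
  assumes flc: "FLC \<Omega>" and R_pos: "0 < R" and W_local: "X \<in> \<Omega> \<Longrightarrow> Y \<in> \<Omega> \<Longrightarrow> agree R X Y \<Longrightarrow> W X = W Y"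
    and R0: "R0 = R + 2 * \<bar>D\<bar> + 2"
begin

lemma \<beta>_local:
  assumes XY: "X \<in> \<Omega>" "Y \<in> \<Omega>" and ag: "agree (R + r) X Y" and v: "norm v \<le> r"
  shows "\<beta> X v = \<beta> Y v"
proof -
  have "W (shift (t *\<^sub>R v) X) = W (shift (t *\<^sub>R v) Y)" if t: "t \<in> {0..1}" for t
  proof (rule W_local[OF shift_closed[OF XY(1)] shift_closed[OF XY(2)] agree_shift[OF ag]])
    have "t * norm v \<le> 1 * norm v" using t by (intro mult_right_mono) auto
    then show "norm (t *\<^sub>R v) + R \<le> R + r" using t v by simp
  qed
  then have "form_primitive (\<lambda>x. W (shift x X)) v = form_primitive (\<lambda>x. W (shift x Y)) v"
    unfolding form_primitive_def by (intro Henstock_Kurzweil_Integration.integral_cong) simp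
  then show ?thesis using deformation.form_primitive_eq XY by simp
qed

lemma moved_mem_ball: "agree K (deform X) (deform Y) \<Longrightarrow> t \<in> X \<Longrightarrow> norm (\<beta> X (c t)) < K \<Longrightarrow> \<exists>s\<in>Y. moved X t = moved Y s"
  using agree_mem[of K "deform X" "deform Y" "moved X t"] moved_meets unfolding deform_def by blast

text \<open>
  The walk from the origin to \<open>c t\<close> uses steps of length at most \<open>2 * D + 1\<close>.  The label at the last point
  \<open>c u\<close> shows the next tile and the form along the step, hence where the next point is moved; the label
  found there continues the walk.
\<close>

lemma walk:
  assumes XY: "X \<in> \<Omega>" "Y \<in> \<Omega>" and s0: "s0 \<in> X" "c s0 = 0" and ag0: "agree R0 X Y"
    and agK: "agree K (deform X) (deform Y)" and K: "hi * real n < K"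
    and t: "t \<in> X" "norm (c t) \<le> real n"
  shows "t \<in> Y \<and> \<beta> X (c t) = \<beta> Y (c t) \<and> agree R0 (shift (c t) X) (shift (c t) Y)"
  using K t
proof (induction n arbitrary: t)
  case 0
  then have "t = s0" using s0 control_inj[OF XY(1)] by simp
  moreover have "0 < R0" using R0 R_pos by simp
  ultimately show ?case using s0 ag0 agree_mem[OF ag0 s0(1) control_meets[OF XY(1) s0(1)]] \<beta>_0 XY by simp
next
  case (Suc n)
  have D: "0 \<le> D" by (rule D_nonneg[OF XY(1)])
  have hi: "hi * real n < K" using Suc.prems(1) hi_pos[OF XY(1)] by (simp add: algebra_simps)
  have "\<exists>u\<in>X. norm (c u) \<le> real n \<and> norm (c t - c u) \<le> 2 * D + 1"
  proof (cases "norm (c t) \<le> D + 1")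
    case True then show ?thesis using s0 D by (intro bexI[of _ s0]) auto
  next
    case False
    \<comment> \<open>\<open>D + 1\<close> back from \<open>c t\<close> towards the origin, so that the control point near \<open>x\<close> has norm smaller by \<open>1\<close>\<close>
    define x where "x = c t - ((D + 1) / norm (c t)) *\<^sub>R c t"
    have pos: "0 < norm (c t)" using False D by linarith
    have xt: "norm (c t - x) = D + 1" unfolding x_def using pos D by simp
    have "x = (1 - (D + 1) / norm (c t)) *\<^sub>R c t" unfolding x_def by (simp add: scaleR_diff_left)
    moreover have "0 \<le> 1 - (D + 1) / norm (c t)" using False pos by simp
    ultimately have "norm x = (1 - (D + 1) / norm (c t)) * norm (c t)" by simp
    then have nx: "norm x = norm (c t) - (D + 1)" using pos by (simp add: left_diff_distrib)
    obtain u where u: "u \<in> X" "dist x (c u) \<le> D" using control_dense[OF XY(1)] by blast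
    have "norm (c u) \<le> norm x + dist x (c u)" using norm_triangle_sub[of "c u" x] by (simp add: dist_norm norm_minus_commute)
    moreover have "norm (c t - c u) \<le> norm (c t - x) + dist x (c u)" using norm_triangle_ineq[of "c t - x" "x - c u"] by (simp add: dist_norm)
    ultimately show ?thesis using u nx xt Suc.prems(3) by (intro bexI[of _ u]) auto
  qed
  then obtain u where u: "u \<in> X" "norm (c u) \<le> real n" "norm (c t - c u) \<le> 2 * D + 1" by blast
  note IH = Suc.IH[OF hi u(1,2)]
  let ?X = "shift (c u) X" and ?Y = "shift (c u) Y"
  have XY': "?X \<in> \<Omega>" "?Y \<in> \<Omega>" using XY shift_closed by auto
  have agu: "agree R0 ?X ?Y" using IH by blast
  have ct: "c (shift_tile (c u) t) = c t - c u" by (rule control_shift[OF XY(1) Suc.prems(2)])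
  have meets: "fst (shift_tile (c u) t) \<inter> ball 0 R0 \<noteq> {}"
    by (rule control_meets[OF XY'(1)]) (use Suc.prems(2) ct u(3) R0 R_pos D in auto)
  have "shift_tile (c u) t \<in> ?Y" by (rule agree_mem[OF agu _ meets]) (use Suc.prems(2) in simp)
  then have tY: "t \<in> Y" by simp
  have "\<beta> ?X (c t - c u) = \<beta> ?Y (c t - c u)"
    by (rule \<beta>_local[OF XY' agree_mono[OF agu] u(3)]) (use R0 D in simp)
  then have eq: "\<beta> X (c t) = \<beta> Y (c t)" using IH \<beta>_shift XY by simp
  have "norm (\<beta> X (c t)) \<le> hi * real (Suc n)"
    using \<beta>_upper[OF XY(1), of "c t"] mult_left_mono[OF Suc.prems(3), of hi] hi_pos[OF XY(1)] by linarith
  then obtain s where s: "s \<in> Y" "moved X t = moved Y s"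
    using moved_mem_ball[OF agK Suc.prems(2)] Suc.prems(1) by fastforce
  then have "\<beta> X (c t) = \<beta> Y (c s)" "agree R0 (shift (c t) X) (shift (c s) Y)" unfolding moved_def agree_def by auto
  moreover from this have "c t = c s" using eq \<beta>_inject[OF XY(2)] by metis
  ultimately show ?case using tY eq by simp
qed

lemma agree_of_controls:
  assumes XY: "X \<in> \<Omega>" "Y \<in> \<Omega>" and 1: "\<And>t. t \<in> X \<Longrightarrow> norm (c t) \<le> r + D \<Longrightarrow> t \<in> Y" and 2: "\<And>t. t \<in> Y \<Longrightarrow> norm (c t) \<le> r + D \<Longrightarrow> t \<in> X"
  shows "agree r X Y"
proof -
  have near: "norm (c t) \<le> r + D" if Z: "Z \<in> \<Omega>" "t \<in> Z" "fst t \<inter> ball 0 r \<noteq> {}" for Z t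
  proof -
    obtain x where x: "x \<in> fst t" "norm x < r" using Z(3) by auto
    have "norm (c t) \<le> norm x + dist x (c t)" using norm_triangle_sub[of "c t" x] by (simp add: dist_norm norm_minus_commute)
    then show ?thesis using x tile_diam[OF Z(1,2) x(1)] by linarith
  qed
  show ?thesis unfolding agree_def patch_def
    by (intro Collect_cong) (use 1 2 near[OF XY(1)] near[OF XY(2)] in blast)
qed

text \<open>Walking from point to point, a large patch of the deformed pattern determines the original patch.\<close>

lemma deform_inverse_local: "\<exists>K. \<forall>X\<in>\<Omega>. \<forall>Y\<in>\<Omega>. agree K (deform X) (deform Y) \<longrightarrow> agree r X Y"
proof -
  obtain n :: nat where n: "\<bar>r\<bar> + R + 2 * \<bar>D\<bar> \<le> real n" using real_arch_simple by blast
  define K where "K = hi * \<bar>D\<bar> + hi * real n + 1"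
  have "agree r X Y" if XY: "X \<in> \<Omega>" "Y \<in> \<Omega>" and ag: "agree K (deform X) (deform Y)" for X Y
  proof -
    have hi: "0 < hi" by (rule hi_pos[OF XY(1)])
    obtain s where s: "s \<in> X" "norm (c s) \<le> \<bar>D\<bar>" using control_dense[OF XY(1), of 0] by force
    have nb: "norm (\<beta> X (c s)) \<le> hi * \<bar>D\<bar>" using \<beta>_upper[OF XY(1), of "c s"] mult_left_mono[OF s(2), of hi] hi by linarith
    have "0 \<le> hi * real n" using hi by simp
    then have "norm (\<beta> X (c s)) < K" using nb unfolding K_def by linarith
    then obtain s' where s': "s' \<in> Y" "moved X s = moved Y s'" using moved_mem_ball[OF ag s(1)] by blast
    then have eq: "\<beta> X (c s) = \<beta> Y (c s')" and ag0: "agree R0 (shift (c s) X) (shift (c s') Y)"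
      unfolding moved_def agree_def by auto
    let ?X = "shift (c s) X" and ?Y = "shift (c s') Y"
    have XY': "?X \<in> \<Omega>" "?Y \<in> \<Omega>" using XY shift_closed by auto
    have agK: "agree (hi * real n + 1) (deform ?X) (deform ?Y)"
      unfolding deform_shift[OF XY(1)] deform_shift[OF XY(2)] eq[symmetric]
      by (rule agree_shift[OF ag]) (use nb in \<open>simp add: K_def\<close>)
    obtain p q where p: "p \<in> ?X" "c p = 0" and q: "q \<in> ?Y" "c q = 0" using pinned_shift[OF XY(1) s(1)] pinned_shift[OF XY(2) s'(1)] by blast
    have ag1: "agree (real n - D) ?X ?Y"
    proof (rule agree_of_controls[OF XY'])
      fix t assume "t \<in> ?X" "norm (c t) \<le> real n - D + D"
      then show "t \<in> ?Y" using walk[OF XY' p ag0 agK, of n t] by simp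
    next
      fix t assume "t \<in> ?Y" "norm (c t) \<le> real n - D + D"
      then show "t \<in> ?X" using walk[OF XY'(2,1) q agree_sym[OF ag0] agree_sym[OF agK], of n t] by simp
    qed
    \<comment> \<open>it remains to see that the two patterns were recentred by the same vector\<close>
    have "\<beta> ?X (- c s) = \<beta> ?Y (- c s)"
      by (rule \<beta>_local[OF XY' agree_mono[OF ag1], of "\<bar>D\<bar>"]) (use n s(2) in auto)
    moreover have "\<beta> ?X (- c s) = \<beta> ?Y (- c s')" using \<beta>_shift \<beta>_0 XY eq by simp
    ultimately have "- c s = - c s'" using \<beta>_inject[OF XY'(2)] by metis
    then have cs: "c s' = c s" by simp
    have "agree r (shift (- c s) ?X) (shift (- c s) ?Y)"
      by (rule agree_shift[OF ag1]) (use n s(2) R_pos in auto)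
    then show ?thesis unfolding cs by (simp add: shift_add)
  qed
  then show ?thesis by blast
qed

lemma agree_all_imp_eq:
  assumes XY: "X \<in> \<Omega>" "Y \<in> \<Omega>" and ag: "\<And>r. agree r X Y" shows "X = Y"
proof
  have "t \<in> Y" if "X \<in> \<Omega>" "t \<in> X" "\<And>r. agree r X Y" for X Y t
    using agree_mem[OF that(3,2) control_meets[OF that(1,2), of "norm (c t) + 1"]] by simp
  then show "X \<subseteq> Y" "Y \<subseteq> X" using XY ag agree_sym by blast+
qed

lemma deform_inj: "inj_on deform \<Omega>"
proof (rule inj_onI)
  fix X Y assume XY: "X \<in> \<Omega>" "Y \<in> \<Omega>" "deform X = deform Y"
  have "agree r X Y" for r using deform_inverse_local[of r] XY agree_refl by metis
  then show "X = Y" by (rule agree_all_imp_eq[OF XY(1,2)])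
qed

lemma deform_local: "\<exists>M. \<forall>X\<in>\<Omega>. \<forall>Y\<in>\<Omega>. agree M X Y \<longrightarrow> agree r (deform X) (deform Y)"
proof -
  define k where "k = \<bar>r\<bar> / lo"
  have k: "0 \<le> k" unfolding k_def using deformation.c_pos by simp
  have sub: "patch (deform X) 0 r \<subseteq> patch (deform Y) 0 r" if XY: "X \<in> \<Omega>" "Y \<in> \<Omega>" and ag: "agree (k + R0 + R) X Y" for X Y
  proof
    fix p assume "p \<in> patch (deform X) 0 r"
    then obtain t where t: "t \<in> X" "p = moved X t" "norm (\<beta> X (c t)) < r"
      unfolding mem_patch_deform by blast
    have "lo * norm (c t) \<le> \<bar>r\<bar>" using \<beta>_lower[OF XY(1), of "c t"] t(3) by linarith
    then have ct: "norm (c t) \<le> k" unfolding k_def using deformation.c_pos by (simp add: field_simps)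
    have R0': "0 < R0" using R0 R_pos by simp
    have tY: "t \<in> Y" by (rule agree_mem[OF ag t(1) control_meets[OF XY(1) t(1)]]) (use ct R0' R_pos in simp)
    have eq: "\<beta> X (c t) = \<beta> Y (c t)" by (rule \<beta>_local[OF XY agree_mono[OF ag] ct]) (use R0' in simp)
    have "agree R0 (shift (c t) X) (shift (c t) Y)" by (rule agree_shift[OF ag]) (use ct R_pos in simp)
    then have "p = moved Y t" using eq unfolding t(2) moved_def agree_def by simp
    moreover have "norm (\<beta> Y (c t)) < r" using t(3) eq by simp
    ultimately show "p \<in> patch (deform Y) 0 r" unfolding mem_patch_deform using tY by blast
  qed
  have "agree r (deform X) (deform Y)" if XY: "X \<in> \<Omega>" "Y \<in> \<Omega>" and ag: "agree (k + R0 + R) X Y" for X Y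
    unfolding agree_def using sub[OF XY ag] sub[OF XY(2,1) agree_sym[OF ag]] by (rule subset_antisym)
  then show ?thesis by blast
qed

lemma deform_FLC: "FLC (deform ` \<Omega>)"
  unfolding FLC_def
proof
  fix r :: real
  \<comment> \<open>any patch of radius \<open>r\<close> lies, after a translation, in a patch of radius \<open>r1\<close> centred at a moved point\<close>
  define r1 where "r1 = r + \<bar>hi * D\<bar>"
  obtain M where M: "\<forall>X\<in>\<Omega>. \<forall>Y\<in>\<Omega>. agree M X Y \<longrightarrow> agree r1 (deform X) (deform Y)" using deform_local by blast
  define G where "G = {patch X 0 (max M 1) | X. X \<in> \<Omega> \<and> (\<exists>t\<in>X. c t = 0)}"
  have meets: "fst t \<inter> ball (c t) (max M 1) \<noteq> {}" if "X \<in> \<Omega>" "t \<in> X" for X t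
    by (rule control_meets_ball[OF that]) simp
  have "finite G" unfolding G_def by (rule finite_pinned_patches[OF flc control_shift meets])
  define rep where "rep = (\<lambda>P. SOME X. X \<in> \<Omega> \<and> patch X 0 (max M 1) = P)"
  have rep: "rep (patch X 0 (max M 1)) \<in> \<Omega> \<and> patch (rep (patch X 0 (max M 1))) 0 (max M 1) = patch X 0 (max M 1)"
    if "X \<in> \<Omega>" for X
    unfolding rep_def by (rule someI[where x = X]) (use that in simp)
  define F0 where "F0 = (\<lambda>P. patch (deform (rep P)) 0 r1) ` G"
  have finF: "finite F0" unfolding F0_def using \<open>finite G\<close> by simp
  have mem: "patch (deform X) 0 r1 \<in> F0" if X: "X \<in> \<Omega>" "\<exists>t\<in>X. c t = 0" for X
  proof -
    let ?P = "patch X 0 (max M 1)"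
    have "agree (max M 1) X (rep ?P)" using rep[OF X(1)] unfolding agree_def by (elim conjE) (rule sym)
    then have "agree M X (rep ?P)" by (rule agree_mono) simp
    then have "agree r1 (deform X) (deform (rep ?P))" using M rep X(1) by blast
    moreover have "?P \<in> G" unfolding G_def using X by blast
    ultimately show ?thesis unfolding F0_def agree_def by (rule image_eqI)
  qed
  define F where "F = (\<Union>P\<in>{P\<in>F0. finite P}. Pow P)"
  have "finite F" unfolding F_def using finF by auto
  moreover have "\<exists>P\<in>F. \<exists>y. patch T1 x r = shift y P" if T1: "T1 \<in> deform ` \<Omega>" for T1 x
  proof -
    obtain S where S: "S \<in> \<Omega>" "T1 = deform S" using T1 by blast
    obtain v where v: "x = \<beta> S v" using deformation.surj_\<beta>[OF S(1)] unfolding surj_def by blast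
    obtain s where s: "s \<in> S" "dist v (c s) \<le> D" using control_dense[OF S(1)] by blast
    let ?X = "shift (c s) S" and ?z = "\<beta> S (c s)"
    have X: "?X \<in> \<Omega>" by (rule shift_closed[OF S(1)])
    have "norm (x - ?z) \<le> hi * norm (v - c s)" unfolding v by (rule deformation.upper_lip[OF S(1)])
    also have "\<dots> \<le> hi * D" using s(2) hi_pos[OF S(1)] by (intro mult_left_mono) (auto simp: dist_norm)
    finally have "patch (deform ?X) (x - ?z) r \<subseteq> patch (deform ?X) 0 r1"
      using ball_subset_ball_origin[of "x - ?z" r r1] unfolding patch_def r1_def by force
    moreover have "finite (patch (deform ?X) 0 r1)"
      using locally_finite_delone_pattern[OF deform_delone[OF X]] unfolding locally_finite_pattern_def by blast
    ultimately have "patch (deform ?X) (x - ?z) r \<in> F" unfolding F_def using mem[OF X pinned_shift[OF S(1) s(1)]] by blast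
    moreover have "patch T1 x r = shift (- ?z) (patch (deform ?X) (x - ?z) r)"
      unfolding S(2) deform_shift[OF S(1)] patch_shift by (simp add: shift_add)
    ultimately show ?thesis by blast
  qed
  ultimately show "\<exists>F. finite F \<and> (\<forall>T\<in>deform ` \<Omega>. \<forall>x. \<exists>P\<in>F. \<exists>y. patch T x r = shift y P)" by blast
qed

end

text \<open>
  With patches as labels, finite local complexity of \<open>\<Omega>\<close> leaves finitely many labels, and locality of \<open>g\<close>
  passes to the factor map because \<open>deform\<close> has a local inverse.
\<close>

lemma (in pattern_space) strong_deformation_exists:
  assumes fd: "flow_deformation \<Omega> (pattern_dist m) shift \<beta> W lo hi"
    and min: "minimal m \<Omega>" and ne: "\<Omega> \<noteq> {}" and flc: "FLC \<Omega>" and flc': "FLC \<Omega>'"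
    and R: "0 < R" "\<And>X Y. X \<in> \<Omega> \<Longrightarrow> Y \<in> \<Omega> \<Longrightarrow> agree R X Y \<Longrightarrow> W X = W Y"
    and g: "continuous_map (tiling_topology m \<Omega>) (tiling_topology m' \<Omega>') g"
    and onto: "g ` \<Omega> = \<Omega>'" and T': "tiling_space m' \<Omega>'"
    and equiv: "\<And>X v. X \<in> \<Omega> \<Longrightarrow> g (shift v X) = shift (\<beta> X v) (g X)"
    and loc: "\<And>r. \<exists>M. \<forall>X\<in>\<Omega>. \<forall>Y\<in>\<Omega>. agree M X Y \<longrightarrow> agree r (g X) (g Y)"
  shows "\<exists>m1 \<Omega>1 h0 \<phi>. strong_shape_deformation m \<Omega> m1 \<Omega>1 h0 \<and> local_derivation m1 \<Omega>1 m' \<Omega>' \<phi> \<and> (\<forall>X\<in>\<Omega>. \<phi> (h0 X) = g X)"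
proof -
  obtain T where T: "T \<in> \<Omega>" "0 \<in> c ` T" using pinned_exists[OF ne] by (metis image_eqI)
  define R0 where "R0 = R + 2 * \<bar>D\<bar> + 2"
  let ?lab = "\<lambda>X. patch X 0 R0"
  define L where "L = (\<lambda>p. ?lab (shift p T)) ` c ` T"
  let ?m1 = "metric (L, discrete_metric.dd)"
  interpret L: discrete_metric L .
  have "L \<subseteq> {?lab X | X. X \<in> \<Omega> \<and> (\<exists>t\<in>X. c t = 0)}"
  proof
    fix P assume "P \<in> L"
    then obtain t where t: "t \<in> T" "P = ?lab (shift (c t) T)" unfolding L_def by blast
    then have "\<exists>u\<in>shift (c t) T. c u = 0"
      using control_shift[OF T(1), of t "c t"] by (intro bexI[of _ "shift_tile (c t) t"]) auto
    then show "P \<in> {?lab X | X. X \<in> \<Omega> \<and> (\<exists>t\<in>X. c t = 0)}" using t(2) shift_closed[OF T(1)] by blast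
  qed
  moreover have "0 < R0" unfolding R0_def using R(1) by simp
  ultimately have finL: "finite L"
    using finite_pinned_patches[OF flc, of c R0] control_shift control_meets_ball[of _ _ _ R0] finite_subset by simp
  interpret flc_deformed_space m \<Omega> c \<kappa> D \<beta> W lo hi ?m1 R0 R
  proof (intro flc_deformed_space.intro deformed_space.intro pattern_space_axioms fd
      deformed_space_axioms.intro flc_deformed_space_axioms.intro flc R R0_def)
    show "?lab X \<in> mspace ?m1" if "X \<in> \<Omega>" "t \<in> X" "c t = 0" for X t
    proof -
      have "\<exists>s\<in>T. agree R0 X (shift (c s) T)" by (rule pinned_patch_recurs[OF flc min T(1) that(1)]) (use that in blast)
      then have "?lab X \<in> L" unfolding L_def agree_def by blast
      then show ?thesis by (simp only: L.disc.mspace_metric)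
    qed
    show "(\<lambda>n. mdist ?m1 (?lab (\<sigma> n)) (?lab X)) \<longlonglongrightarrow> 0"
      if lim: "limitin metric.mtopology \<sigma> X sequentially" and pin: "\<forall>\<^sub>F n in sequentially. \<exists>t\<in>\<sigma> n. c t = 0" "\<exists>t\<in>X. c t = 0" for \<sigma> X
    proof (rule tendsto_eventually)
      show "\<forall>\<^sub>F n in sequentially. mdist ?m1 (?lab (\<sigma> n)) (?lab X) = 0"
        unfolding L.disc.mdist_metric
        using pinned_limit_agree[OF flc lim pin, of R0] by eventually_elim (simp add: agree_def L.dd_def)
    qed
    show "compact_space (mtopology_of ?m1)"
      using finL by (simp add: L.mtopology_discrete_metric compact_space_discrete_topology)
  qed
  obtain \<phi> where \<phi>: "factor_map ?m1 (deform ` \<Omega>) m' \<Omega>' \<phi>" "\<And>X. X \<in> \<Omega> \<Longrightarrow> \<phi> (deform X) = g X"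
    using factor_through_deform[OF deform_inj g onto T' equiv] by blast
  have "\<exists>K>0. \<forall>P\<in>deform ` \<Omega>. \<forall>Q\<in>deform ` \<Omega>. patch P 0 K = patch Q 0 K \<longrightarrow> patch (\<phi> P) 0 r = patch (\<phi> Q) 0 r" for r
  proof -
    obtain M where M: "\<forall>X\<in>\<Omega>. \<forall>Y\<in>\<Omega>. agree M X Y \<longrightarrow> agree r (g X) (g Y)" using loc by blast
    obtain K where K: "\<forall>X\<in>\<Omega>. \<forall>Y\<in>\<Omega>. agree K (deform X) (deform Y) \<longrightarrow> agree M X Y" using deform_inverse_local by blast
    have "patch (\<phi> (deform X)) 0 r = patch (\<phi> (deform Y)) 0 r"
      if XY: "X \<in> \<Omega>" "Y \<in> \<Omega>" "patch (deform X) 0 (max K 1) = patch (deform Y) 0 (max K 1)" for X Y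
    proof -
      have "agree K (deform X) (deform Y)" by (rule agree_mono[of "max K 1"]) (use XY(3) in \<open>simp_all add: agree_def\<close>)
      then have "agree r (g X) (g Y)" using K M XY(1,2) by blast
      then show ?thesis using \<phi>(2) XY(1,2) unfolding agree_def by simp
    qed
    then have "\<forall>P\<in>deform ` \<Omega>. \<forall>Q\<in>deform ` \<Omega>. patch P 0 (max K 1) = patch Q 0 (max K 1) \<longrightarrow> patch (\<phi> P) 0 r = patch (\<phi> Q) 0 r"
      by (intro ballI impI) (elim imageE, hypsubst)
    then show ?thesis by (intro exI[of _ "max K 1"] conjI) (simp, assumption)
  qed
  then have "local_derivation ?m1 (deform ` \<Omega>) m' \<Omega>' \<phi>"
    unfolding local_derivation_def using deform_FLC flc' \<phi>(1) by blast
  moreover have "strong_shape_deformation m \<Omega> ?m1 (deform ` \<Omega>) deform"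
    unfolding strong_shape_deformation_def
  proof (intro conjI exI flc)
    show "T \<in> \<Omega>" "0 \<in> c ` T" by (rule T)+
    show "associated_delone m \<Omega> T (c ` T)" by (rule associated[OF T(1)])
    show "0 < R" by (rule R(1))
    show "strongly_PE_form T R (\<lambda>x. W (shift x T))"
      unfolding strongly_PE_form_def strongly_PE_fun_def
    proof (intro conjI allI impI deformation.form_smooth[OF T(1)])
      fix i j x y assume "patch (shift x T) 0 R = patch (shift y T) 0 R"
      then have "W (shift x T) = W (shift y T)" using R(2) shift_closed[OF T(1)] unfolding agree_def by blast
      then show "W (shift x T) $ i $ j = W (shift y T) $ i $ j" by simp
    qed
    show "closed_form (\<lambda>x. W (shift x T))" by (rule deformation.form_closed[OF T(1)])
    show "\<beta> T = form_primitive (\<lambda>x. W (shift x T))" by (rule deformation.form_primitive_eq[OF T(1), symmetric])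
    show "homeomorphic_map euclidean euclidean (\<beta> T)" by (rule \<beta>_homeomorphism[OF T(1)])
    show "\<forall>p q. neighbours (c ` T) p q \<longrightarrow> R + dist p q < R0"
      using neighbours_dist[OF T(1)] unfolding R0_def by fastforce
    show "(\<lambda>p. ?lab (shift p T)) = (\<lambda>p. patch (shift p T) 0 R0)" ..
    show "?m1 = metric ((\<lambda>p. ?lab (shift p T)) ` c ` T, discrete_metric.dd)" unfolding L_def ..
    show "deform T = deformed_pattern (\<beta> T) (\<lambda>p. ?lab (shift p T)) (c ` T)" using deformed_pattern_eq[OF T(1)] by simp
    show "deform ` \<Omega> = orbit_closure ?m1 (deform T)" by (rule orbit_closure_deform[OF min T(1), symmetric])
    show "extends_deformation m \<Omega> ?m1 (deform ` \<Omega>) T (deform T) (\<beta> T) deform" by (rule deform_extends[OF deform_inj T(1)])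
  qed
  ultimately show ?thesis using \<phi>(2) by blast
qed

section \<open>Every map is homotopic to a deformation followed by a factor map\<close>

context orbit_map
begin

text \<open>The factorization reproduces \<open>follow f\<close> only on \<open>\<Omega>\<close>, which is all that homotopy can see.\<close>

lemma homotopic_through:
  assumes f: "continuous_map S.metric.mtopology euclidean f" and eq: "\<forall>X\<in>\<Omega>. \<phi> (h0 X) = follow f X"
  shows "homotopic_maps m \<Omega> m' \<Omega>' h (\<phi> \<circ> h0)"
proof -
  have hom: "homotopic_maps m \<Omega> m' \<Omega>' h (follow f)" by (rule homotopic_follow[OF f])
  then have "continuous_map (tiling_topology m \<Omega>) (tiling_topology m' \<Omega>') (follow f)"
    unfolding homotopic_maps_def by (blast dest: homotopic_with_imp_continuous_maps)
  then have "homotopic_maps m \<Omega> m' \<Omega>' (follow f) (\<phi> \<circ> h0)"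
    unfolding homotopic_maps_def by (intro homotopic_with_equal TrueI) (use eq in simp_all)
  with hom show ?thesis unfolding homotopic_maps_def by (rule homotopic_with_trans)
qed

lemma follow_continuous:
  assumes f: "continuous_map S.metric.mtopology euclidean f"
  shows "continuous_map (tiling_topology m \<Omega>) (tiling_topology m' \<Omega>') (follow f)"
  using homotopic_follow[OF f] unfolding homotopic_maps_def by (blast dest: homotopic_with_imp_continuous_maps)

lemma weak_factorization:
  assumes \<mu>: "uniquely_ergodic m \<Omega> \<mu>" and det: "det (matrix (ruelle_sullivan \<mu> \<alpha>)) \<noteq> 0"
    and min: "minimal m \<Omega>" and ne: "\<Omega> \<noteq> {}" and onto: "h ` \<Omega> = \<Omega>'" and T': "tiling_space m' \<Omega>'"
  shows "\<exists>m1 \<Omega>1 h0 \<phi>. weak_shape_deformation m \<Omega> m1 \<Omega>1 h0 \<and> factor_map m1 \<Omega>1 m' \<Omega>' \<phi> \<and> homotopic_maps m \<Omega> m' \<Omega>' h (\<phi> \<circ> h0)"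
proof -
  have c0: "continuous_map S.metric.mtopology euclidean (\<lambda>X. 0 :: real ^ 'n)" by simp
  obtain f W lo hi V where *: "continuous_map S.metric.mtopology euclidean f"
    "flow_deformation \<Omega> (pattern_dist m) shift (\<lambda>X v. \<alpha> X v + (0 + f (shift v X)) - (0 + f X)) W lo hi"
    using smooth_representative[OF c0 \<mu> det] by (elim exE conjE) (rule that; assumption)
  note fd = *(2)[unfolded add_0]
  interpret B: flow_deformation \<Omega> "pattern_dist m" shift "\<lambda>X v. \<alpha> X v + f (shift v X) - f X" W lo hi by (rule fd)
  note ex = S.weak_deformation_exists[OF fd min ne follow_continuous[OF *(1)] follow_surj[OF onto B.surj_\<beta>] T' follow_shift]
  obtain m1 \<Omega>1 h0 \<phi> where "weak_shape_deformation m \<Omega> m1 \<Omega>1 h0" "factor_map m1 \<Omega>1 m' \<Omega>' \<phi>"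
      and eq: "\<forall>X\<in>\<Omega>. \<phi> (h0 X) = follow f X"
    by (rule exE[OF ex], assumption+, elim exE conjE, (rule that; assumption))
  then show ?thesis using homotopic_through[of f \<phi> h0, OF *(1) eq] by blast
qed

end

lemma (in flc_orbit_map) strong_factorization:
  assumes \<mu>: "uniquely_ergodic m \<Omega> \<mu>" and det: "det (matrix (ruelle_sullivan \<mu> \<alpha>)) \<noteq> 0"
    and min: "minimal m \<Omega>" and ne: "\<Omega> \<noteq> {}" and onto: "h ` \<Omega> = \<Omega>'" and T': "tiling_space m' \<Omega>'"
  shows "\<exists>m1 \<Omega>1 h0 \<phi>. strong_shape_deformation m \<Omega> m1 \<Omega>1 h0 \<and> local_derivation m1 \<Omega>1 m' \<Omega>' \<phi> \<and> homotopic_maps m \<Omega> m' \<Omega>' h (\<phi> \<circ> h0)"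
proof -
  obtain f W lo hi R where f: "continuous_map S.metric.mtopology euclidean f"
    and fd: "flow_deformation \<Omega> (pattern_dist m) shift (\<lambda>X v. \<alpha> X v + f (shift v X) - f X) W lo hi"
    and R: "0 < R" "\<forall>X\<in>\<Omega>. \<forall>Y\<in>\<Omega>. agree R X Y \<longrightarrow> W X = W Y"
    and loc: "\<forall>r. \<exists>M. \<forall>X\<in>\<Omega>. \<forall>Y\<in>\<Omega>. agree M X Y \<longrightarrow> agree r (follow f X) (follow f Y)"
    using local_smooth_representative[OF \<mu> det] by (elim exE conjE) (rule that; assumption)
  interpret B: flow_deformation \<Omega> "pattern_dist m" shift "\<lambda>X v. \<alpha> X v + f (shift v X) - f X" W lo hi by (rule fd)
  note ex = S.strong_deformation_exists[OF fd min ne flc flc' R(1) R(2)[rule_format] follow_continuous[OF f]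
    follow_surj[OF onto B.surj_\<beta>] T' follow_shift spec[OF loc]]
  obtain m1 \<Omega>1 h0 \<phi> where "strong_shape_deformation m \<Omega> m1 \<Omega>1 h0" "local_derivation m1 \<Omega>1 m' \<Omega>' \<phi>"
      and eq: "\<forall>X\<in>\<Omega>. \<phi> (h0 X) = follow f X"
    by (rule exE[OF ex], assumption+, elim exE conjE, (rule that; assumption))
  then show ?thesis using homotopic_through[of f \<phi> h0, OF f eq] by blast
qed

theorem corollary10p2:
  fixes m :: "'l metric" and \<Omega> :: "('n::finite, 'l) pattern set"
    and m' :: "'k metric" and \<Omega>' :: "('n, 'k) pattern set"
    and \<mu> :: "('n, 'l) pattern measure"
    and h :: "('n, 'l) pattern \<Rightarrow> ('n, 'k) pattern"
  assumes "tiling_space m \<Omega>" and "minimal m \<Omega>" and "aperiodic \<Omega>"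
    and "tiling_space m' \<Omega>'" and "minimal m' \<Omega>'" and "aperiodic \<Omega>'"
    and "uniquely_ergodic m \<Omega> \<mu>"
    and "tiling_map m \<Omega> m' \<Omega>' h" and "h ` \<Omega> = \<Omega>'" and "orbit_preserving \<Omega> h"
    and "det (matrix (ruelle_sullivan \<mu> (orbit_cocycle h))) \<noteq> 0"
  shows "(\<exists>m1 \<Omega>1 h0 \<phi>. weak_shape_deformation m \<Omega> m1 \<Omega>1 h0 \<and>
            factor_map m1 \<Omega>1 m' \<Omega>' \<phi> \<and> homotopic_maps m \<Omega> m' \<Omega>' h (\<phi> \<circ> h0)) \<and>
         (FLC \<Omega> \<and> FLC \<Omega>' \<longrightarrow>
           (\<exists>m1 \<Omega>1 h0 \<phi>. strong_shape_deformation m \<Omega> m1 \<Omega>1 h0 \<and>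
              local_derivation m1 \<Omega>1 m' \<Omega>' \<phi> \<and> homotopic_maps m \<Omega> m' \<Omega>' h (\<phi> \<circ> h0)))"
proof -
  have "prob_space \<mu>" "space \<mu> = \<Omega>" using assms(7) unfolding uniquely_ergodic_def invariant_prob_def by auto
  then have ne: "\<Omega> \<noteq> {}" using prob_space.not_empty by blast
  then have ne': "\<Omega>' \<noteq> {}" using assms(9) by blast
  obtain c \<kappa> D where "pattern_space m \<Omega> c \<kappa> D" using pattern_space_exists[OF assms(1,2) ne] .
  then interpret S: pattern_space m \<Omega> c \<kappa> D .
  obtain c' \<kappa>' D' where "pattern_space m' \<Omega>' c' \<kappa>' D'" using pattern_space_exists[OF assms(4,5) ne'] .
  then interpret T: pattern_space m' \<Omega>' c' \<kappa>' D' .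
  interpret O: orbit_map m \<Omega> c \<kappa> D m' \<Omega>' c' \<kappa>' D' h by unfold_locales (rule assms(8,10,6))+
  have "\<exists>m1 \<Omega>1 h0 \<phi>. strong_shape_deformation m \<Omega> m1 \<Omega>1 h0 \<and> local_derivation m1 \<Omega>1 m' \<Omega>' \<phi> \<and> homotopic_maps m \<Omega> m' \<Omega>' h (\<phi> \<circ> h0)"
    if "FLC \<Omega>" "FLC \<Omega>'"
  proof -
    interpret flc_orbit_map m \<Omega> c \<kappa> D m' \<Omega>' c' \<kappa>' D' h by unfold_locales (rule that)+
    show ?thesis by (rule strong_factorization[OF assms(7,11,2) ne assms(9,4)])
  qed
  then show ?thesis using O.weak_factorization[OF assms(7,11,2) ne assms(9,4)] by blast
qed

end
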